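(* Let $M$ be the interior of a compact 3-manifold with non-empty boundary and let $\mathcal{T}$ be an ideal triangulation of $M$. Assume that each boundary component is a torus or a Klein bottle. Then the following are equivalent: (1) $(M;\mathcal{T})$ admits an angle structure; (2) for all $s\in C(M;\mathcal{T})$ with all quadrilateral coordinates non-negative and at least one quadrilateral coordinate positive, $\chi^*(s)<0$; (3) for all $s\in PC(M;\mathcal{T})$ with at least one quadrilateral coordinate positive, $\chi^*(s)<0$; (4) $\chi^*(V_i)<0$ for all vertex solutions $V_i$ with at least one quadrilateral coordinate positive.
   Context: **Ideal triangulation.** Let $X$ be a disjoint union of compact 3-simplices $\sigma^3_1,\dots,\sigma^3_t$ and let $\Phi$ be a collection of affine isomorphisms pairing the codimension-one faces of these simplices (each $\phi\in\Phi$ identifies two distinct faces, each face belonging to exactly one pairing). The quotient $K=X/\Phi$ is a closed 3-dimensional pseudo-manifold; the images of the simplices and their sub-simplices are its vertices, edges, triangles and tetrahedra. An ideal triangulation $\mathcal{T}$ of a non-compact 3-manifold $M$ is such a $K$, with non-manifold points at most at its vertices, together with an identification of $M$ with $K$ minus all of its vertices. The (ideal) edges, triangles and tetrahedra of $\mathcal{T}$ are the corresponding cells of $K$ with vertices removed. "Boundary components" means the boundary components of the compact 3-manifold of which $M$ is the interior. **Normal disc types.** A normal arc in a triangle is a properly embedded arc joining the interiors of two distinct edges; a normal disc in a tetrahedron is a properly embedded disc meeting each face in one normal arc or not at all. Up to normal isotopy (isotopy preserving each cell) each tetrahedron has seven normal disc types: four normal triangles (each cutting off one corner, meeting the three edges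 at that corner) and three normal quadrilaterals (each separating a pair of opposite edges and meeting the other four edges). A quadrilateral type in a tetrahedron faces the two edges of that tetrahedron disjoint from it. Let $q_1,\dots,q_{3t}$ be all quadrilateral types and $p_1,\dots,p_{4t}$ all triangle types of $\mathcal{T}$. The degree $d(e)$ of an edge $e$ is the number of edges of the unglued tetrahedra which are glued to form $e$; each of these contributes one quadrilateral type facing $e$. **Solution spaces.** $C(M;\mathcal{T})\subset\mathbb{R}^{7t}$ is the vector space of all $(x_1,\dots,x_{3t},y_1,\dots,y_{4t})$ satisfying the compatibility equations: for each triangle of $\mathcal{T}$, arising by gluing a face $\tau$ of $\sigma^3_i$ to a face $\delta$ of $\sigma^3_j$ (possibly $i=j$), and each of the three normal arc types in it, $x_q+y_p=x_{q'}+y_{p'}$, where $q,p$ are the unique quadrilateral and triangle types in $\sigma^3_i$ meeting $\tau$ in this arc type, and $q',p'$ are the unique quadrilateral and triangle types in $\sigma^3_j$ meeting $\delta$ in this arc type. The $x_i$ are the quadrilateral coordinates. $PC(M;\mathcal{T})$ is the convex polytope $C(M;\mathcal{T})\cap\{x\in\mathbb{R}^{7t}: x_i\ge 0,\ \sum_{i=1}^{7t}x_i=1\}$, and the vertex solutions $V_1,\dots,V_m$ are its vertices. **Generalised Euler characteristic.** $\chi^*:\mathbb{R}^{7t}\to\mathbb{R}$ is the linear function $\chi^*(x,y)=\sum_i x_i\chi^*(q_i)+\sum_j y_j\chi^*(p_j)$, where $\chi^*(p)=-\tfrac12+\sum_{a=0}^2\tfrac1{d(e_a)}$ for a triangle type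 $p$ meeting edges $e_0,e_1,e_2$ (with multiplicity), and $\chi^*(q)=-1+\sum_{a=0}^3\tfrac1{d(e_a)}$ for a quadrilateral type $q$ meeting edges $e_0,\dots,e_3$ (with multiplicity). **Angle structure.** A function $\alpha:\{q_1,\dots,q_{3t}\}\to\mathbb{R}$ with all values positive such that: (i) for each tetrahedron, the sum of $\alpha$ over its three quadrilateral types is $\pi$; (ii) for each edge $e$, the sum of $\alpha$ over the $d(e)$ quadrilateral types facing $e$ (with multiplicity) is $2\pi$. *)

theory Defs
  imports "HOL-Analysis.Analysis"
begin

section \<open>Quotient spaces\<close>

definition glued_class :: "('a \<times> 'a) set \<Rightarrow> 'a \<Rightarrow> 'a set" where
  "glued_class r x = {y. (x, y) \<in> (r \<union> r\<inverse>)\<^sup>*}"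

text \<open>The quotient of \<open>X\<close> by the equivalence relation generated by \<open>r\<close>.\<close>

definition quotient_topology :: "'a topology \<Rightarrow> ('a \<times> 'a) set \<Rightarrow> 'a set topology" where
  "quotient_topology X r = topology (\<lambda>U. U \<subseteq> glued_class r ` topspace X \<and>
     openin X {x \<in> topspace X. glued_class r x \<in> U})"

lemma openin_quotient_topology:
  "openin (quotient_topology X r) U \<longleftrightarrow>
     U \<subseteq> glued_class r ` topspace X \<and> openin X {x \<in> topspace X. glued_class r x \<in> U}"
proof -
  have "istopology (\<lambda>U. U \<subseteq> glued_class r ` topspace X \<and>
          openin X {x \<in> topspace X. glued_class r x \<in> U})"
    unfolding istopology_def
  proof (intro conjI allI impI)
    fix S T
    assume "S \<subseteq> glued_class r ` topspace X \<and> openin X {x \<in> topspace X. glued_class r x \<in> S}"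
      and "T \<subseteq> glued_class r ` topspace X \<and> openin X {x \<in> topspace X. glued_class r x \<in> T}"
    moreover have "{x \<in> topspace X. glued_class r x \<in> S \<inter> T} =
        {x \<in> topspace X. glued_class r x \<in> S} \<inter> {x \<in> topspace X. glued_class r x \<in> T}"
      by auto
    ultimately show "S \<inter> T \<subseteq> glued_class r ` topspace X"
      and "openin X {x \<in> topspace X. glued_class r x \<in> S \<inter> T}"
      by auto
  next
    fix \<K>
    assume \<K>: "\<forall>S\<in>\<K>. S \<subseteq> glued_class r ` topspace X \<and>
        openin X {x \<in> topspace X. glued_class r x \<in> S}"
    then show "\<Union>\<K> \<subseteq> glued_class r ` topspace X"
      by blast
    have "{x \<in> topspace X. glued_class r x \<in> \<Union>\<K>} =
        (\<Union>S\<in>\<K>. {x \<in> topspace X. glued_class r x \<in> S})"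
      by auto
    with \<K> show "openin X {x \<in> topspace X. glued_class r x \<in> \<Union>\<K>}"
      by auto
  qed
  then show ?thesis
    unfolding quotient_topology_def by (simp add: topology_inverse')
qed

lemma topspace_quotient_topology:
  "topspace (quotient_topology X r) = glued_class r ` topspace X"
proof
  show "topspace (quotient_topology X r) \<subseteq> glued_class r ` topspace X"
    using openin_quotient_topology[of X r "topspace (quotient_topology X r)"] by simp
  have "{x \<in> topspace X. glued_class r x \<in> glued_class r ` topspace X} = topspace X"
    by auto
  then show "glued_class r ` topspace X \<subseteq> topspace (quotient_topology X r)"
    by (intro openin_subset) (simp add: openin_quotient_topology)
qed

lemma quotient_map_glued_class:
  "quotient_map X (quotient_topology X r) (glued_class r)"
  by (auto simp: quotient_map_def topspace_quotient_topology openin_quotient_topology)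

section \<open>3-manifolds, the torus and the Klein bottle\<close>

definition manifold_point :: "'a topology \<Rightarrow> 'a \<Rightarrow> bool" where
  "manifold_point X x \<longleftrightarrow> (\<exists>U V. openin X U \<and> x \<in> U \<and> open (V :: (real^3) set) \<and>
     subtopology X U homeomorphic_space top_of_set V)"

definition half_space_point :: "'a topology \<Rightarrow> 'a \<Rightarrow> bool" where
  "half_space_point X x \<longleftrightarrow> (\<exists>U V. openin X U \<and> x \<in> U \<and>
     openin (top_of_set {v :: real^3. 0 \<le> v $ 1}) V \<and>
     subtopology X U homeomorphic_space top_of_set V)"

definition compact_3_manifold_with_boundary :: "'a topology \<Rightarrow> bool" where
  "compact_3_manifold_with_boundary N \<longleftrightarrow> compact_space N \<and> Hausdorff_space N \<and>
     second_countable N \<and> (\<forall>x \<in> topspace N. half_space_point N x)"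

definition manifold_interior :: "'a topology \<Rightarrow> 'a set" where
  "manifold_interior N = {x \<in> topspace N. manifold_point N x}"

definition manifold_boundary :: "'a topology \<Rightarrow> 'a set" where
  "manifold_boundary N = topspace N - manifold_interior N"

definition torus :: "(complex \<times> complex) topology" where
  "torus = prod_topology (top_of_set (sphere 0 1)) (top_of_set (sphere 0 1))"

definition klein_bottle :: "(real \<times> real) set topology" where
  "klein_bottle = quotient_topology (top_of_set ({0..1} \<times> {0..1}))
     ({((0, y), (1, 1 - y)) | y. 0 \<le> y \<and> y \<le> 1} \<union> {((x, 0), (x, 1)) | x. 0 \<le> x \<and> x \<le> 1})"

section \<open>Face pairings and ideal triangulations\<close>

text \<open>
  The tetrahedra are indexed by a finite type \<open>'t\<close>, and the corners of each tetrahedron by the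
  four-element type \<open>4\<close>. Face \<open>a\<close> of a tetrahedron is the one opposite corner \<open>a\<close>. An affine
  isomorphism between faces is determined by its values on the vertices, so the one defined on
  face \<open>a\<close> of tetrahedron \<open>i\<close> is recorded by the target tetrahedron \<open>nbr T i a\<close> and a permutation
  \<open>perm T i a\<close> of the corners, which sends each vertex \<open>c \<noteq> a\<close> of the face to its image; the value
  of the permutation at \<open>a\<close> is then the label of the target face.
\<close>

record 't gluing =
  nbr :: "'t \<Rightarrow> 4 \<Rightarrow> 't"
  perm :: "'t \<Rightarrow> 4 \<Rightarrow> 4 \<Rightarrow> 4"

definition face_pairing :: "'t gluing \<Rightarrow> bool" where
  "face_pairing T \<longleftrightarrow> (\<forall>i a.
     bij (perm T i a) \<and>
     (nbr T i a, perm T i a a) \<noteq> (i, a) \<and>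
     nbr T (nbr T i a) (perm T i a a) = i \<and>
     perm T (nbr T i a) (perm T i a a) = inv (perm T i a))"

definition std_simplex :: "(real^4) set" where
  "std_simplex = {x. (\<forall>c. 0 \<le> x $ c) \<and> (\<Sum>c\<in>UNIV. x $ c) = 1}"

definition simplices :: "('t \<times> (real^4)) topology" where
  "simplices = sum_topology (\<lambda>i. top_of_set std_simplex) UNIV"

definition point_gluing :: "'t gluing \<Rightarrow> (('t \<times> (real^4)) \<times> ('t \<times> (real^4))) set" where
  "point_gluing T = {((i, x), (nbr T i a, y)) | i a x y.
     x \<in> std_simplex \<and> x $ a = 0 \<and> (\<forall>c. y $ perm T i a c = x $ c)}"

definition pseudo_manifold :: "'t gluing \<Rightarrow> ('t \<times> (real^4)) set topology" where
  "pseudo_manifold T = quotient_topology simplices (point_gluing T)"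

definition ideal_vertices :: "'t gluing \<Rightarrow> ('t \<times> (real^4)) set set" where
  "ideal_vertices T = {glued_class (point_gluing T) (i, axis c 1) | i c. True}"

definition minus_vertices :: "'t gluing \<Rightarrow> ('t \<times> (real^4)) set topology" where
  "minus_vertices T = subtopology (pseudo_manifold T)
     (topspace (pseudo_manifold T) - ideal_vertices T)"

definition ideal_triangulation ::
    "'m topology \<Rightarrow> 't gluing \<Rightarrow> (('t \<times> (real^4)) set \<Rightarrow> 'm) \<Rightarrow> bool" where
  "ideal_triangulation M T h \<longleftrightarrow> face_pairing T \<and>
     (\<forall>x \<in> topspace (pseudo_manifold T) - ideal_vertices T. manifold_point (pseudo_manifold T) x) \<and>
     homeomorphic_map (minus_vertices T) M h"

text \<open>
  An edge of an unglued tetrahedron is a pair of a tetrahedron and a two-element set of corners;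
  an edge of the triangulation is the set of all unglued edges that form it.
\<close>

definition edge_gluing :: "'t gluing \<Rightarrow> (('t \<times> 4 set) \<times> ('t \<times> 4 set)) set" where
  "edge_gluing T = {((i, e), (nbr T i a, perm T i a ` e)) | i a e. card e = 2 \<and> a \<notin> e}"

definition edges :: "'t gluing \<Rightarrow> ('t \<times> 4 set) set set" where
  "edges T = glued_class (edge_gluing T) ` {(i, e). card e = 2}"

definition edge_degree :: "'t gluing \<Rightarrow> 't \<times> 4 set \<Rightarrow> nat" where
  "edge_degree T ie = card (glued_class (edge_gluing T) ie)"

section \<open>Normal disc types\<close>

text \<open>
  A quadrilateral type is named by the pair of opposite edges it separates; these are also the
  edges it faces. A triangle type is named by the corner it cuts off.
\<close>

datatype quad = Q12_34 | Q13_24 | Q14_23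

lemma UNIV_quad: "UNIV = {Q12_34, Q13_24, Q14_23}"
  by (auto intro: quad.exhaust)

instance quad :: finite
  by standard (simp add: UNIV_quad)

fun faced_edges :: "quad \<Rightarrow> 4 set set" where
  "faced_edges Q12_34 = {{1, 2}, {3, 4}}"
| "faced_edges Q13_24 = {{1, 3}, {2, 4}}"
| "faced_edges Q14_23 = {{1, 4}, {2, 3}}"

definition quad_edges :: "quad \<Rightarrow> 4 set set" where
  "quad_edges q = {e. card e = 2 \<and> e \<notin> faced_edges q}"

definition tri_edges :: "4 \<Rightarrow> 4 set set" where
  "tri_edges p = {{p, c} | c. c \<noteq> p}"

text \<open>
  Normal arcs and discs are determined up to normal isotopy by the edges they meet. The normal arc
  in face \<open>a\<close> cutting off the vertex \<open>v\<close> of that face meets the two edges of the face at \<open>v\<close>.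
  A disc meeting the edges in \<open>D\<close> meets face \<open>a\<close> in the arc joining those edges in \<open>D\<close>
  which lie in face \<open>a\<close>.
\<close>

definition arc_edges :: "4 \<Rightarrow> 4 \<Rightarrow> 4 set set" where
  "arc_edges a v = {{v, c} | c. c \<noteq> v \<and> c \<noteq> a}"

definition meets_face_in :: "4 set set \<Rightarrow> 4 \<Rightarrow> 4 set set \<Rightarrow> bool" where
  "meets_face_in D a A \<longleftrightarrow> {e \<in> D. a \<notin> e} = A"

lemma two_subsets_4:
  "card (e :: 4 set) = 2 \<longleftrightarrow> e \<in> {{1,2},{1,3},{1,4},{2,3},{2,4},{3,4}}"
proof
  assume "card e = 2"
  then obtain b c where e: "e = {b, c}" "b \<noteq> c"
    by (meson card_2_iff)
  show "e \<in> {{1,2},{1,3},{1,4},{2,3},{2,4},{3,4}}"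
    using exhaust_4[of b] exhaust_4[of c] e(2) unfolding e(1)
    by (elim disjE) (simp_all add: doubleton_eq_iff)
qed auto

text \<open>
  The compatibility equations below quantify over all disc types meeting a face in a given arc;
  by the following lemmas there is exactly one of each kind.
\<close>

lemma quad_meets_face_in_iff:
  assumes "v \<noteq> a"
  shows "meets_face_in (quad_edges q) a (arc_edges a v) \<longleftrightarrow> {a, v} \<in> faced_edges q"
proof -
  have arc: "e \<in> arc_edges a v \<longleftrightarrow> card e = 2 \<and> v \<in> e \<and> a \<notin> e" for e
    using assms by (auto simp: arc_edges_def card_2_iff)
  have "meets_face_in (quad_edges q) a (arc_edges a v) \<longleftrightarrow>
      (\<forall>e. card e = 2 \<longrightarrow> a \<notin> e \<longrightarrow> (e \<in> faced_edges q \<longleftrightarrow> v \<notin> e))"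
    unfolding meets_face_in_def set_eq_iff mem_Collect_eq arc quad_edges_def by blast
  also have "\<dots> \<longleftrightarrow> (\<forall>e \<in> {{1,2},{1,3},{1,4},{2,3},{2,4},{3,4}}.
      a \<notin> e \<longrightarrow> (e \<in> faced_edges q \<longleftrightarrow> v \<notin> e))"
    unfolding two_subsets_4 Ball_def ..
  also have "\<dots> \<longleftrightarrow> {a, v} \<in> faced_edges q"
  proof -
    have "\<forall>a v :: 4. v \<noteq> a \<longrightarrow> ((\<forall>e \<in> {{1,2},{1,3},{1,4},{2,3},{2,4},{3,4}}.
      a \<notin> e \<longrightarrow> (e \<in> faced_edges q \<longleftrightarrow> v \<notin> e)) \<longleftrightarrow> {a, v} \<in> faced_edges q)"
      by (cases q) (simp_all add: forall_4 doubleton_eq_iff)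
    from this[THEN spec, THEN spec, THEN mp, OF assms] show ?thesis .
  qed
  finally show ?thesis .
qed

lemma tri_meets_face_in_iff:
  assumes "v \<noteq> a"
  shows "meets_face_in (tri_edges p) a (arc_edges a v) \<longleftrightarrow> p = v"
proof
  have tri: "{e \<in> tri_edges p. a \<notin> e} = (if p = a then {} else arc_edges a p)"
    by (auto simp: tri_edges_def arc_edges_def)
  obtain b c where bc: "b \<noteq> v" "b \<noteq> a" "c \<noteq> v" "c \<noteq> a" "b \<noteq> c"
  proof -
    have "card (UNIV - {v, a}) = 2"
      using assms by (simp add: card_Diff_subset)
    then obtain b c where "UNIV - {v, a} = {b, c}" "b \<noteq> c"
      by (meson card_2_iff)
    with that show thesis by blast
  qed
  assume "meets_face_in (tri_edges p) a (arc_edges a v)"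
  then have *: "(if p = a then {} else arc_edges a p) = arc_edges a v"
    by (simp add: meets_face_in_def tri)
  have "{v, b} \<in> arc_edges a v" "{v, c} \<in> arc_edges a v"
    using bc by (auto simp: arc_edges_def)
  then have "{v, b} \<in> arc_edges a p" "{v, c} \<in> arc_edges a p"
    using * by (auto split: if_splits)
  then have "p \<in> {v, b}" "p \<in> {v, c}"
    by (auto simp: arc_edges_def)
  with bc show "p = v" by auto
next
  assume "p = v"
  with assms show "meets_face_in (tri_edges p) a (arc_edges a v)"
    by (auto simp: meets_face_in_def tri_edges_def arc_edges_def)
qed

section \<open>Solution spaces, the generalised Euler characteristic and angle structures\<close>

text \<open>
  The two components of a vector are its quadrilateral and its triangle coordinates.
\<close>

type_synonym 't coords = "(real ^ ('t \<times> quad)) \<times> (real ^ ('t \<times> 4))"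

definition solution_space :: "'t gluing \<Rightarrow> ('t::finite) coords set" where
  "solution_space T = {(x, y). \<forall>i a v q p q' p'. v \<noteq> a \<longrightarrow>
     meets_face_in (quad_edges q) a (arc_edges a v) \<longrightarrow>
     meets_face_in (tri_edges p) a (arc_edges a v) \<longrightarrow>
     meets_face_in (quad_edges q') (perm T i a a) (arc_edges (perm T i a a) (perm T i a v)) \<longrightarrow>
     meets_face_in (tri_edges p') (perm T i a a) (arc_edges (perm T i a a) (perm T i a v)) \<longrightarrow>
     x $ (i, q) + y $ (i, p) = x $ (nbr T i a, q') + y $ (nbr T i a, p')}"

definition projective_solution_space :: "'t gluing \<Rightarrow> ('t::finite) coords set" where
  "projective_solution_space T = solution_space T \<inter>
     {(x, y). (\<forall>k. 0 \<le> x $ k) \<and> (\<forall>k. 0 \<le> y $ k) \<and> (\<Sum>k\<in>UNIV. x $ k) + (\<Sum>k\<in>UNIV. y $ k) = 1}"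

definition tri_euler :: "'t gluing \<Rightarrow> 't \<times> 4 \<Rightarrow> real" where
  "tri_euler T = (\<lambda>(i, p). - 1 / 2 + (\<Sum>e\<in>tri_edges p. 1 / real (edge_degree T (i, e))))"

definition quad_euler :: "'t gluing \<Rightarrow> 't \<times> quad \<Rightarrow> real" where
  "quad_euler T = (\<lambda>(i, q). - 1 + (\<Sum>e\<in>quad_edges q. 1 / real (edge_degree T (i, e))))"

definition gen_euler :: "'t gluing \<Rightarrow> ('t::finite) coords \<Rightarrow> real" where
  "gen_euler T = (\<lambda>(x, y).
     (\<Sum>k\<in>UNIV. x $ k * quad_euler T k) + (\<Sum>k\<in>UNIV. y $ k * tri_euler T k))"

text \<open>
  The inner sum in the last condition has exactly one term, the quadrilateral type in tetrahedron
  \<open>i\<close> facing \<open>e\<close>; a type facing two unglued edges in the same class is counted twice.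
\<close>

definition angle_structure :: "'t gluing \<Rightarrow> ('t \<times> quad \<Rightarrow> real) \<Rightarrow> bool" where
  "angle_structure T \<alpha> \<longleftrightarrow>
     (\<forall>k. 0 < \<alpha> k) \<and>
     (\<forall>i. (\<Sum>q\<in>UNIV. \<alpha> (i, q)) = pi) \<and>
     (\<forall>E \<in> edges T. (\<Sum>(i, e)\<in>E. \<Sum>q | e \<in> faced_edges q. \<alpha> (i, q)) = 2 * pi)"

lemma unique_faced_quad:
  assumes "card (e :: 4 set) = 2"
  shows "\<exists>!q. e \<in> faced_edges q"
proof -
  obtain b c where e: "e = {b, c}" "b \<noteq> c"
    using assms by (meson card_2_iff)
  obtain q where q: "e \<in> faced_edges q"
  proof -
    have "e \<in> faced_edges Q12_34 \<or> e \<in> faced_edges Q13_24 \<or> e \<in> faced_edges Q14_23"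
      using exhaust_4[of b] exhaust_4[of c] e(2) unfolding e(1)
      by (elim disjE) (simp_all add: doubleton_eq_iff)
    with that show thesis by blast
  qed
  moreover have "q = q'" if "e \<in> faced_edges q" "e \<in> faced_edges q'" for q q'
    using that by (cases q; cases q') (auto simp: doubleton_eq_iff)
  ultimately show ?thesis by blast
qed

end

theory Submission
  imports Defs
begin

text \<open>
The algebra rests on a change of coordinates. A solution \<open>s\<close> is governed by a weight \<open>z i\<close> for each
tetrahedron and a weight \<open>w e\<close> for each unglued edge: a quadrilateral coordinate is \<open>z i\<close> plus the
weights of the two faced edges, and the compatibility equations say that \<open>w\<close> is constant on the
classes forming the edges of the triangulation. Summation gives
\<open>gen_euler T s = - (sum of z) - 2 * (sum of w over the edges of T)\<close> (\<open>gen_euler_weights\<close>), while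
pairing the quadrilateral coordinates with \<open>\<alpha>\<close> collects the sum of \<open>\<alpha>\<close> in tetrahedron \<open>i\<close> as
coefficient of \<open>z i\<close> and the sum of \<open>\<alpha>\<close> around an edge as coefficient of its weight. Hence a positive \<open>\<alpha>\<close>
is an angle structure if and only if this pairing is \<open>- pi * gen_euler T s\<close> for every solution
(\<open>angle_structure_iff\<close>). An angle structure thus makes \<open>gen_euler\<close> negative on every solution
whose quadrilateral coordinates are non-negative and not all zero, and conversely such an \<open>\<alpha>\<close> is found by separating the solutions with \<open>gen_euler T s = 0\<close> from the simplex of
non-negative quadrilateral coordinates (\<open>angle_structure_of_negative\<close>).

Restricting this negativity to the polytope, and then to its vertices, is immediate. In the other direction one adds a multiple of the
solution with all triangle coordinates 1 and no quadrilaterals, rescales, and writes a point of the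
polytope as a convex combination of vertices. This works once \<open>gen_euler\<close> vanishes on the
solutions without quadrilaterals. Such a solution is constant on the corners around each ideal
vertex, so the claim is that the link of an ideal vertex has Euler characteristic zero, in the form
\<open>sum_tri_euler_corner_class\<close>.

The hypothesis concerns the boundary components of \<open>N\<close>, whereas the links live in the glued complex;
a priori the two only share their deleted neighbourhoods. They are compared through cohomology in degree one
with coefficients in the field with two elements, realised by two-valued local systems
(\<open>local_system\<close>). On the one hand the collar of an ideal vertex is glued from convex pieces, so
its cohomology consists of the cocycles modulo the coboundaries on the sides of the corners
(\<open>realises_exists\<close>, \<open>realises_some\<close>, \<open>realises_trivial_iff\<close>). On the other hand the collar is a deleted
neighbourhood of a whole boundary component (\<open>end_of_component\<close>), and restriction to this component
is injective and surjective, because systems extend over a boundary with half-ball charts and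
because on a compact Hausdorff space the germs along a closed set have the cohomology of that set
(\<open>local_system_extends_boundary\<close>, \<open>trivial_near_closed\<close>, \<open>local_system_extends_near_closed\<close>). The torus and the Klein bottle
have cohomology of order four, and this number determines how many edges end at the ideal vertex
(\<open>twice_card_edge_ends\<close>).

The Euler characteristic also requires that no edge is glued to itself with its ends
exchanged. Otherwise the deleted neighbourhood of its midpoint would carry a nontrivial system, the
one exchanging the two ends, while a punctured ball carries none (\<open>no_reversed_edge\<close>).
\<close>

section \<open>Two-valued local systems\<close>

text \<open>Boolean functions are taken modulo global negation, so only where they jump matters. Here \<open>f\<close> and \<open>g\<close>
define the same germ at \<open>x\<close> modulo constants.\<close>

definition same_jumps_at :: "'a topology => ('a => bool) => ('a => bool) => 'a => bool" where
 "same_jumps_at X f g x \<longleftrightarrow>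
   (\<exists>U. openin X U & x \<in> U & (\<forall>y\<in>U. (f y = f x) = (g y = g x)))"

text \<open>A system assigns to each point \<open>x\<close> the germ modulo constants of a Boolean function \<open>s x\<close>, locally
consistently: nearby germs come from a single function. These are the global sections of the sheaf
of Boolean functions modulo locally constant ones. Since the sheaf of all functions is flabby, modulo the systems
given by a single function they form the first cohomology group with coefficients in the field with two elements.\<close>

definition local_system :: "'a topology => ('a => 'a => bool) => bool" where
 "local_system X s \<longleftrightarrow> (\<forall>x\<in>topspace X. \<exists>U. openin X U & x \<in> U &
   (\<forall>y\<in>U. same_jumps_at X (s x) (s y) y))"

definition trivialises :: "'a topology => ('a => 'a => bool) => ('a => bool) => bool" where
 "trivialises X s f \<longleftrightarrow> (\<forall>x\<in>topspace X. same_jumps_at X (s x) f x)"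

definition trivial_system :: "'a topology => ('a => 'a => bool) => bool" where
 "trivial_system X s \<longleftrightarrow> (\<exists>f. trivialises X s f)"

definition H1_trivial :: "'a topology => bool" where
 "H1_trivial X \<longleftrightarrow> (\<forall>s. local_system X s --> trivial_system X s)"

text \<open>Addition in the cohomology group; two systems define the same class if their sum is trivial.\<close>

definition system_sum :: "('a => 'a => bool) => ('a => 'a => bool) => 'a => 'a => bool" where
 "system_sum s t x y \<longleftrightarrow> (s x y ~= t x y)"

definition locally_constant_on :: "'a topology => ('a => bool) => bool" where
 "locally_constant_on X P \<longleftrightarrow>
   (\<forall>x\<in>topspace X. \<exists>U. openin X U & x \<in> U & (\<forall>y\<in>U. P y = P x))"

lemma same_jumps_atI:
 assumes "openin X U" "x \<in> U" "\<And>y. y \<in> U ==> (f y = f x) = (g y = g x)"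
 shows "same_jumps_at X f g x"
 using assms unfolding same_jumps_at_def by blast

lemma same_jumps_atE:
 assumes "same_jumps_at X f g x"
 obtains U where "openin X U" "x \<in> U" "\<forall>y\<in>U. (f y = f x) = (g y = g x)"
 using assms unfolding same_jumps_at_def by blast

lemma same_jumps_at_refl: "x \<in> topspace X ==> same_jumps_at X f f x"
 by (rule same_jumps_atI[of _ "topspace X"]) auto

lemma same_jumps_at_sym: "same_jumps_at X f g x ==> same_jumps_at X g f x"
 by (elim same_jumps_atE, rule same_jumps_atI) blast+

lemma same_jumps_at_trans:
 assumes "same_jumps_at X f g x" "same_jumps_at X g h x"
 shows "same_jumps_at X f h x"
proof -
 obtain U where U: "openin X U" "x \<in> U" "\<forall>y\<in>U. (f y = f x) = (g y = g x)"
  using assms(1) by (rule same_jumps_atE)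
 obtain V where V: "openin X V" "x \<in> V" "\<forall>y\<in>V. (g y = g x) = (h y = h x)"
  using assms(2) by (rule same_jumps_atE)
 show ?thesis
  by (rule same_jumps_atI[of _ "U \<inter> V"]) (use U V in auto)
qed

lemma same_jumps_at_pullback:
 assumes "continuous_map X Y g" "x \<in> topspace X" "same_jumps_at Y f f' (g x)"
 shows "same_jumps_at X (%z. f (g z)) (%z. f' (g z)) x"
using assms(3) assms(1) openin_continuous_map_preimage assms(2) by (auto simp: same_jumps_at_def)

lemma same_jumps_at_subtopology:
 "same_jumps_at X f g x ==> x \<in> S ==> same_jumps_at (subtopology X S) f g x"
 unfolding same_jumps_at_def by (metis IntD1 IntD2 IntI openin_subtopology)

lemma same_jumps_at_open_subtopology:
 assumes "openin X S" "same_jumps_at (subtopology X S) f g x"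
 shows "same_jumps_at X f g x"
 using assms unfolding same_jumps_at_def by (metis openin_open_subtopology)

lemma same_jumps_at_xor:
 assumes "same_jumps_at X f g x" "same_jumps_at X f' g' x"
 shows "same_jumps_at X (%y. f y ~= f' y) (%y. g y ~= g' y) x"
proof -
 obtain U where U: "openin X U" "x \<in> U" "\<forall>y\<in>U. (f y = f x) = (g y = g x)"
  using assms(1) by (rule same_jumps_atE)
 obtain V where V: "openin X V" "x \<in> V" "\<forall>y\<in>V. (f' y = f' x) = (g' y = g' x)"
  using assms(2) by (rule same_jumps_atE)
 show ?thesis
 proof (rule same_jumps_atI[of _ "U \<inter> V"])
  fix y assume "y \<in> U \<inter> V"
  with U(3) V(3) have "(f y = f x) = (g y = g x)" "(f' y = f' x) = (g' y = g' x)" by blast+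
  then show "((f y ~= f' y) = (f x ~= f' x)) = ((g y ~= g' y) = (g x ~= g' x))" by blast
 qed (use U V in auto)
qed

lemma local_system_pullback:
 assumes g: "continuous_map X Y g" and s: "local_system Y s"
 shows "local_system X (%x z. s (g x) (g z))"
 unfolding local_system_def
proof
 fix x assume x: "x \<in> topspace X"
 then have "g x \<in> topspace Y" using g by (auto simp: continuous_map_def)
 then obtain U where U: "openin Y U" "g x \<in> U" "\<forall>y\<in>U. same_jumps_at Y (s (g x)) (s y) y"
  using s unfolding local_system_def by blast
 show "\<exists>V. openin X V & x \<in> V &
   (\<forall>y\<in>V. same_jumps_at X (%z. s (g x) (g z)) (%z. s (g y) (g z)) y)"
 proof (intro exI conjI ballI)
  show "openin X {z \<in> topspace X. g z \<in> U}"
   using g U(1) openin_continuous_map_preimage by blast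
  show "x \<in> {z \<in> topspace X. g z \<in> U}" using x U by auto
 next
  fix y assume "y \<in> {z \<in> topspace X. g z \<in> U}"
  then show "same_jumps_at X (%z. s (g x) (g z)) (%z. s (g y) (g z)) y"
   using U(3) by (intro same_jumps_at_pullback[OF g]) auto
 qed
qed

lemma trivialises_pullback:
 assumes g: "continuous_map X Y g" and s: "trivialises Y s f"
 shows "trivialises X (%x z. s (g x) (g z)) (%x. f (g x))"
 unfolding trivialises_def
proof
 fix x assume "x \<in> topspace X"
 moreover from this have "g x \<in> topspace Y" using g by (auto simp: continuous_map_def)
 ultimately show "same_jumps_at X (%z. s (g x) (g z)) (%x. f (g x)) x"
  using s by (intro same_jumps_at_pullback[OF g]) (auto simp: trivialises_def)
qed

lemma local_system_subtopology:
 "local_system X s ==> local_system (subtopology X S) s"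
 using local_system_pullback[of "subtopology X S" X id s] by (simp add: continuous_map_from_subtopology)

lemma trivialises_subtopology:
 "trivialises X s f ==> trivialises (subtopology X S) s f"
 using trivialises_pullback[of "subtopology X S" X id s] by (simp add: continuous_map_from_subtopology)

lemma trivial_system_subtopology:
 "trivial_system X s ==> trivial_system (subtopology X S) s"
 unfolding trivial_system_def using trivialises_subtopology by blast

lemma local_system_sum:
 assumes "local_system X s" "local_system X t"
 shows "local_system X (system_sum s t)"
 unfolding local_system_def
proof
 fix x assume x: "x \<in> topspace X"
 obtain U where U: "openin X U" "x \<in> U" "\<forall>y\<in>U. same_jumps_at X (s x) (s y) y"
  using x assms(1) unfolding local_system_def by blast
 obtain V where V: "openin X V" "x \<in> V" "\<forall>y\<in>V. same_jumps_at X (t x) (t y) y"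
  using x assms(2) unfolding local_system_def by blast
 have eq: "system_sum s t y = (%z. s y z ~= t y z)" for y by (auto simp: system_sum_def fun_eq_iff)
 show "\<exists>W. openin X W & x \<in> W & (\<forall>y\<in>W. same_jumps_at X (system_sum s t x) (system_sum s t y) y)"
  unfolding eq
  by (intro exI[of _ "U \<inter> V"] conjI ballI same_jumps_at_xor) (use U V in auto)
qed

lemma trivialises_sum:
 assumes "trivialises X s f" "trivialises X t g"
 shows "trivialises X (system_sum s t) (%x. f x ~= g x)"
proof -
 have eq: "system_sum s t y = (%z. s y z ~= t y z)" for y by (auto simp: system_sum_def fun_eq_iff)
 show ?thesis using assms unfolding trivialises_def eq by (intro ballI same_jumps_at_xor) auto
qed

lemma connected_locally_constant:
 assumes X: "connected_space X" and P: "locally_constant_on X P"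
  and "x \<in> topspace X" "y \<in> topspace X"
 shows "P x = P y"
proof -
 have op: "openin X {z \<in> topspace X. P z = b}" for b
 proof (subst openin_subopen, intro ballI)
  fix z assume z: "z \<in> {z \<in> topspace X. P z = b}"
  then obtain U where U: "openin X U" "z \<in> U" "\<forall>y\<in>U. P y = P z"
   using P unfolding locally_constant_on_def by blast
  have "U \<subseteq> {z \<in> topspace X. P z = b}"
  using U(3) z openin_subset U(1) by blast
  with U show "\<exists>T. openin X T & z \<in> T & T \<subseteq> {z \<in> topspace X. P z = b}"
   by blast
 qed
 show ?thesis
 using op assms(3,4) X unfolding connected_space_def by blast
qed
lemma locally_constant_differenceI:
 assumes "\<And>x. x \<in> topspace X ==> same_jumps_at X f g x"
 shows "locally_constant_on X (%x. f x ~= g x)"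
 unfolding locally_constant_on_def
by (metis assms same_jumps_atE)

lemma trivialises_unique:
 assumes "trivialises X s f" "trivialises X s g"
 shows "locally_constant_on X (%x. f x ~= g x)"
 using assms unfolding trivialises_def
 by (intro locally_constant_differenceI) (meson same_jumps_at_sym same_jumps_at_trans)

lemma H1_trivial_homeomorphic:
 assumes "X homeomorphic_space Y" "H1_trivial X"
 shows "H1_trivial Y"
 unfolding H1_trivial_def
proof (intro allI impI)
 fix s assume s: "local_system Y s"
 obtain f g where fg: "homeomorphic_maps X Y f g"
  using assms(1) unfolding homeomorphic_space_def by blast
 then have f: "continuous_map X Y f" and g: "continuous_map Y X g"
  and fg': "\<And>y. y \<in> topspace Y ==> f (g y) = y"
  unfolding homeomorphic_maps_def by auto
 obtain k where "trivialises X (%x z. s (f x) (f z)) k"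
  using local_system_pullback[OF f s] assms(2) unfolding H1_trivial_def trivial_system_def by blast
 from trivialises_pullback[OF g this]
 have *: "trivialises Y (%x z. s (f (g x)) (f (g z))) (%x. k (g x))" .
 have "trivialises Y s (%x. k (g x))"
  unfolding trivialises_def
 proof
  fix y assume y: "y \<in> topspace Y"
  then obtain U where U: "openin Y U" "y \<in> U"
   "\<forall>z\<in>U. (s (f (g y)) (f (g z)) = s (f (g y)) (f (g y))) = (k (g z) = k (g y))"
   using * unfolding trivialises_def same_jumps_at_def by blast
  have "f (g z) = z" if "z \<in> U" for z using openin_subset[OF U(1)] fg' that by auto
  then have "\<forall>z\<in>U. (s y z = s y y) = (k (g z) = k (g y))"
   using U(2,3) by simp
  with U show "same_jumps_at Y (s y) (%x. k (g x)) y"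
   unfolding same_jumps_at_def by blast
 qed
 then show "trivial_system Y s" unfolding trivial_system_def by blast
qed

text \<open>Trivialisations on the two pieces differ on the overlap by a locally constant function, which
is a constant since the overlap is connected, and one of them can be negated. This is a case of the
Mayer--Vietoris sequence.\<close>

lemma H1_trivial_Un:
 assumes A: "openin X A" "H1_trivial (subtopology X A)"
  and B: "openin X B" "H1_trivial (subtopology X B)"
  and AB: "A \<union> B = topspace X" "connectedin X (A \<inter> B)"
 shows "H1_trivial X"
 unfolding H1_trivial_def
proof (intro allI impI)
 fix s assume s: "local_system X s"
 obtain f where f: "trivialises (subtopology X A) s f"
  using A(2) local_system_subtopology[OF s] unfolding H1_trivial_def trivial_system_def by blast
 obtain g where g: "trivialises (subtopology X B) s g"
  using B(2) local_system_subtopology[OF s] unfolding H1_trivial_def trivial_system_def by blast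
 have fA: "same_jumps_at X (s x) f x" if "x \<in> A" for x
  using f A(1) that same_jumps_at_open_subtopology openin_subset[OF A(1)]
  unfolding trivialises_def by (metis Int_absorb1 topspace_subtopology)
 have gB: "same_jumps_at X (s x) g x" if "x \<in> B" for x
  using g B(1) that same_jumps_at_open_subtopology openin_subset[OF B(1)]
  unfolding trivialises_def by (metis Int_absorb1 topspace_subtopology)
 have "same_jumps_at X f g x" if "x \<in> A \<inter> B" for x
  using fA[of x] gB[of x] that by (meson IntD1 IntD2 same_jumps_at_trans same_jumps_at_sym)
 then have "locally_constant_on (subtopology X (A \<inter> B)) (%x. f x ~= g x)"
  by (intro locally_constant_differenceI same_jumps_at_subtopology) auto
 moreover have "connected_space (subtopology X (A \<inter> B))" using AB(2) by (simp add: connectedin_def)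
 ultimately have const: "(f x ~= g x) = (f y ~= g y)" if "x \<in> A \<inter> B" "y \<in> A \<inter> B" for x y
  using connected_locally_constant[of "subtopology X (A \<inter> B)"] that openin_subset[OF A(1)] by auto
 define d where "d \<longleftrightarrow> (\<exists>x\<in>A \<inter> B. f x ~= g x)"
 have d: "(f x ~= g x) = d" if "x \<in> A \<inter> B" for x
  using const that unfolding d_def by blast
 define k where "k x \<longleftrightarrow> (if x \<in> A then f x else (g x ~= d))" for x
 have kB: "k x = (g x ~= d)" if "x \<in> B" for x
  using d[of x] that unfolding k_def by auto
 have "trivialises X s k"
  unfolding trivialises_def
 proof
  fix x assume "x \<in> topspace X"
  with AB consider "x \<in> A" | "x \<in> B" by blast
  then show "same_jumps_at X (s x) k x"
  proof cases
   case 1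
   have "same_jumps_at X f k x"
    by (rule same_jumps_atI[OF A(1) 1]) (use 1 in \<open>simp add: k_def\<close>)
   then show ?thesis by (rule same_jumps_at_trans[OF fA[OF 1]])
  next
   case 2
   have "same_jumps_at X g k x"
    by (rule same_jumps_atI[OF B(1) 2]) (use 2 kB in blast)
   then show ?thesis by (rule same_jumps_at_trans[OF gB[OF 2]])
  qed
 qed
 then show "trivial_system X s" unfolding trivial_system_def by blast
qed

lemma H1_trivial_disjoint_open_cover:
 assumes "\<And>i. i \<in> I ==> openin X (A i)" "\<And>i. i \<in> I ==> H1_trivial (subtopology X (A i))"
  and cover: "topspace X = (\<Union>i\<in>I. A i)" and disj: "disjoint_family_on A I"
 shows "H1_trivial X"
 unfolding H1_trivial_def
proof (intro allI impI)
 fix s assume s: "local_system X s"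
 have "\<exists>f. trivialises (subtopology X (A i)) s f" if "i \<in> I" for i
  using assms(2)[OF that] local_system_subtopology[OF s] unfolding H1_trivial_def trivial_system_def by blast
 then obtain f where f: "\<And>i. i \<in> I ==> trivialises (subtopology X (A i)) s (f i)" by metis
 define k where "k x \<longleftrightarrow> (\<exists>i\<in>I. x \<in> A i & f i x)" for x
 have k: "k x = f i x" if "i \<in> I" "x \<in> A i" for i x
 proof
  assume "k x"
  then obtain j where j: "j \<in> I" "x \<in> A j" "f j x" unfolding k_def by blast
  have "j = i" using disj j(1,2) that unfolding disjoint_family_on_def by blast
  with j show "f i x" by simp
 qed (use that k_def in blast)
 have "trivialises X s k"
  unfolding trivialises_def
 proof
  fix x assume x: "x \<in> topspace X"
  then obtain i where i: "i \<in> I" "x \<in> A i" using cover by blast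
  have *: "same_jumps_at X (f i) k x"
   by (rule same_jumps_atI[OF assms(1)[OF i(1)] i(2)]) (use k[OF i(1)] i(2) in blast)
  have "same_jumps_at (subtopology X (A i)) (s x) (f i) x"
   using f[OF i(1)] i x unfolding trivialises_def by simp
  then have "same_jumps_at X (s x) (f i) x"
   by (rule same_jumps_at_open_subtopology[OF assms(1)[OF i(1)]])
  from this * show "same_jumps_at X (s x) k x" by (rule same_jumps_at_trans)
 qed
 then show "trivial_system X s" unfolding trivial_system_def by blast
qed

section \<open>Local systems on contractible spaces\<close>

text \<open>Bolzano's bisection extends a trivialisation along the interval over a small neighbourhood of
\<open>x\<close>. Two adjacent ones are matched by adding to the second the discrepancy \<open>e\<close> at the meeting height, which is allowed
to depend on the point of \<open>X\<close> because it is locally constant there.\<close>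

lemma trivialising_tube:
 fixes s :: "'a \<times> real => 'a \<times> real => bool"
 assumes s: "local_system (prod_topology X (top_of_set {0..1})) s" and x: "x \<in> topspace X"
 obtains V f where "openin X V" "x \<in> V"
  "\<forall>y\<in>V. \<forall>t\<in>{0..1}. same_jumps_at (prod_topology X (top_of_set {0..1})) (s (y, t)) f (y, t)"
proof -
 let ?I = "top_of_set {0..1::real}"
 let ?Z = "prod_topology X ?I"
 have box: "openin ?Z (W \<times> ({0..1} \<inter> J))" if "openin X W" "open J" for W J
  using that by (simp add: openin_prod_Times_iff openin_open_Int)
 define P where "P a b \<longleftrightarrow> (0 <= a --> b <= 1 --> (\<exists>V f d. openin X V & x \<in> V & 0 < d &
   (\<forall>y\<in>V. \<forall>t\<in>{0..1} \<inter> {a - d<..<b + d}. same_jumps_at ?Z (s (y, t)) f (y, t))))" for a b :: real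
 have "P 0 1"
 proof (rule Bolzano)
  fix a b c assume ab: "P a b" and bc: "P b c" and le: "a <= b" "b <= c"
  show "P a c"
   unfolding P_def
  proof (intro impI)
   assume ac: "0 <= a" "c <= 1"
   have b: "b <= 1" "0 <= b" using ac le by auto
   obtain V f d where V: "openin X V" "x \<in> V" "0 < d"
    "\<forall>y\<in>V. \<forall>t\<in>{0..1} \<inter> {a - d<..<b + d}. same_jumps_at ?Z (s (y, t)) f (y, t)"
    using ab[unfolded P_def, rule_format, OF ac(1) b(1)] by (elim exE conjE)
   obtain V' g d' where V': "openin X V'" "x \<in> V'" "0 < d'"
    "\<forall>y\<in>V'. \<forall>t\<in>{0..1} \<inter> {b - d'<..<c + d'}. same_jumps_at ?Z (s (y, t)) g (y, t)"
    using bc[unfolded P_def, rule_format, OF b(2) ac(2)] by (elim exE conjE)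
   note V4 = V(4)[rule_format] and V'4 = V'(4)[rule_format]
   define G where "G = V \<inter> V'"
   define r where "r = min d d'"
   have G: "openin X G" "x \<in> G" "0 < r" using V V' by (auto simp: G_def r_def)
   define e where "e y \<longleftrightarrow> f (y, b) ~= g (y, b)" for y
   (* By connectedness of the overlap, h is also equal to f slightly above the height b. *)
   define h where "h p \<longleftrightarrow> (if snd p <= b then f p else g p ~= e (fst p))" for p
   have fg: "same_jumps_at ?Z f g (y, u)" if "y \<in> G" "u \<in> {0..1} \<inter> ball b r" for y u
   proof -
    have "same_jumps_at ?Z (s (y, u)) f (y, u)" "same_jumps_at ?Z (s (y, u)) g (y, u)"
     using that le by (auto intro!: V4 V'4 simp: G_def r_def dist_real_def)
    then show ?thesis by (meson same_jumps_at_sym same_jumps_at_trans)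
   qed
   have over: "f (y, u) = (g (y, u) ~= e y)" if y: "y \<in> G" and u: "u \<in> {0..1} \<inter> ball b r" for y u
   proof -
    let ?K = "top_of_set ({0..1} \<inter> ball b r)"
    have yX: "y \<in> topspace X" using y G(1) openin_subset by blast
    have c: "continuous_map ?K ?Z (%t. (y, t))"
     using yX by (intro continuous_map_pairedI) auto
    have "locally_constant_on ?K (%t. f (y, t) ~= g (y, t))"
     by (intro locally_constant_differenceI same_jumps_at_pullback[OF c]) (use fg[OF y] in auto)
    moreover have "connectedin euclidean ({0..1} \<inter> ball b r)"
     unfolding connectedin_iff_connected by (intro convex_connected convex_Int convex_ball) auto
    then have "connected_space ?K" unfolding connectedin_def by blast
    moreover have "b \<in> {0..1} \<inter> ball b r" using G(3) le ac by auto
    ultimately have "(f (y, u) ~= g (y, u)) = e y"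
     using connected_locally_constant[of ?K _ u b] u unfolding e_def by simp
    then show ?thesis by argo
   qed
   have "same_jumps_at ?Z (s (y, t)) h (y, t)" if y: "y \<in> G" and t: "t \<in> {0..1} \<inter> {a - r<..<c + r}" for y t
   proof (cases "t < b + r")
    case True
    have hf: "h p = f p" if "p \<in> G \<times> ({0..1} \<inter> {..<b + r})" for p
     using over[of "fst p" "snd p"] that by (cases p) (auto simp: h_def dist_real_def)
    have yt: "(y, t) \<in> G \<times> ({0..1} \<inter> {..<b + r})" using y t True by simp
    have "same_jumps_at ?Z f h (y, t)"
    proof (rule same_jumps_atI[OF box[OF G(1)] yt])
     fix p assume p: "p \<in> G \<times> ({0..1} \<inter> {..<b + r})"
     show "(f p = f (y, t)) = (h p = h (y, t))" unfolding hf[OF p] hf[OF yt] ..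
    qed simp
    moreover have "same_jumps_at ?Z (s (y, t)) f (y, t)"
     using y t True by (intro V4) (auto simp: G_def r_def)
    ultimately show ?thesis by (rule same_jumps_at_trans[rotated])
   next
    case False
    have yX: "y \<in> topspace X" using y G(1) openin_subset by blast
    have b01: "b \<in> {0..1} \<inter> ball b r" using G(3) le ac by auto
    have c: "continuous_map X ?Z (%z. (z, b))"
     using b01 by (intro continuous_map_pairedI) (auto simp: continuous_map_id[unfolded id_def])
    obtain W where W: "openin X W" "y \<in> W" "\<forall>z\<in>W. (f (z, b) = f (y, b)) = (g (z, b) = g (y, b))"
     using same_jumps_at_pullback[OF c yX fg[OF y b01]] by (rule same_jumps_atE)
    have "e z = e y" if z: "z \<in> W" for z using bspec[OF W(3) z] unfolding e_def by argo
    then have hg: "h p = (g p ~= e y)" if "p \<in> (G \<inter> W) \<times> ({0..1} \<inter> {b<..})" for p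
     using that by (auto simp: h_def)
    have yt: "(y, t) \<in> (G \<inter> W) \<times> ({0..1} \<inter> {b<..})" using y W(2) t False G(3) by simp
    have "same_jumps_at ?Z g h (y, t)"
    proof (rule same_jumps_atI[OF box[OF openin_Int[OF G(1) W(1)]] yt])
     fix p assume p: "p \<in> (G \<inter> W) \<times> ({0..1} \<inter> {b<..})"
     show "(g p = g (y, t)) = (h p = h (y, t))" unfolding hg[OF p] hg[OF yt] by argo
    qed simp
    moreover have "same_jumps_at ?Z (s (y, t)) g (y, t)"
     using y t False G(3) V'(3) by (intro V'4) (auto simp: G_def r_def)
    ultimately show ?thesis by (rule same_jumps_at_trans[rotated])
   qed
   with G show "\<exists>V f d. openin X V & x \<in> V & 0 < d &
     (\<forall>y\<in>V. \<forall>t\<in>{0..1} \<inter> {a - d<..<c + d}. same_jumps_at ?Z (s (y, t)) f (y, t))" by blast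
  qed
 next
  fix t :: real assume t: "0 <= t" "t <= 1"
  then have "(x, t) \<in> topspace ?Z" using x by simp
  then obtain U where U: "openin ?Z U" "(x, t) \<in> U" "\<forall>p\<in>U. same_jumps_at ?Z (s (x, t)) (s p) p"
   using s unfolding local_system_def by blast
  obtain W J where WJ: "openin X W" "openin ?I J" "x \<in> W" "t \<in> J" "W \<times> J \<subseteq> U"
   using openin_prod_topology_alt[THEN iffD1, rule_format, OF U(1,2)] by blast
  obtain d where d: "d > 0" "\<And>u. u \<in> {0..1} ==> dist u t < d ==> u \<in> J"
   using WJ(2,4) unfolding openin_euclidean_subtopology_iff by blast
  show "\<exists>d>0. \<forall>a b. a <= t & t <= b & b - a < d --> P a b"
  proof (intro exI[of _ "d/2"] conjI allI impI)
   fix a b assume ab: "a <= t & t <= b & b - a < d/2"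
   have sj: "same_jumps_at ?Z (s (y, u)) (s (x, t)) (y, u)"
    if "y \<in> W" "u \<in> {0..1} \<inter> {a - d/2<..<b + d/2}" for y u
   proof -
    have "u \<in> J" using that ab by (intro d(2)) (auto simp: dist_real_def abs_if field_simps)
    then have "(y, u) \<in> U" using WJ(5) that(1) by blast
    then show ?thesis by (rule same_jumps_at_sym[OF bspec[OF U(3)]])
   qed
   show "P a b" unfolding P_def
   proof (intro impI exI[of _ W] exI[of _ "s (x, t)"] exI[of _ "d/2"] conjI WJ(1,3) ballI)
    show "0 < d/2" using d(1) by simp
   qed (rule sj)
  qed (use d in simp)
 qed simp
 then have "\<exists>V f d. openin X V & x \<in> V & 0 < d &
   (\<forall>y\<in>V. \<forall>t\<in>{0..1} \<inter> {0 - d<..<1 + d}. same_jumps_at ?Z (s (y, t)) f (y, t))"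
  unfolding P_def by simp
 then obtain V f d where V: "openin X V" "x \<in> V" "0 < (d::real)"
  "\<forall>y\<in>V. \<forall>t\<in>{0..1} \<inter> {0 - d<..<1 + d}. same_jumps_at ?Z (s (y, t)) f (y, t)" by (elim exE conjE)
 have "\<forall>y\<in>V. \<forall>t\<in>{0..1}. same_jumps_at ?Z (s (y, t)) f (y, t)"
 proof (intro ballI)
  fix y t :: _ assume "y \<in> V" and t: "t \<in> {0..1::real}"
  from t V(3) have "t \<in> {0..1} \<inter> {0 - d<..<1 + d}" by simp
  with \<open>y \<in> V\<close> show "same_jumps_at ?Z (s (y, t)) f (y, t)" by (rule V(4)[rule_format])
 qed
 with V(1,2) that show thesis by blast
qed

text \<open>Pull the system back along a contraction \<open>H\<close>. Over each tube the jump of a trivialisation from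
the constant end to the identity end is unambiguous, and these jumps trivialise the original system.\<close>

lemma H1_trivial_contractible:
 assumes "contractible_space X"
 shows "H1_trivial X"
 unfolding H1_trivial_def
proof (intro allI impI)
 fix s assume s: "local_system X s"
 obtain a where a: "homotopic_with (%x. True) X X id (%x. a)"
  using assms unfolding contractible_space_def by blast
 then have "homotopic_with (%x. True) X X (%x. a) id" by (rule homotopic_with_symD)
 then obtain H0 where H0: "continuous_map (prod_topology (top_of_set {0..1::real}) X) X H0"
  "\<forall>x. H0 (0, x) = a" "\<forall>x. H0 (1, x) = x"
  unfolding homotopic_with_def by auto
 let ?Z = "prod_topology X (top_of_set {0..1::real})"
 define H where "H = H0 \<circ> (%p. (snd p, fst p))"
 have H: "continuous_map ?Z X H"
  unfolding H_def by (rule continuous_map_compose[OF _ H0(1)])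
   (intro continuous_map_pairedI continuous_map_fst continuous_map_snd)
 have H01: "H (x, 0) = a" "H (x, 1) = x" for x using H0(2,3) by (auto simp: H_def)
 define s' where "s' p r = s (H p) (H r)" for p r
 have s': "local_system ?Z s'" unfolding s'_def by (rule local_system_pullback[OF H s])
 have "\<exists>V f. openin X V & x \<in> V & (\<forall>y\<in>V. \<forall>t\<in>{0..1}. same_jumps_at ?Z (s' (y, t)) f (y, t))"
  if "x \<in> topspace X" for x
  using trivialising_tube[OF s' that] by metis
 then obtain V f where V: "\<And>x. x \<in> topspace X ==> openin X (V x) & x \<in> V x"
  and f: "\<And>x y t. x \<in> topspace X ==> y \<in> V x ==> t \<in> {0..1} ==> same_jumps_at ?Z (s' (y, t)) (f x) (y, t)"
  by metis
 define g where "g x y \<longleftrightarrow> (f x (y, 1) ~= f x (y, 0))" for x y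
 have line: "continuous_map (top_of_set {0..1::real}) ?Z (%t. (y, t))" if "y \<in> topspace X" for y
  using that by (intro continuous_map_pairedI) auto
 have vert: "continuous_map X ?Z (%y. (y, t))" if "t \<in> {0..1}" for t
  using that by (intro continuous_map_pairedI) (auto simp: continuous_map_id[unfolded id_def])
 have gg: "g x y = g y y" if x: "x \<in> topspace X" and y: "y \<in> V x" for x y
 proof -
  have y': "y \<in> topspace X" using V[OF x] y openin_subset by blast
  let ?I = "top_of_set {0..1::real}"
  have "locally_constant_on ?I (%t. f x (y, t) ~= f y (y, t))"
  proof (rule locally_constant_differenceI)
   fix t assume "t \<in> topspace ?I"
   then have t: "t \<in> {0..1}" by simp
   from f[OF x y t] f[OF y' _ t, of y] V[OF y'] have "same_jumps_at ?Z (f x) (f y) (y, t)"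
    by (meson same_jumps_at_sym same_jumps_at_trans)
   then show "same_jumps_at ?I (%t. f x (y, t)) (%t. f y (y, t)) t"
    using same_jumps_at_pullback[OF line[OF y'], of t "f x" "f y"] t by auto
  qed
  moreover have "connected_space ?I" by (simp add: connected_space_subtopology)
  ultimately have "(f x (y, 0) ~= f y (y, 0)) = (f x (y, 1) ~= f y (y, 1))"
   using connected_locally_constant[of ?I "%t. f x (y, t) ~= f y (y, t)" 0 1] by simp
  then show ?thesis unfolding g_def by blast
 qed
 have "trivialises X s (%y. g y y)"
  unfolding trivialises_def
 proof
  fix x assume x: "x \<in> topspace X"
  have "same_jumps_at ?Z (s' (x, 1)) (f x) (x, 1)" using f[OF x, of x 1] V[OF x] by auto
  from same_jumps_at_pullback[OF vert[of 1] x this]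
  have 1: "same_jumps_at X (s x) (%y. f x (y, 1)) x" by (simp add: s'_def H01)
  have "same_jumps_at ?Z (s' (x, 0)) (f x) (x, 0)" using f[OF x, of x 0] V[OF x] by auto
  from same_jumps_at_pullback[OF vert[of 0] x this]
  have "same_jumps_at X (%y. False) (%y. f x (y, 0)) x" unfolding same_jumps_at_def s'_def H01 by simp
  from same_jumps_at_xor[OF 1 this]
  have "same_jumps_at X (s x) (g x) x" unfolding g_def by simp
  moreover have "same_jumps_at X (g x) (%y. g y y) x"
  proof (rule same_jumps_atI[of _ "V x"])
   fix y assume "y \<in> V x"
   moreover have "x \<in> V x" using V[OF x] by blast
   ultimately show "(g x y = g x x) = (g y y = g x x)" using gg[OF x] by blast
  qed (use V[OF x] in auto)
  ultimately show "same_jumps_at X (s x) (%y. g y y) x" by (rule same_jumps_at_trans)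
 qed
 then show "trivial_system X s" unfolding trivial_system_def by blast
qed

lemma H1_trivial_starlike:
 fixes S :: "'a::real_normed_vector set"
 assumes "starlike S"
 shows "H1_trivial (top_of_set S)"
 by (intro H1_trivial_contractible) (simp add: starlike_imp_contractible[OF assms])

lemma H1_trivial_convex:
 fixes S :: "'a::real_normed_vector set"
 assumes "convex S"
 shows "H1_trivial (top_of_set S)"
proof (cases "S = {}")
 case True
 then show ?thesis
  by (auto simp: H1_trivial_def trivial_system_def trivialises_def)
next
 case False
 then show ?thesis by (intro H1_trivial_starlike convex_imp_starlike assms)
qed

section \<open>Descent along maps with finite fibres\<close>

text \<open>The last clause is closedness of the map, phrased for neighbourhoods of finite fibres: over a small
neighbourhood of \<open>P\<close> only points close to the fibre of \<open>P\<close> occur.\<close>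

definition descent_map :: "'a topology => 'b topology => ('a => 'b) => bool" where
 "descent_map X Y \<pi> \<longleftrightarrow> Hausdorff_space X & continuous_map X Y \<pi> & \<pi> ` topspace X = topspace Y &
   (\<forall>P\<in>topspace Y. finite {x \<in> topspace X. \<pi> x = P}) &
   (\<forall>P\<in>topspace Y. \<forall>U. openin X U & {x \<in> topspace X. \<pi> x = P} \<subseteq> U -->
    (\<exists>V. openin Y V & P \<in> V & (\<forall>x\<in>topspace X. \<pi> x \<in> V --> x \<in> U)))"

text \<open>The comparison of the values at two points with the same image is locally constant on the
fibre product. This is what it takes for the germs of \<open>f\<close> upstairs to come from a system downstairs.\<close>

definition descent_function :: "'a topology => ('a => 'b) => ('a => bool) => bool" where
 "descent_function X \<pi> f \<longleftrightarrow> (\<forall>x\<in>topspace X. \<forall>x'\<in>topspace X. \<pi> x = \<pi> x' -->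
   (\<exists>U U'. openin X U & x \<in> U & openin X U' & x' \<in> U' &
    (\<forall>y\<in>U. \<forall>y'\<in>U'. \<pi> y = \<pi> y' --> (f y = f y') = (f x = f x'))))"

definition pullback_system :: "('a => 'b) => ('b => 'b => bool) => 'a => 'a => bool" where
 "pullback_system \<pi> s = (%x z. s (\<pi> x) (\<pi> z))"

lemma descent_mapD:
 assumes "descent_map X Y \<pi>"
 shows "Hausdorff_space X" "continuous_map X Y \<pi>" "\<pi> ` topspace X = topspace Y"
  "\<And>P. P \<in> topspace Y ==> finite {x \<in> topspace X. \<pi> x = P}"
  "\<And>x. x \<in> topspace X ==> \<pi> x \<in> topspace Y"
 using assms unfolding descent_map_def by auto

lemma descent_map_nbhd:
 assumes "descent_map X Y \<pi>" "P \<in> topspace Y" "openin X U" "{x \<in> topspace X. \<pi> x = P} \<subseteq> U"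
 obtains V where "openin Y V" "P \<in> V" "\<forall>x\<in>topspace X. \<pi> x \<in> V --> x \<in> U"
using assms unfolding descent_map_def by blast

lemma descent_map_restrict:
 assumes d: "descent_map X Y \<pi>" and S: "S \<subseteq> topspace Y"
 shows "descent_map (subtopology X {x \<in> topspace X. \<pi> x \<in> S}) (subtopology Y S) \<pi>"
proof -
 let ?S = "{x \<in> topspace X. \<pi> x \<in> S}"
 have tS: "topspace (subtopology X ?S) = ?S" by auto
 have tY: "topspace (subtopology Y S) = S" using S by auto
 have "\<exists>V. openin (subtopology Y S) V & P \<in> V & (\<forall>x\<in>?S. \<pi> x \<in> V --> x \<in> U)"
  if P: "P \<in> S" and U: "openin (subtopology X ?S) U" "{x \<in> ?S. \<pi> x = P} \<subseteq> U" for P U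
 proof -
  obtain W where W: "openin X W" "U = W \<inter> ?S" using U(1) unfolding openin_subtopology by auto
  have "{x \<in> topspace X. \<pi> x = P} \<subseteq> W" using U(2) W(2) P by auto
  then obtain V where V: "openin Y V" "P \<in> V" "\<forall>x\<in>topspace X. \<pi> x \<in> V --> x \<in> W"
   using descent_map_nbhd[OF d _ W(1)] P S by blast
  show ?thesis
   by (intro exI[of _ "V \<inter> S"]) (use V P W in \<open>auto simp: openin_subtopology\<close>)
 qed
 moreover have "finite {x \<in> ?S. \<pi> x = P}" if "P \<in> S" for P
  using descent_mapD(4)[OF d, of P] S that by (auto intro: finite_subset[rotated])
 moreover have "\<pi> ` ?S = S" using descent_mapD(3)[OF d] S by auto
 moreover have "continuous_map (subtopology X ?S) (subtopology Y S) \<pi>"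
  using descent_mapD(2)[OF d] by (auto simp: continuous_map_in_subtopology continuous_map_from_subtopology)
 moreover have "Hausdorff_space (subtopology X ?S)"
  using descent_mapD(1)[OF d] by (rule Hausdorff_space_subtopology)
 ultimately show ?thesis unfolding descent_map_def tS tY by blast
qed

lemma descent_map_homeomorphic:
 assumes d: "descent_map X Y \<pi>" and h: "homeomorphic_map Y Z h"
 shows "descent_map X Z (h \<circ> \<pi>)"
proof -
 have ch: "continuous_map Y Z h" and oh: "open_map Y Z h" and ih: "inj_on h (topspace Y)"
  and sh: "h ` topspace Y = topspace Z"
  using h homeomorphic_imp_continuous_map homeomorphic_imp_open_map
   homeomorphic_imp_injective_map homeomorphic_imp_surjective_map by blast+
 have fib: "{x \<in> topspace X. (h \<circ> \<pi>) x = h P} = {x \<in> topspace X. \<pi> x = P}" if "P \<in> topspace Y" for P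
  using that ih descent_mapD(5)[OF d] by (auto dest: inj_onD)
 have "\<exists>V. openin Z V & Q \<in> V & (\<forall>x\<in>topspace X. (h \<circ> \<pi>) x \<in> V --> x \<in> U)"
  if Q: "Q \<in> topspace Z" and U: "openin X U" "{x \<in> topspace X. (h \<circ> \<pi>) x = Q} \<subseteq> U" for Q U
 proof -
  obtain P where P: "P \<in> topspace Y" "Q = h P" using Q sh by auto
  obtain V where V: "openin Y V" "P \<in> V" "\<forall>x\<in>topspace X. \<pi> x \<in> V --> x \<in> U"
   using descent_map_nbhd[OF d P(1) U(1)] U(2) fib[OF P(1)] P(2) by auto
  have "x \<in> U" if x: "x \<in> topspace X" "h (\<pi> x) \<in> h ` V" for x
   using x V(3) ih descent_mapD(5)[OF d x(1)] openin_subset[OF V(1)] by (metis inj_on_image_mem_iff)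
  then show ?thesis
   using V oh P(2) unfolding open_map_def by (intro exI[of _ "h ` V"]) auto
 qed
 moreover have "finite {x \<in> topspace X. (h \<circ> \<pi>) x = Q}" if "Q \<in> topspace Z" for Q
 proof -
  obtain P where P: "P \<in> topspace Y" "Q = h P" using \<open>Q \<in> topspace Z\<close> sh by auto
  show ?thesis using fib[OF P(1)] descent_mapD(4)[OF d P(1)] P(2) by simp
 qed
 moreover have "(h \<circ> \<pi>) ` topspace X = topspace Z"
  unfolding image_comp[symmetric] descent_mapD(3)[OF d] sh ..
 ultimately show ?thesis
  unfolding descent_map_def
  using continuous_map_compose[OF descent_mapD(2)[OF d] ch] descent_mapD(1)[OF d] by blast
qed

lemma descent_map_compact_Hausdorff:
 assumes "compact_space X" "Hausdorff_space X" "Hausdorff_space Y" and c: "continuous_map X Y \<pi>"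
  and surj: "\<pi> ` topspace X = topspace Y"
  and fin: "\<And>P. P \<in> topspace Y ==> finite {x \<in> topspace X. \<pi> x = P}"
 shows "descent_map X Y \<pi>"
proof -
 have cl: "closed_map X Y \<pi>"
  using continuous_imp_closed_map[OF c] assms(1,3) by auto
 have "\<exists>V. openin Y V & P \<in> V & (\<forall>x\<in>topspace X. \<pi> x \<in> V --> x \<in> U)"
  if P: "P \<in> topspace Y" and U: "openin X U" "{x \<in> topspace X. \<pi> x = P} \<subseteq> U" for P U
 proof (intro exI[of _ "topspace Y - \<pi> ` (topspace X - U)"] conjI)
  show "openin Y (topspace Y - \<pi> ` (topspace X - U))"
   using cl U(1) unfolding closed_map_def by blast
 qed (use P U in auto)
 then show ?thesis unfolding descent_map_def using assms by blast
qed

lemma descent_function_trivialisation: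
 assumes s: "trivialises X (pullback_system \<pi> s) f"
 shows "descent_function X \<pi> f"
 unfolding descent_function_def
proof (intro ballI impI)
 fix x x' assume x: "x \<in> topspace X" "x' \<in> topspace X" and eq: "\<pi> x = \<pi> x'"
 obtain U where U: "openin X U" "x \<in> U" "\<forall>y\<in>U. (s (\<pi> x) (\<pi> y) = s (\<pi> x) (\<pi> x)) = (f y = f x)"
  using s x(1) unfolding trivialises_def pullback_system_def same_jumps_at_def by blast
 obtain U' where U': "openin X U'" "x' \<in> U'" "\<forall>y\<in>U'. (s (\<pi> x) (\<pi> y) = s (\<pi> x) (\<pi> x)) = (f y = f x')"
  using s x(2) unfolding trivialises_def pullback_system_def same_jumps_at_def eq by blast
 have "\<forall>y\<in>U. \<forall>y'\<in>U'. \<pi> y = \<pi> y' --> (f y = f y') = (f x = f x')"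
 by (metis U(3) U'(3))
 with U U' show "\<exists>U U'. openin X U & x \<in> U & openin X U' & x' \<in> U' &
    (\<forall>y\<in>U. \<forall>y'\<in>U'. \<pi> y = \<pi> y' --> (f y = f y') = (f x = f x'))"
  by (intro exI[of _ U] exI[of _ U'] conjI) simp_all
qed

text \<open>Over \<open>P\<close> the germ downstairs is read off from \<open>f\<close> at any preimage, corrected by a constant for each
point of the finite fibre so that the different preimages agree.\<close>

lemma descent_exists:
 assumes d: "descent_map X Y \<pi>" and f: "descent_function X \<pi> f"
 shows "\<exists>s. local_system Y s & trivialises X (pullback_system \<pi> s) f"
proof -
 have "\<exists>A B. openin X A & x \<in> A & openin X B & x' \<in> B &
    (\<forall>y\<in>A. \<forall>y'\<in>B. \<pi> y = \<pi> y' --> (f y = f y') = (f x = f x'))"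
  if "x \<in> topspace X" "x' \<in> topspace X" "\<pi> x = \<pi> x'" for x x'
  using f that unfolding descent_function_def by blast
 then obtain A B where AB: "\<And>x x'. x \<in> topspace X ==> x' \<in> topspace X ==> \<pi> x = \<pi> x' ==>
   openin X (A x x') & x \<in> A x x' & openin X (B x x') & x' \<in> B x x' &
    (\<forall>y\<in>A x x'. \<forall>y'\<in>B x x'. \<pi> y = \<pi> y' --> (f y = f y') = (f x = f x'))"
  by metis
 define fib where "fib P = {x \<in> topspace X. \<pi> x = P}" for P
 have fin: "finite (fib P)" if "P \<in> topspace Y" for P using descent_mapD(4)[OF d that] by (simp add: fib_def)
 define N where "N x = (\<Inter>x'\<in>fib (\<pi> x). A x x' \<inter> B x' x)" for x
 have N: "openin X (N x)" "x \<in> N x" if x: "x \<in> topspace X" for x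
 proof -
  have "fib (\<pi> x) ~= {}" using x by (auto simp: fib_def)
  then show "openin X (N x)" unfolding N_def
   using fin[OF descent_mapD(5)[OF d x]] AB x by (intro openin_INT2) (auto simp: fib_def)
  show "x \<in> N x" unfolding N_def using AB x by (auto simp: fib_def)
 qed
 have Nf: "(f y = f y') = (f x = f x')"
  if "x \<in> topspace X" "x' \<in> topspace X" "\<pi> x = \<pi> x'" "y \<in> N x" "y' \<in> N x'" "\<pi> y = \<pi> y'" for x x' y y'
 proof -
  have "y \<in> A x x'" "y' \<in> B x x'" using that unfolding N_def fib_def by auto
  then show ?thesis using AB that by blast
 qed
 define s where "s P Q \<longleftrightarrow> (\<exists>x\<in>topspace X. \<exists>z\<in>topspace X. \<pi> x = P & \<pi> z = Q & z \<in> N x & f z ~= f x)" for P Q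
 have s: "s (\<pi> x) (\<pi> z) = (f z ~= f x)" if "x \<in> topspace X" "z \<in> N x" for x z
 proof
  assume "s (\<pi> x) (\<pi> z)"
  then obtain x' z' where x': "x' \<in> topspace X" "\<pi> x' = \<pi> x" "\<pi> z' = \<pi> z" "z' \<in> N x'" "f z' ~= f x'"
   unfolding s_def by blast
  have "(f z' = f z) = (f x' = f x)" by (rule Nf) (use x' that in auto)
  with x'(5) show "f z ~= f x" by blast
 next
  assume "f z ~= f x"
  then show "s (\<pi> x) (\<pi> z)" unfolding s_def using that openin_subset[OF N(1)[OF that(1)]] by blast
 qed
 have "trivialises X (pullback_system \<pi> s) f"
  unfolding trivialises_def
 proof
  fix x assume x: "x \<in> topspace X"
  show "same_jumps_at X (pullback_system \<pi> s x) f x"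
   by (rule same_jumps_atI[OF N[OF x]])
    (use s[OF x N(2)[OF x]] s[OF x] in \<open>auto simp: pullback_system_def\<close>)
 qed
 moreover have "local_system Y s"
  unfolding local_system_def
 proof
  fix P assume P: "P \<in> topspace Y"
  have "openin X (\<Union>x\<in>fib P. N x)" using N by (auto simp: fib_def)
  moreover have "{x \<in> topspace X. \<pi> x = P} \<subseteq> (\<Union>x\<in>fib P. N x)" using N by (auto simp: fib_def)
  ultimately obtain V where V: "openin Y V" "P \<in> V" "\<forall>x\<in>topspace X. \<pi> x \<in> V --> x \<in> (\<Union>x\<in>fib P. N x)"
   using descent_map_nbhd[OF d P] by blast
  have "same_jumps_at Y (s P) (s Q) Q" if Q: "Q \<in> V" for Q
  proof -
   have QY: "Q \<in> topspace Y" using Q openin_subset[OF V(1)] by blast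
   have "\<exists>x\<in>fib P. y \<in> N x" if "y \<in> fib Q" for y
    using V(3) Q that by (auto simp: fib_def)
   then obtain \<xi> where \<xi>: "\<And>y. y \<in> fib Q ==> \<xi> y \<in> fib P & y \<in> N (\<xi> y)" by metis
   have "openin X (\<Union>y\<in>fib Q. N y \<inter> N (\<xi> y))"
    by (intro openin_Union) (use N \<xi> in \<open>auto simp: fib_def intro!: openin_Int\<close>)
   moreover have "{x \<in> topspace X. \<pi> x = Q} \<subseteq> (\<Union>y\<in>fib Q. N y \<inter> N (\<xi> y))" using N \<xi> by (auto simp: fib_def)
   ultimately obtain W where W: "openin Y W" "Q \<in> W"
    "\<forall>x\<in>topspace X. \<pi> x \<in> W --> x \<in> (\<Union>y\<in>fib Q. N y \<inter> N (\<xi> y))"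
    using descent_map_nbhd[OF d QY] by blast
   show ?thesis
   proof (rule same_jumps_atI[OF W(1,2)])
    fix R assume R: "R \<in> W"
    then have "R \<in> topspace Y" using openin_subset[OF W(1)] by blast
    then obtain z where z: "z \<in> topspace X" "R = \<pi> z" using descent_mapD(3)[OF d] by auto
    then obtain y where y: "y \<in> fib Q" "z \<in> N y" "z \<in> N (\<xi> y)" using W(3) R by blast
    have yX: "y \<in> topspace X" "\<pi> y = Q" using y(1) by (auto simp: fib_def)
    have xX: "\<xi> y \<in> topspace X" "\<pi> (\<xi> y) = P" "y \<in> N (\<xi> y)" using \<xi>[OF y(1)] by (auto simp: fib_def)
    have "s P R = (f z ~= f (\<xi> y))" using s[OF xX(1) y(3)] xX z by simp
    moreover have "s Q R = (f z ~= f y)" using s[OF yX(1) y(2)] yX z by simp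
    moreover have "s P Q = (f y ~= f (\<xi> y))" using s[OF xX(1,3)] xX yX by simp
    moreover have "s Q Q = (f y ~= f y)" using s[OF yX(1) N(2)[OF yX(1)]] yX by simp
    ultimately show "(s P R = s P Q) = (s Q R = s Q Q)" by blast
   qed
  qed
  with V show "\<exists>U. openin Y U & P \<in> U & (\<forall>y\<in>U. same_jumps_at Y (s P) (s y) y)" by blast
 qed
 ultimately show ?thesis by blast
qed

text \<open>Two trivialisations upstairs, \<open>f\<close> and the pullback of one downstairs, differ by a locally constant
\<open>\<psi>\<close>; the latter takes equal values on fibres, so \<open>f\<close> and \<open>\<psi>\<close> jump alike there.\<close>

lemma descent_trivial_imp:
 assumes d: "descent_map X Y \<pi>" and f: "trivialises X (pullback_system \<pi> s) f" and "trivial_system Y s"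
 obtains \<psi> where "locally_constant_on X \<psi>"
  "\<And>x x'. x \<in> topspace X ==> x' \<in> topspace X ==> \<pi> x = \<pi> x' ==> (f x = f x') = (\<psi> x = \<psi> x')"
proof -
 obtain \<phi> where \<phi>: "trivialises Y s \<phi>" using assms(3) unfolding trivial_system_def by blast
 have "trivialises X (pullback_system \<pi> s) (%x. \<phi> (\<pi> x))"
  unfolding pullback_system_def by (rule trivialises_pullback[OF descent_mapD(2)[OF d] \<phi>])
 from trivialises_unique[OF f this] have "locally_constant_on X (%x. f x ~= \<phi> (\<pi> x))" .
 moreover have "(f x = f x') = ((f x ~= \<phi> (\<pi> x)) = (f x' ~= \<phi> (\<pi> x')))" if "\<pi> x = \<pi> x'" for x x'
  unfolding that by blast
 ultimately show thesis by (rule that)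
qed

lemma descent_trivial:
 assumes d: "descent_map X Y \<pi>" and f: "trivialises X (pullback_system \<pi> s) f"
  and \<psi>: "locally_constant_on X \<psi>"
  and eq: "\<And>x x'. x \<in> topspace X ==> x' \<in> topspace X ==> \<pi> x = \<pi> x' ==> (f x = f x') = (\<psi> x = \<psi> x')"
 shows "trivial_system Y s"
proof -
 define \<phi> where "\<phi> P \<longleftrightarrow> (\<exists>x\<in>topspace X. \<pi> x = P & f x ~= \<psi> x)" for P
 have \<phi>: "\<phi> (\<pi> x) = (f x ~= \<psi> x)" if x: "x \<in> topspace X" for x
 by (metis eq x \<phi>_def)
 have "trivialises Y s \<phi>"
  unfolding trivialises_def
 proof
  fix P assume P: "P \<in> topspace Y"
  define good where "good x A \<longleftrightarrow> (\<forall>z\<in>A. (s P (\<pi> z) = s P P) = (f z = f x) & \<psi> z = \<psi> x)" for x A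
  have "\<exists>A. openin X A & x \<in> A & good x A"
   if x: "x \<in> topspace X" "\<pi> x = P" for x
  proof -
   obtain A where A: "openin X A" "x \<in> A" "\<forall>z\<in>A. (s P (\<pi> z) = s P P) = (f z = f x)"
    using f x unfolding trivialises_def pullback_system_def same_jumps_at_def by blast
   obtain B where B: "openin X B" "x \<in> B" "\<forall>z\<in>B. \<psi> z = \<psi> x"
    using \<psi> x unfolding locally_constant_on_def by blast
   have "\<forall>z\<in>A \<inter> B. (s P (\<pi> z) = s P P) = (f z = f x) & \<psi> z = \<psi> x"
    using A(3) B(3) by blast
   then have "good x (A \<inter> B)" unfolding good_def .
   with A(1,2) B(1,2) show ?thesis by (intro exI[of _ "A \<inter> B"] conjI openin_Int) simp_all
  qed
  then obtain A where A: "\<And>x. x \<in> topspace X ==> \<pi> x = P ==> openin X (A x) & x \<in> A x & good x (A x)" by metis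
  let ?U = "\<Union>x\<in>{x \<in> topspace X. \<pi> x = P}. A x"
  have "openin X ?U" "{x \<in> topspace X. \<pi> x = P} \<subseteq> ?U" using A by auto
  then obtain V where V: "openin Y V" "P \<in> V" "\<forall>x\<in>topspace X. \<pi> x \<in> V --> x \<in> ?U"
   using descent_map_nbhd[OF d P] by blast
  show "same_jumps_at Y (s P) \<phi> P"
  proof (rule same_jumps_atI[OF V(1,2)])
   fix Q assume Q: "Q \<in> V"
   then have "Q \<in> topspace Y" using openin_subset[OF V(1)] by blast
   then obtain z where z: "z \<in> topspace X" "Q = \<pi> z" using descent_mapD(3)[OF d] by auto
   then obtain x where x: "x \<in> topspace X" "\<pi> x = P" "z \<in> A x" using V(3) Q by blast
   have "(s P Q = s P P) = (f z = f x)" "\<psi> z = \<psi> x"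
    using A[OF x(1,2)] x(3) z(2) unfolding good_def by blast+
   moreover have "\<phi> Q = (f z ~= \<psi> z)" "\<phi> P = (f x ~= \<psi> x)" using \<phi> z x by auto
   ultimately show "(s P Q = s P P) = (\<phi> Q = \<phi> P)" by blast
  qed
 qed
 then show ?thesis unfolding trivial_system_def by blast
qed

section \<open>Extension across a boundary\<close>

text \<open>The property of the boundary of a manifold that matters for local systems: removing \<open>D\<close> from a
small neighbourhood leaves a connected set without cohomology.\<close>

definition H1_nice_boundary :: "'a topology => 'a set => bool" where
 "H1_nice_boundary Y D \<longleftrightarrow> closedin Y D & (\<forall>a\<in>D. \<forall>U. openin Y U & a \<in> U -->
   (\<exists>W. openin Y W & a \<in> W & W \<subseteq> U & W - D ~= {} & connectedin Y (W - D) &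
    H1_trivial (subtopology Y (W - D))))"

lemma nice_boundary_nbhd:
 assumes "H1_nice_boundary Y D" "a \<in> D" "openin Y U" "a \<in> U"
 obtains W where "openin Y W" "a \<in> W" "W \<subseteq> U" "W - D ~= {}" "connectedin Y (W - D)"
  "H1_trivial (subtopology Y (W - D))"
by (metis assms H1_nice_boundary_def)

lemma nice_boundary_dense:
 assumes "H1_nice_boundary Y D" "openin Y U" "U ~= {}"
 obtains z where "z \<in> U" "z \<notin> D"
proof (cases "U \<subseteq> D")
 case True
 then obtain a where "a \<in> D" "a \<in> U" using assms(3) by blast
 with nice_boundary_nbhd[OF assms(1) _ assms(2)] obtain W where "W \<subseteq> U" "W - D ~= {}" by metis
 with that show thesis by blast
qed (use that in blast)

text \<open>On a connected set a germwise agreement modulo constants has a single global constant.\<close>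

lemma constant_difference:
 assumes "connectedin X S" and "\<And>x. x \<in> S ==> same_jumps_at (subtopology X S) f g x"
 obtains k where "\<forall>y\<in>S. (f y ~= g y) = k"
proof -
 have S: "topspace (subtopology X S) = S" "connected_space (subtopology X S)"
  using assms(1) by (auto simp: connectedin_def)
 have lc: "locally_constant_on (subtopology X S) (%x. f x ~= g x)"
  by (rule locally_constant_differenceI) (use assms(2) S in simp)
 have c: "(f x ~= g x) = (f y ~= g y)" if "x \<in> S" "y \<in> S" for x y
  by (rule connected_locally_constant[OF S(2) lc, unfolded S(1)]) (rule that)+
 show thesis
 proof (cases "S = {}")
  case False
  then obtain x where "x \<in> S" by blast
  with c that[of "f x ~= g x"] show thesis by blast
 qed (use that[of True] in blast)
qed

text \<open>A trivialisation off \<open>D\<close> agrees up to a constant with the germ of the system near each point of \<open>D\<close>, since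
small neighbourhoods stay connected when \<open>D\<close> is removed. The value at that point is chosen so that the germs agree.\<close>

lemma trivial_system_extends_boundary:
 assumes D: "H1_nice_boundary Y D" and s: "local_system Y s"
  and triv: "trivial_system (subtopology Y (topspace Y - D)) s"
 shows "trivial_system Y s"
proof -
 obtain f where f: "trivialises (subtopology Y (topspace Y - D)) s f"
  using triv unfolding trivial_system_def by blast
 have op: "openin Y (topspace Y - D)" using D unfolding H1_nice_boundary_def by blast
 have sf: "same_jumps_at Y (s y) f y" if "y \<in> topspace Y" "y \<notin> D" for y
  using f that by (intro same_jumps_at_open_subtopology[OF op]) (auto simp: trivialises_def)
 define good where "good a W k \<longleftrightarrow> openin Y W & a \<in> W & (\<forall>y\<in>W. same_jumps_at Y (s a) (s y) y) &
   (\<forall>y\<in>W - D. (s a y ~= f y) = k)" for a W k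
 have "\<exists>W k. good a W k" if a: "a \<in> D" for a
 proof -
  have "a \<in> topspace Y" using a D closedin_subset unfolding H1_nice_boundary_def by blast
  then obtain U where U: "openin Y U" "a \<in> U" "\<forall>y\<in>U. same_jumps_at Y (s a) (s y) y"
   using s unfolding local_system_def by blast
  obtain W where W: "openin Y W" "a \<in> W" "W \<subseteq> U" "connectedin Y (W - D)"
   using nice_boundary_nbhd[OF D a U(1,2)] by metis
  have "same_jumps_at (subtopology Y (W - D)) (s a) f y" if y: "y \<in> W - D" for y
  proof -
   have "same_jumps_at Y (s a) (s y) y" using U(3) W(3) y by blast
   moreover have "same_jumps_at Y (s y) f y" using sf y openin_subset[OF W(1)] by blast
   ultimately have "same_jumps_at Y (s a) f y" by (rule same_jumps_at_trans)
   then show ?thesis using y by (rule same_jumps_at_subtopology)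
  qed
  from constant_difference[OF W(4) this] obtain k where "\<forall>y\<in>W - D. (s a y ~= f y) = k" by blast
  then have "good a W k" unfolding good_def using W U by blast
  then show ?thesis by blast
 qed
 then obtain W k where good: "\<And>a. a \<in> D ==> good a (W a) (k a)" by metis
 define F where "F y \<longleftrightarrow> (if y \<in> D then s y y ~= k y else f y)" for y
 have "trivialises Y s F"
  unfolding trivialises_def
 proof
  fix x assume x: "x \<in> topspace Y"
  show "same_jumps_at Y (s x) F x"
  proof (cases "x \<in> D")
   case False
   have "same_jumps_at Y f F x"
    by (rule same_jumps_atI[OF op]) (use x False in \<open>auto simp: F_def\<close>)
   from sf[OF x False] this show ?thesis by (rule same_jumps_at_trans)
  next
   case True
   note G = good[OF True, unfolded good_def]
   have FW: "F y = (s x y ~= k x)" if y: "y \<in> W x" for y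
   proof (cases "y \<in> D")
    case False
    then have "(s x y ~= f y) = k x" using G y by blast
    with False show ?thesis unfolding F_def by auto
   next
    case yD: True
    note G' = good[OF yD, unfolded good_def]
    have "same_jumps_at Y (s x) (s y) y" using G y by blast
    then obtain U where U: "openin Y U" "y \<in> U" "\<forall>z\<in>U. (s x z = s x y) = (s y z = s y y)"
     by (rule same_jumps_atE)
    have "openin Y (U \<inter> W x \<inter> W y)" "U \<inter> W x \<inter> W y ~= {}" using U G G' y by blast+
    from nice_boundary_dense[OF D this] obtain z where z: "z \<in> U" "z \<in> W x" "z \<in> W y" "z \<notin> D" by blast
    have "(s x z ~= f z) = k x" using G z by blast
    moreover have "(s y z ~= f z) = k y" using G' z by blast
    moreover have "(s x z = s x y) = (s y z = s y y)" using U z by blast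
    moreover have "F y = (s y y ~= k y)" using yD by (simp add: F_def)
    ultimately show ?thesis by argo
   qed
   have oW: "openin Y (W x)" and xW: "x \<in> W x" using G by blast+
   show ?thesis
   by (metis same_jumps_atI oW xW FW)
  qed
 qed
 then show ?thesis unfolding trivial_system_def by blast
qed

text \<open>At a point of \<open>D\<close> the germ is given by a trivialisation on the complement of \<open>D\<close> in a small
neighbourhood. The values on \<open>D\<close> have no meaning before they are normalised: two such
trivialisations \<open>f a\<close> and \<open>f z\<close> differ by a constant \<open>m a z\<close> near \<open>z\<close>, which is absorbed in the value at \<open>z\<close>.\<close>

lemma local_system_extends_boundary:
 assumes D: "H1_nice_boundary Y D" and s: "local_system (subtopology Y (topspace Y - D)) s"
 obtains s' where "local_system Y s'" "\<And>x. x \<in> topspace Y - D ==> s' x = s x"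
proof -
 have op: "openin Y (topspace Y - D)" and DY: "D \<subseteq> topspace Y"
  using D closedin_subset unfolding H1_nice_boundary_def by blast+
 define good where "good a W f \<longleftrightarrow> openin Y W & a \<in> W & (\<forall>y\<in>W - D. same_jumps_at Y (s y) f y)" for a W f
 have "\<exists>W f. good a W f" if a: "a \<in> D" for a
 proof -
  obtain W where W: "openin Y W" "a \<in> W" "H1_trivial (subtopology Y (W - D))"
   using nice_boundary_nbhd[OF D a openin_topspace subsetD[OF DY a]] by metis
  have sub: "subtopology (subtopology Y (topspace Y - D)) (W - D) = subtopology Y (W - D)"
   using openin_subset[OF W(1)] by (simp add: subtopology_subtopology Int_absorb1 Diff_mono)
  have oWD: "openin Y (W - D)" using W(1) D unfolding H1_nice_boundary_def by blast
  from local_system_subtopology[OF s, of "W - D"] W(3) obtain f where "trivialises (subtopology Y (W - D)) s f"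
   unfolding sub H1_trivial_def trivial_system_def by blast
  then have "\<forall>y\<in>W - D. same_jumps_at Y (s y) f y"
   using oWD openin_subset[OF oWD] unfolding trivialises_def
   by (auto intro!: same_jumps_at_open_subtopology[OF oWD])
  with W have "good a W f" unfolding good_def by blast
  then show ?thesis by blast
 qed
 then obtain W f where good: "\<And>a. a \<in> D ==> good a (W a) (f a)" by metis
 have W: "openin Y (W a)" "a \<in> W a" if "a \<in> D" for a using good[OF that] unfolding good_def by blast+
 have fs: "same_jumps_at Y (s y) (f a) y" if "a \<in> D" "y \<in> W a" "y \<notin> D" for a y
  using good[OF that(1)] that unfolding good_def by blast
 define near where "near a z V k \<longleftrightarrow> openin Y V & z \<in> V & V \<subseteq> W a \<inter> W z & (\<forall>y\<in>V - D. (f a y ~= f z y) = k)" for a z V k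
 have "\<exists>V k. near a z V k" if a: "a \<in> D" and z: "z \<in> D" "z \<in> W a" for a z
 proof -
  have "openin Y (W a \<inter> W z)" "z \<in> W a \<inter> W z" using W a z by auto
  from nice_boundary_nbhd[OF D z(1) this] obtain V where V: "openin Y V" "z \<in> V" "V \<subseteq> W a \<inter> W z"
   "connectedin Y (V - D)" by metis
  have "same_jumps_at (subtopology Y (V - D)) (f a) (f z) y" if y: "y \<in> V - D" for y
  proof -
   have "same_jumps_at Y (f a) (s y) y" using fs[OF a, of y] V(3) y by (auto intro: same_jumps_at_sym)
   moreover have "same_jumps_at Y (s y) (f z) y" using fs[OF z(1), of y] V(3) y by auto
   ultimately have "same_jumps_at Y (f a) (f z) y" by (rule same_jumps_at_trans)
   then show ?thesis using y by (rule same_jumps_at_subtopology)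
  qed
  from constant_difference[OF V(4) this] obtain k where "\<forall>y\<in>V - D. (f a y ~= f z y) = k" by blast
  with V have "near a z V k" unfolding near_def by blast
  then show ?thesis by blast
 qed
 then obtain V m where near: "\<And>a z. a \<in> D ==> z \<in> D ==> z \<in> W a ==> near a z (V a z) (m a z)" by metis
 have m: "(f a y ~= f z y) = m a z" if "a \<in> D" "z \<in> D" "z \<in> W a" "y \<in> V a z" "y \<notin> D" for a z y
  using near[OF that(1-3)] that unfolding near_def by blast
 have V: "openin Y (V a z)" "z \<in> V a z" "V a z \<subseteq> W a \<inter> W z" if "a \<in> D" "z \<in> D" "z \<in> W a" for a z
  using near[OF that] unfolding near_def by blast+
 have m_diag: "\<not> m a a" if a: "a \<in> D" for a
 proof -
  have "V a a ~= {}" using V(2)[OF a a W(2)[OF a]] by blast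
  from nice_boundary_dense[OF D V(1)[OF a a W(2)[OF a]] this] obtain y where "y \<in> V a a" "y \<notin> D" by blast
  from m[OF a a W(2)[OF a] this] show ?thesis by blast
 qed
 have m_add: "(m a z ~= m y z) = m a y"
  if a: "a \<in> D" and y: "y \<in> D" "y \<in> W a" and z: "z \<in> D" "z \<in> V a y" for a y z
 proof -
  have za: "z \<in> W a" and zy: "z \<in> W y" using V(3)[OF a y] z by auto
  let ?U = "V a y \<inter> V a z \<inter> V y z"
  have "openin Y ?U" "?U ~= {}"
   using V(1,2)[OF a y] V(1,2)[OF a z(1) za] V(1,2)[OF y(1) z(1) zy] z by auto
  from nice_boundary_dense[OF D this] obtain w where w: "w \<in> V a y" "w \<in> V a z" "w \<in> V y z" "w \<notin> D" by blast
  from m[OF a y w(1,4)] m[OF a z(1) za w(2,4)] m[OF y(1) z(1) zy w(3,4)] show ?thesis by argo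
 qed
 define s' where "s' x y \<longleftrightarrow> (if x \<in> D then (if y \<in> D then m x y else f x y) else s x y)" for x y
 have "local_system Y s'"
  unfolding local_system_def
 proof
  fix x assume x: "x \<in> topspace Y"
  show "\<exists>U. openin Y U & x \<in> U & (\<forall>y\<in>U. same_jumps_at Y (s' x) (s' y) y)"
  proof (cases "x \<in> D")
   case False
   then have "x \<in> topspace (subtopology Y (topspace Y - D))" using x by simp
   then obtain U where U: "openin (subtopology Y (topspace Y - D)) U" "x \<in> U"
    "\<forall>y\<in>U. same_jumps_at (subtopology Y (topspace Y - D)) (s x) (s y) y"
    using s unfolding local_system_def by blast
   have U': "openin Y U" "U \<subseteq> topspace Y - D" using U(1) op openin_open_subtopology by blast+
   have eq: "s' y = s y" if "y \<in> U" for y using that U'(2) by (auto simp: s'_def fun_eq_iff)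
   have "\<forall>y\<in>U. same_jumps_at Y (s' x) (s' y) y"
    using U(2,3) eq by (auto intro: same_jumps_at_open_subtopology[OF op])
   with U' U(2) show ?thesis by blast
  next
   case xD: True
   have "same_jumps_at Y (s' x) (s' y) y" if y: "y \<in> W x" for y
   proof (cases "y \<in> D")
    case False
    have "y \<in> topspace Y" using openin_subset[OF W(1)[OF xD]] y by blast
    have "same_jumps_at Y (f x) (s' x) y"
     by (rule same_jumps_atI[OF op]) (use \<open>y \<in> topspace Y\<close> False xD in \<open>auto simp: s'_def\<close>)
    moreover have "s' y = s y" using False by (auto simp: s'_def fun_eq_iff)
    ultimately show ?thesis using fs[OF xD y False] by (metis same_jumps_at_sym same_jumps_at_trans)
   next
    case yD: True
    note xy = xD yD y
    show ?thesis
    proof (rule same_jumps_atI[OF V(1,2)[OF xy]])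
     fix z assume z: "z \<in> V x y"
     have "s' x y = m x y" "s' y y = False" using xD yD m_diag by (auto simp: s'_def)
     moreover have "(s' x z ~= s' y z) = m x y"
     using m_add xy z m by (auto simp: s'_def)
     ultimately show "(s' x z = s' x y) = (s' y z = s' y y)" by argo
    qed
   qed
   with W[OF xD] show ?thesis by blast
  qed
 qed
 moreover have "s' x = s x" if "x \<in> topspace Y - D" for x using that by (auto simp: s'_def fun_eq_iff)
 ultimately show thesis by (rule that)
qed

section \<open>Germs along a closed subset\<close>

text \<open>The shrunk sets have closures inside the given ones, so that a point avoiding one of these
closures has a neighbourhood avoiding it as well.\<close>

lemma finite_shrunk_cover:
 assumes X: "compact_space X" "Hausdorff_space X" and A: "closedin X A"
  and U: "\<And>a. a \<in> A ==> openin X (U a) & a \<in> U a"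
 obtains F P where "finite F" "F \<subseteq> A" "\<And>b. b \<in> F ==> openin X (P b)"
  "\<And>b. b \<in> F ==> P b \<subseteq> X closure_of (P b) & X closure_of (P b) \<subseteq> U b" "A \<subseteq> (\<Union>b\<in>F. P b)"
proof -
 have "regular_space X" using X compact_Hausdorff_imp_regular_space by blast
 have "\<exists>V. openin X V & a \<in> V & X closure_of V \<subseteq> U a" if a: "a \<in> A" for a
 proof -
  obtain V C where "openin X V" "closedin X C" "a \<in> V" "V \<subseteq> C" "C \<subseteq> U a"
   using \<open>regular_space X\<close> U[OF a] unfolding neighbourhood_base_of_closedin[symmetric] neighbourhood_base_of
   by metis
  then show ?thesis using closure_of_minimal[of V C X] by blast
 qed
 then obtain P where P: "\<And>a. a \<in> A ==> openin X (P a) & a \<in> P a & X closure_of (P a) \<subseteq> U a" by metis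
 have "compactin X A" using closedin_compact_space[OF X(1) A] .
 moreover have "\<And>S. S \<in> P ` A ==> openin X S" "A \<subseteq> \<Union>(P ` A)" using P by auto
 ultimately obtain \<F> where "finite \<F>" "\<F> \<subseteq> P ` A" "A \<subseteq> \<Union>\<F>"
  unfolding compactin_def by meson
 then obtain F where F: "finite F" "F \<subseteq> A" "A \<subseteq> (\<Union>b\<in>F. P b)"
  by (metis finite_subset_image)
 have "P b \<subseteq> X closure_of (P b)" if "b \<in> F" for b
  using P F(2) that by (meson closure_of_subset openin_subset subsetD)
 then show thesis using that[of F P] F P by blast
qed

lemma shrunk_cover_nbhd:
 assumes "finite F" "a \<in> topspace X"
 shows "openin X (topspace X \<inter> (\<Inter>b\<in>{b \<in> F. a \<notin> X closure_of (P b)}. topspace X - X closure_of (P b)))"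
proof (rule openin_Int_Inter)
 show "finite ((%b. topspace X - X closure_of (P b)) ` {b \<in> F. a \<notin> X closure_of (P b)})"
  using assms by simp
qed auto

text \<open>A two-variable function \<open>c\<close> is used as a cocycle near the diagonal; on \<open>V\<close> it is the difference of \<open>f\<close>.\<close>

definition coboundary_on :: "'a set => ('a => 'a => bool) => ('a => bool) => bool" where
 "coboundary_on V c f \<longleftrightarrow> (\<forall>x\<in>V. \<forall>y\<in>V. c x y = (f x ~= f y))"

text \<open>The germs \<open>s a\<close> can be chosen coherently: a single \<open>c\<close> serves near every point of \<open>A\<close> for both of its arguments.
Only finitely many of the functions \<open>s b\<close> are used to define \<open>c\<close>, so near \<open>a\<close> finitely many agreements suffice.\<close>

lemma strong_cocycle_exists:
 assumes X: "compact_space X" "Hausdorff_space X" and A: "closedin X A"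
  and s: "\<And>a. a \<in> A ==> \<exists>U. openin X U & a \<in> U & (\<forall>y\<in>U. same_jumps_at X (s a) (s y) y)"
 obtains c where "\<And>a. a \<in> A ==> \<exists>V. openin X V & a \<in> V & coboundary_on V c (s a)"
proof -
 obtain U where U: "\<And>a. a \<in> A ==> openin X (U a) & a \<in> U a"
  and sU: "\<And>a y. a \<in> A ==> y \<in> U a ==> same_jumps_at X (s a) (s y) y" using s by metis
 obtain F P where F: "finite F" "F \<subseteq> A" and P: "\<And>b. b \<in> F ==> openin X (P b)"
  "\<And>b. b \<in> F ==> P b \<subseteq> X closure_of (P b) & X closure_of (P b) \<subseteq> U b" "A \<subseteq> (\<Union>b\<in>F. P b)"
  using finite_shrunk_cover[OF X A U] by metis
 define \<beta> where "\<beta> x = (SOME b. b \<in> F & x \<in> P b)" for x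
 define c where "c x y \<longleftrightarrow> s (\<beta> x) x ~= s (\<beta> x) y" for x y
 have "\<exists>V. openin X V & a \<in> V & coboundary_on V c (s a)" if a: "a \<in> A" for a
 proof -
  have aX: "a \<in> topspace X" using a A closedin_subset by blast
  define G where "G = {b \<in> F. a \<in> X closure_of (P b)}"
  define good where "good b V \<longleftrightarrow> (\<forall>y\<in>V. (s b y = s b a) = (s a y = s a a))" for b V
  have "\<exists>V. openin X V & a \<in> V & good b V" if "b \<in> G" for b
  proof -
   have b: "b \<in> A" "a \<in> U b" using that F(2) P(2) unfolding G_def by auto
   obtain V where "openin X V" "a \<in> V" "\<forall>y\<in>V. (s b y = s b a) = (s a y = s a a)"
    using sU[OF b] by (rule same_jumps_atE)
   then show ?thesis unfolding good_def by blast
  qed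
  then obtain V where V: "\<And>b. b \<in> G ==> openin X (V b) & a \<in> V b & good b (V b)" by metis
  let ?N = "topspace X \<inter> (\<Inter>b\<in>{b \<in> F. a \<notin> X closure_of (P b)}. topspace X - X closure_of (P b))"
  obtain b0 where b0: "b0 \<in> F" "a \<in> P b0" using P(3) a by blast
  define W where "W = ?N \<inter> P b0 \<inter> (topspace X \<inter> (\<Inter>b\<in>G. V b))"
  have "openin X (topspace X \<inter> (\<Inter>b\<in>G. V b))" using V F(1) unfolding G_def
   by (intro openin_Int_Inter) auto
  then have oW: "openin X W" unfolding W_def
   by (rule openin_Int[OF openin_Int[OF shrunk_cover_nbhd[OF F(1) aX] P(1)[OF b0(1)]]])
  have aW: "a \<in> W" unfolding W_def using b0(2) V aX by auto
  have "c x y = (s a x ~= s a y)" if x: "x \<in> W" and y: "y \<in> W" for x y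
  proof -
   have "\<exists>b. b \<in> F & x \<in> P b" using x b0(1) unfolding W_def by blast
   then have b: "\<beta> x \<in> F" "x \<in> P (\<beta> x)" unfolding \<beta>_def by (metis (mono_tags, lifting) someI_ex)+
   have "a \<in> X closure_of (P (\<beta> x))"
    using x b P(2)[OF b(1)] unfolding W_def by blast
   then have bG: "\<beta> x \<in> G" using b(1) unfolding G_def by blast
   then have "x \<in> V (\<beta> x)" "y \<in> V (\<beta> x)" "good (\<beta> x) (V (\<beta> x))" using V x y unfolding W_def by blast+
   then have "(s (\<beta> x) x = s (\<beta> x) a) = (s a x = s a a)" "(s (\<beta> x) y = s (\<beta> x) a) = (s a y = s a a)"
    unfolding good_def by blast+
   then show ?thesis unfolding c_def by argo
  qed
  then have "coboundary_on W c (s a)" unfolding coboundary_on_def by blast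
  with oW aW show ?thesis by blast
 qed
 with that show thesis by blast
qed

text \<open>No continuity is asked of \<open>\<rho>\<close>. It only moves points near \<open>A\<close> to points of \<open>A\<close> in the same member of
the cover, which is all that a cocycle near the diagonal can notice.\<close>

lemma near_retraction_exists:
 assumes X: "compact_space X" "Hausdorff_space X" and A: "closedin X A"
  and U: "\<And>a. a \<in> A ==> openin X (U a) & a \<in> U a"
 obtains \<rho> where "\<And>x. x \<in> A ==> \<rho> x = x"
  "\<And>a. a \<in> A ==> \<exists>V b. openin X V & a \<in> V & b \<in> A & V \<subseteq> U b & (\<forall>x\<in>V. \<rho> x \<in> A \<inter> U b)"
proof -
 obtain F P where F: "finite F" "F \<subseteq> A" and P: "\<And>b. b \<in> F ==> openin X (P b)"
  "\<And>b. b \<in> F ==> P b \<subseteq> X closure_of (P b) & X closure_of (P b) \<subseteq> U b" "A \<subseteq> (\<Union>b\<in>F. P b)"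
  using finite_shrunk_cover[OF X A U] by metis
 define \<rho> where "\<rho> x = (if x \<in> A then x else SOME a. a \<in> A & (\<forall>b\<in>F. x \<in> P b --> a \<in> U b))" for x
 have "\<exists>V b. openin X V & a \<in> V & b \<in> A & V \<subseteq> U b & (\<forall>x\<in>V. \<rho> x \<in> A \<inter> U b)" if a: "a \<in> A" for a
 proof -
  have aX: "a \<in> topspace X" using a A closedin_subset by blast
  obtain b where b: "b \<in> F" "a \<in> P b" using P(3) a by blast
  define V where "V = (topspace X \<inter> (\<Inter>b\<in>{b \<in> F. a \<notin> X closure_of (P b)}. topspace X - X closure_of (P b))) \<inter> P b"
  have oV: "openin X V" "a \<in> V" unfolding V_def
   using openin_Int[OF shrunk_cover_nbhd[OF F(1) aX] P(1)[OF b(1)]] aX b(2) by auto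
  have VU: "V \<subseteq> U b" using P(2)[OF b(1)] unfolding V_def by blast
  have "\<rho> x \<in> A \<inter> U b" if x: "x \<in> V" for x
  proof (cases "x \<in> A")
   case True
   then show ?thesis using VU x by (auto simp: \<rho>_def)
  next
   case False
   have "a \<in> U b'" if b': "b' \<in> F" "x \<in> P b'" for b'
    using x P(2)[OF b'(1)] b' unfolding V_def by blast
   with a have "\<exists>a. a \<in> A & (\<forall>b\<in>F. x \<in> P b --> a \<in> U b)" by blast
   from someI_ex[OF this] have "\<rho> x \<in> A & (\<forall>b\<in>F. x \<in> P b --> \<rho> x \<in> U b)"
    using False by (simp add: \<rho>_def)
   then show ?thesis using x b(1) unfolding V_def by blast
  qed
  with oV VU b F(2) show ?thesis by blast
 qed
 moreover have "\<rho> x = x" if "x \<in> A" for x using that by (simp add: \<rho>_def)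
 ultimately show thesis using that by blast
qed

text \<open>A trivialisation \<open>f\<close> on \<open>A\<close> is continued by \<open>F x = c x (\<rho> x) + f (\<rho> x)\<close>, where \<open>c\<close> is a coherent choice
of the germs and \<open>\<rho>\<close> moves \<open>x\<close> into \<open>A\<close>.\<close>

lemma trivial_near_closed:
 assumes X: "compact_space X" "Hausdorff_space X" and A: "closedin X A"
  and G: "openin X G" "A \<subseteq> G" and s: "local_system (subtopology X G) s"
  and triv: "trivial_system (subtopology X A) s"
 obtains H where "openin X H" "A \<subseteq> H" "H \<subseteq> G" "trivial_system (subtopology X H) s"
proof -
 have AX: "A \<subseteq> topspace X" by (rule closedin_subset[OF A])
 have GX: "topspace (subtopology X G) = G" using openin_subset[OF G(1)] by auto
 have TA: "topspace (subtopology X A) = A" using AX by auto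
 have sG: "\<exists>U. openin X U & a \<in> U & U \<subseteq> G & (\<forall>y\<in>U. same_jumps_at X (s a) (s y) y)" if a: "a \<in> A" for a
 proof -
  have "a \<in> topspace (subtopology X G)" using a G(2) GX by blast
  then have "\<exists>U. openin (subtopology X G) U & a \<in> U & (\<forall>y\<in>U. same_jumps_at (subtopology X G) (s a) (s y) y)"
   using s unfolding local_system_def by simp
  then obtain U where U: "openin (subtopology X G) U" "a \<in> U"
   "\<And>y. y \<in> U ==> same_jumps_at (subtopology X G) (s a) (s y) y" by metis
  have "openin X U" "U \<subseteq> G" using U(1) openin_open_subtopology[OF G(1)] by blast+
  moreover have "\<forall>y\<in>U. same_jumps_at X (s a) (s y) y"
   by (intro ballI same_jumps_at_open_subtopology[OF G(1)] U(3))
  ultimately show ?thesis using U(2) by metis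
 qed
 then obtain U where U: "\<And>a. a \<in> A ==> openin X (U a) & a \<in> U a & U a \<subseteq> G"
  and sU: "\<And>a y. a \<in> A ==> y \<in> U a ==> same_jumps_at X (s a) (s y) y" by metis
 obtain c where c: "\<And>a. a \<in> A ==> \<exists>V. openin X V & a \<in> V & coboundary_on V c (s a)"
  using strong_cocycle_exists[OF X A, of s] sG by metis
 obtain f where f: "trivialises (subtopology X A) s f" using triv unfolding trivial_system_def by blast
 define good where "good a V \<longleftrightarrow> coboundary_on V c (s a) &
   (\<forall>y\<in>A \<inter> V. (s a y = s a a) = (f y = f a))" for a V
 have "\<exists>V. openin X V & a \<in> V & V \<subseteq> U a & good a V" if a: "a \<in> A" for a
 proof -
  obtain V where V: "openin X V" "a \<in> V" "coboundary_on V c (s a)" using c[OF a] by metis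
  have "same_jumps_at (subtopology X A) (s a) f a" using f a TA unfolding trivialises_def by blast
  then obtain V' where V': "openin (subtopology X A) V'" "a \<in> V'" "\<forall>y\<in>V'. (s a y = s a a) = (f y = f a)"
   by (rule same_jumps_atE)
  then obtain V'' where V'': "openin X V''" "V' = V'' \<inter> A" unfolding openin_subtopology by blast
  have "good a (V \<inter> V'' \<inter> U a)" unfolding good_def coboundary_on_def
  using V(3) V'(3) V''(2) unfolding coboundary_on_def by blast
  then show ?thesis using V V' V'' U[OF a] by (intro exI[of _ "V \<inter> V'' \<inter> U a"]) auto
 qed
 then obtain V where V: "\<And>a. a \<in> A ==> openin X (V a) & a \<in> V a" and VU: "\<And>a. a \<in> A ==> V a \<subseteq> U a"
  and good: "\<And>a. a \<in> A ==> good a (V a)" by metis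
 obtain \<rho> where \<rho>: "\<And>a. a \<in> A ==> \<exists>W b. openin X W & a \<in> W & b \<in> A & W \<subseteq> V b & (\<forall>x\<in>W. \<rho> x \<in> A \<inter> V b)"
  using near_retraction_exists[OF X A V] by metis
 (* Near a this is s b up to a constant, for any b in A whose neighbourhood contains x and \<rho> x. *)
 define F where "F x \<longleftrightarrow> c x (\<rho> x) ~= f (\<rho> x)" for x
 define H where "H = \<Union>{W. openin X W & W \<subseteq> G & (\<forall>x\<in>W. same_jumps_at X (s x) F x)}"
 have "A \<subseteq> H"
 proof
  fix a assume a: "a \<in> A"
  obtain W b where W: "openin X W" "a \<in> W" "b \<in> A" "W \<subseteq> V b" "\<forall>x\<in>W. \<rho> x \<in> A \<inter> V b"
   using \<rho>[OF a] by metis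
  have Fb: "F x = (s b x ~= (s b b ~= f b))" if x: "x \<in> W" for x
  proof -
   have "c x (\<rho> x) = (s b x ~= s b (\<rho> x))" "(s b (\<rho> x) = s b b) = (f (\<rho> x) = f b)"
    using good[OF W(3)] W(4,5) x unfolding good_def coboundary_on_def by blast+
   then show ?thesis unfolding F_def by argo
  qed
  have "same_jumps_at X (s x) F x" if x: "x \<in> W" for x
  proof -
   have "same_jumps_at X (s b) F x"
   proof (rule same_jumps_atI[OF W(1) x])
    fix y assume "y \<in> W"
    from Fb[OF this] Fb[OF x] show "(s b y = s b x) = (F y = F x)" by argo
   qed
   moreover have "same_jumps_at X (s b) (s x) x" using sU[OF W(3)] VU[OF W(3)] W(4) x by blast
   ultimately show ?thesis by (meson same_jumps_at_sym same_jumps_at_trans)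
  qed
  moreover have "W \<subseteq> G" using W VU U by blast
  ultimately show "a \<in> H" unfolding H_def using W by blast
 qed
 moreover have oH: "openin X H" unfolding H_def by (rule openin_Union) blast
 moreover have "H \<subseteq> G" unfolding H_def by blast
 moreover have "trivial_system (subtopology X H) s"
  unfolding trivial_system_def trivialises_def
  by (intro exI[of _ F] ballI same_jumps_at_subtopology) (auto simp: H_def)
 ultimately show thesis using that by blast
qed

text \<open>The cocycle of the system on \<open>A\<close> is pulled back along \<open>\<rho>\<close> to a neighbourhood. Only the class
of the system is preserved, since \<open>\<rho>\<close> is not continuous.\<close>

lemma local_system_extends_near_closed:
 assumes X: "compact_space X" "Hausdorff_space X" and A: "closedin X A"
  and s: "local_system (subtopology X A) s"
 obtains H s' where "openin X H" "A \<subseteq> H" "local_system (subtopology X H) s'"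
  "trivial_system (subtopology X A) (system_sum s s')"
proof -
 have AX: "A \<subseteq> topspace X" by (rule closedin_subset[OF A])
 have TA: "topspace (subtopology X A) = A" using AX by auto
 let ?A = "subtopology X A"
 have "compact_space ?A" "Hausdorff_space ?A" "closedin ?A A"
  using closedin_compact_space[OF X(1) A] X(2) TA
  by (auto simp: compactin_subspace Hausdorff_space_subtopology closedin_subtopology_refl AX)
 moreover have "\<And>a. a \<in> A ==> \<exists>U. openin ?A U & a \<in> U & (\<forall>y\<in>U. same_jumps_at ?A (s a) (s y) y)"
  using s TA unfolding local_system_def by simp
 ultimately obtain c where c: "\<And>a. a \<in> A ==> \<exists>V. openin ?A V & a \<in> V & coboundary_on V c (s a)"
  using strong_cocycle_exists[of ?A A s] by metis
 define good where "good a V \<longleftrightarrow> coboundary_on (A \<inter> V) c (s a)" for a V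
 have "\<exists>V. openin X V & a \<in> V & good a V" if a: "a \<in> A" for a
 proof -
  obtain V where V: "openin ?A V" "a \<in> V" "coboundary_on V c (s a)" using c[OF a] by metis
  then obtain V' where V': "openin X V'" "V = V' \<inter> A" unfolding openin_subtopology by blast
  have "good a V'" unfolding good_def using V(3) V'(2) by (simp add: Int_commute)
  then show ?thesis using V V' by blast
 qed
 then obtain V where V: "\<And>a. a \<in> A ==> openin X (V a) & a \<in> V a"
  and good: "\<And>a. a \<in> A ==> good a (V a)" by metis
 obtain \<rho> where \<rho>A: "\<And>x. x \<in> A ==> \<rho> x = x" and
  \<rho>: "\<And>a. a \<in> A ==> \<exists>W b. openin X W & a \<in> W & b \<in> A & W \<subseteq> V b & (\<forall>x\<in>W. \<rho> x \<in> A \<inter> V b)"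
  using near_retraction_exists[OF X A V] by metis
 define s' where "s' x y = c (\<rho> x) (\<rho> y)" for x y
 define H where "H = \<Union>{W. openin X W & (\<exists>b\<in>A. \<forall>x\<in>W. \<rho> x \<in> A \<inter> V b)}"
 have oH: "openin X H" unfolding H_def by (rule openin_Union) blast
 moreover have AH: "A \<subseteq> H"
 using \<rho> by (fastforce simp: H_def)
 moreover have "local_system (subtopology X H) s'"
  unfolding local_system_def
 proof
  fix x assume "x \<in> topspace (subtopology X H)"
  then have "x \<in> H" by simp
  then obtain W b where W: "openin X W" "x \<in> W" "b \<in> A" "\<forall>x\<in>W. \<rho> x \<in> A \<inter> V b" unfolding H_def by blast
  have s': "s' y z = (s b (\<rho> y) ~= s b (\<rho> z))" if "y \<in> W" "z \<in> W" for y z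
   using good[OF W(3)] W(4) that unfolding good_def s'_def coboundary_on_def by blast
  have "W \<subseteq> H" unfolding H_def using W by blast
  then have oW: "openin (subtopology X H) W" using W(1) oH openin_open_subtopology by blast
  have "same_jumps_at (subtopology X H) (s' x) (s' y) y" if y: "y \<in> W" for y
  by (metis same_jumps_atI oW y s' W(2))
  with oW W(2) show "\<exists>U. openin (subtopology X H) U & x \<in> U &
    (\<forall>y\<in>U. same_jumps_at (subtopology X H) (s' x) (s' y) y)" by blast
 qed
 moreover have "trivialises ?A (system_sum s s') (%_. False)"
  unfolding trivialises_def
 proof
  fix a assume "a \<in> topspace ?A"
  then have a: "a \<in> A" using TA by simp
  show "same_jumps_at ?A (system_sum s s' a) (%_. False) a"
  proof (rule same_jumps_atI[of _ "A \<inter> V a"])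
   show "openin ?A (A \<inter> V a)" using V[OF a] by (metis inf_commute openin_subtopology)
   show "a \<in> A \<inter> V a" using V[OF a] a by blast
  next
   fix y assume y: "y \<in> A \<inter> V a"
   have aV: "a \<in> A \<inter> V a" using V[OF a] a by blast
   have "s' a y = (s a a ~= s a y)" "s' a a = (s a a ~= s a a)"
    using good[OF a] y aV \<rho>A unfolding good_def s'_def coboundary_on_def by auto
   then show "(system_sum s s' a y = system_sum s s' a a) = (False = False)"
    unfolding system_sum_def by argo
  qed
 qed
 then have "trivial_system ?A (system_sum s s')" unfolding trivial_system_def by blast
 ultimately show thesis using that by blast
qed

section \<open>The torus and the Klein bottle\<close>

text \<open>The cohomology group has four elements; a labelling of the systems by pairs of Boolean values avoids
forming the quotient group.\<close>

definition H1_order_four :: "'a topology => bool" where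
 "H1_order_four Y \<longleftrightarrow> (\<exists>\<theta> :: ('a => 'a => bool) => bool \<times> bool.
   (\<forall>s t. local_system Y s --> local_system Y t --> (\<theta> s = \<theta> t \<longleftrightarrow> trivial_system Y (system_sum s t))) &
   (\<forall>b. \<exists>s. local_system Y s & \<theta> s = b))"

lemma trivialises_cong:
 assumes "trivialises Y s f" "\<And>x y. x \<in> topspace Y ==> y \<in> topspace Y ==> s x y = s' x y"
 shows "trivialises Y s' f"
 unfolding trivialises_def
proof
 fix x assume x: "x \<in> topspace Y"
 then obtain U where U: "openin Y U" "x \<in> U" "\<forall>y\<in>U. (s x y = s x x) = (f y = f x)"
  using assms(1) unfolding trivialises_def same_jumps_at_def by blast
 show "same_jumps_at Y (s' x) f x"
 proof (rule same_jumps_atI[OF U(1,2)])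
  fix y assume "y \<in> U"
  then have "y \<in> topspace Y" using openin_subset[OF U(1)] by blast
  then have "s' x y = s x y" "s' x x = s x x" using assms(2)[OF x] x by auto
  then show "(s' x y = s' x x) = (f y = f x)" using U(3) \<open>y \<in> U\<close> by blast
 qed
qed

lemma trivial_system_homeomorphic_iff:
 assumes fg: "homeomorphic_maps X Y f g"
 shows "trivial_system X (pullback_system f s) \<longleftrightarrow> trivial_system Y s"
proof
 have f: "continuous_map X Y f" and g: "continuous_map Y X g"
  and fg': "\<And>y. y \<in> topspace Y ==> f (g y) = y"
  using fg unfolding homeomorphic_maps_def by auto
 show "trivial_system X (pullback_system f s)" if "trivial_system Y s"
  using that trivialises_pullback[OF f] unfolding trivial_system_def pullback_system_def by blast
 assume "trivial_system X (pullback_system f s)"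
 then obtain k where "trivialises X (%x z. s (f x) (f z)) k"
  unfolding trivial_system_def pullback_system_def by blast
 from trivialises_cong[OF trivialises_pullback[OF g this], of s]
 show "trivial_system Y s" using fg' unfolding trivial_system_def by auto
qed

lemma H1_order_four_homeomorphic:
 assumes "X homeomorphic_space Y" "H1_order_four X"
 shows "H1_order_four Y"
proof -
 obtain f g where fg: "homeomorphic_maps X Y f g"
  using assms(1) unfolding homeomorphic_space_def by blast
 then have f: "continuous_map X Y f" and g: "continuous_map Y X g"
  and gf: "\<And>x. x \<in> topspace X ==> g (f x) = x"
  unfolding homeomorphic_maps_def by auto
 obtain \<theta> :: "('a => 'a => bool) => bool \<times> bool" where
  \<theta>: "\<And>s t. local_system X s ==> local_system X t ==> (\<theta> s = \<theta> t \<longleftrightarrow> trivial_system X (system_sum s t))"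
  "\<And>b. \<exists>s. local_system X s & \<theta> s = b"
  using assms(2) unfolding H1_order_four_def by metis
 have pf: "local_system X (pullback_system f s)" if "local_system Y s" for s
  using local_system_pullback[OF f that] by (simp add: pullback_system_def)
 show ?thesis
  unfolding H1_order_four_def
 proof (intro exI[of _ "%s. \<theta> (pullback_system f s)"] conjI allI impI)
  fix s t assume st: "local_system Y s" "local_system Y t"
  have "system_sum (pullback_system f s) (pullback_system f t) = pullback_system f (system_sum s t)"
   by (auto simp: fun_eq_iff system_sum_def pullback_system_def)
  then show "\<theta> (pullback_system f s) = \<theta> (pullback_system f t) \<longleftrightarrow> trivial_system Y (system_sum s t)"
   using \<theta>(1)[OF pf[OF st(1)] pf[OF st(2)]] trivial_system_homeomorphic_iff[OF fg] by metis
 next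
  fix b
  obtain s where s: "local_system X s" "\<theta> s = b" using \<theta>(2) by blast
  let ?t = "pullback_system g s"
  have t: "local_system Y ?t" using local_system_pullback[OF g s(1)] by (simp add: pullback_system_def)
  have "trivialises X (system_sum (pullback_system f ?t) s) (%_. False)"
   by (rule trivialises_cong[of _ "%_ _. False"])
    (auto simp: trivialises_def same_jumps_at_refl pullback_system_def system_sum_def gf)
  then have "\<theta> (pullback_system f ?t) = \<theta> s"
   using \<theta>(1)[OF pf[OF t] s(1)] unfolding trivial_system_def by blast
  with s(2) t show "\<exists>s. local_system Y s & \<theta> (pullback_system f s) = b" by blast
 qed
qed

text \<open>Two paths with the same image downstairs have a locally constant comparison of values; for
the sides of a square this makes the jump from one side to the other constant along the side.\<close>

lemma descent_function_along:
 assumes f: "descent_function X \<pi> f" and \<gamma>: "continuous_map Z X \<gamma>" and \<delta>: "continuous_map Z X \<delta>"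
  and eq: "\<And>z. z \<in> topspace Z ==> \<pi> (\<gamma> z) = \<pi> (\<delta> z)"
 shows "locally_constant_on Z (%z. f (\<gamma> z) ~= f (\<delta> z))"
 unfolding locally_constant_on_def
proof
 fix z assume z: "z \<in> topspace Z"
 then have zX: "\<gamma> z \<in> topspace X" "\<delta> z \<in> topspace X"
  using \<gamma> \<delta> by (auto simp: continuous_map_def)
 have "\<exists>U U'. openin X U & \<gamma> z \<in> U & openin X U' & \<delta> z \<in> U' &
    (\<forall>y\<in>U. \<forall>y'\<in>U'. \<pi> y = \<pi> y' --> (f y = f y') = (f (\<gamma> z) = f (\<delta> z)))"
  using f zX eq[OF z] unfolding descent_function_def by simp
 then obtain U U' where U: "openin X U" "\<gamma> z \<in> U" "openin X U'" "\<delta> z \<in> U'"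
  "\<forall>y\<in>U. \<forall>y'\<in>U'. \<pi> y = \<pi> y' --> (f y = f y') = (f (\<gamma> z) = f (\<delta> z))" by (elim exE conjE) blast
 let ?W = "{w \<in> topspace Z. \<gamma> w \<in> U} \<inter> {w \<in> topspace Z. \<delta> w \<in> U'}"
 have "openin Z ?W" by (intro openin_Int openin_continuous_map_preimage[OF \<gamma> U(1)] openin_continuous_map_preimage[OF \<delta> U(3)])
 moreover have "z \<in> ?W" using U z by blast
 moreover have "\<forall>w\<in>?W. (f (\<gamma> w) ~= f (\<delta> w)) = (f (\<gamma> z) ~= f (\<delta> z))"
 using U(5) eq by blast
 ultimately show "\<exists>W. openin Z W & z \<in> W & (\<forall>w\<in>W. (f (\<gamma> w) ~= f (\<delta> w)) = (f (\<gamma> z) ~= f (\<delta> z)))" by blast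
qed

definition unit_square :: "(real \<times> real) set" where "unit_square = {0..1} \<times> {0..1}"

definition side_flip :: "bool => real => real" where "side_flip b y = (if b then 1 - y else y)"

definition same_or_ends :: "real => real => bool" where
 "same_or_ends x x' \<longleftrightarrow> x = x' \<or> x = 0 & x' = 1 \<or> x = 1 & x' = 0"

text \<open>The gluing of opposite sides of the unit square. The flag \<open>b\<close> tells whether the vertical
sides are matched with a flip, giving the Klein bottle, or without, giving the torus.\<close>

definition side_rel :: "bool => real \<times> real => real \<times> real => bool" where
 "side_rel b p p' \<longleftrightarrow> same_or_ends (fst p) (fst p') &
   same_or_ends (if fst p = fst p' then snd p else side_flip b (snd p)) (snd p')"

lemma same_or_ends_flip: "same_or_ends (side_flip b y) y' = same_or_ends y (side_flip b y')"
 by (auto simp: same_or_ends_def side_flip_def)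

text \<open>The jump between two identified sides is constant along the side, so it is measured at the midpoints.
If both jumps vanish then \<open>f\<close> descends to a trivialisation.\<close>

lemma square_trivial_iff:
 assumes d: "descent_map (top_of_set unit_square) Y \<pi>"
  and \<pi>: "\<And>p p'. p \<in> unit_square ==> p' \<in> unit_square ==> \<pi> p = \<pi> p' \<longleftrightarrow> side_rel b p p'"
  and f: "trivialises (top_of_set unit_square) (pullback_system \<pi> s) f"
 shows "trivial_system Y s \<longleftrightarrow> f (0, 1/2) = f (1, 1/2) & f (1/2, 0) = f (1/2, 1)"
proof
 let ?X = "top_of_set unit_square"
 have conn: "connected_space ?X"
  unfolding connected_space_subtopology unit_square_def
  by (simp add: connected_space_subtopology connected_Times)
 assume "trivial_system Y s"
 from descent_trivial_imp[OF d f this] obtain \<psi> where \<psi>: "locally_constant_on ?X \<psi>"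
  "\<And>x x'. x \<in> topspace ?X ==> x' \<in> topspace ?X ==> \<pi> x = \<pi> x' ==> (f x = f x') = (\<psi> x = \<psi> x')" by metis
 have "f p = f p'" if "p \<in> unit_square" "p' \<in> unit_square" "side_rel b p p'" for p p'
  using \<psi>(2)[of p p'] connected_locally_constant[OF conn \<psi>(1), of p p'] \<pi>[of p p'] that by simp
 note this[of "(0, 1/2)" "(1, 1/2)"] this[of "(1/2, 0)" "(1/2, 1)"]
 then show "f (0, 1/2) = f (1, 1/2) & f (1/2, 0) = f (1/2, 1)"
  by (auto simp: unit_square_def side_rel_def same_or_ends_def side_flip_def split: if_splits)
next
 let ?X = "top_of_set unit_square" and ?I = "top_of_set {0..1::real}"
 assume f0: "f (0, 1/2) = f (1, 1/2) & f (1/2, 0) = f (1/2, 1)"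
 have df: "descent_function ?X \<pi> f" by (rule descent_function_trivialisation[OF f])
 have "connected_space ?I" by (simp add: connected_space_subtopology)
 note cI = connected_locally_constant[OF this]
 have "continuous_on {0..1} (side_flip b)"
  by (cases b) (auto simp: side_flip_def intro!: continuous_intros)
 then have "locally_constant_on ?I (%y. f (0, y) ~= f (1, side_flip b y))"
 proof (intro descent_function_along[OF df])
  fix y :: real assume "y \<in> topspace ?I"
  then have "(0, y) \<in> unit_square" "(1, side_flip b y) \<in> unit_square"
   by (auto simp: unit_square_def side_flip_def)
  then show "\<pi> (0, y) = \<pi> (1, side_flip b y)"
   by (simp add: \<pi> side_rel_def same_or_ends_def)
 qed (auto intro!: continuous_intros simp: unit_square_def, auto simp: side_flip_def)
 from cI[OF this, of _ "1/2"] f0 have K1: "f (0, y) = f (1, side_flip b y)" if "y \<in> {0..1}" for y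
  using that by (auto simp: side_flip_def split: if_splits)
 have "locally_constant_on ?I (%x. f (x, 0) ~= f (x, 1))"
  by (rule descent_function_along[OF df])
   (auto intro!: continuous_intros simp: unit_square_def \<pi> side_rel_def same_or_ends_def side_flip_def)
 from cI[OF this, of _ "1/2"] f0 have K2: "f (x, 0) = f (x, 1)" if "x \<in> {0..1}" for x
  using that by auto
 have K2': "f (x, y) = f (x, y')" if "x \<in> {0..1}" "same_or_ends y y'" for x y y'
  using K2[OF that(1)] that(2) by (auto simp: same_or_ends_def)
 have "f p = f p'" if p: "p \<in> unit_square" "p' \<in> unit_square" and r: "side_rel b p p'" for p p'
 proof -
  obtain x y x' y' where xy: "p = (x, y)" "p' = (x', y')" by fastforce
  have I: "x \<in> {0..1}" "y \<in> {0..1}" "x' \<in> {0..1}" "y' \<in> {0..1}" using p xy by (auto simp: unit_square_def)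
  consider "x = x'" | "x = 0" "x' = 1" | "x = 1" "x' = 0"
   using r xy by (auto simp: side_rel_def same_or_ends_def)
  then show ?thesis
  proof cases
   case 1
   then show ?thesis using r K2'[OF I(1), of y y'] by (simp add: xy side_rel_def)
  next
   case 2
   then have "same_or_ends (side_flip b y) y'" using r by (simp add: xy side_rel_def)
   from K2'[OF _ this, of 1] K1[OF I(2)] show ?thesis by (simp add: xy 2)
  next
   case 3
   then have "same_or_ends (side_flip b y) y'" using r by (simp add: xy side_rel_def)
   then have "same_or_ends y (side_flip b y')" by (simp add: same_or_ends_flip)
   from K2'[OF _ this, of 1] K1[OF I(4)] show ?thesis by (simp add: xy 3)
  qed
 qed
 then show "trivial_system Y s"
  by (intro descent_trivial[OF d f, of "%_. True"]) (auto simp: locally_constant_on_def \<pi>)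
qed

text \<open>The function on the square with prescribed jumps \<open>\<alpha>\<close> and \<open>\<beta>\<close> across the two pairs of sides. It is
altered only on two closed sides; with a flip, the corners force the condition to be read on the left side.\<close>

definition square_function :: "bool => bool => bool => real \<times> real => bool" where
 "square_function b \<alpha> \<beta> p \<longleftrightarrow>
   (\<alpha> & fst p = 1) ~= (\<beta> & (if fst p = 1 then side_flip b (snd p) else snd p) = 1)"

lemma square_function_jump:
 assumes "side_rel b (x, y) (x', y')"
 shows "(square_function b \<alpha> \<beta> (x, y) ~= square_function b \<alpha> \<beta> (x', y')) \<longleftrightarrow>
  (\<alpha> & x ~= x') ~= (\<beta> & (if x = x' then y else side_flip b y) ~= y')"
proof -
 consider "x = x'" | "x = 0" "x' = 1" | "x = 1" "x' = 0"
  using assms by (auto simp: side_rel_def same_or_ends_def)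
 then show ?thesis
  using assms by cases (auto simp: side_rel_def same_or_ends_def square_function_def side_flip_def split: if_splits)
qed

lemma same_or_ends_near:
 assumes "same_or_ends x x'" "same_or_ends u u'" "\<bar>u - x\<bar> < 1/4" "\<bar>u' - x'\<bar> < 1/4"
 shows "u = u' \<longleftrightarrow> x = x'"
using assms(1,2) assms(3,4) by (auto simp: same_or_ends_def)

text \<open>A jump depends only on which coordinates are identified across the square, and this does not change
within distance 1/4.\<close>

lemma square_function_descent:
 assumes \<pi>: "\<And>p p'. p \<in> unit_square ==> p' \<in> unit_square ==> \<pi> p = \<pi> p' \<longleftrightarrow> side_rel b p p'"
 shows "descent_function (top_of_set unit_square) \<pi> (square_function b \<alpha> \<beta>)"
 unfolding descent_function_def
proof (intro ballI impI)
 let ?X = "top_of_set unit_square" and ?f = "square_function b \<alpha> \<beta>"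
 fix p p' assume p: "p \<in> topspace ?X" "p' \<in> topspace ?X" and "\<pi> p = \<pi> p'"
 then have r: "side_rel b p p'" using \<pi> by simp
 obtain x y x' y' where xy: "p = (x, y)" "p' = (x', y')" by fastforce
 have "(?f q = ?f q') = (?f p = ?f p')"
  if q: "q \<in> unit_square \<inter> ball p (1/4)" "q' \<in> unit_square \<inter> ball p' (1/4)" "\<pi> q = \<pi> q'" for q q'
 proof -
  have r': "side_rel b q q'" using \<pi> q by simp
  obtain u v u' v' where uv: "q = (u, v)" "q' = (u', v')" by fastforce
  have near: "\<bar>u - x\<bar> < 1/4" "\<bar>v - y\<bar> < 1/4" "\<bar>u' - x'\<bar> < 1/4" "\<bar>v' - y'\<bar> < 1/4"
  proof -
   have "dist p q < 1/4" "dist p' q' < 1/4" using q by auto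
   with dist_fst_le[of p q] dist_snd_le[of p q] dist_fst_le[of p' q'] dist_snd_le[of p' q']
   have "dist x u < 1/4" "dist y v < 1/4" "dist x' u' < 1/4" "dist y' v' < 1/4"
    unfolding xy uv fst_conv snd_conv by linarith+
   then show "\<bar>u - x\<bar> < 1/4" "\<bar>v - y\<bar> < 1/4" "\<bar>u' - x'\<bar> < 1/4" "\<bar>v' - y'\<bar> < 1/4"
    by (simp_all add: dist_real_def abs_minus_commute)
  qed
  have e1: "same_or_ends x x'" "same_or_ends (if x = x' then y else side_flip b y) y'"
   and e2: "same_or_ends u u'" "same_or_ends (if u = u' then v else side_flip b v) v'"
   using r r' unfolding xy uv side_rel_def fst_conv snd_conv by blast+
  have u: "(u = u') = (x = x')" by (rule same_or_ends_near[OF e1(1) e2(1) near(1,3)])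
  have "\<bar>(if u = u' then v else side_flip b v) - (if x = x' then y else side_flip b y)\<bar> < 1/4"
   using near(2) by (auto simp: u side_flip_def abs_minus_commute)
  from same_or_ends_near[OF e1(2) e2(2) this near(4)] u
  have "(u = u') = (x = x')" and "(if u = u' then v else side_flip b v) = v' \<longleftrightarrow> (if x = x' then y else side_flip b y) = y'"
   by blast+
  with square_function_jump[OF r[unfolded xy], of \<alpha> \<beta>] square_function_jump[OF r'[unfolded uv], of \<alpha> \<beta>]
  show ?thesis unfolding xy uv by argo
 qed
 then show "\<exists>U U'. openin ?X U & p \<in> U & openin ?X U' & p' \<in> U' &
    (\<forall>y\<in>U. \<forall>y'\<in>U'. \<pi> y = \<pi> y' --> (?f y = ?f y') = (?f p = ?f p'))"
  using p by (intro exI[of _ "unit_square \<inter> ball p (1/4)"] exI[of _ "unit_square \<inter> ball p' (1/4)"] conjI ballI impI)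
   (auto simp: openin_open)
qed

lemma H1_order_four_square:
 assumes d: "descent_map (top_of_set unit_square) Y \<pi>"
  and \<pi>: "\<And>p p'. p \<in> unit_square ==> p' \<in> unit_square ==> \<pi> p = \<pi> p' \<longleftrightarrow> side_rel b p p'"
 shows "H1_order_four Y"
proof -
 let ?X = "top_of_set unit_square"
 have "convex unit_square" unfolding unit_square_def by (intro convex_Times) auto
 then have H: "H1_trivial ?X" by (rule H1_trivial_convex)
 define F where "F s = (SOME f. trivialises ?X (pullback_system \<pi> s) f)" for s
 have F: "trivialises ?X (pullback_system \<pi> s) (F s)" if "local_system Y s" for s
 proof -
  have "local_system ?X (pullback_system \<pi> s)"
   unfolding pullback_system_def by (rule local_system_pullback[OF descent_mapD(2)[OF d] that])
  then have "\<exists>f. trivialises ?X (pullback_system \<pi> s) f"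
   using H unfolding H1_trivial_def trivial_system_def by blast
  then show ?thesis unfolding F_def by (rule someI_ex)
 qed
 define \<theta> where "\<theta> s = (F s (0, 1/2) ~= F s (1, 1/2), F s (1/2, 0) ~= F s (1/2, 1))" for s
 have crit: "trivial_system Y (system_sum s t) \<longleftrightarrow>
   (f (0, 1/2) ~= g (0, 1/2)) = (f (1, 1/2) ~= g (1, 1/2)) & (f (1/2, 0) ~= g (1/2, 0)) = (f (1/2, 1) ~= g (1/2, 1))"
  if "trivialises ?X (pullback_system \<pi> s) f" "trivialises ?X (pullback_system \<pi> t) g" for s t f g
 proof -
  have "pullback_system \<pi> (system_sum s t) = system_sum (pullback_system \<pi> s) (pullback_system \<pi> t)"
   by (auto simp: fun_eq_iff system_sum_def pullback_system_def)
  then show ?thesis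
   using square_trivial_iff[OF d \<pi>, of "system_sum s t" "%x. f x ~= g x"] trivialises_sum[OF that] by simp
 qed
 show ?thesis
  unfolding H1_order_four_def
 proof (intro exI[of _ \<theta>] conjI allI impI)
  fix s t assume st: "local_system Y s" "local_system Y t"
  show "\<theta> s = \<theta> t \<longleftrightarrow> trivial_system Y (system_sum s t)"
   unfolding crit[OF F[OF st(1)] F[OF st(2)]] \<theta>_def prod.inject by argo
 next
  fix c :: "bool \<times> bool"
  obtain s where s: "local_system Y s"
   "trivialises ?X (pullback_system \<pi> s) (square_function b (fst c) (snd c))"
   using descent_exists[OF d square_function_descent[OF \<pi>]] by blast
  have "locally_constant_on ?X (%x. F s x ~= square_function b (fst c) (snd c) x)"
   by (rule trivialises_unique[OF F[OF s(1)] s(2)])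
  have "system_sum s s = (%_ _. False)" by (auto simp: system_sum_def fun_eq_iff)
  then have "trivialises Y (system_sum s s) (%_. False)"
   by (simp add: trivialises_def same_jumps_at_refl)
  then have "trivial_system Y (system_sum s s)" unfolding trivial_system_def by blast
  note this[unfolded crit[OF F[OF s(1)] s(2)]]
  then have "\<theta> s = c"
   unfolding \<theta>_def by (cases c) (auto simp: square_function_def side_flip_def split: if_splits)
  with s(1) show "\<exists>s. local_system Y s & \<theta> s = c" by blast
 qed
qed

lemma finite_side_rel: "finite {p' \<in> unit_square. side_rel b p p'}"
proof (rule finite_subset)
 show "{p' \<in> unit_square. side_rel b p p'} \<subseteq> {fst p, 0, 1} \<times> {snd p, side_flip b (snd p), 0, 1}"
 by (fastforce simp: side_rel_def same_or_ends_def)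
qed auto

lemma cis_eq_iff_unit:
 assumes "x \<in> {0..1}" "x' \<in> {0..1}"
 shows "cis (2 * pi * x) = cis (2 * pi * x') \<longleftrightarrow> same_or_ends x x'"
proof
 assume "cis (2 * pi * x) = cis (2 * pi * x')"
 then have "sin (2 * pi * x) = sin (2 * pi * x') & cos (2 * pi * x) = cos (2 * pi * x')"
  by (simp add: complex_eq_iff)
 then obtain n :: int where "2 * pi * x = 2 * pi * x' + 2 * pi * n"
  using sin_cos_eq_iff by metis
 then have "2 * pi * x = 2 * pi * (x' + n)" by (simp add: algebra_simps)
 then have n: "x = x' + n" by simp
 then have "\<bar>real_of_int n\<bar> <= 1" using assms by auto
 then have "n = -1 \<or> n = 0 \<or> n = 1" by linarith
 then show "same_or_ends x x'" using n assms by (auto simp: same_or_ends_def)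
qed (auto simp: same_or_ends_def cis_2pi)

lemma H1_order_four_torus: "H1_order_four torus"
proof -
 define \<pi> where "\<pi> = (%p::real \<times> real. (cis (2 * pi * fst p), cis (2 * pi * snd p)))"
 have eq: "\<pi> p = \<pi> p' \<longleftrightarrow> side_rel False p p'" if "p \<in> unit_square" "p' \<in> unit_square" for p p'
  using that cis_eq_iff_unit[of "fst p" "fst p'"] cis_eq_iff_unit[of "snd p" "snd p'"]
  by (auto simp: \<pi>_def side_rel_def unit_square_def side_flip_def)
 have "descent_map (top_of_set unit_square) torus \<pi>"
 proof (rule descent_map_compact_Hausdorff)
  show "compact_space (top_of_set unit_square)"
   by (simp add: compact_space_subtopology compactin_euclidean_iff unit_square_def compact_Times)
  show "Hausdorff_space (top_of_set unit_square)" by (simp add: Hausdorff_space_subtopology)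
  show "Hausdorff_space torus"
   by (simp add: torus_def Hausdorff_space_prod_topology Hausdorff_space_subtopology)
  show "continuous_map (top_of_set unit_square) torus \<pi>"
   unfolding torus_def \<pi>_def
   by (intro continuous_map_pairedI) (auto intro!: continuous_intros)
  show "\<pi> ` topspace (top_of_set unit_square) = topspace torus"
  proof -
   have "\<exists>x\<in>{0..1}. z = cis (2 * pi * x)" if "z \<in> sphere 0 1" for z
   proof -
    have "norm z = 1" using that by simp
    then obtain t where t: "0 <= t" "t < 2 * pi" "z = cis t"
     using complex_norm_eq_1_exp[of z] by (metis Arg2pi_eq Arg2pi_ge_0 Arg2pi_lt_2pi cis_conv_exp mult.commute mult.left_neutral of_real_1)
    then show ?thesis by (intro bexI[of _ "t / (2 * pi)"]) auto
   qed
   then show ?thesis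
    by (force simp: torus_def \<pi>_def unit_square_def image_iff)
  qed
  fix P assume "P \<in> topspace torus"
  show "finite {x \<in> topspace (top_of_set unit_square). \<pi> x = P}"
  proof (cases "\<exists>p\<in>unit_square. \<pi> p = P")
   case True
   then obtain p where "p \<in> unit_square" "\<pi> p = P" by blast
   then have "{x \<in> topspace (top_of_set unit_square). \<pi> x = P} = {x \<in> unit_square. side_rel False p x}"
    using eq[of p] by (simp, metis)
   then show ?thesis by (simp add: finite_side_rel)
  next
   case False
   then have "{x \<in> topspace (top_of_set unit_square). \<pi> x = P} = {}" unfolding topspace_euclidean_subtopology by blast
   then show ?thesis by (rule ssubst) simp
  qed
 qed
 then show ?thesis using eq by (rule H1_order_four_square)
qed

lemma glued_class_refl: "x \<in> glued_class r x"
 by (simp add: glued_class_def)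

lemma glued_class_eq_iff: "glued_class r x = glued_class r y \<longleftrightarrow> (x, y) \<in> (r \<union> r\<inverse>)\<^sup>*"
proof
 assume "glued_class r x = glued_class r y"
 then show "(x, y) \<in> (r \<union> r\<inverse>)\<^sup>*" using glued_class_refl[of y r] unfolding glued_class_def by blast
next
 have sym: "sym ((r \<union> r\<inverse>)\<^sup>*)" by (intro sym_rtrancl) (auto simp: sym_def)
 assume "(x, y) \<in> (r \<union> r\<inverse>)\<^sup>*"
 then show "glued_class r x = glued_class r y"
  unfolding glued_class_def using sym by (auto dest: symD intro: rtrancl_trans)
qed

lemma side_rel_refl: "side_rel b p p" by (simp add: side_rel_def same_or_ends_def)

lemma side_rel_trans: "side_rel b p q ==> side_rel b q r ==> side_rel b p r"
 by (cases p; cases q; cases r) (auto simp: side_rel_def same_or_ends_def side_flip_def split: if_splits)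

text \<open>That the quotient is Hausdorff is assumed because it is inherited from the ambient manifold
when the Klein bottle occurs as a boundary component.\<close>

lemma H1_order_four_klein_bottle:
 assumes "Hausdorff_space klein_bottle"
 shows "H1_order_four klein_bottle"
proof -
 define r :: "((real \<times> real) \<times> (real \<times> real)) set" where
  "r = {((0, y), (1, 1 - y)) | y. 0 <= y & y <= 1} \<union> {((x, 0), (x, 1)) | x. 0 <= x & x <= 1}"
 have kb: "klein_bottle = quotient_topology (top_of_set unit_square) r"
  by (simp add: klein_bottle_def r_def unit_square_def)
 have r_rel: "side_rel True p q" if "(p, q) \<in> r \<union> r\<inverse>" for p q
  using that by (auto simp: r_def side_rel_def same_or_ends_def side_flip_def)
 have rel_r: "(p, q) \<in> (r \<union> r\<inverse>)\<^sup>*" if pq: "p \<in> unit_square" "q \<in> unit_square" "side_rel True p q" for p q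
 proof -
  obtain x y x' y' where xy: "p = (x, y)" "q = (x', y')" by fastforce
  have I: "x \<in> {0..1}" "y \<in> {0..1}" "x' \<in> {0..1}" "y' \<in> {0..1}" using pq xy by (auto simp: unit_square_def)
  have vert: "((x, y), (x, y')) \<in> (r \<union> r\<inverse>)\<^sup>*" if "x \<in> {0..1}" "same_or_ends y y'" for x y y'
   using that by (auto simp: same_or_ends_def r_def)
  have hor: "((x, y), (x', 1 - y)) \<in> (r \<union> r\<inverse>)\<^sup>*" if "y \<in> {0..1}" "same_or_ends x x'" "x ~= x'" for x x' y
  proof -
   have "((x, y), (x', 1 - y)) \<in> r \<union> r\<inverse>"
    using that by (auto simp: same_or_ends_def r_def)
   then show ?thesis by blast
  qed
  show ?thesis
  proof (cases "x = x'")
   case True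
   then show ?thesis using pq(3) vert[OF I(1), of y y'] by (simp add: xy side_rel_def)
  next
   case False
   then have "((x, y), (x', 1 - y)) \<in> (r \<union> r\<inverse>)\<^sup>*" "((x', 1 - y), (x', y')) \<in> (r \<union> r\<inverse>)\<^sup>*"
    using pq(3) hor[OF I(2), of x x'] vert[OF I(3), of "1 - y" y'] by (auto simp: xy side_rel_def side_flip_def)
   then show ?thesis unfolding xy by (rule rtrancl_trans)
  qed
 qed
 have eq: "glued_class r p = glued_class r q \<longleftrightarrow> side_rel True p q" if pq: "p \<in> unit_square" "q \<in> unit_square" for p q
 proof -
  have "side_rel True p q" if "(p, q) \<in> (r \<union> r\<inverse>)\<^sup>*"
   using that by (induction rule: rtrancl_induct) (auto intro: side_rel_refl side_rel_trans r_rel)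
  then show ?thesis unfolding glued_class_eq_iff using rel_r[OF pq] by blast
 qed
 have "descent_map (top_of_set unit_square) klein_bottle (glued_class r)"
 proof (rule descent_map_compact_Hausdorff[OF _ _ assms])
  show "compact_space (top_of_set unit_square)"
   by (simp add: compact_space_subtopology compactin_euclidean_iff unit_square_def compact_Times)
  show "Hausdorff_space (top_of_set unit_square)" by (simp add: Hausdorff_space_subtopology)
  show "continuous_map (top_of_set unit_square) klein_bottle (glued_class r)"
   unfolding kb by (intro quotient_imp_continuous_map quotient_map_glued_class)
  show "glued_class r ` topspace (top_of_set unit_square) = topspace klein_bottle"
   unfolding kb topspace_quotient_topology ..
  fix P assume "P \<in> topspace klein_bottle"
  then obtain p where "p \<in> unit_square" "glued_class r p = P"
   unfolding kb topspace_quotient_topology by auto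
  then have "{x \<in> topspace (top_of_set unit_square). glued_class r x = P} = {x \<in> unit_square. side_rel True p x}"
   using eq[of p] by (simp, metis)
  then show "finite {x \<in> topspace (top_of_set unit_square). glued_class r x = P}" by (simp add: finite_side_rel)
 qed
 then show ?thesis using eq by (rule H1_order_four_square)
qed

section \<open>The points of the glued complex\<close>

definition simplex_points :: "('t \<times> (real^4)) set" where
 "simplex_points = UNIV \<times> std_simplex"

lemma topspace_simplices: "topspace simplices = simplex_points"
 by (auto simp: simplices_def simplex_points_def)

lemma openin_simplices:
 "openin simplices U \<longleftrightarrow> U \<subseteq> simplex_points & (\<forall>i. openin (top_of_set std_simplex) {x. (i, x) \<in> U})"
 by (auto simp: simplices_def openin_sum_topology simplex_points_def)

text \<open>The gluing map of face \<open>a\<close>, as a permutation of all four barycentric coordinates. Being an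
isometry of the whole space, it is defined also off the face.\<close>

definition face_move :: "'t gluing => 't => 4 => real^4 => real^4" where
 "face_move T i a x = (\<chi> d. x $ inv (perm T i a) d)"

lemma face_pairingD:
 assumes "face_pairing T"
 shows "bij (perm T i a)" "(nbr T i a, perm T i a a) ~= (i, a)"
  "nbr T (nbr T i a) (perm T i a a) = i" "perm T (nbr T i a) (perm T i a a) = inv (perm T i a)"
 using assms unfolding face_pairing_def by blast+

lemma perm_inj: "face_pairing T ==> perm T i a c = perm T i a d \<longleftrightarrow> c = d"
 using face_pairingD(1) by (metis bij_pointE)

lemma perm_back: "face_pairing T ==> perm T (nbr T i a) (perm T i a a) (perm T i a c) = c"
 by (simp add: face_pairingD(1,4) bij_is_inj)

lemma perm_forth: "face_pairing T ==> perm T i a (perm T (nbr T i a) (perm T i a a) c) = c"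
 using face_pairingD(1,4) by (metis bij_is_surj surj_f_inv_f)

lemma face_move_nth: "face_pairing T ==> face_move T i a x $ perm T i a c = x $ c"
 by (simp add: face_move_def face_pairingD(1) bij_is_inj)

lemma face_move_nth': "face_pairing T ==>
  face_move T i a x $ c = x $ perm T (nbr T i a) (perm T i a a) c"
 by (simp add: face_move_def face_pairingD(4))

lemma face_move_eqI: "face_pairing T ==> (\<And>c. y $ perm T i a c = x $ c) ==> y = face_move T i a x"
 unfolding vec_eq_iff using face_move_nth perm_forth by metis

lemma face_move_back:
 assumes "face_pairing T"
 shows "face_move T (nbr T i a) (perm T i a a) (face_move T i a x) = x"
 unfolding vec_eq_iff using assms by (simp add: face_move_nth' face_pairingD(3) perm_back)

lemma sum_face_move:
 fixes f :: "real => real"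
 assumes "face_pairing T"
 shows "(\<Sum>c\<in>UNIV. f (face_move T i a x $ c)) = (\<Sum>c\<in>UNIV. f (x $ c))"
 by (rule sum.reindex_bij_betw[of "perm T i a" UNIV UNIV "%c. f (face_move T i a x $ c)", symmetric,
    unfolded face_move_nth[OF assms]]) (rule face_pairingD(1)[OF assms])

lemma face_move_simplex:
 assumes "face_pairing T"
 shows "face_move T i a x \<in> std_simplex \<longleftrightarrow> x \<in> std_simplex"
proof -
 have "(\<forall>c. 0 <= face_move T i a x $ c) \<longleftrightarrow> (\<forall>c. 0 <= x $ c)"
  by (metis assms face_move_nth face_move_nth')
 then show ?thesis
  unfolding std_simplex_def using sum_face_move[OF assms, of "%u. u"] by simp
qed

lemma face_move_diff: "face_move T i a x - face_move T i a y = face_move T i a (x - y)"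
 by (simp add: face_move_def vec_eq_iff)

lemma dist_face_move:
 assumes "face_pairing T"
 shows "dist (face_move T i a x) (face_move T i a y) = dist x y"
proof -
 have "norm (face_move T i a z) = norm z" for z
  unfolding norm_vec_def L2_set_def using sum_face_move[OF assms, of "%u. (norm u)\<^sup>2"] by simp
 then show ?thesis by (simp add: dist_norm face_move_diff)
qed

lemma point_gluing_iff:
 assumes "face_pairing T"
 shows "((i, x), (j, y)) \<in> point_gluing T \<longleftrightarrow>
  x \<in> std_simplex & (\<exists>a. x $ a = 0 & j = nbr T i a & y = face_move T i a x)"
 unfolding point_gluing_def using face_move_eqI[OF assms] face_move_nth[OF assms] by auto

lemma point_gluing_sym:
 assumes fp: "face_pairing T" and "(p, q) \<in> point_gluing T"
 shows "(q, p) \<in> point_gluing T"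
proof -
 obtain i x j y where pq: "p = (i, x)" "q = (j, y)" by fastforce
 with assms(2) obtain a where a: "x \<in> std_simplex" "x $ a = 0" "j = nbr T i a" "y = face_move T i a x"
  using point_gluing_iff[OF fp] by blast
 have "y \<in> std_simplex" "y $ perm T i a a = 0" "i = nbr T j (perm T i a a)"
  "x = face_move T j (perm T i a a) y"
  using a face_move_simplex[OF fp] face_move_nth[OF fp] face_pairingD(3)[OF fp] face_move_back[OF fp] by auto
 then show ?thesis unfolding pq point_gluing_iff[OF fp] by blast
qed

definition glued :: "'t gluing => 't \<times> (real^4) => 't \<times> (real^4) => bool" where
 "glued T p q \<longleftrightarrow> (p, q) \<in> (point_gluing T)\<^sup>*"

lemma sym_rtrancl_Un: "(\<And>p q. (p, q) \<in> r ==> (q, p) \<in> r) ==> r \<union> r\<inverse> = r"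
 by auto

lemma glued_class_eq_glued:
 assumes "face_pairing T"
 shows "glued_class (point_gluing T) p = glued_class (point_gluing T) q \<longleftrightarrow> glued T p q"
 unfolding glued_class_eq_iff glued_def using sym_rtrancl_Un point_gluing_sym[OF assms] by metis

lemma glued_refl: "glued T p p" by (simp add: glued_def)

lemma glued_sym: "face_pairing T ==> glued T p q ==> glued T q p"
 using glued_class_eq_glued by metis

lemma glued_trans: "glued T p q ==> glued T q r ==> glued T p r"
 unfolding glued_def by (rule rtrancl_trans)

lemma glued_step:
 assumes "face_pairing T" "x \<in> std_simplex" "x $ a = 0"
 shows "glued T (i, x) (nbr T i a, face_move T i a x)"
 unfolding glued_def using point_gluing_iff[OF assms(1)] assms(2,3) by blast

lemma glued_induct[consumes 2, case_names refl step]: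
 assumes fp: "face_pairing T" and g: "glued T p q" and refl: "P (fst p) (snd p)"
  and step: "\<And>i x a. glued T p (i, x) ==> P i x ==> x \<in> std_simplex ==> x $ a = 0 ==> P (nbr T i a) (face_move T i a x)"
 shows "P (fst q) (snd q)"
 using g unfolding glued_def
proof (induction rule: rtrancl_induct)
 case base
 show ?case by (rule refl)
next
 case (step y z)
 obtain i x j w where yz: "y = (i, x)" "z = (j, w)" by fastforce
 with step(2) obtain a where "x \<in> std_simplex" "x $ a = 0" "j = nbr T i a" "w = face_move T i a x"
  using point_gluing_iff[OF fp] by blast
 with yz step(1,3) assms(4)[of i x a] show ?case by (simp add: glued_def)
qed

lemma glued_simplex:
 assumes fp: "face_pairing T" and g: "glued T p q" and p: "p \<in> simplex_points"
 shows "q \<in> simplex_points"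
proof -
 have "snd q \<in> std_simplex"
  using fp g by (induction rule: glued_induct) (use p in \<open>auto simp: simplex_points_def face_move_simplex[OF fp]\<close>)
 then show ?thesis by (auto simp: simplex_points_def mem_Times_iff)
qed

lemma glued_values:
 assumes fp: "face_pairing T" and g: "glued T p q"
 shows "\<exists>d. snd q $ c = snd p $ d"
proof -
 have "\<forall>c. \<exists>d. snd q $ c = snd p $ d"
  using fp g by (induction rule: glued_induct) (auto simp: face_move_nth'[OF fp])
 then show ?thesis by blast
qed

definition fibre :: "'t gluing => 't \<times> (real^4) => ('t \<times> (real^4)) set" where
 "fibre T p = {q. glued T p q}"

lemma finite_fibre:
 fixes T :: "('t::finite) gluing"
 assumes fp: "face_pairing T"
 shows "finite (fibre T p)"
proof (rule finite_subset)
 let ?S = "range (%c. snd p $ c)"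
 show "fibre T p \<subseteq> UNIV \<times> (%f. \<chi> c. f c) ` (PiE UNIV (%_. ?S))"
 proof
  fix q assume "q \<in> fibre T p"
  then have "glued T p q" by (simp add: fibre_def)
  then have "(%c. snd q $ c) \<in> PiE UNIV (%_. ?S)" using glued_values[OF fp] by (auto simp: PiE_iff image_iff)
  moreover have "snd q = (\<chi> c. (%c. snd q $ c) c)" by (simp add: vec_eq_iff)
  ultimately have "snd q \<in> (%f. \<chi> c. f c) ` (PiE UNIV (%_. ?S))" by blast
  then show "q \<in> UNIV \<times> (%f. \<chi> c. f c) ` (PiE UNIV (%_. ?S))" by (simp add: mem_Times_iff)
 qed
 show "finite (UNIV \<times> (%f. \<chi> c. f c) ` (PiE UNIV (%_. ?S)) :: ('t \<times> (real^4)) set)"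
  by (intro finite_cartesian_product finite_imageI finite_PiE) auto
qed

text \<open>The class of a point is finite, so its positive coordinates and distances
have a positive minimum.\<close>

lemma glued_radius:
 fixes T :: "('t::finite) gluing"
 assumes fp: "face_pairing T"
 obtains r where "r > 0"
  "\<And>q c. glued T p q ==> 0 < snd q $ c ==> r <= snd q $ c"
  "\<And>j y y'. glued T p (j, y) ==> glued T p (j, y') ==> dist y y' < 2 * r ==> y = y'"
proof -
 define A where "A = insert 1 {v. 0 < v & (\<exists>q\<in>fibre T p. (\<exists>c. v = snd q $ c) \<or>
   (\<exists>q'\<in>fibre T p. v = dist (snd q) (snd q') / 2))}"
 have "A \<subseteq> insert 1 ((%(q, c). snd q $ c) ` (fibre T p \<times> UNIV) \<union>
   (%(q, q'). dist (snd q) (snd q') / 2) ` (fibre T p \<times> fibre T p))"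
  by (force simp: A_def image_iff)
 moreover have "finite \<dots>" using finite_fibre[OF fp] by (intro finite.insertI finite_UnI finite_imageI finite_cartesian_product) auto
 ultimately have fA: "finite A" by (rule finite_subset)
 have neA: "A ~= {}" by (simp add: A_def)
 show thesis
 proof (rule that[of "Min A"])
  show "0 < Min A" using fA neA by (auto simp: A_def)
  show "Min A <= snd q $ c" if "glued T p q" "0 < snd q $ c" for q c
  proof (rule Min_le[OF fA])
   show "snd q $ c \<in> A" unfolding A_def fibre_def using that by blast
  qed
  show "y = y'" if "glued T p (j, y)" "glued T p (j, y')" "dist y y' < 2 * Min A" for j y y'
  proof (rule ccontr)
   assume "y ~= y'"
   then have "dist y y' / 2 \<in> A" using that(1,2) unfolding A_def fibre_def
    by (intro insertI2) force
   then have "Min A <= dist y y' / 2" using fA by (rule Min_le[rotated])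
   with that(3) show False by simp
  qed
 qed
qed

text \<open>A point \<open>z\<close> close to \<open>y\<close> has its zero coordinates among those of \<open>y\<close>, hence every chain of gluings of \<open>z\<close>
can be followed from \<open>y\<close>. The face maps are isometries, so the distance is kept, and the jumps of \<open>f\<close> along both
chains add up to the same value.\<close>

lemma glued_follow:
 fixes f :: "'t \<times> (real^4) => bool"
 assumes fp: "face_pairing T"
  and r: "\<And>q c. glued T p q ==> 0 < snd q $ c ==> r <= snd q $ c"
  and y: "glued T p (j, y)" "y \<in> std_simplex" and zy: "dist z y < r" and g: "glued T (j, z) (k, z')"
  and jump: "\<And>i x a. glued T p (i, x) ==> x $ a = 0 ==> (f (i, x) ~= f (nbr T i a, face_move T i a x)) = \<kappa> i a x"
   "\<And>i x a. glued T (j, z) (i, x) ==> x $ a = 0 ==> (f (i, x) ~= f (nbr T i a, face_move T i a x)) = \<kappa> i a x"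
  and loc: "\<And>i x x' a. glued T p (i, x) ==> glued T (j, z) (i, x') ==> dist x' x = dist z y ==>
    x $ a = 0 ==> x' $ a = 0 ==> \<kappa> i a x' = \<kappa> i a x"
 shows "\<exists>y'. glued T (j, y) (k, y') & dist z' y' = dist z y & (f (j, z) = f (k, z')) = (f (j, y) = f (k, y'))"
proof -
 have "\<exists>y'. glued T (j, y) (fst (k, z'), y') & y' \<in> std_simplex & dist (snd (k, z')) y' = dist z y &
   (f (j, z) = f (fst (k, z'), snd (k, z'))) = (f (j, y) = f (fst (k, z'), y'))"
  using fp g
 proof (induction rule: glued_induct)
  case refl
  show ?case using y by (intro exI[of _ y]) (auto simp: glued_refl)
 next
  case (step i x a)
  then obtain y' where y': "glued T (j, y) (i, y')" "y' \<in> std_simplex" "dist x y' = dist z y"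
   "(f (j, z) = f (i, x)) = (f (j, y) = f (i, y'))" by auto
  have py: "glued T p (i, y')" using y(1) y'(1) by (rule glued_trans)
  have "y' $ a = 0"
  proof (rule ccontr)
   assume "y' $ a ~= 0"
   then have "0 < y' $ a" using y'(2) by (auto simp: std_simplex_def less_le)
   then have "r <= y' $ a" using r[OF py, of a] by simp
   moreover have "\<bar>y' $ a\<bar> <= dist x y'"
    using component_le_norm_cart[of "x - y'" a] step(3) by (simp add: dist_norm)
   ultimately show False using y'(3) zy by simp
  qed
  note jumps = jump(1)[OF py this] jump(2)[OF step(1) step(3)] loc[OF py step(1) y'(3) this step(3)]
  show ?case
  proof (intro exI[of _ "face_move T i a y'"] conjI)
   show "glued T (j, y) (nbr T i a, face_move T i a y')"
    using y'(1) glued_step[OF fp y'(2) \<open>y' $ a = 0\<close>] by (rule glued_trans)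
   show "face_move T i a y' \<in> std_simplex" by (simp add: face_move_simplex[OF fp] y')
   show "dist (face_move T i a x) (face_move T i a y') = dist z y" by (simp add: dist_face_move[OF fp] y')
   show "(f (j, z) = f (nbr T i a, face_move T i a x)) = (f (j, y) = f (nbr T i a, face_move T i a y'))"
    using jumps y'(4) by argo
  qed
 qed
 then show ?thesis by auto
qed

lemma openin_simplex_balls: "openin simplices {(j, z) \<in> simplex_points. \<exists>y. (j, y) \<in> F & dist z y < r}"
proof -
 have "openin (top_of_set std_simplex) {z \<in> std_simplex. \<exists>y. (j, y) \<in> F & dist z y < r}" for j
 proof -
  have "{z \<in> std_simplex. \<exists>y. (j, y) \<in> F & dist z y < r} = std_simplex \<inter> (\<Union>y\<in>{y. (j, y) \<in> F}. ball y r)"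
   by (auto simp: dist_commute)
  then show ?thesis by (metis (no_types, lifting) open_UN open_ball openin_open)
 qed
 then show ?thesis by (auto simp: openin_simplices simplex_points_def)
qed

lemma Hausdorff_simplices: "Hausdorff_space simplices"
 unfolding Hausdorff_space_def
proof (intro allI impI)
 fix p q :: "'t \<times> (real^4)"
 assume pq: "p \<in> topspace simplices & q \<in> topspace simplices & p ~= q"
 show "\<exists>U V. openin simplices U & openin simplices V & p \<in> U & q \<in> V & disjnt U V"
 proof -
  define r where "r = (if fst p = fst q then dist (snd p) (snd q) / 2 else 1)"
  have r: "r > 0" using pq by (auto simp: r_def prod_eq_iff)
  let ?B = "%p. {(j, z) \<in> simplex_points. \<exists>y. (j, y) \<in> {p} & dist z y < r}"
  have "disjnt (?B p) (?B q)"
  proof -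
   have False if "z \<in> ?B p" "z \<in> ?B q" for z
   proof -
    have "fst p = fst z" "fst q = fst z" "dist (snd z) (snd p) < r" "dist (snd z) (snd q) < r"
     using that by auto
    then show False using dist_triangle2[of "snd p" "snd q" "snd z"] by (auto simp: r_def dist_commute)
   qed
   then show ?thesis unfolding disjnt_def by blast
  qed
  moreover have "p \<in> ?B p" "q \<in> ?B q" using pq r by (auto simp: topspace_simplices split: prod.splits)
  ultimately show ?thesis using openin_simplex_balls by blast
 qed
qed

abbreviation quotient_point :: "'t gluing => 't \<times> (real^4) => ('t \<times> (real^4)) set" where
 "quotient_point T \<equiv> glued_class (point_gluing T)"

text \<open>Balls of the same small radius around the points of one class are carried to each other by the
gluing maps, so their union is a saturated neighbourhood.\<close>

lemma descent_map_pseudo_manifold: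
 fixes T :: "('t::finite) gluing"
 assumes fp: "face_pairing T"
 shows "descent_map simplices (pseudo_manifold T) (quotient_point T)"
proof -
 have qm: "quotient_map simplices (pseudo_manifold T) (quotient_point T)"
  unfolding pseudo_manifold_def by (rule quotient_map_glued_class)
 have top: "topspace (pseudo_manifold T) = quotient_point T ` simplex_points"
  by (simp add: pseudo_manifold_def topspace_quotient_topology topspace_simplices)
 have fib: "{x \<in> topspace simplices. quotient_point T x = quotient_point T p} = fibre T p" if "p \<in> simplex_points" for p
  unfolding glued_class_eq_glued[OF fp] fibre_def topspace_simplices
  using that glued_simplex[OF fp] glued_sym[OF fp] by blast
 have "\<exists>V. openin (pseudo_manifold T) V & P \<in> V & (\<forall>x\<in>topspace simplices. quotient_point T x \<in> V --> x \<in> U)"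
  if P: "P \<in> topspace (pseudo_manifold T)" and U: "openin simplices U"
   "{x \<in> topspace simplices. quotient_point T x = P} \<subseteq> U" for P U
 proof -
  obtain p where p: "p \<in> simplex_points" "P = quotient_point T p" using P top by auto
  have FU: "fibre T p \<subseteq> U" using U(2) fib[OF p(1)] p(2) by simp
  obtain r where r: "r > 0" "\<And>q c. glued T p q ==> 0 < snd q $ c ==> r <= snd q $ c"
   using glued_radius[OF fp, of p] by metis
  have "\<exists>e>0. \<forall>z\<in>std_simplex. dist z (snd q) < e --> (fst q, z) \<in> U" if "q \<in> fibre T p" for q
  proof -
   have "openin (top_of_set std_simplex) {x. (fst q, x) \<in> U}" using U(1) by (simp add: openin_simplices)
   moreover have "snd q \<in> {x. (fst q, x) \<in> U}" using FU that by auto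
   ultimately show ?thesis unfolding openin_euclidean_subtopology_iff by blast
  qed
  then obtain e where e: "\<And>q. q \<in> fibre T p ==> e q > 0 & (\<forall>z\<in>std_simplex. dist z (snd q) < e q --> (fst q, z) \<in> U)"
   by metis
  define \<rho> where "\<rho> = Min (insert r (e ` fibre T p))"
  have \<rho>: "\<rho> > 0" "\<rho> <= r" "\<And>q. q \<in> fibre T p ==> \<rho> <= e q"
   unfolding \<rho>_def using finite_fibre[OF fp, of p] r(1) e by auto
  define B where "B = {(j, z) \<in> simplex_points. \<exists>y. (j, y) \<in> fibre T p & dist z y < \<rho>}"
  have oB: "openin simplices B" unfolding B_def by (rule openin_simplex_balls)
  have BU: "B \<subseteq> U" unfolding B_def using e \<rho>(3) by (fastforce simp: simplex_points_def)
  have sat: "q \<in> B" if q: "q' \<in> B" "glued T q' q" for q q'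
  proof -
   obtain j z k w where qs: "q' = (j, z)" "q = (k, w)" by fastforce
   obtain y where y: "glued T p (j, y)" "dist z y < \<rho>" "(j, z) \<in> simplex_points"
    using q(1) unfolding qs B_def fibre_def by auto
   have yD: "y \<in> std_simplex" using glued_simplex[OF fp y(1) p(1)] by (simp add: simplex_points_def)
   have "\<exists>y'. glued T (j, y) (k, y') & dist w y' = dist z y & (True = True) = (True = True)"
    by (rule glued_follow[OF fp r(2) y(1) yD, where f = "%_. True" and \<kappa> = "%_ _ _. False"])
     (use q(2) y(2) \<rho>(2) in \<open>auto simp: qs\<close>)
   then obtain y' where "glued T (j, y) (k, y')" "dist w y' = dist z y" by blast
   moreover have "(k, w) \<in> simplex_points" using glued_simplex[OF fp q(2)] y(3) by (simp add: qs)
   moreover have "glued T p (k, y')" by (rule glued_trans[OF y(1) \<open>glued T (j, y) (k, y')\<close>])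
   ultimately show ?thesis using y(2) unfolding B_def qs fibre_def by auto
  qed
  have pre: "{x \<in> topspace simplices. quotient_point T x \<in> quotient_point T ` B} = B"
  using sat glued_sym fp glued_class_eq_glued topspace_simplices unfolding B_def by blast
  have "openin (pseudo_manifold T) (quotient_point T ` B)"
   unfolding pseudo_manifold_def openin_quotient_topology
   using pre oB openin_subset[OF oB] by (simp add: image_mono)
  moreover have "p \<in> B" unfolding B_def using p(1) \<rho>(1) glued_refl[of T p]
   by (cases p) (auto simp: fibre_def intro!: exI[of _ "snd p"])
  then have "P \<in> quotient_point T ` B" using p(2) by blast
  ultimately show ?thesis using pre BU by blast
 qed
 moreover have "finite {x \<in> topspace simplices. quotient_point T x = P}" if "P \<in> topspace (pseudo_manifold T)" for P
  using that top fib finite_fibre[OF fp] by auto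
 ultimately show ?thesis
  unfolding descent_map_def
  using Hausdorff_simplices quotient_imp_continuous_map[OF qm] quotient_imp_surjective_map[OF qm] by blast
qed

definition saturated :: "'t gluing => ('t \<times> (real^4)) set => bool" where
 "saturated T S \<longleftrightarrow> S \<subseteq> simplex_points & (\<forall>i x a. (i, x) \<in> S --> x $ a = 0 --> (nbr T i a, face_move T i a x) \<in> S)"

lemma saturated_glued:
 assumes fp: "face_pairing T" and S: "saturated T S" and g: "glued T p q" and p: "p \<in> S"
 shows "q \<in> S"
proof -
 have "(fst q, snd q) \<in> S"
  using fp g by (induction rule: glued_induct) (use S p in \<open>auto simp: saturated_def\<close>)
 then show ?thesis by simp
qed

text \<open>The function changes by \<open>\<kappa> i a x\<close> when the point \<open>x\<close> of face \<open>a\<close> is carried across the face.\<close>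

definition has_jumps :: "'t gluing => ('t \<times> (real^4)) set => ('t \<times> (real^4) => bool) => ('t => 4 => real^4 => bool) => bool" where
 "has_jumps T S f \<kappa> \<longleftrightarrow> (\<forall>i x a. (i, x) \<in> S --> x $ a = 0 -->
   (f (i, x) ~= f (nbr T i a, face_move T i a x)) = \<kappa> i a x)"

text \<open>If the prescribed jumps are locally constant, the values along a chain of gluings starting near \<open>y\<close>
change as along the chain starting at \<open>y\<close>.\<close>

lemma descent_function_of_jumps:
 fixes T :: "('t::finite) gluing"
 assumes fp: "face_pairing T" and S: "saturated T S" and f: "has_jumps T S f \<kappa>"
  and loc: "\<And>i x. (i, x) \<in> S ==> \<exists>e>0. \<forall>z a. (i, z) \<in> S --> dist z x < e --> z $ a = 0 --> x $ a = 0 --> \<kappa> i a z = \<kappa> i a x"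
  and \<pi>: "\<And>p q. p \<in> S ==> q \<in> S ==> \<pi> p = \<pi> q \<longleftrightarrow> glued T p q"
 shows "descent_function (subtopology simplices S) \<pi> f"
 unfolding descent_function_def
proof (intro ballI impI)
 let ?X = "subtopology simplices S"
 have SD: "S \<subseteq> simplex_points" using S by (simp add: saturated_def)
 have tX: "topspace ?X = S" using SD by (auto simp: topspace_simplices)
 fix p p' assume p: "p \<in> topspace ?X" "p' \<in> topspace ?X" and eq: "\<pi> p = \<pi> p'"
 have pS: "p \<in> S" "p' \<in> S" using p tX by auto
 have pp': "glued T p p'" using eq \<pi> pS by simp
 obtain r where r: "r > 0" "\<And>q c. glued T p q ==> 0 < snd q $ c ==> r <= snd q $ c"
  "\<And>j y y'. glued T p (j, y) ==> glued T p (j, y') ==> dist y y' < 2 * r ==> y = y'"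
  using glued_radius[OF fp, of p] by metis
 define L where "L q e \<longleftrightarrow> (\<forall>z a. (fst q, z) \<in> S --> dist z (snd q) < e --> z $ a = 0 --> snd q $ a = 0 --> \<kappa> (fst q) a z = \<kappa> (fst q) a (snd q))"
  for q and e :: real
 have fS: "q \<in> S" if "q \<in> fibre T p" for q
  using saturated_glued[OF fp S _ pS(1)] that by (simp add: fibre_def)
 have "\<exists>e>0. L q e" if "q \<in> fibre T p" for q
  using loc[of "fst q" "snd q"] fS[OF that] unfolding L_def by simp
 then obtain e where e: "\<And>q. q \<in> fibre T p ==> e q > 0 & L q (e q)" by metis
 define \<rho> where "\<rho> = Min (insert r (e ` fibre T p))"
 have \<rho>: "\<rho> > 0" "\<rho> <= r" "\<And>q. q \<in> fibre T p ==> \<rho> <= e q"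
  unfolding \<rho>_def using finite_fibre[OF fp, of p] r(1) e by auto
 define B where "B q = S \<inter> {(j, z) \<in> simplex_points. \<exists>y. (j, y) \<in> {q} & dist z y < \<rho>}" for q
 have oB: "openin ?X (B q)" for q
  unfolding B_def openin_subtopology using openin_simplex_balls by blast
 have inB: "q \<in> B q" if "q \<in> S" for q unfolding B_def using that SD \<rho>(1) by (cases q) auto
 have "(f q = f q') = (f p = f p')" if q: "q \<in> B p" "q' \<in> B p'" "\<pi> q = \<pi> q'" for q q'
 proof -
  obtain j z k z' where qs: "q = (j, z)" "q' = (k, z')" by fastforce
  obtain y y' where ys: "p = (j, y)" "p' = (k, y')" and d: "dist z y < \<rho>" "dist z' y' < \<rho>"
   using q unfolding B_def qs by auto
  have qS: "q \<in> S" "q' \<in> S" using q unfolding B_def by auto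
  have g: "glued T (j, z) (k, z')" using \<pi>[OF qS] q(3) qs by simp
  have "y \<in> std_simplex" using pS SD ys by (auto simp: simplex_points_def)
  have S1: "(i, x) \<in> S" if "glued T p (i, x)" for i x using saturated_glued[OF fp S that pS(1)] .
  have S2: "(i, x) \<in> S" if "glued T (j, z) (i, x)" for i x using saturated_glued[OF fp S that] qS(1) qs by simp
  have "\<exists>y''. glued T (j, y) (k, y'') & dist z' y'' = dist z y & (f (j, z) = f (k, z')) = (f (j, y) = f (k, y''))"
  proof (rule glued_follow[OF fp r(2) _ \<open>y \<in> std_simplex\<close> _ g])
   show "glued T p (j, y)" by (simp add: ys glued_refl)
   show "dist z y < r" using d \<rho>(2) by simp
   show "(f (i, x) ~= f (nbr T i a, face_move T i a x)) = \<kappa> i a x" if "glued T p (i, x)" "x $ a = 0" for i x a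
    using f S1[OF that(1)] that(2) unfolding has_jumps_def by blast
   show "(f (i, x) ~= f (nbr T i a, face_move T i a x)) = \<kappa> i a x" if "glued T (j, z) (i, x)" "x $ a = 0" for i x a
    using f S2[OF that(1)] that(2) unfolding has_jumps_def by blast
   show "\<kappa> i a x' = \<kappa> i a x" if "glued T p (i, x)" "glued T (j, z) (i, x')" "dist x' x = dist z y" "x $ a = 0" "x' $ a = 0" for i x x' a
   proof -
    have "(i, x) \<in> fibre T p" using that by (simp add: fibre_def)
    then have "L (i, x) (e (i, x))" "dist x' x < e (i, x)" using e \<rho>(3)[of "(i, x)"] d that(3) by auto
    then show ?thesis using S2[OF that(2)] that(4,5) unfolding L_def by simp
   qed
  qed auto
  then obtain y'' where y'': "glued T (j, y) (k, y'')" "dist z' y'' = dist z y"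
   "(f (j, z) = f (k, z')) = (f (j, y) = f (k, y''))" by blast
  have "y'' = y'"
  proof (rule r(3))
   show "glued T p (k, y'')" "glued T p (k, y')" using y''(1) pp' ys by auto
   show "dist y'' y' < 2 * r" using dist_triangle2[of y'' y' z'] y''(2) d \<rho>(2) by (simp add: dist_commute)
  qed
  then show ?thesis using y''(3) qs ys by simp
 qed
 then have "\<forall>y\<in>B p. \<forall>y'\<in>B p'. \<pi> y = \<pi> y' --> (f y = f y') = (f p = f p')" by blast
 then show "\<exists>U U'. openin ?X U & p \<in> U & openin ?X U' & p' \<in> U' &
    (\<forall>y\<in>U. \<forall>y'\<in>U'. \<pi> y = \<pi> y' --> (f y = f y') = (f p = f p'))"
  using oB inB pS by (intro exI[of _ "B p"] exI[of _ "B p'"] conjI) auto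
qed

text \<open>A point interior to a face is glued to one other point only, so one of the two values is chosen freely and \<open>sym\<close> makes the other one
consistent. Chains branch only at points on two faces, where \<open>f0\<close> provides the values.\<close>

lemma function_with_jumps_exists:
 assumes fp: "face_pairing T" and S: "saturated T S"
  and sym: "\<And>i x a. (i, x) \<in> S ==> x $ a = 0 ==> \<kappa> (nbr T i a) (perm T i a a) (face_move T i a x) = \<kappa> i a x"
  and f0: "\<And>i x a b. (i, x) \<in> S ==> a ~= b ==> x $ a = 0 ==> x $ b = 0 ==>
    (f0 (i, x) ~= f0 (nbr T i a, face_move T i a x)) = \<kappa> i a x"
 obtains f where "has_jumps T S f \<kappa>"
  "\<And>i x a b. a ~= b ==> x $ a = 0 ==> x $ b = 0 ==> f (i, x) = f0 (i, x)"
proof -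
 define f where "f p = (if \<exists>a b. a ~= b & snd p $ a = 0 & snd p $ b = 0 then f0 p
   else if \<exists>a. snd p $ a = 0 then (SOME q. glued T p q) ~= p & \<kappa> (fst p) (THE a. snd p $ a = 0) (snd p) else False)" for p
 have "(f (i, x) ~= f (nbr T i a, face_move T i a x)) = \<kappa> i a x" if ix: "(i, x) \<in> S" "x $ a = 0" for i x a
 proof (cases "\<exists>b. b ~= a & x $ b = 0")
  case True
  then obtain b where b: "b ~= a" "x $ b = 0" by blast
  let ?y = "face_move T i a x" and ?\<sigma> = "perm T i a"
  have "?\<sigma> a ~= ?\<sigma> b & ?y $ ?\<sigma> a = 0 & ?y $ ?\<sigma> b = 0"
   using b ix by (simp add: face_move_nth[OF fp] perm_inj[OF fp])
  then have "f (nbr T i a, ?y) = f0 (nbr T i a, ?y)" unfolding f_def snd_conv by meson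
  moreover have "f (i, x) = f0 (i, x)" unfolding f_def snd_conv using b ix(2) by meson
  ultimately show ?thesis using f0[OF ix(1) _ ix(2) b(2)] b(1) by metis
 next
  case False
  let ?y = "face_move T i a x" and ?\<sigma> = "perm T i a" and ?j = "nbr T i a"
  have xz: "x $ b = 0 \<longleftrightarrow> b = a" for b using False ix(2) by blast
  have yz: "?y $ b = 0 \<longleftrightarrow> b = ?\<sigma> a" for b
   by (metis face_move_nth[OF fp] face_move_nth'[OF fp] perm_back[OF fp] perm_forth[OF fp] xz)
  have xD: "x \<in> std_simplex" using S ix by (auto simp: saturated_def simplex_points_def)
  have step: "(i, x) = q \<or> (?j, ?y) = q" if "glued T (i, x) q" for q
  proof -
   have "(i, x) = (fst q, snd q) \<or> (?j, ?y) = (fst q, snd q)"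
    using fp that
   proof (induction rule: glued_induct)
    case (step k z b)
    then show ?case
    proof (elim disjE)
     assume "(i, x) = (k, z)"
     then show ?thesis using step(3) xz by auto
    next
     assume *: "(?j, ?y) = (k, z)"
     then have "b = ?\<sigma> a" "k = ?j" "z = ?y" using step(3) yz by auto
     then show ?thesis using face_move_back[OF fp, of i a x] face_pairingD(3)[OF fp, of i a] by simp
    qed
   qed auto
   then show ?thesis by simp
  qed
  have ne: "(i, x) ~= (?j, ?y)"
  proof
   assume *: "(i, x) = (?j, ?y)"
   then have "?\<sigma> a = a" using xz yz by (metis prod.inject)
   then show False using * face_pairingD(2)[OF fp, of i a] by auto
  qed
  have gxy: "glued T (i, x) (?j, ?y)" by (rule glued_step[OF fp xD ix(2)])
  have same: "glued T (i, x) q = glued T (?j, ?y) q" for q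
   using gxy glued_sym[OF fp] glued_trans by metis
  have "glued T (i, x) (SOME q. glued T (i, x) q)" using glued_refl by (rule someI)
  then have some: "(SOME q. glued T (i, x) q) = (i, x) \<or> (SOME q. glued T (i, x) q) = (?j, ?y)"
   using step by metis
  have "f (i, x) = ((SOME q. glued T (i, x) q) ~= (i, x) & \<kappa> i a x)"
   unfolding f_def using xz by auto
  moreover have "f (?j, ?y) = ((SOME q. glued T (i, x) q) ~= (?j, ?y) & \<kappa> ?j (?\<sigma> a) ?y)"
   unfolding f_def using yz same by auto
  ultimately show ?thesis using some ne sym[OF ix] by metis
 qed
 then have "has_jumps T S f \<kappa>" unfolding has_jumps_def by blast
 moreover have "f (i, x) = f0 (i, x)" if "a ~= b" "x $ a = 0" "x $ b = 0" for i x a b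
  unfolding f_def snd_conv using that by meson
 ultimately show thesis by (rule that)
qed

section \<open>Collars of the ideal vertices\<close>

text \<open>Its classes group the corners of the tetrahedra by the ideal vertex at which they lie.\<close>

definition corner_gluing :: "'t gluing => (('t \<times> 4) \<times> ('t \<times> 4)) set" where
 "corner_gluing T = {((i, p), (nbr T i a, perm T i a p)) | i p a. a ~= p}"

lemma corner_gluing_sym:
 assumes fp: "face_pairing T" and "(v, w) \<in> corner_gluing T"
 shows "(w, v) \<in> corner_gluing T"
proof -
 obtain i p a where v: "v = (i, p)" "w = (nbr T i a, perm T i a p)" "a ~= p"
  using assms(2) unfolding corner_gluing_def by blast
 have "v = (nbr T (nbr T i a) (perm T i a a), perm T (nbr T i a) (perm T i a a) (perm T i a p))"
  "perm T i a a ~= perm T i a p"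
  using v(1,3) by (simp_all add: face_pairingD(3)[OF fp] perm_back[OF fp] perm_inj[OF fp])
 then show ?thesis unfolding v(2) corner_gluing_def by blast
qed

definition corner_class :: "'t gluing => ('t \<times> 4) set => bool" where
 "corner_class T V \<longleftrightarrow> (\<exists>v. V = glued_class (corner_gluing T) v)"

lemma corner_class_nonempty: "corner_class T V ==> V ~= {}"
 unfolding corner_class_def using glued_class_refl by fastforce

lemma corner_class_step:
 assumes "corner_class T V" "(i, p) \<in> V" "a ~= p"
 shows "(nbr T i a, perm T i a p) \<in> V"
proof -
 have "((i, p), (nbr T i a, perm T i a p)) \<in> corner_gluing T"
  unfolding corner_gluing_def using assms(3) by blast
 with assms(1,2) show ?thesis unfolding corner_class_def glued_class_def
  by (auto intro: rtrancl_into_rtrancl)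
qed

lemma corner_class_induct:
 assumes fp: "face_pairing T" and V: "corner_class T V" and v: "v \<in> V" and w: "w \<in> V" and P: "P v"
  and step: "\<And>i p a. (i, p) \<in> V ==> P (i, p) ==> a ~= p ==> P (nbr T i a, perm T i a p)"
 shows "P w"
proof -
 obtain u where u: "V = glued_class (corner_gluing T) u" using V unfolding corner_class_def by blast
 have "glued_class (corner_gluing T) u = glued_class (corner_gluing T) v"
  "glued_class (corner_gluing T) u = glued_class (corner_gluing T) w"
  using v w unfolding glued_class_eq_iff unfolding u glued_class_def by auto
 then have "(v, w) \<in> (corner_gluing T \<union> (corner_gluing T)\<inverse>)\<^sup>*" using glued_class_eq_iff by metis
 then have "(v, w) \<in> (corner_gluing T)\<^sup>*" using sym_rtrancl_Un[of "corner_gluing T"] corner_gluing_sym[OF fp] by metis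
 then have "w \<in> V & P w"
 proof (induction rule: rtrancl_induct)
  case (step y z)
  then obtain i p a where "y = (i, p)" "z = (nbr T i a, perm T i a p)" "a ~= p"
   unfolding corner_gluing_def by blast
  then show ?case using step assms(6)[of i p a] corner_class_step[OF V] by blast
 qed (use v P in blast)
 then show ?thesis by blast
qed

lemma simplex_pair_le_1:
 assumes "x \<in> std_simplex" "p ~= q"
 shows "x $ p + x $ q <= 1"
proof -
 have "x $ p + x $ q = (\<Sum>c\<in>{p, q}. x $ c)" using assms(2) by simp
 also have "\<dots> <= (\<Sum>c\<in>UNIV. x $ c)" using assms(1) by (intro sum_mono2) (auto simp: std_simplex_def)
 finally show ?thesis using assms(1) by (simp add: std_simplex_def)
qed

text \<open>In a point of a corner with \<open>eps <= 1/2\<close> the large coordinate tells which corner it is.\<close>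

definition big_corner :: "real^4 => 4" where "big_corner x = (THE p. 1/2 < x $ p)"

lemma big_corner_eq: "x \<in> std_simplex ==> 1/2 < x $ p ==> big_corner x = p"
 unfolding big_corner_def
using simplex_pair_le_1 by fastforce

text \<open>The vertex itself is excluded, so this is a corner of the tetrahedron with the tip removed.\<close>

definition corner_cone :: "real => 4 => (real^4) set" where
 "corner_cone eps p = {x \<in> std_simplex. 1 - eps < x $ p & x $ p < 1}"

definition corner_points :: "('t \<times> 4) set => real => ('t \<times> (real^4)) set" where
 "corner_points V eps = {(i, x). \<exists>p. (i, p) \<in> V & x \<in> corner_cone eps p}"

lemma convex_std_simplex: "convex std_simplex"
proof (rule convexI)
 fix x y :: "real^4" and u v :: real
 assume *: "x \<in> std_simplex" "y \<in> std_simplex" "0 <= u" "0 <= v" "u + v = 1"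
 then have "(\<Sum>c\<in>UNIV. (u *\<^sub>R x + v *\<^sub>R y) $ c) = u * (\<Sum>c\<in>UNIV. x $ c) + v * (\<Sum>c\<in>UNIV. y $ c)"
  by (simp add: sum.distrib sum_distrib_left)
 also have "\<dots> = 1" using * by (simp add: std_simplex_def)
 finally show "u *\<^sub>R x + v *\<^sub>R y \<in> std_simplex" using * by (simp add: std_simplex_def)
qed

lemma convex_corner_cone: "convex (corner_cone eps p)"
proof -
 have "corner_cone eps p = std_simplex \<inter> {x. axis p 1 \<bullet> x > 1 - eps} \<inter> {x. axis p 1 \<bullet> x < 1}"
  by (auto simp: corner_cone_def inner_axis')
 then show ?thesis by (auto intro!: convex_Int convex_std_simplex convex_halfspace_lt convex_halfspace_gt)
qed

lemma convex_corner_face: "convex {x \<in> corner_cone eps p. x $ a = 0}"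
proof -
 have "{x \<in> corner_cone eps p. x $ a = 0} = corner_cone eps p \<inter> {x. axis a 1 \<bullet> x = 0}"
  by (auto simp: inner_axis')
 then show ?thesis by (auto intro!: convex_Int convex_corner_cone convex_hyperplane)
qed

lemma corner_points_move:
 assumes fp: "face_pairing T" and V: "corner_class T V" and p: "(i, p) \<in> V" "x \<in> corner_cone eps p" and a: "a ~= p"
 shows "(nbr T i a, perm T i a p) \<in> V" "face_move T i a x \<in> corner_cone eps (perm T i a p)"
 using corner_class_step[OF V p(1) a] p(2) unfolding corner_cone_def
 by (auto simp: face_move_nth[OF fp] face_move_simplex[OF fp])

lemma saturated_corner_points:
 assumes fp: "face_pairing T" and V: "corner_class T V" and eps: "eps <= 1/2"
 shows "saturated T (corner_points V eps)"
 unfolding saturated_def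
proof (intro conjI allI impI)
 show "corner_points V eps \<subseteq> simplex_points" by (auto simp: corner_points_def corner_cone_def simplex_points_def)
 fix i x a assume "(i, x) \<in> corner_points V eps" "x $ a = 0"
 then obtain p where p: "(i, p) \<in> V" "x \<in> corner_cone eps p" by (auto simp: corner_points_def)
 then have "a ~= p" using \<open>x $ a = 0\<close> eps by (auto simp: corner_cone_def)
 from corner_points_move[OF fp V p this] show "(nbr T i a, face_move T i a x) \<in> corner_points V eps"
  unfolding corner_points_def by blast
qed

lemma big_corner_cone: "x \<in> corner_cone eps p ==> eps <= 1/2 ==> big_corner x = p"
 by (rule big_corner_eq) (auto simp: corner_cone_def)

definition edge_point :: "real => 4 => 4 => real^4" where
 "edge_point eps p c = (\<chi> d. if d = p then 1 - eps/2 else if d = c then eps/2 else 0)"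

lemma edge_point_cone:
 assumes "0 < eps" "eps <= 1/2" "c ~= p"
 shows "edge_point eps p c \<in> corner_cone eps p"
proof -
 have "(\<Sum>d\<in>UNIV. edge_point eps p c $ d) = (\<Sum>d\<in>{p, c}. edge_point eps p c $ d)"
  by (rule sum.mono_neutral_right) (auto simp: edge_point_def)
 then show ?thesis using assms by (auto simp: corner_cone_def std_simplex_def edge_point_def)
qed

lemma face_move_edge_point:
 assumes fp: "face_pairing T"
 shows "face_move T i a (edge_point eps p c) = edge_point eps (perm T i a p) (perm T i a c)"
 by (rule face_move_eqI[OF fp, symmetric]) (auto simp: edge_point_def perm_inj[OF fp])

lemma homeomorphic_simplex_slice:
 fixes i :: 't
 assumes "S \<subseteq> std_simplex"
 shows "top_of_set S homeomorphic_space subtopology simplices ({i} \<times> S)"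
proof -
 have "continuous_map simplices (top_of_set std_simplex) (snd :: 't \<times> (real^4) => real^4)"
  unfolding continuous_map_def
 proof (intro conjI allI impI)
  fix U assume U: "openin (top_of_set std_simplex) U"
  have slice: "{x. (i, x) \<in> {x \<in> simplex_points. snd x \<in> U}} = U" for i :: 't
   using openin_subset[OF U] by (auto simp: simplex_points_def)
  show "openin simplices {x :: 't \<times> (real^4) \<in> topspace simplices. snd x \<in> U}"
   unfolding openin_simplices topspace_simplices
  using slice U by auto
 qed (auto simp: topspace_simplices simplex_points_def)
 from continuous_map_into_fulltopology[OF this]
 have 1: "continuous_map (subtopology simplices ({i} \<times> S)) (top_of_set S) snd"
  by (intro continuous_map_into_subtopology continuous_map_from_subtopology) auto
 have "continuous_map (top_of_set std_simplex) simplices (%x. (i, x))"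
  unfolding simplices_def using continuous_map_component_injection[of i UNIV "%i. top_of_set std_simplex"] by simp
 from continuous_map_from_subtopology[OF this, of S]
 have "continuous_map (top_of_set S) simplices (%x. (i, x))"
  using assms by (simp add: subtopology_subtopology Int_absorb1)
 then have 2: "continuous_map (top_of_set S) (subtopology simplices ({i} \<times> S)) (%x. (i, x))"
  by (auto simp: continuous_map_in_subtopology)
 show ?thesis unfolding homeomorphic_space_def homeomorphic_maps_def
  by (intro exI[of _ "%x. (i, x)"] exI[of _ snd]) (use 1 2 in auto)
qed

lemma continuous_map_simplex_slice:
 assumes "S \<subseteq> std_simplex" "\<And>x. x \<in> S ==> (i, g x) \<in> U" "U \<subseteq> simplex_points" "continuous_on S g"
 shows "continuous_map (top_of_set S) (subtopology simplices U) (%x. (i, g x))"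
proof -
 have "continuous_map (top_of_set std_simplex) simplices (%x. (i, x))"
  unfolding simplices_def using continuous_map_component_injection[of i UNIV "%i. top_of_set std_simplex"] by simp
 moreover have "continuous_map (top_of_set S) (top_of_set std_simplex) g"
  using assms by (fastforce simp: simplex_points_def)
 ultimately have "continuous_map (top_of_set S) simplices (%x. (i, g x))"
  using continuous_map_compose[of "top_of_set S" "top_of_set std_simplex" g simplices "%x. (i, x)"] by (simp add: o_def)
 then show ?thesis using assms(2) by (auto simp: continuous_map_in_subtopology)
qed

lemma continuous_on_face_move: "continuous_on S (face_move T i a)"
 unfolding face_move_def by (intro continuous_intros)

lemma openin_slice:
 assumes "openin (top_of_set std_simplex) S"
 shows "openin simplices ({i} \<times> S)"
proof -
 have "{x. (j, x) \<in> {i} \<times> S} = (if j = i then S else {})" for j by auto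
 then show ?thesis using assms openin_subset[OF assms] by (auto simp: openin_simplices simplex_points_def)
qed

lemma openin_corner_cone: "openin (top_of_set std_simplex) (corner_cone eps p)"
proof -
 have "corner_cone eps p = std_simplex \<inter> ({x. 1 - eps < x $ p} \<inter> {x. x $ p < 1})"
  by (auto simp: corner_cone_def)
 moreover have "open ({x::real^4. 1 - eps < x $ p} \<inter> {x. x $ p < 1})"
  by (intro open_Int open_Collect_less continuous_intros)
 ultimately show ?thesis by (metis openin_open)
qed

lemma corner_points_eq: "corner_points V eps = (\<Union>v\<in>V. {fst v} \<times> corner_cone eps (snd v))"
 by (auto simp: corner_points_def)

lemma openin_corner_points: "openin simplices (corner_points V eps)"
 unfolding corner_points_eq by (intro openin_Union) (auto intro!: openin_slice openin_corner_cone)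

lemma topspace_corner: "topspace (subtopology simplices (corner_points V eps)) = corner_points V eps"
 using openin_subset[OF openin_corner_points, of V eps] by auto

lemma subtopology_corner_piece:
 assumes "v \<in> V"
 shows "subtopology (subtopology simplices (corner_points V eps)) ({fst v} \<times> corner_cone eps (snd v)) =
  subtopology simplices ({fst v} \<times> corner_cone eps (snd v))"
proof -
 have "{fst v} \<times> corner_cone eps (snd v) \<subseteq> corner_points V eps" using assms unfolding corner_points_eq by blast
 then show ?thesis by (simp add: subtopology_subtopology Int_absorb1)
qed

lemma homeomorphic_corner_piece:
 "top_of_set (corner_cone eps p) homeomorphic_space subtopology simplices ({i} \<times> corner_cone eps p)"
 by (rule homeomorphic_simplex_slice) (auto simp: corner_cone_def)

lemma H1_trivial_corner_points:
 assumes eps: "eps <= 1/2"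
 shows "H1_trivial (subtopology simplices (corner_points V eps))"
proof (rule H1_trivial_disjoint_open_cover[where I = V and A = "%v. {fst v} \<times> corner_cone eps (snd v)"])
 fix v assume v: "v \<in> V"
 show "openin (subtopology simplices (corner_points V eps)) ({fst v} \<times> corner_cone eps (snd v))"
  unfolding openin_open_subtopology[OF openin_corner_points]
  using v by (auto intro!: openin_slice openin_corner_cone simp: corner_points_eq)
 show "H1_trivial (subtopology (subtopology simplices (corner_points V eps)) ({fst v} \<times> corner_cone eps (snd v)))"
  unfolding subtopology_corner_piece[OF v]
  by (rule H1_trivial_homeomorphic[OF homeomorphic_corner_piece H1_trivial_convex[OF convex_corner_cone]])
next
 show "topspace (subtopology simplices (corner_points V eps)) = (\<Union>v\<in>V. {fst v} \<times> corner_cone eps (snd v))"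
  using topspace_corner[of V eps] corner_points_eq[of V eps] by simp
 show "disjoint_family_on (%v. {fst v} \<times> corner_cone eps (snd v)) V"
  unfolding disjoint_family_on_def
 proof (intro ballI impI equals0I)
  fix v w q assume "v ~= w" and q: "q \<in> {fst v} \<times> corner_cone eps (snd v) \<inter> {fst w} \<times> corner_cone eps (snd w)"
  then have "fst v = fst w" "snd q \<in> corner_cone eps (snd v)" "snd q \<in> corner_cone eps (snd w)" by auto
  with \<open>v ~= w\<close> show False using big_corner_cone[OF _ eps] by (metis prod_eq_iff)
 qed
qed

lemma corner_locally_constant:
 assumes P: "locally_constant_on (subtopology simplices (corner_points V eps)) P"
  and p: "(i, p) \<in> V" "x \<in> corner_cone eps p" "y \<in> corner_cone eps p"
 shows "P (i, x) = P (i, y)"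
proof -
 have "connected_space (subtopology simplices ({i} \<times> corner_cone eps p))"
  using homeomorphic_connected_space[OF homeomorphic_corner_piece[of eps p i]]
   convex_connected[OF convex_corner_cone, of eps p] by (simp add: connected_space_subtopology)
 moreover have "locally_constant_on (subtopology simplices ({i} \<times> corner_cone eps p)) P"
  unfolding locally_constant_on_def
 proof
  fix q assume "q \<in> topspace (subtopology simplices ({i} \<times> corner_cone eps p))"
  then have q: "q \<in> {i} \<times> corner_cone eps p" by simp
  then have "q \<in> topspace (subtopology simplices (corner_points V eps))"
   unfolding topspace_corner using p(1) by (auto simp: corner_points_def)
  then obtain U where U: "openin (subtopology simplices (corner_points V eps)) U" "q \<in> U" "\<forall>y\<in>U. P y = P q"
   using P unfolding locally_constant_on_def by blast
  have "openin (subtopology (subtopology simplices (corner_points V eps)) ({i} \<times> corner_cone eps p)) (U \<inter> ({i} \<times> corner_cone eps p))"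
   using U(1) openin_subtopology by blast
  then have "openin (subtopology simplices ({i} \<times> corner_cone eps p)) (U \<inter> ({i} \<times> corner_cone eps p))"
   using subtopology_corner_piece[OF p(1), of eps] by simp
  with U q show "\<exists>U. openin (subtopology simplices ({i} \<times> corner_cone eps p)) U & q \<in> U & (\<forall>y\<in>U. P y = P q)" by blast
 qed
 moreover have "(i, x) \<in> topspace (subtopology simplices ({i} \<times> corner_cone eps p))"
  "(i, y) \<in> topspace (subtopology simplices ({i} \<times> corner_cone eps p))"
  using p by (auto simp: topspace_simplices simplex_points_def corner_cone_def)
 ultimately show ?thesis by (rule connected_locally_constant)
qed

text \<open>The collar as it appears in an arbitrary space \<open>Y\<close>, which need not be the glued complex.\<close>

definition corner_chart :: "'t gluing => ('t \<times> 4) set => real => 'b topology => ('t \<times> (real^4) => 'b) => bool" where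
 "corner_chart T V eps Y \<pi> \<longleftrightarrow> descent_map (subtopology simplices (corner_points V eps)) Y \<pi> &
   (\<forall>p\<in>corner_points V eps. \<forall>q\<in>corner_points V eps. \<pi> p = \<pi> q \<longleftrightarrow> glued T p q)"

text \<open>Jumps across the sides of the corners which cancel around each edge: a function \<open>g\<close> on the
edges of the link at each corner integrates them.\<close>

definition corner_cocycle :: "'t gluing => ('t \<times> 4) set => ('t => 4 => 4 => bool) => bool" where
 "corner_cocycle T V \<kappa> \<longleftrightarrow> (\<exists>g :: 't => 4 => 4 => bool. \<forall>i p a c. (i, p) \<in> V --> a ~= p --> c ~= p --> c ~= a -->
   \<kappa> i p a = (g i p c ~= g (nbr T i a) (perm T i a p) (perm T i a c)))"

definition corner_coboundary :: "'t gluing => ('t \<times> 4) set => ('t => 4 => 4 => bool) => bool" where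
 "corner_coboundary T V \<kappa> \<longleftrightarrow> (\<exists>\<psi> :: 't => 4 => bool. \<forall>i p a. (i, p) \<in> V --> a ~= p -->
   \<kappa> i p a = (\<psi> i p ~= \<psi> (nbr T i a) (perm T i a p)))"

text \<open>After pulling back to the corners, which are convex, the system becomes a function whose jump across each side is
a constant prescribed by \<open>\<kappa>\<close>.\<close>

definition realises :: "'t gluing => ('t \<times> 4) set => real => ('t \<times> (real^4) => 'b) =>
  ('t => 4 => 4 => bool) => ('b => 'b => bool) => bool" where
 "realises T V eps \<pi> \<kappa> s \<longleftrightarrow> (\<exists>f. trivialises (subtopology simplices (corner_points V eps)) (pullback_system \<pi> s) f &
   has_jumps T (corner_points V eps) f (%i a x. \<kappa> i (big_corner x) a))"

lemma exists_third: "\<exists>c :: 4. c ~= p & c ~= a"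
proof -
 have "card {p, a} < card (UNIV :: 4 set)" by (cases "p = a") auto
 then have "{p, a} ~= UNIV" by auto
 then show ?thesis by auto
qed

lemma exists_fourth: "\<exists>c :: 4. c ~= p & c ~= a & c ~= b"
proof -
 have "card {p, a, b} < card (UNIV :: 4 set)" by (auto simp: card_insert_if)
 then have "{p, a, b} ~= UNIV" by auto
 then show ?thesis by auto
qed

text \<open>The values on the edges are those of the integrating function \<open>g\<close>; there a point has exactly one
further nonzero coordinate \<open>c\<close> besides the large one.\<close>

lemma realises_exists:
 fixes T :: "('t::finite) gluing"
 assumes fp: "face_pairing T" and V: "corner_class T V" and eps: "0 < eps" "eps <= 1/2"
  and ch: "corner_chart T V eps Y \<pi>" and \<kappa>: "corner_cocycle T V \<kappa>"
 obtains s where "local_system Y s" "realises T V eps \<pi> \<kappa> s"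
proof -
 let ?S = "corner_points V eps"
 obtain g :: "'t => 4 => 4 => bool" where g': "\<forall>i p a c. (i, p) \<in> V --> a ~= p --> c ~= p --> c ~= a -->
   \<kappa> i p a = (g i p c ~= g (nbr T i a) (perm T i a p) (perm T i a c))"
  using \<kappa>[unfolded corner_cocycle_def] by (-, atomize_elim, assumption)
 note g = g'[rule_format]
 note sat = saturated_corner_points[OF fp V eps(2)]
 (* On an edge of the tetrahedron the description picks the other end of that edge. *)
 define f0 where "f0 q = g (fst q) (big_corner (snd q)) (THE c. c ~= big_corner (snd q) & snd q $ c ~= 0)" for q
 have f0: "f0 (i, x) = g i p c"
  if "(i, p) \<in> V" "x \<in> corner_cone eps p" "a ~= b" "x $ a = 0" "x $ b = 0" "c ~= p" "c ~= a" "c ~= b" for i x p a b c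
 proof -
  have bc: "big_corner x = p" by (rule big_corner_cone[OF that(2) eps(2)])
  have x: "x $ p > 1/2" "x $ p < 1" "(\<Sum>d\<in>UNIV. x $ d) = 1" using that(2) eps by (auto simp: corner_cone_def std_simplex_def)
  have dist: "p ~= a" "p ~= b" using x(1) that by auto
  have all: "UNIV = {p, a, b, c}"
  proof (rule card_subset_eq[symmetric])
   show "card {p, a, b, c} = card (UNIV :: 4 set)" using dist that by simp
  qed auto
  then have "x $ p + x $ c = 1" using x(3) dist that by (simp add: all)
  then have "x $ c ~= 0" using x(2) by auto
  then have "(THE d. d ~= p & x $ d ~= 0) = c"
   using that all by (intro the_equality) auto
  then show ?thesis by (simp add: f0_def bc)
 qed
 have corner: "\<exists>p. (i, p) \<in> V & x \<in> corner_cone eps p & big_corner x = p & (\<forall>a. x $ a = 0 --> a ~= p)"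
  if ix: "(i, x) \<in> ?S" for i x
 using ix big_corner_cone eps by (auto simp: corner_points_def corner_cone_def)
 have move_corner: "big_corner (face_move T i a x) = perm T i a p"
  if "(i, p) \<in> V" "x \<in> corner_cone eps p" "a ~= p" for i p x a
  by (rule big_corner_cone[OF corner_points_move(2)[OF fp V that] eps(2)])
 obtain f where f: "has_jumps T ?S f (%i a x. \<kappa> i (big_corner x) a)"
 proof (rule function_with_jumps_exists[OF fp sat, where \<kappa> = "%i a x. \<kappa> i (big_corner x) a" and ?f0.0 = f0])
  fix i x a assume ix: "(i, x) \<in> ?S" "x $ a = 0"
  then obtain p where p: "(i, p) \<in> V" "x \<in> corner_cone eps p" "big_corner x = p" "a ~= p" using corner by blast
  obtain c where c: "c ~= p" "c ~= a" using exists_third by blast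
  have "\<kappa> (nbr T i a) (perm T i a p) (perm T i a a) = \<kappa> i p a"
   using g[OF corner_class_step[OF V p(1,4)], of "perm T i a a" "perm T i a c"] g[OF p(1,4) c]
   by (auto simp: perm_inj[OF fp] p(4) c c[symmetric] face_pairingD(3)[OF fp] perm_back[OF fp] p(4)[symmetric])
  then show "\<kappa> (nbr T i a) (big_corner (face_move T i a x)) (perm T i a a) = \<kappa> i (big_corner x) a"
   by (simp add: move_corner[OF p(1,2,4)] p(3))
 next
  fix i x a b assume ix: "(i, x) \<in> ?S" "a ~= b" "x $ a = 0" "x $ b = 0"
  then obtain p where p: "(i, p) \<in> V" "x \<in> corner_cone eps p" "big_corner x = p" "a ~= p" "b ~= p" using corner by blast
  obtain c where c: "c ~= p" "c ~= a" "c ~= b" using exists_fourth by blast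
  have "f0 (i, x) = g i p c" by (rule f0[OF p(1,2) ix(2-4) c])
  moreover have "f0 (nbr T i a, face_move T i a x) = g (nbr T i a) (perm T i a p) (perm T i a c)"
   by (rule f0[OF corner_points_move[OF fp V p(1,2,4)], of "perm T i a a" "perm T i a b"])
    (use ix c in \<open>auto simp: perm_inj[OF fp] face_move_nth[OF fp]\<close>)
  ultimately show "(f0 (i, x) ~= f0 (nbr T i a, face_move T i a x)) = \<kappa> i (big_corner x) a"
   using g[OF p(1,4) c(1,2)] p(3) by simp
 qed (use that in blast)
 have "descent_function (subtopology simplices ?S) \<pi> f"
 proof (rule descent_function_of_jumps[OF fp sat f])
  show "\<pi> p = \<pi> q \<longleftrightarrow> glued T p q" if "p \<in> ?S" "q \<in> ?S" for p q using ch that unfolding corner_chart_def by blast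
  fix i x assume "(i, x) \<in> ?S"
  then obtain p where p: "(i, p) \<in> V" "x \<in> corner_cone eps p" "big_corner x = p" using corner by blast
  have "big_corner z = big_corner x" if z: "(i, z) \<in> ?S" "dist z x < x $ p - 1/2" for z
  proof -
   have "\<bar>z $ p - x $ p\<bar> <= dist z x" using component_le_norm_cart[of "z - x" p] by (simp add: dist_norm)
   then have "1/2 < z $ p" using z(2) by linarith
   moreover have "z \<in> std_simplex" using z(1) by (auto simp: corner_points_def corner_cone_def)
   ultimately show ?thesis using p(3) by (simp add: big_corner_eq)
  qed
  moreover have "x $ p - 1/2 > 0" using p(2) eps by (auto simp: corner_cone_def)
  ultimately show "\<exists>e>0. \<forall>z a. (i, z) \<in> ?S --> dist z x < e --> z $ a = 0 --> x $ a = 0 -->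
    \<kappa> i (big_corner z) a = \<kappa> i (big_corner x) a"
   by (intro exI[of _ "x $ p - 1/2"]) simp
 qed
 with ch obtain s where "local_system Y s" "trivialises (subtopology simplices ?S) (pullback_system \<pi> s) f"
  unfolding corner_chart_def using descent_exists by blast
 then show thesis using that f unfolding realises_def by blast
qed

text \<open>The cohomology of the convex corners vanishes, so the system has a trivialisation there; the jump across a side is constant because the side
is convex. The values at points on the edges integrate the jumps.\<close>

lemma realises_some:
 fixes T :: "('t::finite) gluing"
 assumes fp: "face_pairing T" and V: "corner_class T V" and eps: "0 < eps" "eps <= 1/2"
  and ch: "corner_chart T V eps Y \<pi>" and s: "local_system Y s"
 obtains \<kappa> where "corner_cocycle T V \<kappa>" "realises T V eps \<pi> \<kappa> s"
proof -
 let ?S = "corner_points V eps"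
 let ?X = "subtopology simplices ?S"
 have d: "descent_map ?X Y \<pi>" using ch unfolding corner_chart_def by blast
 have SD: "?S \<subseteq> simplex_points" by (auto simp: corner_points_def corner_cone_def simplex_points_def)
 have "local_system ?X (pullback_system \<pi> s)"
  unfolding pullback_system_def by (rule local_system_pullback[OF descent_mapD(2)[OF d] s])
 then obtain f where f: "trivialises ?X (pullback_system \<pi> s) f"
  using H1_trivial_corner_points[OF eps(2), of V] unfolding H1_trivial_def trivial_system_def by blast
 have df: "descent_function ?X \<pi> f" by (rule descent_function_trivialisation[OF f])
 define F where "F p a = {x \<in> corner_cone eps p. x $ a = 0}" for p a
 define jump where "jump i a x \<longleftrightarrow> f (i, x) ~= f (nbr T i a, face_move T i a x)" for i a x
 have const: "jump i a x = jump i a y"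
  if p: "(i, p) \<in> V" "a ~= p" and xy: "x \<in> F p a" "y \<in> F p a" for i p a x y
 proof -
  have conn: "connected_space (top_of_set (F p a))"
   using convex_connected[OF convex_corner_face[of eps p a]] by (simp add: F_def connected_space_subtopology)
  have FD: "F p a \<subseteq> std_simplex" by (auto simp: F_def corner_cone_def)
  have in1: "(i, z) \<in> ?S" if "z \<in> F p a" for z using that p(1) by (auto simp: F_def corner_points_def)
  have in2: "(nbr T i a, face_move T i a z) \<in> ?S" if "z \<in> F p a" for z
   using that corner_points_move[OF fp V p(1) _ p(2), of z] by (auto simp: F_def corner_points_def)
  have "locally_constant_on (top_of_set (F p a)) (%x. f (i, x) ~= f (nbr T i a, face_move T i a x))"
  proof (rule descent_function_along[OF df])
   show "continuous_map (top_of_set (F p a)) ?X (%x. (i, x))"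
    by (rule continuous_map_simplex_slice[OF FD in1 SD]) (auto intro: continuous_intros)
   show "continuous_map (top_of_set (F p a)) ?X (%x. (nbr T i a, face_move T i a x))"
    by (rule continuous_map_simplex_slice[OF FD in2 SD]) (auto intro: continuous_on_face_move)
   fix z assume "z \<in> topspace (top_of_set (F p a))"
   then have z: "z \<in> F p a" by simp
   then have "glued T (i, z) (nbr T i a, face_move T i a z)"
    using FD by (intro glued_step[OF fp]) (auto simp: F_def)
   then show "\<pi> (i, z) = \<pi> (nbr T i a, face_move T i a z)"
    using ch in1[OF z] in2[OF z] unfolding corner_chart_def by blast
  qed
  from connected_locally_constant[OF conn this, of x y] xy show ?thesis by (simp add: jump_def)
 qed
 define \<kappa> where "\<kappa> i p a \<longleftrightarrow> (\<exists>x\<in>F p a. jump i a x)" for i p a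
 have \<kappa>: "jump i a x = \<kappa> i p a" if "(i, p) \<in> V" "a ~= p" "x \<in> F p a" for i p a x
  using const[OF that(1,2)] that(3) unfolding \<kappa>_def by blast
 have "has_jumps T ?S f (%i a x. \<kappa> i (big_corner x) a)"
  unfolding has_jumps_def
 proof (intro allI impI)
  fix i x a assume "(i, x) \<in> ?S" "x $ a = 0"
  then obtain p where p: "(i, p) \<in> V" "x \<in> corner_cone eps p" by (auto simp: corner_points_def)
  then have "a ~= p" using \<open>x $ a = 0\<close> eps by (auto simp: corner_cone_def)
  moreover have "x \<in> F p a" using p \<open>x $ a = 0\<close> by (simp add: F_def)
  ultimately show "(f (i, x) ~= f (nbr T i a, face_move T i a x)) = \<kappa> i (big_corner x) a"
   using \<kappa>[OF p(1)] big_corner_cone[OF p(2) eps(2)] by (simp add: jump_def)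
 qed
 then have "realises T V eps \<pi> \<kappa> s" unfolding realises_def using f by blast
 moreover have "corner_cocycle T V \<kappa>"
  unfolding corner_cocycle_def
 proof (intro exI[of _ "%i p c. f (i, edge_point eps p c)"] allI impI)
  fix i p a c assume *: "(i, p) \<in> V" "a ~= p" "c ~= p" "c ~= a"
  have "edge_point eps p c \<in> F p a"
   using edge_point_cone[OF eps *(3)] * by (auto simp: F_def edge_point_def)
  from \<kappa>[OF *(1,2) this]
  show "\<kappa> i p a = (f (i, edge_point eps p c) ~= f (nbr T i a, edge_point eps (perm T i a p) (perm T i a c)))"
   by (simp add: jump_def face_move_edge_point[OF fp])
 qed
 ultimately show thesis using that by blast
qed

text \<open>The system is trivial if and only if the jumps come from a function constant on each corner, by descent.\<close>

lemma realises_trivial_iff: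
 fixes T :: "('t::finite) gluing"
 assumes fp: "face_pairing T" and V: "corner_class T V" and eps: "0 < eps" "eps <= 1/2"
  and ch: "corner_chart T V eps Y \<pi>" and r: "realises T V eps \<pi> \<kappa> s"
 shows "trivial_system Y s \<longleftrightarrow> corner_coboundary T V \<kappa>"
proof -
 let ?S = "corner_points V eps"
 let ?X = "subtopology simplices ?S"
 have d: "descent_map ?X Y \<pi>" and \<pi>: "\<And>p q. p \<in> ?S ==> q \<in> ?S ==> \<pi> p = \<pi> q \<longleftrightarrow> glued T p q"
  using ch unfolding corner_chart_def by blast+
 note sat = saturated_corner_points[OF fp V eps(2)]
 obtain f where f: "trivialises ?X (pullback_system \<pi> s) f"
  and j: "has_jumps T ?S f (%i a x. \<kappa> i (big_corner x) a)" using r unfolding realises_def by blast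
 show ?thesis
 proof
  assume "trivial_system Y s"
  from descent_trivial_imp[OF d f this] obtain \<psi> where \<psi>: "locally_constant_on ?X \<psi>"
   "\<And>x x'. x \<in> ?S ==> x' \<in> ?S ==> \<pi> x = \<pi> x' ==> (f x = f x') = (\<psi> x = \<psi> x')"
   unfolding topspace_corner by metis
  define \<psi>' where "\<psi>' i p = \<psi> (i, edge_point eps p (if p = 1 then 2 else 1))" for i p
  have pt: "edge_point eps p (if p = 1 then 2 else 1) \<in> corner_cone eps p" for p
   by (rule edge_point_cone[OF eps]) auto
  have \<psi>': "\<psi> (i, x) = \<psi>' i p" if "(i, p) \<in> V" "x \<in> corner_cone eps p" for i p x
   unfolding \<psi>'_def by (rule corner_locally_constant[OF \<psi>(1) that pt])
  show "corner_coboundary T V \<kappa>"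
   unfolding corner_coboundary_def
  proof (intro exI[of _ \<psi>'] allI impI)
   fix i p a assume p: "(i, p) \<in> V" "a ~= p"
   obtain c where c: "c ~= p" "c ~= a" using exists_third by blast
   define x where "x = edge_point eps p c"
   have x: "x \<in> corner_cone eps p" "x $ a = 0" "x \<in> std_simplex"
    using edge_point_cone[OF eps c(1)] c p(2) by (auto simp: x_def edge_point_def corner_cone_def)
   have S: "(i, x) \<in> ?S" "(nbr T i a, face_move T i a x) \<in> ?S"
    using p x corner_points_move[OF fp V p(1) x(1) p(2)] by (auto simp: corner_points_def)
   have "\<pi> (i, x) = \<pi> (nbr T i a, face_move T i a x)" using \<pi>[OF S] glued_step[OF fp x(3,2)] by simp
   from \<psi>(2)[OF S this] have "\<kappa> i p a = (\<psi> (i, x) ~= \<psi> (nbr T i a, face_move T i a x))"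
    using j S(1) x(2) big_corner_cone[OF x(1) eps(2)] unfolding has_jumps_def by metis
   then show "\<kappa> i p a = (\<psi>' i p ~= \<psi>' (nbr T i a) (perm T i a p))"
    using \<psi>'[OF p(1) x(1)] \<psi>'[OF corner_points_move[OF fp V p(1) x(1) p(2)]] by simp
  qed
 next
  assume "corner_coboundary T V \<kappa>"
  then obtain \<psi> :: "'t => 4 => bool" where \<psi>': "\<forall>i p a. (i, p) \<in> V --> a ~= p -->
    \<kappa> i p a = (\<psi> i p ~= \<psi> (nbr T i a) (perm T i a p))"
   unfolding corner_coboundary_def by (-, atomize_elim, assumption)
  note \<psi> = \<psi>'[rule_format]
  define \<Psi> where "\<Psi> q = \<psi> (fst q) (big_corner (snd q))" for q
  have bc: "big_corner x = p" if "x \<in> corner_cone eps p" for x p by (rule big_corner_cone[OF that eps(2)])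
  show "trivial_system Y s"
  proof (rule descent_trivial[OF d f])
   show "locally_constant_on ?X \<Psi>"
    unfolding locally_constant_on_def topspace_corner
   proof
    fix q assume "q \<in> ?S"
    then obtain v where v: "v \<in> V" "q \<in> {fst v} \<times> corner_cone eps (snd v)" unfolding corner_points_eq by blast
    have "openin ?X ({fst v} \<times> corner_cone eps (snd v))"
     unfolding openin_open_subtopology[OF openin_corner_points]
     using v by (auto intro!: openin_slice openin_corner_cone simp: corner_points_eq)
    moreover have "\<forall>y\<in>{fst v} \<times> corner_cone eps (snd v). \<Psi> y = \<Psi> q"
     using v(2) bc by (auto simp: \<Psi>_def)
    ultimately show "\<exists>U. openin ?X U & q \<in> U & (\<forall>y\<in>U. \<Psi> y = \<Psi> q)" using v(2) by blast
   qed
   fix q q' assume "q \<in> topspace ?X" "q' \<in> topspace ?X" "\<pi> q = \<pi> q'"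
   then have qS: "q \<in> ?S" and g: "glued T q q'" using \<pi> unfolding topspace_corner by blast+
   have "(f q = f (fst q', snd q')) = (\<Psi> q = \<Psi> (fst q', snd q'))"
    using fp g
   proof (induction rule: glued_induct)
    case (step i x a)
    have S: "(i, x) \<in> ?S" by (rule saturated_glued[OF fp sat step(1) qS])
    then obtain p where p: "(i, p) \<in> V" "x \<in> corner_cone eps p" by (auto simp: corner_points_def)
    have "a ~= p" using step(3) p(2) eps by (auto simp: corner_cone_def)
    have "(f (i, x) ~= f (nbr T i a, face_move T i a x)) = \<kappa> i p a"
     using j S step(3) bc[OF p(2)] unfolding has_jumps_def by metis
    moreover have "\<Psi> (i, x) = \<psi> i p" "\<Psi> (nbr T i a, face_move T i a x) = \<psi> (nbr T i a) (perm T i a p)"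
     using bc[OF p(2)] bc[OF corner_points_move(2)[OF fp V p \<open>a ~= p\<close>]] by (simp_all add: \<Psi>_def)
    ultimately show ?case using \<psi>[OF p(1) \<open>a ~= p\<close>] step(4) by argo
   qed simp
   then show "(f q = f q') = (\<Psi> q = \<Psi> q')" by simp
  qed
 qed
qed

lemma corner_points_mono: "eps' <= eps ==> corner_points V eps' \<subseteq> corner_points V eps"
 by (fastforce simp: corner_points_def corner_cone_def)

lemma realises_mono:
 assumes "eps' <= eps" "realises T V eps \<pi> \<kappa> s"
 shows "realises T V eps' \<pi> \<kappa> s"
proof -
 note sub = corner_points_mono[OF assms(1), of V]
 obtain f where f: "trivialises (subtopology simplices (corner_points V eps)) (pullback_system \<pi> s) f"
  and j: "has_jumps T (corner_points V eps) f (%i a x. \<kappa> i (big_corner x) a)" using assms(2) unfolding realises_def by blast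
 from trivialises_subtopology[OF f, of "corner_points V eps'"]
 have "trivialises (subtopology simplices (corner_points V eps')) (pullback_system \<pi> s) f"
  using sub by (simp add: subtopology_subtopology Int_absorb1)
 moreover have "has_jumps T (corner_points V eps') f (%i a x. \<kappa> i (big_corner x) a)"
  using j sub unfolding has_jumps_def by blast
 ultimately show ?thesis unfolding realises_def by blast
qed

lemma realises_sum:
 assumes "realises T V eps \<pi> \<kappa> s" "realises T V eps \<pi> \<mu> t"
 shows "realises T V eps \<pi> (%i p a. \<kappa> i p a ~= \<mu> i p a) (system_sum s t)"
proof -
 let ?X = "subtopology simplices (corner_points V eps)"
 obtain f where f: "trivialises ?X (pullback_system \<pi> s) f"
  and jf: "has_jumps T (corner_points V eps) f (%i a x. \<kappa> i (big_corner x) a)" using assms(1) unfolding realises_def by blast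
 obtain g where g: "trivialises ?X (pullback_system \<pi> t) g"
  and jg: "has_jumps T (corner_points V eps) g (%i a x. \<mu> i (big_corner x) a)" using assms(2) unfolding realises_def by blast
 have eq: "pullback_system \<pi> (system_sum s t) = system_sum (pullback_system \<pi> s) (pullback_system \<pi> t)"
  by (auto simp: fun_eq_iff system_sum_def pullback_system_def)
 have "has_jumps T (corner_points V eps) (%x. f x ~= g x) (%i a x. \<kappa> i (big_corner x) a ~= \<mu> i (big_corner x) a)"
  unfolding has_jumps_def
 using jf jg unfolding has_jumps_def by blast
 with trivialises_sum[OF f g] show ?thesis unfolding realises_def eq by blast
qed

lemma realises_cong:
 assumes r: "realises T V eps \<pi> \<kappa> s" and Y: "continuous_map (subtopology simplices (corner_points V eps)) Y \<pi>"
  and eq: "\<And>x y. x \<in> topspace Y ==> y \<in> topspace Y ==> s x y = s' x y"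
 shows "realises T V eps \<pi> \<kappa> s'"
proof -
 let ?X = "subtopology simplices (corner_points V eps)"
 obtain f where f: "trivialises ?X (pullback_system \<pi> s) f"
  and j: "has_jumps T (corner_points V eps) f (%i a x. \<kappa> i (big_corner x) a)" using r unfolding realises_def by blast
 have "\<pi> x \<in> topspace Y" if "x \<in> topspace ?X" for x using Y that by (auto simp: continuous_map_def)
 then have "trivialises ?X (pullback_system \<pi> s') f"
  by (intro trivialises_cong[OF f]) (simp add: pullback_system_def eq)
 with j show ?thesis unfolding realises_def by blast
qed

text \<open>Adjacent corners share points of their common side.\<close>

lemma connected_corner_chart:
 fixes T :: "('t::finite) gluing"
 assumes fp: "face_pairing T" and V: "corner_class T V" and eps: "0 < eps" "eps <= 1/2"
  and ch: "corner_chart T V eps Y \<pi>"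
 shows "connected_space Y"
 unfolding connected_space_clopen_in
proof (intro allI impI)
 let ?S = "corner_points V eps"
 let ?X = "subtopology simplices ?S"
 have d: "descent_map ?X Y \<pi>" and \<pi>: "\<And>p q. p \<in> ?S ==> q \<in> ?S ==> \<pi> p = \<pi> q \<longleftrightarrow> glued T p q"
  using ch unfolding corner_chart_def by blast+
 fix C assume C: "openin Y C & closedin Y C"
 define P where "P q \<longleftrightarrow> \<pi> q \<in> C" for q
 have "locally_constant_on ?X P"
  unfolding locally_constant_on_def
 proof
  fix q assume q: "q \<in> topspace ?X"
  have "openin ?X {x \<in> topspace ?X. \<pi> x \<in> C}" "openin ?X {x \<in> topspace ?X. \<pi> x \<in> topspace Y - C}"
   using openin_continuous_map_preimage[OF descent_mapD(2)[OF d]] C unfolding closedin_def by blast+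
  then show "\<exists>U. openin ?X U & q \<in> U & (\<forall>y\<in>U. P y = P q)"
   using q descent_mapD(5)[OF d q] unfolding P_def
   by (cases "\<pi> q \<in> C") (rule exI, rule conjI, assumption, force)+
 qed
 note lc = corner_locally_constant[OF this]
 obtain i0 p0 where v0: "(i0, p0) \<in> V" using corner_class_nonempty[OF V] by auto
 define x0 where "x0 p = edge_point eps p (if p = 1 then 2 else 1)" for p
 have x0: "x0 p \<in> corner_cone eps p" for p unfolding x0_def by (rule edge_point_cone[OF eps]) auto
 have all: "P (fst w, x0 (snd w)) = P (i0, x0 p0)" if w: "w \<in> V" for w
 proof (rule corner_class_induct[OF fp V v0 w])
  fix i p a assume p: "(i, p) \<in> V" and IH: "P (fst (i, p), x0 (snd (i, p))) = P (i0, x0 p0)" and a: "a ~= p"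
  obtain c where c: "c ~= p" "c ~= a" using exists_third by blast
  define x where "x = edge_point eps p c"
  have x: "x \<in> corner_cone eps p" "x $ a = 0" "x \<in> std_simplex"
   using edge_point_cone[OF eps c(1)] c a by (auto simp: x_def edge_point_def corner_cone_def)
  have S: "(i, x) \<in> ?S" "(nbr T i a, face_move T i a x) \<in> ?S"
   using p x corner_points_move[OF fp V p x(1) a] by (auto simp: corner_points_def)
  have "\<pi> (i, x) = \<pi> (nbr T i a, face_move T i a x)" using \<pi>[OF S] glued_step[OF fp x(3,2)] by simp
  then have "P (i, x) = P (nbr T i a, face_move T i a x)" by (simp add: P_def)
  then show "P (fst (nbr T i a, perm T i a p), x0 (snd (nbr T i a, perm T i a p))) = P (i0, x0 p0)"
   using IH lc[OF p x(1) x0] lc[OF corner_points_move[OF fp V p x(1) a] x0] by simp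
 qed simp
 have const: "P q = P (i0, x0 p0)" if "q \<in> ?S" for q
 proof -
  obtain p where p: "(fst q, p) \<in> V" "snd q \<in> corner_cone eps p" using \<open>q \<in> ?S\<close> by (auto simp: corner_points_def)
  show ?thesis using all[OF p(1)] lc[OF p x0] by simp
 qed
 have "\<pi> ` ?S = topspace Y" using descent_mapD(3)[OF d] unfolding topspace_corner .
 then have "y \<in> C \<longleftrightarrow> P (i0, x0 p0)" if "y \<in> topspace Y" for y
  using that const unfolding P_def by (metis imageE)
 then show "C = {} \<or> C = topspace Y"
  using C openin_subset[of Y C] by blast
qed

section \<open>Counting edge ends at an ideal vertex\<close>

text \<open>Boolean functions form a vector space over the field with two elements.\<close>

definition fxor :: "('a => bool) => ('a => bool) => 'a => bool" where
 "fxor f g x \<longleftrightarrow> (f x ~= g x)"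

definition supported :: "'a set => ('a => bool) set" where
 "supported S = {f. \<forall>x. f x --> x \<in> S}"

lemma xor_self: "fxor f f = (%_. False)" by (simp add: fxor_def fun_eq_iff)
lemma xor_zero: "fxor f (%_. False) = f" by (simp add: fxor_def fun_eq_iff)
lemma xor_cancel: "fxor f (fxor f g) = g" by (auto simp: fxor_def fun_eq_iff)

lemma card_supported: "finite S ==> card (supported S) = 2 ^ card S"
proof -
 assume S: "finite S"
 have "bij_betw Collect (supported S) (Pow S)"
  by (rule bij_betw_byWitness[where f' = "%A x. x \<in> A"]) (auto simp: supported_def)
 then show ?thesis using S by (simp add: bij_betw_same_card card_Pow)
qed

lemma finite_supported: "finite S ==> finite (supported S)"
 by (rule card_ge_0_finite) (simp add: card_supported)

lemma supported_xor: "f \<in> supported S ==> g \<in> supported S ==> fxor f g \<in> supported S"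
 by (auto simp: supported_def fxor_def)

text \<open>Rank and nullity: all fibres of an additive map are translates of its kernel.\<close>

lemma card_xor_image:
 assumes G: "finite G" "\<And>f g. f \<in> G ==> g \<in> G ==> fxor f g \<in> G"
  and L: "\<And>f g. f \<in> G ==> g \<in> G ==> L (fxor f g) = fxor (L f) (L g)"
 shows "card G = card (L ` G) * card {f \<in> G. L f = (%_. False)}"
proof -
 define K where "K = {f \<in> G. L f = (%_. False)}"
 have "card {g \<in> G. L g = y} = card K" if "y \<in> L ` G" for y
 proof -
  obtain f where f: "f \<in> G" "y = L f" using \<open>y \<in> L ` G\<close> by blast
  have "bij_betw (fxor f) {g \<in> G. L g = y} K"
   by (rule bij_betw_byWitness[where f' = "fxor f"])
    (use f G L in \<open>auto simp: xor_cancel K_def xor_self xor_zero\<close>)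
  then show ?thesis by (rule bij_betw_same_card)
 qed
 moreover have "card G = (\<Sum>y\<in>L ` G. card {g \<in> G. L g = y})"
  using sum.image_gen[OF G(1), of "%_. 1::nat" L] by (simp only: card_eq_sum)
 ultimately have "card G = (\<Sum>y\<in>L ` G. card K)" by simp
 then show ?thesis by (simp add: K_def)
qed

text \<open>Such a function is the same as a set of classes.\<close>

lemma card_invariant_functions:
 assumes "finite S" "equiv S R"
 shows "card {f \<in> supported S. \<forall>x y. (x, y) \<in> R --> f x = f y} = 2 ^ card (S // R)"
proof -
 let ?I = "{f \<in> supported S. \<forall>x y. (x, y) \<in> R --> f x = f y}"
 have "bij_betw (%C x. x \<in> \<Union>C) (Pow (S // R)) ?I"
 proof (rule bij_betw_byWitness[where f' = "%f. {c \<in> S // R. \<exists>x\<in>c. f x}"])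
  have disj: "c = c'" if "c \<in> S // R" "c' \<in> S // R" "x \<in> c" "x \<in> c'" for c c' x
   using quotient_disj[OF assms(2) that(1,2)] that(3,4) by blast
  show "\<forall>C\<in>Pow (S // R). {c \<in> S // R. \<exists>x\<in>c. x \<in> \<Union>C} = C"
  proof
   fix C assume C: "C \<in> Pow (S // R)"
   show "{c \<in> S // R. \<exists>x\<in>c. x \<in> \<Union>C} = C"
   proof
    show "{c \<in> S // R. \<exists>x\<in>c. x \<in> \<Union>C} \<subseteq> C" using C disj by blast
    show "C \<subseteq> {c \<in> S // R. \<exists>x\<in>c. x \<in> \<Union>C}"
    using C in_quotient_imp_non_empty assms(2) by blast
   qed
  qed
  show "\<forall>f\<in>?I. (%x. x \<in> \<Union>{c \<in> S // R. \<exists>x\<in>c. f x}) = f"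
  proof
   fix f assume f: "f \<in> ?I"
   show "(%x. x \<in> \<Union>{c \<in> S // R. \<exists>x\<in>c. f x}) = f"
   proof
    fix x
    show "(x \<in> \<Union>{c \<in> S // R. \<exists>x\<in>c. f x}) = f x"
    proof
     assume "x \<in> \<Union>{c \<in> S // R. \<exists>x\<in>c. f x}"
     then obtain c y where "c \<in> S // R" "x \<in> c" "y \<in> c" "f y" by blast
     then have "(x, y) \<in> R" using quotient_eq_iff[OF assms(2)] by blast
     then show "f x" using f \<open>f y\<close> by blast
    next
     assume fx: "f x"
     then have "x \<in> S" using f by (simp add: supported_def)
     then have "R `` {x} \<in> S // R" "x \<in> R `` {x}"
      using equiv_class_self[OF assms(2)] by (auto intro: quotientI)
     with fx show "x \<in> \<Union>{c \<in> S // R. \<exists>x\<in>c. f x}" by blast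
    qed
   qed
  qed
  show "(%C x. x \<in> \<Union>C) ` Pow (S // R) \<subseteq> ?I"
  proof (intro image_subsetI CollectI conjI allI impI)
   fix C assume C: "C \<in> Pow (S // R)"
   show "(%x. x \<in> \<Union>C) \<in> supported S"
    using C in_quotient_imp_subset[OF assms(2)] by (auto simp: supported_def)
   fix x y assume xy: "(x, y) \<in> R"
   have "x \<in> c \<longleftrightarrow> y \<in> c" if "c \<in> S // R" for c
    using in_quotient_imp_closed[OF assms(2) that] xy equivE[OF assms(2)] by (metis symE)
   then show "(x \<in> \<Union>C) = (y \<in> \<Union>C)" using C by blast
  qed
 qed auto
 then have "card ?I = card (Pow (S // R))" by (simp add: bij_betw_same_card)
 then show ?thesis using finite_quotient[OF assms(1)] equiv_type[OF assms(2)] by (simp add: card_Pow)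
qed

lemma odd_card_xor:
 assumes "finite (Collect f)" "finite (Collect g)"
 shows "odd (card (Collect (fxor f g))) = (odd (card (Collect f)) ~= odd (card (Collect g)))"
proof -
 let ?A = "Collect f" and ?B = "Collect g"
 have "Collect (fxor f g) = (?A - ?B) \<union> (?B - ?A)" by (auto simp: fxor_def)
 then have "card (Collect (fxor f g)) = card (?A - ?B) + card (?B - ?A)"
  using assms by (simp add: card_Un_disjoint Diff_Int_distrib) (subst card_Un_disjoint, auto)
 moreover have "card ?A = card (?A - ?B) + card (?A \<inter> ?B)" "card ?B = card (?B - ?A) + card (?A \<inter> ?B)"
  using assms card_Diff_subset_Int[of ?A ?B] card_Diff_subset_Int[of ?B ?A]
  by (simp_all add: card_mono Int_commute)
 ultimately show ?thesis by auto
qed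

text \<open>The orbits of a fixed-point-free involution have two elements.\<close>

lemma involution_pairs:
 assumes A: "finite A" and \<tau>: "\<And>x. x \<in> A ==> \<tau> x \<in> A & \<tau> (\<tau> x) = x & \<tau> x ~= x"
  and R: "R = {(x, y). x \<in> A & (y = x \<or> y = \<tau> x)}"
 shows "equiv A R" "2 * card (A // R) = card A"
proof -
 show eq: "equiv A R"
 proof (rule equivI)
  show "R \<subseteq> A \<times> A" "refl_on A R" unfolding R refl_on_def using \<tau> by auto
  show "sym R"
  proof (rule symI)
   fix x y assume "(x, y) \<in> R"
   then show "(y, x) \<in> R" using \<tau>[of x] unfolding R by auto
  qed
  show "trans R"
  proof (rule transI)
   fix x y z assume "(x, y) \<in> R" "(y, z) \<in> R"
   then show "(x, z) \<in> R" using \<tau>[of x] unfolding R by auto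
  qed
 qed
 have "2 * card (A // R) = card (\<Union>(A // R))"
 proof (rule card_partition)
  show "finite (A // R)" "finite (\<Union>(A // R))"
   using A finite_quotient[OF A] equiv_type[OF eq] Union_quotient[OF eq] by auto
  show "card c = 2" if "c \<in> A // R" for c
  proof -
   obtain x where "x \<in> A" "c = R `` {x}" using \<open>c \<in> A // R\<close> by (rule quotientE)
   then have "c = {x, \<tau> x}" "\<tau> x ~= x" using \<tau> by (auto simp: R)
   then show ?thesis by simp
  qed
  show "c \<inter> c' = {}" if "c \<in> A // R" "c' \<in> A // R" "c ~= c'" for c c'
   using quotient_disj[OF eq that(1,2)] that(3) by blast
 qed
 then show "2 * card (A // R) = card A" using Union_quotient[OF eq] by simp
qed

lemma four_elements:
 fixes p a :: 4
 assumes "a ~= p"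
 obtains b c where "b ~= p" "b ~= a" "c ~= p" "c ~= a" "b ~= c" "UNIV = {p, a, b, c}"
proof -
 obtain b where b: "b ~= p" "b ~= a" using exists_third by blast
 obtain c where c: "c ~= p" "c ~= a" "c ~= b" using exists_fourth by blast
 have "{p, a, b, c} = UNIV"
  by (rule card_subset_eq) (use assms b c in auto)
 with b c show thesis using that by blast
qed

definition flags :: "('t \<times> 4) set => ('t \<times> 4 \<times> 4) set" where
 "flags V = {(i, p, a). (i, p) \<in> V & a ~= p}"

definition flag_move :: "'t gluing => 4 => 't \<times> 4 \<times> 4 => 't \<times> 4 \<times> 4" where
 "flag_move T a = (%(i, p, c). (nbr T i a, perm T i a p, perm T i a c))"

text \<open>A flag \<open>(i, p, c)\<close> is the corner \<open>p\<close> together with the edge from \<open>p\<close> to \<open>c\<close>, that is, an end of an unglued edge. The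
classes are the ends of edges at the ideal vertex.\<close>

definition edge_flag_rel :: "'t gluing => ('t \<times> 4) set => (('t \<times> 4 \<times> 4) \<times> ('t \<times> 4 \<times> 4)) set" where
 "edge_flag_rel T V = {(x, flag_move T a x) | x a. x \<in> flags V & a ~= fst (snd x) & a ~= snd (snd x)}\<^sup>* \<inter>
   (flags V \<times> flags V)"

lemma flag_move_in:
 assumes "face_pairing T" "corner_class T V" "(i, p, c) \<in> flags V" "a ~= p"
 shows "flag_move T a (i, p, c) \<in> flags V"
 using assms corner_class_step[OF assms(2), of i p a] by (auto simp: flags_def flag_move_def perm_inj)

lemma flag_move_back:
 assumes "face_pairing T"
 shows "flag_move T (perm T i a a) (flag_move T a (i, p, c)) = (i, p, c)"
 using assms by (simp add: flag_move_def face_pairingD(3) perm_back)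

lemma equiv_edge_flag_rel:
 assumes fp: "face_pairing T" and V: "corner_class T V"
 shows "equiv (flags V) (edge_flag_rel T V)"
proof -
 let ?r = "{(x, flag_move T a x) | x a. x \<in> flags V & a ~= fst (snd x) & a ~= snd (snd x)}"
 have sy: "(y, x) \<in> ?r" if xy: "(x, y) \<in> ?r" for x y
 proof -
  obtain i p c a where x: "x = (i, p, c)" "y = flag_move T a x" "x \<in> flags V" "a ~= p" "a ~= c"
   using xy by force
  have "y \<in> flags V" using flag_move_in[OF fp V _ x(4)] x by blast
  moreover have "x = flag_move T (perm T i a a) y" using flag_move_back[OF fp] x by simp
  moreover have "perm T i a a ~= fst (snd y)" "perm T i a a ~= snd (snd y)"
   using x by (simp_all add: flag_move_def perm_inj[OF fp])
  ultimately show ?thesis by blast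
 qed
 have "sym ?r" by (rule symI) (rule sy)
 then have "sym (?r\<^sup>*)" by (rule sym_rtrancl)
 then have "sym (edge_flag_rel T V)" unfolding edge_flag_rel_def sym_def by blast
 moreover have "trans (edge_flag_rel T V)" unfolding edge_flag_rel_def trans_def by (auto intro: rtrancl_trans)
 moreover have "refl_on (flags V) (edge_flag_rel T V)" unfolding edge_flag_rel_def refl_on_def by auto
 ultimately show ?thesis unfolding equiv_def edge_flag_rel_def by auto
qed

lemma edge_flag_invariant_iff:
 assumes fp: "face_pairing T" and V: "corner_class T V"
 shows "(\<forall>x y. (x, y) \<in> edge_flag_rel T V --> g x = g y) \<longleftrightarrow>
  (\<forall>i p c a. (i, p, c) \<in> flags V --> a ~= p --> a ~= c --> g (i, p, c) = g (flag_move T a (i, p, c)))"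
proof
 let ?r = "{(x, flag_move T a x) | x a. x \<in> flags V & a ~= fst (snd x) & a ~= snd (snd x)}"
 assume *: "\<forall>x y. (x, y) \<in> edge_flag_rel T V --> g x = g y"
 show "\<forall>i p c a. (i, p, c) \<in> flags V --> a ~= p --> a ~= c --> g (i, p, c) = g (flag_move T a (i, p, c))"
 proof (intro allI impI)
  fix i p c a assume a: "(i, p, c) \<in> flags V" "a ~= p" "a ~= c"
  then have "((i, p, c), flag_move T a (i, p, c)) \<in> ?r" by force
  then have "((i, p, c), flag_move T a (i, p, c)) \<in> edge_flag_rel T V"
   unfolding edge_flag_rel_def using a flag_move_in[OF fp V a(1,2)] by blast
  with * show "g (i, p, c) = g (flag_move T a (i, p, c))" by blast
 qed
next
 let ?r = "{(x, flag_move T a x) | x a. x \<in> flags V & a ~= fst (snd x) & a ~= snd (snd x)}"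
 assume *: "\<forall>i p c a. (i, p, c) \<in> flags V --> a ~= p --> a ~= c --> g (i, p, c) = g (flag_move T a (i, p, c))"
 have "g x = g y" if "(x, y) \<in> ?r\<^sup>*" for x y
  using that
 proof (induction rule: rtrancl_induct)
  case (step y z)
  then obtain i p c a where "y = (i, p, c)" "z = flag_move T a (i, p, c)" "y \<in> flags V" "a ~= p" "a ~= c"
   by force
  then show ?case using * step(3) by metis
 qed simp
 then show "\<forall>x y. (x, y) \<in> edge_flag_rel T V --> g x = g y" unfolding edge_flag_rel_def by blast
qed

context
 fixes T :: "('t::finite) gluing" and V
 assumes fp: "face_pairing T" and V: "corner_class T V"
begin

text \<open>The sides of the triangles of the link, with \<open>\<tau>\<close> exchanging the two triangles at a side. Side \<open>(i, p, a)\<close> is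
the intersection of the triangle at corner \<open>p\<close> with face \<open>a\<close>, opposite to its vertex on the edge from \<open>p\<close> to \<open>a\<close>.\<close>

private definition \<tau> :: "'t \<times> 4 \<times> 4 => 't \<times> 4 \<times> 4" where
 "\<tau> = (%(i, p, a). flag_move T a (i, p, a))"

private lemma \<tau>: "\<tau> (i, p, a) = (nbr T i a, perm T i a p, perm T i a a)"
 by (simp add: \<tau>_def flag_move_def)

private lemma \<tau>_props: "x \<in> flags V ==> \<tau> x \<in> flags V & \<tau> (\<tau> x) = x & \<tau> x ~= x"
proof -
 assume x: "x \<in> flags V"
 obtain i p a where xi: "x = (i, p, a)" by (cases x)
 have "\<tau> x \<in> flags V" using flag_move_in[OF fp V, of i p a a] x by (simp add: xi \<tau>_def flags_def)
 moreover have "\<tau> (\<tau> x) = x" by (simp add: xi \<tau> face_pairingD(3)[OF fp] perm_back[OF fp])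
 moreover have "\<tau> x ~= x" using face_pairingD(2)[OF fp, of i a] by (simp add: xi \<tau>)
 ultimately show ?thesis by blast
qed

private lemma finV: "finite V" "finite (flags V)" by simp_all

private lemma card_sides: "card (flags V) = 3 * card V"
proof -
 have "bij_betw (%(i, p, a). ((i, p), a)) (flags V) (SIGMA v:V. - {snd v})"
  by (rule bij_betw_byWitness[where f' = "%((i, p), a). (i, p, a)"]) (auto simp: flags_def)
 then have "card (flags V) = card (SIGMA v:V. - {snd v})" by (rule bij_betw_same_card)
 also have "\<dots> = (\<Sum>v\<in>V. card (- {snd v}))" by (rule card_SigmaI) auto
 also have "\<dots> = 3 * card V" by (simp add: Compl_eq_Diff_UNIV card_Diff_subset)
 finally show ?thesis .
qed

private definition "Sym = {\<kappa> \<in> supported (flags V). \<forall>x\<in>flags V. \<kappa> (\<tau> x) = \<kappa> x}"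

private lemma card_Sym: "card Sym * card Sym = 2 ^ (3 * card V)"
proof -
 let ?F = "flags V"
 define R where "R = {(x, y). x \<in> ?F & (y = x \<or> y = \<tau> x)}"
 note pairs = involution_pairs[OF finV(2) \<tau>_props R_def]
 have "(\<forall>x\<in>?F. f (\<tau> x) = f x) \<longleftrightarrow> (\<forall>x y. (x, y) \<in> R --> f x = f y)" for f :: "'t \<times> 4 \<times> 4 => bool"
  unfolding R_def by blast
 then have "Sym = {f \<in> supported ?F. \<forall>x y. (x, y) \<in> R --> f x = f y}"
  unfolding Sym_def by simp
 then have c: "card Sym = 2 ^ card (?F // R)" using card_invariant_functions[OF finV(2) pairs(1)] by simp
 show ?thesis unfolding c using pairs(2) card_sides by (metis mult_2 power_add)
qed

private definition tri_sum :: "('t \<times> 4 \<times> 4 => bool) => 't \<times> 4 => bool" where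
 "tri_sum \<kappa> v = odd (card {a. \<kappa> (fst v, snd v, a)})"

private lemma tri_sum_xor: "tri_sum (fxor f g) = fxor (tri_sum f) (tri_sum g)"
proof
 fix v
 have "(%a. fxor f g (fst v, snd v, a)) = fxor (%a. f (fst v, snd v, a)) (%a. g (fst v, snd v, a))"
  by (simp add: fxor_def fun_eq_iff)
 then show "tri_sum (fxor f g) v = fxor (tri_sum f) (tri_sum g) v"
  using odd_card_xor[of "%a. f (fst v, snd v, a)" "%a. g (fst v, snd v, a)"]
  by (simp add: tri_sum_def fxor_def)
qed

private lemma Sym_xor: "f \<in> Sym ==> g \<in> Sym ==> fxor f g \<in> Sym"
 unfolding Sym_def using supported_xor by (auto simp: fxor_def)

text \<open>The triples with \<open>\<kappa>\<close> true are exchanged in pairs by \<open>\<tau>\<close>, so the values of \<open>tri_sum\<close> add up to zero.\<close>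

private lemma tri_sum_even:
 assumes \<kappa>: "\<kappa> \<in> Sym"
 shows "tri_sum \<kappa> \<in> supported V" "even (card (Collect (tri_sum \<kappa>)))"
proof -
 have sup: "\<kappa> x ==> x \<in> flags V" for x using \<kappa> unfolding Sym_def supported_def by blast
 show ts: "tri_sum \<kappa> \<in> supported V"
  unfolding supported_def
 proof (intro CollectI allI impI)
  fix v assume "tri_sum \<kappa> v"
  then have "{a. \<kappa> (fst v, snd v, a)} ~= {}" unfolding tri_sum_def by (metis card.empty even_zero)
  then obtain a where "\<kappa> (fst v, snd v, a)" by blast
  from sup[OF this] show "v \<in> V" by (simp add: flags_def)
 qed
 have "even (card (Collect \<kappa>))"
 proof -
  have "\<tau> x \<in> Collect \<kappa> & \<tau> (\<tau> x) = x & \<tau> x ~= x" if "x \<in> Collect \<kappa>" for x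
   using \<tau>_props[OF sup] \<kappa> sup that unfolding Sym_def by blast
  moreover have "finite (Collect \<kappa>)" by simp
  ultimately have "2 * card (Collect \<kappa> // {(x, y). x \<in> Collect \<kappa> & (y = x \<or> y = \<tau> x)}) = card (Collect \<kappa>)"
   by (intro involution_pairs(2)[OF _ _ refl])
  from dvdI[OF this[symmetric]] show ?thesis .
 qed
 moreover have "card (Collect \<kappa>) = (\<Sum>v\<in>V. card {a. \<kappa> (fst v, snd v, a)})"
 proof -
  have "bij_betw (%(i, p, a). ((i, p), a)) (Collect \<kappa>) (SIGMA v:V. {a. \<kappa> (fst v, snd v, a)})"
   by (rule bij_betw_byWitness[where f' = "%((i, p), a). (i, p, a)"]) (use sup in \<open>auto simp: flags_def\<close>)
  then have "card (Collect \<kappa>) = card (SIGMA v:V. {a. \<kappa> (fst v, snd v, a)})" by (rule bij_betw_same_card)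
  also have "\<dots> = (\<Sum>v\<in>V. card {a. \<kappa> (fst v, snd v, a)})" by (rule card_SigmaI) auto
  finally show ?thesis .
 qed
 ultimately have "even (card {v \<in> V. odd (card {a. \<kappa> (fst v, snd v, a)})})" by (simp only: even_sum_iff[OF finV(1)])
 moreover have "{v \<in> V. odd (card {a. \<kappa> (fst v, snd v, a)})} = Collect (tri_sum \<kappa>)"
  using ts unfolding tri_sum_def supported_def by blast
 ultimately show "even (card (Collect (tri_sum \<kappa>)))" by simp
qed

text \<open>The image has index two. It contains the sum of the indicators of any two corners, because the link is
connected, and it contains no single indicator, by parity.\<close>

private lemma card_tri_sum_image: "2 * card (tri_sum ` Sym) = 2 ^ card V"
proof -
 let ?I = "tri_sum ` Sym"
 have I_xor: "fxor u w \<in> ?I" if uw: "u \<in> ?I" "w \<in> ?I" for u w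
 proof -
  obtain f g where "f \<in> Sym" "g \<in> Sym" "u = tri_sum f" "w = tri_sum g" using uw by blast
  then have "fxor u w = tri_sum (fxor f g)" "fxor f g \<in> Sym" using tri_sum_xor Sym_xor by auto
  then show ?thesis by blast
 qed
 have I_zero: "(%_. False) \<in> ?I"
 proof (rule image_eqI)
  show "(%_. False) = tri_sum (%_. False)" by (rule ext) (simp add: tri_sum_def)
  show "(%_. False) \<in> Sym" by (simp add: Sym_def supported_def)
 qed
 have adj: "fxor ((=) (i, p)) ((=) (nbr T i a, perm T i a p)) \<in> ?I" if "(i, p) \<in> V" "a ~= p" for i p a
 proof (rule image_eqI)
  define x where "x = (i, p, a)"
  have x: "x \<in> flags V" using that by (simp add: x_def flags_def)
  have one: "tri_sum ((=) (j, q, b)) = (=) (j, q)" for j q b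
  proof
   fix v :: "'t \<times> 4"
   have "{c. (j, q, b) = (fst v, snd v, c)} = (if (j, q) = v then {b} else {})" by auto
   then show "tri_sum ((=) (j, q, b)) v = ((j, q) = v)" by (simp add: tri_sum_def)
  qed
  show "fxor ((=) (i, p)) ((=) (nbr T i a, perm T i a p)) = tri_sum (fxor ((=) x) ((=) (\<tau> x)))"
   unfolding tri_sum_xor x_def \<tau> one ..
  show "fxor ((=) x) ((=) (\<tau> x)) \<in> Sym"
   unfolding Sym_def
  proof (intro CollectI conjI ballI)
   show "fxor ((=) x) ((=) (\<tau> x)) \<in> supported (flags V)"
    unfolding supported_def fxor_def using x \<tau>_props[OF x] by blast
   fix y assume y: "y \<in> flags V"
   have "(x = \<tau> y) = (\<tau> x = y)" "(\<tau> x = \<tau> y) = (x = y)" using \<tau>_props[OF x] \<tau>_props[OF y] by metis+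
   then show "fxor ((=) x) ((=) (\<tau> x)) (\<tau> y) = fxor ((=) x) ((=) (\<tau> x)) y" unfolding fxor_def by argo
  qed
 qed
 have pair: "fxor ((=) v) ((=) w) \<in> ?I" if v: "v \<in> V" and w: "w \<in> V" for v w
 proof (rule corner_class_induct[OF fp V v w])
  show "fxor ((=) v) ((=) v) \<in> ?I" using I_zero by (simp add: xor_self)
  fix i p a assume *: "(i, p) \<in> V" "fxor ((=) v) ((=) (i, p)) \<in> ?I" "a ~= p"
  have "fxor ((=) v) ((=) (nbr T i a, perm T i a p)) =
    fxor (fxor ((=) v) ((=) (i, p))) (fxor ((=) (i, p)) ((=) (nbr T i a, perm T i a p)))"
   by (auto simp: fxor_def fun_eq_iff)
  then show "fxor ((=) v) ((=) (nbr T i a, perm T i a p)) \<in> ?I"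
   using I_xor[OF *(2) adj[OF *(1,3)]] by simp
 qed
 obtain v where v: "v \<in> V" using corner_class_nonempty[OF V] by blast
 define e where "e = ((=) v)"
 have "(%x. x \<in> A) \<in> ?I \<union> fxor e ` ?I" if "A \<subseteq> V" for A
  using finite_subset[OF that finV(1)] that
 proof (induction A rule: finite_induct)
  case empty
  then show ?case using I_zero by simp
 next
  case (insert w A)
  have w: "fxor e ((=) w) \<in> ?I" unfolding e_def by (rule pair[OF v]) (use insert.prems in blast)
  have eq: "(%x. x \<in> insert w A) = fxor e (fxor (fxor e ((=) w)) (%x. x \<in> A))"
   using insert.hyps(2) by (auto simp: fxor_def fun_eq_iff)
  have ac: "fxor e (fxor w' (fxor e g)) = fxor w' g" for w' g by (auto simp: fxor_def fun_eq_iff)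
  from insert.IH insert.prems have "(%x. x \<in> A) \<in> ?I \<union> fxor e ` ?I" by blast
  then show ?case
  proof
   assume "(%x. x \<in> A) \<in> ?I"
   then show ?thesis unfolding eq using I_xor[OF w] by blast
  next
   assume "(%x. x \<in> A) \<in> fxor e ` ?I"
   then obtain g where g: "g \<in> ?I" "(%x. x \<in> A) = fxor e g" by blast
   show ?thesis unfolding eq g(2) ac using I_xor[OF w g(1)] by blast
  qed
 qed
 then have all: "(%x. x \<in> Collect u) \<in> ?I \<union> fxor e ` ?I" if "Collect u \<subseteq> V" for u using that by blast
 have "supported V \<subseteq> ?I \<union> fxor e ` ?I"
 proof
  fix u assume "u \<in> supported V"
  then have "Collect u \<subseteq> V" unfolding supported_def by blast
  from all[OF this] show "u \<in> ?I \<union> fxor e ` ?I" by simp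
 qed
 moreover have "?I \<union> fxor e ` ?I \<subseteq> supported V"
 proof -
  have "e \<in> supported V" using v by (simp add: e_def supported_def del: split_paired_All)
  then show ?thesis using tri_sum_even(1) supported_xor by blast
 qed
 ultimately have "supported V = ?I \<union> fxor e ` ?I" by blast
 moreover have "?I \<inter> fxor e ` ?I = {}"
 proof (rule equals0I)
  fix u assume "u \<in> ?I \<inter> fxor e ` ?I"
  then obtain g where g: "g \<in> ?I" "u = fxor e g" "u \<in> ?I" by blast
  have "fxor u g = e" unfolding g(2) by (auto simp: fxor_def fun_eq_iff)
  then have "e \<in> ?I" using I_xor[OF g(3,1)] by simp
  then have "even (card (Collect e))" using tri_sum_even(2) by blast
  moreover have "Collect e = {v}" by (auto simp: e_def)
  ultimately show False by simp
 qed
 moreover have "card (fxor e ` ?I) = card ?I" by (rule card_image) (metis inj_onI xor_cancel)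
 moreover have "finite ?I" using finite_subset[OF _ finite_supported[OF finV(2)], of Sym] by (auto simp: Sym_def)
 ultimately have "card (supported V) = card ?I + card ?I" by (simp add: card_Un_disjoint)
 then show ?thesis using card_supported[OF finV(1)] by simp
qed

text \<open>Values on the sides of the link which add up to zero in each triangle: the simplicial
cocycles of the link, whereas those of \<open>Coc\<close> live on the dual graph.\<close>

private definition "Tri = {\<kappa> \<in> Sym. tri_sum \<kappa> = (%_. False)}"

private lemma card_Tri: "card Tri * 2 ^ card V = 2 * card Sym"
proof -
 have "finite Sym" using finite_supported[OF finV(2)] by (rule finite_subset[rotated]) (auto simp: Sym_def)
 then have "card Sym = card (tri_sum ` Sym) * card Tri"
  using card_xor_image[of Sym tri_sum] Sym_xor tri_sum_xor unfolding Tri_def by simp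
 then show ?thesis using card_tri_sum_image by (simp add: ac_simps)
qed

text \<open>Functions on the vertices of each triangle whose jump across a side is the same at both ends of
the side.\<close>

private definition "Grp = {g \<in> supported (flags V). \<forall>i p a b c. (i, p) \<in> V --> a ~= p --> b ~= p --> b ~= a -->
  c ~= p --> c ~= a --> (g (i, p, b) ~= g (flag_move T a (i, p, b))) = (g (i, p, c) ~= g (flag_move T a (i, p, c)))}"

private lemma GrpD:
 assumes "g \<in> Grp" "(i, p) \<in> V" "a ~= p" "b ~= p" "b ~= a" "c ~= p" "c ~= a"
 shows "(g (i, p, b) ~= g (flag_move T a (i, p, b))) = (g (i, p, c) ~= g (flag_move T a (i, p, c)))"
proof -
 have "\<forall>i p a b c. (i, p) \<in> V --> a ~= p --> b ~= p --> b ~= a -->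
  c ~= p --> c ~= a --> (g (i, p, b) ~= g (flag_move T a (i, p, b))) = (g (i, p, c) ~= g (flag_move T a (i, p, c)))"
  using assms(1)[unfolded Grp_def, THEN CollectD, THEN conjunct2] .
 from this[rule_format, OF assms(2-7)] show ?thesis .
qed

private lemma Grp_supp: "g \<in> Grp ==> g \<in> supported (flags V)" by (simp add: Grp_def)

private lemma GrpI:
 assumes "g \<in> supported (flags V)"
  "\<And>i p a b c. (i, p) \<in> V ==> a ~= p ==> b ~= p ==> b ~= a ==> c ~= p ==> c ~= a ==>
   (g (i, p, b) ~= g (flag_move T a (i, p, b))) = (g (i, p, c) ~= g (flag_move T a (i, p, c)))"
 shows "g \<in> Grp"
 unfolding Grp_def by (intro CollectI conjI allI impI assms)

private lemma Grp_xor: "f \<in> Grp ==> g \<in> Grp ==> fxor f g \<in> Grp"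
proof (rule GrpI)
 assume f: "f \<in> Grp" and g: "g \<in> Grp"
 show "fxor f g \<in> supported (flags V)" by (intro supported_xor Grp_supp f g)
 fix i p a b c assume *: "(i, p) \<in> V" "a ~= p" "b ~= p" "b ~= a" "c ~= p" "c ~= a"
 from GrpD[OF f *] GrpD[OF g *]
 show "(fxor f g (i, p, b) ~= fxor f g (flag_move T a (i, p, b))) = (fxor f g (i, p, c) ~= fxor f g (flag_move T a (i, p, c)))"
  unfolding fxor_def by argo
qed

private lemma finite_Grp: "finite Grp"
 using finite_supported[OF finV(2)] by (rule finite_subset[rotated]) (auto simp: Grp_def)

text \<open>For each side of a corner, the sum of \<open>g\<close> over the two edges of that side.\<close>

private definition opp :: "('t \<times> 4 \<times> 4 => bool) => 't \<times> 4 \<times> 4 => bool" where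
 "opp g x \<longleftrightarrow> (case x of (i, p, a) => (i, p, a) \<in> flags V & odd (card {c. c ~= p & c ~= a & g (i, p, c)}))"

private lemma opp_eq:
 assumes "(i, p) \<in> V" "UNIV = {p, a, b, c}" "a ~= p" "b ~= p" "b ~= a" "c ~= p" "c ~= a" "b ~= c"
 shows "opp g (i, p, a) = (g (i, p, b) ~= g (i, p, c))"
proof -
 have "{d. d ~= p & d ~= a & g (i, p, d)} = {d \<in> {p, a, b, c}. d ~= p & d ~= a & g (i, p, d)}"
  using assms(2) by auto
 also have "\<dots> = (if g (i, p, b) then {b} else {}) \<union> (if g (i, p, c) then {c} else {})"
  using assms by auto
 finally show ?thesis using assms by (simp add: opp_def flags_def)
qed

private lemma tri_sum_eq:
 assumes "g \<in> supported (flags V)" "UNIV = {p, a, b, c}" "a ~= p" "b ~= p" "b ~= a" "c ~= p" "c ~= a" "b ~= c"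
 shows "tri_sum g (i, p) = ((g (i, p, a) ~= g (i, p, b)) ~= g (i, p, c))"
proof -
 have "\<not> g (i, p, p)" using assms(1) by (auto simp: supported_def flags_def)
 then have "{d. g (i, p, d)} = {d \<in> {p, a, b, c}. d ~= p & g (i, p, d)}"
  using assms(2) by (metis UNIV_I)
 also have "\<dots> = (if g (i, p, a) then {a} else {}) \<union> (if g (i, p, b) then {b} else {}) \<union> (if g (i, p, c) then {c} else {})"
  using assms by auto
 finally show ?thesis using assms by (simp add: tri_sum_def)
qed

private lemma flag_move_opp:
 assumes "(i, p) \<in> V" "UNIV = {p, a, b, c}" "a ~= p" "b ~= p" "b ~= a" "c ~= p" "c ~= a" "b ~= c"
 shows "opp g (\<tau> (i, p, a)) = (g (flag_move T a (i, p, b)) ~= g (flag_move T a (i, p, c)))"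
proof -
 have "UNIV = range (perm T i a)" using face_pairingD(1)[OF fp] by (simp add: bij_is_surj)
 then have "UNIV = {perm T i a p, perm T i a a, perm T i a b, perm T i a c}" unfolding assms(2) by simp
 then show ?thesis unfolding \<tau> flag_move_def prod.case
  by (intro opp_eq) (use assms corner_class_step[OF V assms(1,3)] in \<open>simp_all add: perm_inj[OF fp]\<close>)
qed

private lemma opp_xor: "opp (fxor f g) = fxor (opp f) (opp g)"
proof
 fix x :: "'t \<times> 4 \<times> 4"
 obtain i p a where x: "x = (i, p, a)" by (cases x)
 show "opp (fxor f g) x = fxor (opp f) (opp g) x"
 proof (cases "x \<in> flags V")
  case True
  then have pV: "(i, p) \<in> V" and "a ~= p" by (auto simp: x flags_def)
  from four_elements[OF \<open>a ~= p\<close>] obtain b c where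
   *: "b ~= p" "b ~= a" "c ~= p" "c ~= a" "b ~= c" "UNIV = {p, a, b, c}" by metis
  note e = opp_eq[OF pV *(6) \<open>a ~= p\<close> *(1-5)]
  show ?thesis unfolding x e fxor_def by argo
 qed (auto simp: x opp_def fxor_def)
qed

text \<open>In a triangle, values on the sides are sums of values at the ends if and only if they add up to zero;
the same values on the opposite vertices may then be used, which makes \<open>opp\<close> the identity on \<open>Tri\<close>.\<close>

private lemma opp_image: "opp ` Grp = Tri"
proof
 show "opp ` Grp \<subseteq> Tri"
 proof (rule image_subsetI)
  fix g assume g: "g \<in> Grp"
  have sup: "opp g \<in> supported (flags V)" by (auto simp: supported_def opp_def)
  have "opp g (\<tau> x) = opp g x" if x: "x \<in> flags V" for x
  proof -
   obtain i p a where xi: "x = (i, p, a)" by (cases x)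
   then have pV: "(i, p) \<in> V" and ap: "a ~= p" using x by (auto simp: flags_def)
   from four_elements[OF ap] obtain b c where
    *: "b ~= p" "b ~= a" "c ~= p" "c ~= a" "b ~= c" "UNIV = {p, a, b, c}" by metis
   show ?thesis
    using opp_eq[OF pV *(6) ap *(1-5), of g] flag_move_opp[OF pV *(6) ap *(1-5), of g] GrpD[OF g pV ap *(1-4)]
    unfolding xi by argo
  qed
  then have "opp g \<in> Sym" unfolding Sym_def using sup by blast
  moreover have "tri_sum (opp g) v = False" for v
  proof (cases "v \<in> V")
   case True
   obtain i p where v: "v = (i, p)" by (cases v)
   obtain a where ap: "a ~= p" using exists_third by blast
   from four_elements[OF ap] obtain b c where
    *: "b ~= p" "b ~= a" "c ~= p" "c ~= a" "b ~= c" "UNIV = {p, a, b, c}" by metis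
   have pV: "(i, p) \<in> V" using True v by simp
   have "opp g (i, p, a) = (g (i, p, b) ~= g (i, p, c))" by (rule opp_eq[OF pV *(6) ap *(1-5)])
   moreover have "opp g (i, p, b) = (g (i, p, a) ~= g (i, p, c))" by (rule opp_eq[OF pV]) (use * ap in auto)
   moreover have "opp g (i, p, c) = (g (i, p, a) ~= g (i, p, b))" by (rule opp_eq[OF pV]) (use * ap in auto)
   ultimately show ?thesis using tri_sum_eq[OF sup *(6) ap *(1-5), of i] unfolding v by argo
  next
   case False
   then have "\<not> opp g (fst v, snd v, a)" for a by (simp add: opp_def flags_def)
   then show ?thesis by (simp add: tri_sum_def)
  qed
  ultimately show "opp g \<in> Tri" unfolding Tri_def by auto
 qed
next
 show "Tri \<subseteq> opp ` Grp"
 proof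
  fix l assume l: "l \<in> Tri"
  then have sup: "l \<in> supported (flags V)" and sym: "\<And>x. x \<in> flags V ==> l (\<tau> x) = l x"
   and tri: "\<And>v. \<not> tri_sum l v" by (auto simp: Tri_def Sym_def fun_eq_iff)
  have opp: "opp l x = l x" if x: "x \<in> flags V" for x
  proof -
   obtain i p a where xi: "x = (i, p, a)" by (cases x)
   then have pV: "(i, p) \<in> V" and ap: "a ~= p" using x by (auto simp: flags_def)
   from four_elements[OF ap] obtain b c where
    *: "b ~= p" "b ~= a" "c ~= p" "c ~= a" "b ~= c" "UNIV = {p, a, b, c}" by metis
   show ?thesis using opp_eq[OF pV *(6) ap *(1-5), of l] tri_sum_eq[OF sup *(6) ap *(1-5), of i] tri[of "(i, p)"] unfolding xi by argo
  qed
  have "opp l = l"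
  using opp sup unfolding opp_def supported_def by blast
  moreover have "l \<in> Grp"
  proof (rule GrpI[OF sup])
   fix i p a b c assume *: "(i, p) \<in> V" "a ~= p" "b ~= p" "b ~= a" "c ~= p" "c ~= a"
   show "(l (i, p, b) ~= l (flag_move T a (i, p, b))) = (l (i, p, c) ~= l (flag_move T a (i, p, c)))"
   proof (cases "b = c")
    case False
    have U: "UNIV = {p, a, b, c}" by (rule card_subset_eq[symmetric]) (use * False in auto)
    have x: "(i, p, a) \<in> flags V" using * by (simp add: flags_def)
    show ?thesis
     using opp_eq[OF *(1) U *(2-6) False, of l] flag_move_opp[OF *(1) U *(2-6) False, of l]
      opp[OF x] sym[OF x] opp[of "\<tau> (i, p, a)"] \<tau>_props[OF x] by argo
   qed simp
  qed
  ultimately show "l \<in> opp ` Grp" by (metis image_eqI)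
 qed
qed

private lemma card_opp_kernel: "card {g \<in> Grp. opp g = (%_. False)} = 2 ^ card V"
proof -
 have "bij_betw (%u (i, p, a). u (i, p) & a ~= p) (supported V) {g \<in> Grp. opp g = (%_. False)}"
 proof (rule bij_betw_byWitness[where f' = "%g (i, p). \<exists>a. g (i, p, a)"])
  show "\<forall>u\<in>supported V. (%(i, p). \<exists>a. (%(i, p, a). u (i, p) & a ~= p) (i, p, a)) = u"
   using exists_third by (auto simp: fun_eq_iff)
  have const: "g (i, p, b) = g (i, p, c)" if g: "g \<in> Grp" "opp g = (%_. False)" and "b ~= p" "c ~= p" for g i p b c
  proof (cases "(i, p) \<in> V & b ~= c")
   case True
   obtain a where a: "a ~= p" "a ~= b" "a ~= c" using exists_fourth by blast
   have U: "UNIV = {p, a, b, c}" by (rule card_subset_eq[symmetric]) (use that a True in auto)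
   have "opp g (i, p, a) = (g (i, p, b) ~= g (i, p, c))"
    by (rule opp_eq) (use True a that U in auto)
   then show ?thesis using g(2) by simp
  next
   case False
   then show ?thesis using Grp_supp[OF g(1)] by (auto simp: supported_def flags_def)
  qed
  show "\<forall>g\<in>{g \<in> Grp. opp g = (%_. False)}. (%(i, p, a). (%(i, p). \<exists>a. g (i, p, a)) (i, p) & a ~= p) = g"
  proof (intro ballI ext)
   fix g and x :: "'t \<times> 4 \<times> 4" assume g: "g \<in> {g \<in> Grp. opp g = (%_. False)}"
   obtain i p a where x: "x = (i, p, a)" by (cases x)
   have ne: "g (i, p, b) ==> b ~= p" for b using Grp_supp g by (auto simp: supported_def flags_def)
   have "(\<exists>b. g (i, p, b)) & a ~= p \<longleftrightarrow> g (i, p, a)" using const[of g] g ne by blast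
   then show "(%(i, p, a). (%(i, p). \<exists>a. g (i, p, a)) (i, p) & a ~= p) x = g x" by (simp add: x)
  qed
  show "(%g (i, p). \<exists>a. g (i, p, a)) ` {g \<in> Grp. opp g = (%_. False)} \<subseteq> supported V"
  using Grp_supp by (auto simp: supported_def flags_def)
  show "(%u (i, p, a). u (i, p) & a ~= p) ` supported V \<subseteq> {g \<in> Grp. opp g = (%_. False)}"
  proof (rule image_subsetI)
   fix u assume u: "u \<in> supported V"
   let ?g = "%(i, p, a). u (i, p) & a ~= p"
   have "?g \<in> Grp"
    by (rule GrpI) (use u in \<open>auto simp: supported_def flags_def flag_move_def perm_inj[OF fp]\<close>)
   moreover have "opp ?g x = False" for x
   proof (cases "x \<in> flags V")
    case True
    obtain i p a where xi: "x = (i, p, a)" by (cases x)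
    then have pV: "(i, p) \<in> V" and ap: "a ~= p" using True by (auto simp: flags_def)
    from four_elements[OF ap] obtain b c where
     *: "b ~= p" "b ~= a" "c ~= p" "c ~= a" "b ~= c" "UNIV = {p, a, b, c}" by metis
    show ?thesis using opp_eq[OF pV *(6) ap *(1-5), of ?g] * by (simp add: xi)
   qed (auto simp: opp_def split: prod.splits)
   ultimately show "?g \<in> {g \<in> Grp. opp g = (%_. False)}" by (auto simp: fun_eq_iff)
  qed
 qed
 then have "card (supported V) = card {g \<in> Grp. opp g = (%_. False)}" by (rule bij_betw_same_card)
 then show ?thesis by (simp add: card_supported finV(1))
qed

private lemma card_Grp: "card Grp = card Tri * 2 ^ card V"
 using card_xor_image[OF finite_Grp Grp_xor opp_xor] card_opp_kernel opp_image by simp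

text \<open>The common jump across a side; its kernel consists of the functions on the edge ends.\<close>

private definition transition :: "('t \<times> 4 \<times> 4 => bool) => 't \<times> 4 \<times> 4 => bool" where
 "transition g x \<longleftrightarrow> (case x of (i, p, a) => (i, p, a) \<in> flags V &
   (\<exists>c. c ~= p & c ~= a & g (i, p, c) ~= g (flag_move T a (i, p, c))))"

private lemma transition_eq:
 assumes "g \<in> Grp" "(i, p) \<in> V" "a ~= p" "c ~= p" "c ~= a"
 shows "transition g (i, p, a) = (g (i, p, c) ~= g (flag_move T a (i, p, c)))"
using GrpD assms(1-3) assms(4,5) unfolding transition_def flags_def by blast

private lemma transition_xor: "f \<in> Grp ==> g \<in> Grp ==> transition (fxor f g) = fxor (transition f) (transition g)"
proof
 fix x :: "'t \<times> 4 \<times> 4" assume fg: "f \<in> Grp" "g \<in> Grp"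
 obtain i p a where x: "x = (i, p, a)" by (cases x)
 show "transition (fxor f g) x = fxor (transition f) (transition g) x"
 proof (cases "x \<in> flags V")
  case True
  then have pV: "(i, p) \<in> V" and "a ~= p" by (auto simp: x flags_def)
  obtain c where c: "c ~= p" "c ~= a" using exists_third by blast
  note e = transition_eq[OF _ pV \<open>a ~= p\<close> c]
  show ?thesis unfolding x e[OF Grp_xor[OF fg]] fxor_def e[OF fg(1)] e[OF fg(2)] by argo
 qed (auto simp: x transition_def fxor_def)
qed

private definition "Coc = {\<kappa> \<in> supported (flags V). corner_cocycle T V (%i p a. \<kappa> (i, p, a))}"

private lemma transition_image: "transition ` Grp = Coc"
proof
 show "transition ` Grp \<subseteq> Coc"
 proof (rule image_subsetI)
  fix g assume g: "g \<in> Grp"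
  have "corner_cocycle T V (%i p a. transition g (i, p, a))"
   unfolding corner_cocycle_def
   by (intro exI[of _ "%i p c. g (i, p, c)"] allI impI)
    (use transition_eq[OF g] in \<open>simp add: flag_move_def\<close>)
  moreover have "transition g \<in> supported (flags V)" by (auto simp: transition_def supported_def)
  ultimately show "transition g \<in> Coc" by (simp add: Coc_def)
 qed
 show "Coc \<subseteq> transition ` Grp"
 proof
  fix \<kappa> assume \<kappa>: "\<kappa> \<in> Coc"
  then have sup: "\<kappa> \<in> supported (flags V)" and "corner_cocycle T V (%i p a. \<kappa> (i, p, a))" by (auto simp: Coc_def)
  then obtain g :: "'t => 4 => 4 => bool" where g': "\<forall>i p a c. (i, p) \<in> V --> a ~= p --> c ~= p --> c ~= a -->
    \<kappa> (i, p, a) = (g i p c ~= g (nbr T i a) (perm T i a p) (perm T i a c))"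
   unfolding corner_cocycle_def by (-, atomize_elim, auto)
  note g = g'[rule_format]
  define h where "h x \<longleftrightarrow> (case x of (i, p, c) => (i, p, c) \<in> flags V & g i p c)" for x
  have h: "(h (i, p, c) ~= h (flag_move T a (i, p, c))) = \<kappa> (i, p, a)"
   if "(i, p) \<in> V" "a ~= p" "c ~= p" "c ~= a" for i p a c
  proof -
   have "(i, p, c) \<in> flags V" "flag_move T a (i, p, c) \<in> flags V"
    using that flag_move_in[OF fp V, of i p c a] by (auto simp: flags_def)
   then show ?thesis using g[OF that] by (simp add: h_def flag_move_def)
  qed
  have hG: "h \<in> Grp"
   by (rule GrpI) (use h in \<open>auto simp: h_def supported_def\<close>)
  have "transition h = \<kappa>"
  proof
   fix x :: "'t \<times> 4 \<times> 4"
   obtain i p a where x: "x = (i, p, a)" by (cases x)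
   show "transition h x = \<kappa> x"
   proof (cases "x \<in> flags V")
    case True
    then have pV: "(i, p) \<in> V" and ap: "a ~= p" by (auto simp: x flags_def)
    obtain c where c: "c ~= p" "c ~= a" using exists_third by blast
    show ?thesis using transition_eq[OF hG pV ap c] h[OF pV ap c] by (simp add: x)
   next
    case False
    then show ?thesis using sup by (auto simp: x transition_def supported_def)
   qed
  qed
  with hG show "\<kappa> \<in> transition ` Grp" by blast
 qed
qed

private lemma card_transition_kernel:
 "card {g \<in> Grp. transition g = (%_. False)} = 2 ^ card (flags V // edge_flag_rel T V)"
proof -
 have inv: "(\<forall>i p c a. (i, p, c) \<in> flags V --> a ~= p --> a ~= c --> g (i, p, c) = g (flag_move T a (i, p, c)))
   \<longleftrightarrow> g \<in> Grp & transition g = (%_. False)" if sup: "g \<in> supported (flags V)" for g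
 proof
  assume *: "\<forall>i p c a. (i, p, c) \<in> flags V --> a ~= p --> a ~= c --> g (i, p, c) = g (flag_move T a (i, p, c))"
  then have "g \<in> Grp" by (intro GrpI[OF sup]) (auto simp: flags_def)
  moreover have "transition g = (%_. False)"
   using * by (auto simp: transition_def fun_eq_iff flags_def)
  ultimately show "g \<in> Grp & transition g = (%_. False)" by blast
 next
  assume *: "g \<in> Grp & transition g = (%_. False)"
  show "\<forall>i p c a. (i, p, c) \<in> flags V --> a ~= p --> a ~= c --> g (i, p, c) = g (flag_move T a (i, p, c))"
  using transition_eq * by (fastforce simp: flags_def)
 qed
 have "{g \<in> Grp. transition g = (%_. False)} =
   {g \<in> supported (flags V). \<forall>x y. (x, y) \<in> edge_flag_rel T V --> g x = g y}"
 proof (rule set_eqI)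
  fix g
  show "g \<in> {g \<in> Grp. transition g = (%_. False)} \<longleftrightarrow>
   g \<in> {g \<in> supported (flags V). \<forall>x y. (x, y) \<in> edge_flag_rel T V --> g x = g y}"
   unfolding mem_Collect_eq edge_flag_invariant_iff[OF fp V]
   by (cases "g \<in> supported (flags V)") (use inv[of g] Grp_supp[of g] in metis)+
 qed
 then show ?thesis using card_invariant_functions[OF finV(2) equiv_edge_flag_rel[OF fp V]] by simp
qed

private lemma card_Coc: "card Grp = card Coc * 2 ^ card (flags V // edge_flag_rel T V)"
 using card_xor_image[OF finite_Grp Grp_xor transition_xor] unfolding card_transition_kernel transition_image .

private definition corner_delta :: "('t \<times> 4 => bool) => 't \<times> 4 \<times> 4 => bool" where
 "corner_delta \<psi> x \<longleftrightarrow> (case x of (i, p, a) => (i, p, a) \<in> flags V & \<psi> (i, p) ~= \<psi> (nbr T i a, perm T i a p))"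

private definition "Cob = {\<kappa> \<in> supported (flags V). corner_coboundary T V (%i p a. \<kappa> (i, p, a))}"

private lemma corner_delta_image: "corner_delta ` supported V = Cob"
proof
 show "corner_delta ` supported V \<subseteq> Cob"
 by (auto simp: corner_coboundary_def corner_delta_def flags_def supported_def Cob_def)
 show "Cob \<subseteq> corner_delta ` supported V"
 proof
  fix \<kappa> assume "\<kappa> \<in> Cob"
  then have sup: "\<kappa> \<in> supported (flags V)" and "corner_coboundary T V (%i p a. \<kappa> (i, p, a))" by (auto simp: Cob_def)
  then obtain \<psi> :: "'t => 4 => bool" where \<psi>': "\<forall>i p a. (i, p) \<in> V --> a ~= p -->
    \<kappa> (i, p, a) = (\<psi> i p ~= \<psi> (nbr T i a) (perm T i a p))"
   unfolding corner_coboundary_def by (-, atomize_elim, auto)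
  define u where "u v \<longleftrightarrow> v \<in> V & \<psi> (fst v) (snd v)" for v
  have "corner_delta u = \<kappa>"
  proof
   fix x :: "'t \<times> 4 \<times> 4"
   obtain i p a where x: "x = (i, p, a)" by (cases x)
   show "corner_delta u x = \<kappa> x"
   proof (cases "x \<in> flags V")
    case True
    then have pV: "(i, p) \<in> V" and ap: "a ~= p" by (auto simp: x flags_def)
    then show ?thesis using \<psi>'[rule_format, OF pV ap] corner_class_step[OF V pV ap] True
     by (simp add: x corner_delta_def u_def)
   next
    case False
    then show ?thesis using sup by (auto simp: x corner_delta_def supported_def)
   qed
  qed
  moreover have "u \<in> supported V" by (simp add: u_def supported_def)
  ultimately show "\<kappa> \<in> corner_delta ` supported V" by blast
 qed
qed

private lemma card_Cob: "2 ^ card V = 2 * card Cob"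
proof -
 have "corner_delta (fxor f g) = fxor (corner_delta f) (corner_delta g)" for f g
 unfolding corner_delta_def fxor_def by blast
 then have "card (supported V) = card (corner_delta ` supported V) * card {\<psi> \<in> supported V. corner_delta \<psi> = (%_. False)}"
  by (intro card_xor_image finite_supported finV supported_xor)
 moreover have "{\<psi> \<in> supported V. corner_delta \<psi> = (%_. False)} = {%_. False, %v. v \<in> V}"
 proof
  show "{%_. False, %v. v \<in> V} \<subseteq> {\<psi> \<in> supported V. corner_delta \<psi> = (%_. False)}"
   using corner_class_step[OF V] by (auto simp: supported_def corner_delta_def flags_def fun_eq_iff)
  show "{\<psi> \<in> supported V. corner_delta \<psi> = (%_. False)} \<subseteq> {%_. False, %v. v \<in> V}"
  proof
   fix \<psi> assume "\<psi> \<in> {\<psi> \<in> supported V. corner_delta \<psi> = (%_. False)}"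
   then have sup: "\<psi> \<in> supported V" and d: "corner_delta \<psi> = (%_. False)" by auto
   obtain v where v: "v \<in> V" using corner_class_nonempty[OF V] by blast
   have "\<psi> w = \<psi> v" if w: "w \<in> V" for w
   proof (rule corner_class_induct[OF fp V v w])
    fix i p a assume *: "(i, p) \<in> V" "\<psi> (i, p) = \<psi> v" "a ~= p"
    have "\<not> corner_delta \<psi> (i, p, a)" using d by simp
    then show "\<psi> (nbr T i a, perm T i a p) = \<psi> v" using * by (simp add: corner_delta_def flags_def)
   qed simp
   then have "\<psi> = (if \<psi> v then (%v. v \<in> V) else (%_. False))" using sup by (auto simp: supported_def fun_eq_iff)
   then show "\<psi> \<in> {%_. False, %v. v \<in> V}" by (metis insertCI)
  qed
 qed
 moreover have "card {%_. False, %v. v \<in> V} = 2"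
  using corner_class_nonempty[OF V] by (simp add: fun_eq_iff card_insert_if)
 ultimately show ?thesis by (simp add: card_supported finV corner_delta_image)
qed

text \<open>Translating the hypothesis on \<open>\<Phi>\<close> from all functions to those supported on the flags of the
class, where counting is possible.\<close>

private lemma card_Coc_Cob:
 fixes \<Phi> :: "('t => 4 => 4 => bool) => bool \<times> bool"
 assumes inj: "\<And>\<kappa> \<mu>. corner_cocycle T V \<kappa> ==> corner_cocycle T V \<mu> ==>
   \<Phi> \<kappa> = \<Phi> \<mu> \<longleftrightarrow> corner_coboundary T V (%i p a. \<kappa> i p a ~= \<mu> i p a)"
  and surj: "\<And>b. \<exists>\<kappa>. corner_cocycle T V \<kappa> & \<Phi> \<kappa> = b"
 shows "card Coc = 4 * card Cob"
proof -
 define \<Phi>' where "\<Phi>' \<kappa> = \<Phi> (%i p a. \<kappa> (i, p, a))" for \<kappa>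
 have fin: "finite Coc" using finite_supported[OF finV(2)] by (rule finite_subset[rotated]) (auto simp: Coc_def)
 have inj': "\<Phi>' \<kappa> = \<Phi>' \<mu> \<longleftrightarrow> fxor \<kappa> \<mu> \<in> Cob" if "\<kappa> \<in> Coc" "\<mu> \<in> Coc" for \<kappa> \<mu>
 proof -
  have \<kappa>: "\<kappa> \<in> supported (flags V)" "corner_cocycle T V (%i p a. \<kappa> (i, p, a))"
   and \<mu>: "\<mu> \<in> supported (flags V)" "corner_cocycle T V (%i p a. \<mu> (i, p, a))"
   using that unfolding Coc_def by blast+
  have "\<Phi>' \<kappa> = \<Phi>' \<mu> \<longleftrightarrow> corner_coboundary T V (%i p a. \<kappa> (i, p, a) ~= \<mu> (i, p, a))"
   unfolding \<Phi>'_def by (rule inj[OF \<kappa>(2) \<mu>(2)])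
  also have "(%i p a. \<kappa> (i, p, a) ~= \<mu> (i, p, a)) = (%i p a. fxor \<kappa> \<mu> (i, p, a))" by (simp only: fxor_def)
  also have "corner_coboundary T V \<dots> \<longleftrightarrow> fxor \<kappa> \<mu> \<in> Cob"
   unfolding Cob_def using supported_xor[OF \<kappa>(1) \<mu>(1)] by blast
  finally show ?thesis .
 qed
 have Coc_xor: "fxor \<kappa> \<mu> \<in> Coc" if \<kappa>\<mu>: "\<kappa> \<in> Coc" "\<mu> \<in> Coc" for \<kappa> \<mu>
 proof -
  obtain f g where "f \<in> Grp" "g \<in> Grp" "\<kappa> = transition f" "\<mu> = transition g"
   using \<kappa>\<mu> unfolding transition_image[symmetric] by blast
  then have "fxor \<kappa> \<mu> = transition (fxor f g)" "fxor f g \<in> Grp" using transition_xor Grp_xor by simp_all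
  then show ?thesis unfolding transition_image[symmetric] by blast
 qed
 have Cob_Coc: "\<mu> \<in> Coc" if "\<mu> \<in> Cob" for \<mu>
 proof -
  have sup: "\<mu> \<in> supported (flags V)" and "corner_coboundary T V (%i p a. \<mu> (i, p, a))" using that by (auto simp: Cob_def)
  then have "corner_cocycle T V (%i p a. \<mu> (i, p, a))"
  by (auto simp: corner_coboundary_def corner_cocycle_def)
  with sup show ?thesis by (simp add: Coc_def)
 qed
 have surj': "\<exists>\<kappa>\<in>Coc. \<Phi>' \<kappa> = b" for b
 proof -
  obtain \<kappa> where \<kappa>: "corner_cocycle T V \<kappa>" "\<Phi> \<kappa> = b" using surj by blast
  define \<kappa>' where "\<kappa>' x \<longleftrightarrow> (case x of (i, p, a) => (i, p, a) \<in> flags V & \<kappa> i p a)" for x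
  have eq: "\<kappa>' (i, p, a) = \<kappa> i p a" if "(i, p) \<in> V" "a ~= p" for i p a using that by (simp add: \<kappa>'_def flags_def)
  have coc: "corner_cocycle T V (%i p a. \<kappa>' (i, p, a))"
   using \<kappa>(1) eq unfolding corner_cocycle_def by auto
  have "corner_coboundary T V (%i p a. \<kappa>' (i, p, a) ~= \<kappa> i p a)"
   unfolding corner_coboundary_def using eq by (intro exI[of _ "%_ _. False"]) auto
  then have "\<Phi>' \<kappa>' = b" using inj[OF coc \<kappa>(1)] \<kappa>(2) by (simp add: \<Phi>'_def)
  moreover have "\<kappa>' \<in> Coc" using coc by (auto simp: Coc_def supported_def \<kappa>'_def)
  ultimately show ?thesis by blast
 qed
 have "card {\<kappa> \<in> Coc. \<Phi>' \<kappa> = b} = card Cob" for b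
 proof -
  obtain \<kappa> where \<kappa>: "\<kappa> \<in> Coc" "\<Phi>' \<kappa> = b" using surj' by blast
  have "bij_betw (fxor \<kappa>) {\<mu> \<in> Coc. \<Phi>' \<mu> = b} Cob"
  proof (rule bij_betw_byWitness[where f' = "fxor \<kappa>"])
   show "fxor \<kappa> ` {\<mu> \<in> Coc. \<Phi>' \<mu> = b} \<subseteq> Cob" using inj'[OF \<kappa>(1)] \<kappa>(2) by blast
   show "fxor \<kappa> ` Cob \<subseteq> {\<mu> \<in> Coc. \<Phi>' \<mu> = b}"
   proof (rule image_subsetI)
    fix \<mu> assume \<mu>: "\<mu> \<in> Cob"
    then have "fxor \<kappa> \<mu> \<in> Coc" using Coc_xor[OF \<kappa>(1) Cob_Coc] by blast
    moreover from inj'[OF \<kappa>(1) this] \<mu> \<kappa>(2) have "\<Phi>' (fxor \<kappa> \<mu>) = b" by (simp add: xor_cancel)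
    ultimately show "fxor \<kappa> \<mu> \<in> {\<mu> \<in> Coc. \<Phi>' \<mu> = b}" by blast
   qed
  qed (simp_all add: xor_cancel)
  then show ?thesis by (rule bij_betw_same_card)
 qed
 moreover have "\<Phi>' ` Coc = UNIV" using surj' by (auto simp: image_iff) metis
 moreover have "card Coc = (\<Sum>b\<in>\<Phi>' ` Coc. card {\<kappa> \<in> Coc. \<Phi>' \<kappa> = b})"
  using sum.image_gen[OF fin, of "%_. 1::nat" \<Phi>'] by (simp only: card_eq_sum)
 ultimately have "card Coc = (\<Sum>b\<in>(UNIV :: (bool \<times> bool) set). card Cob)" by simp
 then show ?thesis by (simp add: UNIV_bool flip: UNIV_Times_UNIV)
qed

text \<open>Read as cochains on the link, cocycles and coboundaries are counted by ranks over the field with two elements: the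
coboundaries number \<open>2 ^ (card V - 1)\<close> as the link is connected, the hypothesis makes the cocycles four
times as many, and the functions in \<open>Grp\<close> are counted both over the cocycles they integrate and through their
sums over sides. Comparing the exponents gives that the Euler characteristic is zero.\<close>

lemma twice_card_edge_ends:
 fixes \<Phi> :: "('t => 4 => 4 => bool) => bool \<times> bool"
 assumes inj: "\<And>\<kappa> \<mu>. corner_cocycle T V \<kappa> ==> corner_cocycle T V \<mu> ==>
   \<Phi> \<kappa> = \<Phi> \<mu> \<longleftrightarrow> corner_coboundary T V (%i p a. \<kappa> i p a ~= \<mu> i p a)"
  and surj: "\<And>b. \<exists>\<kappa>. corner_cocycle T V \<kappa> & \<Phi> \<kappa> = b"
 shows "2 * card (flags V // edge_flag_rel T V) = card V"
proof -
 define n where "n = card (flags V // edge_flag_rel T V)"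
 have c: "card Coc = 4 * card Cob" by (rule card_Coc_Cob[OF assms])
 have "card Grp = 4 * card Cob * 2 ^ n" using card_Coc c unfolding n_def by simp
 also have "\<dots> = 2 * 2 ^ card V * 2 ^ n" using card_Cob by simp
 finally have "2 * card Sym = 2 * 2 ^ card V * 2 ^ n" using card_Grp card_Tri by simp
 then have "card Sym = 2 ^ (card V + n)" by (simp add: power_add)
 then have "(2::nat) ^ (card V + n + (card V + n)) = 2 ^ (3 * card V)" using card_Sym by (simp add: power_add)
 then have "card V + n + (card V + n) = 3 * card V" by (subst (asm) power_inject_exp) auto
 then show ?thesis unfolding n_def by simp
qed

end

section \<open>Deleted neighbourhoods of edge midpoints\<close>

text \<open>Removing one of two opposite rays from the ball leaves a starlike set, and the two sets meet in the
complement of a line, which is connected.\<close>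

lemma H1_trivial_punctured_ball:
 fixes m :: "real^3"
 assumes r: "r > 0"
 shows "H1_trivial (top_of_set (ball m r - {m}))"
proof -
 define ray where "ray s = {x :: real^3. x $ 1 = m $ 1 & x $ 2 = m $ 2 & 0 <= s * (x $ 3 - m $ 3)}" for s :: real
 (* The complement of the line through m is the union of four half-balls, each meeting the next. *)
 define H where "H k s = ball m r \<inter> {x. 0 < s * (x $ k - m $ k)}" for k :: 3 and s :: real
 have mray: "m \<in> ray s" for s by (simp add: ray_def)
 have axis_in: "m + (s * (r/4)) *\<^sub>R axis k 1 + (s' * (r/4)) *\<^sub>R axis k' 1 \<in> ball m r"
  if "\<bar>s\<bar> <= 1" "\<bar>s'\<bar> <= 1" for k k' :: 3 and s s'
 proof -
  let ?v = "(s * (r/4)) *\<^sub>R axis k 1 :: real^3" and ?w = "(s' * (r/4)) *\<^sub>R axis k' 1 :: real^3"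
  have "norm (?v + ?w) <= norm ?v + norm ?w" by (rule norm_triangle_ineq)
  also have "\<dots> = \<bar>s\<bar> * (r/4) + \<bar>s'\<bar> * (r/4)" using r by (simp add: norm_axis_1 abs_mult)
  also have "\<dots> <= 1 * (r/4) + 1 * (r/4)" using that r by (intro add_mono mult_right_mono) auto
  also have "\<dots> < r" using r by simp
  finally have "norm (?v + ?w) < r" .
  moreover have "dist m (m + z) = norm z" for z by (simp add: dist_norm)
  from this[of "?v + ?w"] have "dist m (m + ?v + ?w) = norm (?v + ?w)" by (simp only: add.assoc)
  ultimately show ?thesis by (simp only: mem_ball)
 qed
 have star: "starlike (ball m r - ray s)" if s: "s = 1 \<or> s = -1" for s
 proof -
  define c where "c = m + ((-s) * (r/4)) *\<^sub>R axis 3 1 + (0 * (r/4)) *\<^sub>R axis 3 1"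
  have c: "c $ 1 = m $ 1" "c $ 2 = m $ 2" "c $ 3 = m $ 3 - s * (r/4)"
   by (simp_all add: c_def axis_def)
  have cb: "c \<in> ball m r" unfolding c_def by (rule axis_in) (use s in auto)
  have key: "x \<in> ray s" if u: "0 <= u" "u <= 1" "(1 - u) *\<^sub>R c + u *\<^sub>R x \<in> ray s" for u x
  proof -
   from u(3) have e: "(1 - u) * m $ 1 + u * x $ 1 = m $ 1" "(1 - u) * m $ 2 + u * x $ 2 = m $ 2"
    "0 <= s * ((1 - u) * (m $ 3 - s * (r/4)) + u * x $ 3 - m $ 3)"
    by (simp_all add: ray_def c)
   have "s * ((1 - u) * (m $ 3 - s * (r/4)) + u * x $ 3 - m $ 3) = u * (s * (x $ 3 - m $ 3)) - (s * s) * ((1 - u) * (r/4))"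
    by (simp add: algebra_simps)
   moreover have "s * s = 1" using s by auto
   ultimately have 3: "(1 - u) * (r/4) <= u * (s * (x $ 3 - m $ 3))" using e(3) by simp
   have u0: "u > 0"
   proof (rule ccontr)
    assume "\<not> u > 0"
    then have "u = 0" using u by simp
    then show False using 3 r by simp
   qed
   have "u * (x $ 1 - m $ 1) = 0" "u * (x $ 2 - m $ 2) = 0" using e(1,2) by (simp_all add: algebra_simps)
   moreover have "0 <= (1 - u) * (r/4)" using u r by simp
   then have "0 <= u * (s * (x $ 3 - m $ 3))" using 3 by linarith
   then have "0 <= s * (x $ 3 - m $ 3)" using u0 by (simp add: zero_le_mult_iff)
   ultimately show ?thesis using u0 by (simp add: ray_def)
  qed
  show ?thesis
   unfolding starlike_def
  proof (intro bexI[of _ c] ballI subsetI)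
   show "c \<in> ball m r - ray s" using cb s r by (auto simp: ray_def c)
   fix x y assume x: "x \<in> ball m r - ray s" and y: "y \<in> closed_segment c x"
   have "y \<in> ball m r" using x y cb convex_contains_segment[of "ball m r"] by blast
   moreover have "y \<notin> ray s" using y key[of _ x] x unfolding in_segment by blast
   ultimately show "y \<in> ball m r - ray s" by blast
  qed
 qed
 have closed_ray: "closed (ray s)" for s
 proof -
  have "ray s = {x. x $ 1 = m $ 1} \<inter> {x. x $ 2 = m $ 2} \<inter> {x. 0 <= s * (x $ 3 - m $ 3)}" by (auto simp: ray_def)
  then show ?thesis by (auto intro!: closed_Int closed_Collect_eq closed_Collect_le continuous_intros)
 qed
 let ?X = "top_of_set (ball m r - {m})"
 have op: "openin ?X (ball m r - ray s)" for s
 using mray open_Diff closed_ray openin_open by fastforce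
 have sub: "subtopology ?X (ball m r - ray s) = top_of_set (ball m r - ray s)" for s
 proof -
  have "(ball m r - {m}) \<inter> (ball m r - ray s) = ball m r - ray s" using mray[of s] by blast
  then show ?thesis by (simp add: subtopology_subtopology)
 qed
 have triv: "H1_trivial (subtopology ?X (ball m r - ray s))" if "s = 1 \<or> s = -1" for s
  unfolding sub by (rule H1_trivial_starlike[OF star[OF that]])
 have conv: "connected (H k s)" for k s
 proof -
  have "H k s = ball m r \<inter> {x. axis k s \<bullet> x > s * (m $ k)}"
   by (auto simp: H_def inner_axis' algebra_simps)
  then show ?thesis by (auto intro!: convex_connected convex_Int convex_halfspace_gt)
 qed
 have meet: "H 1 s \<inter> H 2 s' ~= {}" if "s = 1 \<or> s = -1" "s' = 1 \<or> s' = -1" for s s'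
 proof -
  let ?x = "m + (s * (r/4)) *\<^sub>R axis 1 1 + (s' * (r/4)) *\<^sub>R axis 2 1"
  have "?x \<in> ball m r" by (rule axis_in) (use that in auto)
  moreover have "?x $ 1 = m $ 1 + s * (r/4)" "?x $ 2 = m $ 2 + s' * (r/4)" by (simp_all add: axis_def)
  ultimately have "?x \<in> H 1 s \<inter> H 2 s'" using that r by (auto simp: H_def)
  then show ?thesis by blast
 qed
 have line: "(ball m r - ray 1) \<inter> (ball m r - ray (-1)) = ((H 1 1 \<union> H 2 1) \<union> H 1 (-1)) \<union> H 2 (-1)"
  by (auto simp: ray_def H_def)
 have "connected (((H 1 1 \<union> H 2 1) \<union> H 1 (-1)) \<union> H 2 (-1))"
  by (intro connected_Un conv) (use meet[of 1 1] meet[of "-1" 1] meet[of 1 "-1"] in blast)+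
 then have conn: "connectedin ?X ((ball m r - ray 1) \<inter> (ball m r - ray (-1)))"
  unfolding line[symmetric] using mray by (auto simp: connectedin_subtopology)
 have cover: "(ball m r - ray 1) \<union> (ball m r - ray (-1)) = topspace ?X"
 proof -
  have "x = m" if "x \<in> ray 1" "x \<in> ray (-1)" for x
   using that by (auto simp: ray_def vec_eq_iff forall_3)
  then show ?thesis using mray by auto
 qed
 show ?thesis
  by (rule H1_trivial_Un[OF op triv op triv cover conn]) auto
qed

lemma locally_constant_pullback:
 assumes "continuous_map X Y g" "locally_constant_on Y P"
 shows "locally_constant_on X (%x. P (g x))"
 unfolding locally_constant_on_def
proof
 fix x assume x: "x \<in> topspace X"
 then have "g x \<in> topspace Y" using assms(1) by (auto simp: continuous_map_def)
 then obtain U where U: "openin Y U" "g x \<in> U" "\<forall>y\<in>U. P y = P (g x)"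
  using assms(2) unfolding locally_constant_on_def by blast
 let ?W = "{z \<in> topspace X. g z \<in> U}"
 have "openin X ?W" by (rule openin_continuous_map_preimage[OF assms(1) U(1)])
 moreover have "x \<in> ?W" using x U(2) by blast
 moreover have "\<forall>y\<in>?W. P (g y) = P (g x)" using U(3) by blast
 ultimately show "\<exists>U. openin X U & x \<in> U & (\<forall>y\<in>U. P (g y) = P (g x))" by blast
qed

text \<open>Around a point of a chart there are arbitrarily small neighbourhoods corresponding to a ball in the model \<open>H\<close>.\<close>

lemma chart_ball:
 fixes V :: "'b::euclidean_space set"
 assumes U: "openin X U" "x \<in> U" and V: "openin (top_of_set H) V"
  and \<phi>: "homeomorphic_map (subtopology X U) (top_of_set V) \<phi>" and G: "openin X G" "x \<in> G"
 obtains r W where "r > 0" "openin X W" "x \<in> W" "W \<subseteq> G \<inter> U" "\<phi> ` W = H \<inter> ball (\<phi> x) r"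
  "homeomorphic_map (subtopology X W) (top_of_set (H \<inter> ball (\<phi> x) r)) \<phi>"
proof -
 have tU: "topspace (subtopology X U) = U" using openin_subset[OF U(1)] by auto
 have VH: "V \<subseteq> H" using openin_subset[OF V] by simp
 have img: "\<phi> ` U = V" and inj: "inj_on \<phi> U"
  using homeomorphic_imp_surjective_map[OF \<phi>] homeomorphic_imp_injective_map[OF \<phi>] unfolding tU by auto
 have "openin (subtopology X U) (G \<inter> U)" using G(1) openin_subtopology by blast
 then have "openin (top_of_set V) (\<phi> ` (G \<inter> U))"
  using homeomorphic_imp_open_map[OF \<phi>] unfolding open_map_def by blast
 then have "openin (top_of_set H) (\<phi> ` (G \<inter> U))" using V openin_trans by blast
 moreover have "\<phi> x \<in> \<phi> ` (G \<inter> U)" using U G by blast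
 ultimately obtain r where r: "r > 0" "\<And>y. y \<in> H ==> dist y (\<phi> x) < r ==> y \<in> \<phi> ` (G \<inter> U)"
  unfolding openin_euclidean_subtopology_iff by metis
 define W where "W = {y \<in> U. \<phi> y \<in> ball (\<phi> x) r}"
 have WG: "W \<subseteq> G \<inter> U"
 proof
  fix y assume y: "y \<in> W"
  then have "\<phi> y \<in> \<phi> ` (G \<inter> U)" using r(2)[of "\<phi> y"] img VH by (auto simp: W_def dist_commute)
  then show "y \<in> G \<inter> U" using inj y unfolding W_def inj_on_def by blast
 qed
 have imgW: "\<phi> ` W = H \<inter> ball (\<phi> x) r"
 proof
  show "\<phi> ` W \<subseteq> H \<inter> ball (\<phi> x) r" using img VH unfolding W_def by blast
  show "H \<inter> ball (\<phi> x) r \<subseteq> \<phi> ` W"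
  proof
   fix y assume y: "y \<in> H \<inter> ball (\<phi> x) r"
   then have "y \<in> \<phi> ` (G \<inter> U)" using r(2)[of y] by (auto simp: dist_commute)
   then show "y \<in> \<phi> ` W" using y unfolding W_def by blast
  qed
 qed
 have "continuous_map (subtopology X U) euclidean \<phi>"
  using homeomorphic_imp_continuous_map[OF \<phi>] continuous_map_into_fulltopology by blast
 from openin_continuous_map_preimage[OF this, of "ball (\<phi> x) r"]
 have "openin (subtopology X U) W" unfolding W_def tU by simp
 then have oW: "openin X W" using U(1) openin_open_subtopology by blast
 have "homeomorphic_map (subtopology (subtopology X U) W) (subtopology (top_of_set V) (H \<inter> ball (\<phi> x) r)) \<phi>"
 proof (rule homeomorphic_map_subtopologies[OF \<phi>])
  have "H \<inter> ball (\<phi> x) r \<subseteq> V" using imgW WG img by blast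
  then show "\<phi> ` (topspace (subtopology X U) \<inter> W) = topspace (top_of_set V) \<inter> (H \<inter> ball (\<phi> x) r)"
   unfolding tU using WG imgW by (simp add: Int_absorb1)
 qed
 moreover have "subtopology (subtopology X U) W = subtopology X W"
  using WG by (simp add: subtopology_subtopology Int_absorb1)
 moreover have "subtopology (top_of_set V) (H \<inter> ball (\<phi> x) r) = top_of_set (H \<inter> ball (\<phi> x) r)"
 proof -
  have "H \<inter> ball (\<phi> x) r \<subseteq> V" using imgW WG img by blast
  then show ?thesis by (simp add: subtopology_subtopology Int_absorb1)
 qed
 ultimately have "homeomorphic_map (subtopology X W) (top_of_set (H \<inter> ball (\<phi> x) r)) \<phi>" by simp
 moreover have "x \<in> W" using U(2) r(1) by (simp add: W_def)
 ultimately show thesis using that r(1) oW WG imgW by blast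
qed

lemma manifold_point_punctured_nbhd:
 assumes "manifold_point X x" "openin X G" "x \<in> G"
 obtains W where "openin X W" "x \<in> W" "W \<subseteq> G" "H1_trivial (subtopology X (W - {x}))"
proof -
 obtain U and V :: "(real^3) set" where U: "openin X U" "x \<in> U" "open V" "subtopology X U homeomorphic_space top_of_set V"
  using assms(1) unfolding manifold_point_def by blast
 then obtain \<phi> where \<phi>: "homeomorphic_map (subtopology X U) (top_of_set V) \<phi>" unfolding homeomorphic_space by blast
 have "openin (top_of_set UNIV) V" using U(3) by simp
 from chart_ball[OF U(1,2) this \<phi> assms(2,3)] obtain r W where W: "r > 0" "openin X W" "x \<in> W" "W \<subseteq> G \<inter> U"
  "\<phi> ` W = UNIV \<inter> ball (\<phi> x) r" "homeomorphic_map (subtopology X W) (top_of_set (UNIV \<inter> ball (\<phi> x) r)) \<phi>" by metis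
 have tW: "topspace (subtopology X W) = W" using openin_subset[OF W(2)] by auto
 have inj: "inj_on \<phi> W" using homeomorphic_imp_injective_map[OF W(6)] unfolding tW .
 have "homeomorphic_map (subtopology (subtopology X W) (W - {x}))
   (subtopology (top_of_set (UNIV \<inter> ball (\<phi> x) r)) (ball (\<phi> x) r - {\<phi> x})) \<phi>"
 proof (rule homeomorphic_map_subtopologies[OF W(6)])
  have "\<phi> ` (W - {x}) = \<phi> ` W - {\<phi> x}" using inj W(3) by (simp add: inj_on_image_set_diff[of \<phi> W])
  moreover have "W \<inter> (W - {x}) = W - {x}" by blast
  ultimately show "\<phi> ` (topspace (subtopology X W) \<inter> (W - {x})) =
    topspace (top_of_set (UNIV \<inter> ball (\<phi> x) r)) \<inter> (ball (\<phi> x) r - {\<phi> x})"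
   unfolding tW using W(5) by auto
 qed
 moreover have "subtopology (subtopology X W) (W - {x}) = subtopology X (W - {x})"
  by (simp add: subtopology_subtopology Int_absorb1 Diff_subset)
 moreover have "subtopology (top_of_set (UNIV \<inter> ball (\<phi> x) r)) (ball (\<phi> x) r - {\<phi> x}) = top_of_set (ball (\<phi> x) r - {\<phi> x})"
  by (simp add: subtopology_subtopology Int_absorb1 Diff_subset)
 ultimately have "homeomorphic_map (subtopology X (W - {x})) (top_of_set (ball (\<phi> x) r - {\<phi> x})) \<phi>" by simp
 then have "top_of_set (ball (\<phi> x) r - {\<phi> x}) homeomorphic_space subtopology X (W - {x})"
  using homeomorphic_map_imp_homeomorphic_space homeomorphic_space_sym by blast
 from H1_trivial_homeomorphic[OF this H1_trivial_punctured_ball[OF W(1)]] W that show thesis by blast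
qed

lemma preimage_saturated:
 assumes fp: "face_pairing T" and S: "saturated T S"
 shows "{x \<in> topspace simplices. quotient_point T x \<in> quotient_point T ` S} = S"
proof
 show "{x \<in> topspace simplices. quotient_point T x \<in> quotient_point T ` S} \<subseteq> S"
 using glued_class_eq_glued fp saturated_glued S by blast
 show "S \<subseteq> {x \<in> topspace simplices. quotient_point T x \<in> quotient_point T ` S}"
  using S unfolding topspace_simplices saturated_def by blast
qed

lemma topspace_pseudo_manifold: "topspace (pseudo_manifold T) = quotient_point T ` simplex_points"
 by (simp add: pseudo_manifold_def topspace_quotient_topology topspace_simplices)

lemma openin_saturated_image:
 assumes fp: "face_pairing T" and S: "saturated T S" and "openin simplices S"
 shows "openin (pseudo_manifold T) (quotient_point T ` S)"
using assms(3) openin_quotient_topology preimage_saturated fp S by (fastforce simp: pseudo_manifold_def)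

lemma descent_map_saturated:
 fixes T :: "('t::finite) gluing"
 assumes fp: "face_pairing T" and S: "saturated T S"
 shows "descent_map (subtopology simplices S) (subtopology (pseudo_manifold T) (quotient_point T ` S)) (quotient_point T)"
proof -
 have "quotient_point T ` S \<subseteq> topspace (pseudo_manifold T)"
  using S unfolding topspace_pseudo_manifold saturated_def by blast
 from descent_map_restrict[OF descent_map_pseudo_manifold[OF fp] this] show ?thesis
  unfolding preimage_saturated[OF fp S] .
qed

text \<open>Transport of directed edges through the faces containing them.\<close>

definition flag_reach :: "'t gluing => (('t \<times> 4 \<times> 4) \<times> ('t \<times> 4 \<times> 4)) set" where
 "flag_reach T = {((i, p, c), flag_move T a (i, p, c)) | i p c a. a ~= p & a ~= c}\<^sup>*"

definition edge_mid :: "real => 4 => 4 => real^4" where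
 "edge_mid t p c = (\<chi> d. if d = p then 1/2 + t else if d = c then 1/2 - t else 0)"

lemma edge_mid_simplex:
 assumes "c ~= p" "\<bar>t\<bar> <= 1/2"
 shows "edge_mid t p c \<in> std_simplex"
proof -
 have "(\<Sum>d\<in>UNIV. edge_mid t p c $ d) = (\<Sum>d\<in>{p, c}. edge_mid t p c $ d)"
  by (rule sum.mono_neutral_right) (auto simp: edge_mid_def)
 then show ?thesis using assms by (auto simp: std_simplex_def edge_mid_def abs_le_iff)
qed

lemma face_move_edge_mid:
 assumes fp: "face_pairing T"
 shows "face_move T i a (edge_mid t p c) = edge_mid t (perm T i a p) (perm T i a c)"
 by (rule face_move_eqI[OF fp, symmetric]) (auto simp: edge_mid_def perm_inj[OF fp])

lemma edge_mid_swap: "p ~= c ==> edge_mid t p c = edge_mid (- t) c p"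
 by (auto simp: edge_mid_def vec_eq_iff)

definition edge_ball :: "real => 4 => 4 => (real^4) set" where
 "edge_ball \<delta> p c = {x \<in> std_simplex. dist x (edge_mid 0 p c) < \<delta>}"

lemma edge_ball_coords:
 assumes "x \<in> edge_ball \<delta> p c" "\<delta> <= 1/4" "p ~= c"
 shows "1/4 < x $ p" "1/4 < x $ c" "1/4 < x $ d \<longleftrightarrow> d = p \<or> d = c"
proof -
 have near: "\<bar>x $ d - edge_mid 0 p c $ d\<bar> < 1/4" for d
 proof -
  have "\<bar>(x - edge_mid 0 p c) $ d\<bar> <= dist x (edge_mid 0 p c)" unfolding dist_norm by (rule component_le_norm_cart)
  then show ?thesis using assms by (simp add: edge_ball_def)
 qed
 show p: "1/4 < x $ p" using near[of p] by (simp add: edge_mid_def abs_if split: if_splits)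
 show c: "1/4 < x $ c" using near[of c] assms(3) by (simp add: edge_mid_def abs_if split: if_splits)
 show "1/4 < x $ d \<longleftrightarrow> d = p \<or> d = c"
  using near[of d] p c by (auto simp: edge_mid_def abs_less_iff split: if_splits)
qed

lemma edge_mid_dist:
 assumes "p ~= c" "t > 0"
 shows "edge_mid t p c ~= edge_mid 0 p c" "dist (edge_mid t p c) (edge_mid 0 p c) <= 2 * t"
proof -
 have "edge_mid t p c $ p ~= edge_mid 0 p c $ p" using assms by (simp add: edge_mid_def)
 then show "edge_mid t p c ~= edge_mid 0 p c" by metis
 have e: "edge_mid t p c - edge_mid 0 p c = t *\<^sub>R axis p 1 - t *\<^sub>R axis c 1"
  using assms(1) by (auto simp: edge_mid_def vec_eq_iff axis_def)
 have "norm (t *\<^sub>R axis p 1 - t *\<^sub>R axis c 1 :: real^4) <= norm (t *\<^sub>R axis p 1 :: real^4) + norm (t *\<^sub>R axis c 1 :: real^4)"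
  by (rule norm_triangle_ineq4)
 then show "dist (edge_mid t p c) (edge_mid 0 p c) <= 2 * t" using assms(2) unfolding dist_norm e by (simp add: norm_axis_1)
qed

text \<open>The midpoint is a boundary point of the simplex, so the ball is starlike about an interior point even after its removal.\<close>

lemma connected_punctured_edge_ball:
 assumes "p ~= c" "0 < \<delta>"
 shows "connected (edge_ball \<delta> p c - {edge_mid 0 p c})"
proof -
 let ?m = "edge_mid 0 p c"
 define \<eta> where "\<eta> = min (1/2) (\<delta>/4)"
 have \<eta>: "0 < \<eta>" "\<eta> <= 1/2" "4 * \<eta> <= \<delta>" using assms by (auto simp: \<eta>_def)
 define u where "u = (\<chi> d. if d = p \<or> d = c then 1/2 - \<eta>/2 else \<eta>/2 :: real^4)"
 obtain a b where ab: "a ~= p" "a ~= c" "b ~= p" "b ~= c" "a ~= b" "UNIV = {p, c, a, b}"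
  using four_elements[of c p] assms(1) by metis
 have uD: "u \<in> std_simplex"
  using \<eta> ab assms(1) unfolding std_simplex_def by (auto simp: u_def ab(6))
 have um: "dist u ?m < \<delta>"
 proof -
  have "dist u ?m <= (\<Sum>d\<in>UNIV. \<bar>(u - ?m) $ d\<bar>)" unfolding dist_norm by (rule norm_le_l1_cart)
  also have "\<dots> = 2 * \<eta>" using \<eta>(1) ab assms(1) by (simp add: ab(6) u_def edge_mid_def)
  finally show ?thesis using \<eta> by linarith
 qed
 have "starlike (edge_ball \<delta> p c - {?m})"
  unfolding starlike_def
 proof (intro bexI[of _ u] ballI subsetI)
  have "u $ a ~= ?m $ a" using \<eta> ab by (simp add: u_def edge_mid_def)
  then have ne: "u ~= ?m" by metis
  show "u \<in> edge_ball \<delta> p c - {?m}" using uD um ne by (simp add: edge_ball_def)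
  fix x y assume x: "x \<in> edge_ball \<delta> p c - {?m}" and y: "y \<in> closed_segment u x"
  have cv: "convex (edge_ball \<delta> p c)"
  proof -
   have "edge_ball \<delta> p c = std_simplex \<inter> ball ?m \<delta>" by (auto simp: edge_ball_def dist_commute)
   then show ?thesis by (auto intro!: convex_Int convex_std_simplex)
  qed
  have "y \<in> edge_ball \<delta> p c"
   using cv x y \<open>u \<in> edge_ball \<delta> p c - {?m}\<close> convex_contains_segment by blast
  moreover have "y ~= ?m"
  proof
   assume ym: "y = ?m"
   obtain v where v: "0 <= v" "v <= 1" "y = (1 - v) *\<^sub>R u + v *\<^sub>R x" using y unfolding in_segment by blast
   have "?m $ a = (1 - v) * u $ a + v * x $ a" using v(3) ym by simp
   then have "(1 - v) * (\<eta>/2) + v * x $ a = 0" using ab by (simp add: u_def edge_mid_def)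
   moreover have "0 <= v * x $ a" "0 <= (1 - v) * (\<eta>/2)" using x v \<eta> by (auto simp: edge_ball_def std_simplex_def)
   ultimately have "(1 - v) * (\<eta>/2) = 0" by linarith
   then have "v = 1" using \<eta> by simp
   then show False using v(3) ym x by simp
  qed
  ultimately show "y \<in> edge_ball \<delta> p c - {?m}" by blast
 qed
 then show ?thesis by (rule starlike_imp_connected)
qed

text \<open>Suppose the transport of the edge reverses it. On the deleted balls around the midpoints of the edges reached, prescribe a
jump whenever the face map reverses the order of the two labels. Near the image \<open>P\<close> of the midpoint, which is a
manifold point, the resulting system is trivial, so these jumps are realised by values \<open>\<psi>\<close> that are
constant on each ball. Carried along the transport from \<open>(i, p, c)\<close> to \<open>(i, c, p)\<close>, the comparison of \<open>\<psi>\<close> with the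
order of the labels is constant, although \<open>\<psi>\<close> returns to its value and the order has been reversed.\<close>

lemma no_reversed_edge:
 fixes T :: "('t::finite) gluing"
 assumes fp: "face_pairing T"
  and mf: "\<And>P. P \<in> topspace (pseudo_manifold T) - ideal_vertices T ==> manifold_point (pseudo_manifold T) P"
  and pc: "p ~= c"
 shows "((i, p, c), (i, c, p)) \<notin> flag_reach T"
proof
 assume rev: "((i, p, c), (i, c, p)) \<in> flag_reach T"
 define C where "C = {x. ((i, p, c), x) \<in> flag_reach T}"
 have C0: "(i, p, c) \<in> C" "(i, c, p) \<in> C" using rev by (auto simp: C_def flag_reach_def)
 have C_step: "flag_move T a (j, q, d) \<in> C" if "(j, q, d) \<in> C" "a ~= q" "a ~= d" for j q d a
 proof -
  have "((j, q, d), flag_move T a (j, q, d)) \<in> {((i, p, c), flag_move T a (i, p, c)) | i p c a. a ~= p & a ~= c}"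
   using that(2,3) by blast
  moreover have "((i, p, c), (j, q, d)) \<in> flag_reach T" using that(1) unfolding C_def by (rule CollectD)
  ultimately have "((i, p, c), flag_move T a (j, q, d)) \<in> flag_reach T"
   unfolding flag_reach_def by (rule rtrancl_into_rtrancl[rotated])
  then show ?thesis unfolding C_def by (rule CollectI)
 qed
 have C_induct: "R x" if x: "x \<in> C" and R0: "R (i, p, c)"
  and step: "\<And>j q d a. (j, q, d) \<in> C ==> R (j, q, d) ==> a ~= q ==> a ~= d ==> R (flag_move T a (j, q, d))" for R x
 proof -
  have "((i, p, c), x) \<in> {((i, p, c), flag_move T a (i, p, c)) | i p c a. a ~= p & a ~= c}\<^sup>*"
   using x by (simp add: C_def flag_reach_def)
  then have "x \<in> C & R x"
  proof (induction rule: rtrancl_induct)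
   case (step y z)
   then obtain j q d a where "y = (j, q, d)" "z = flag_move T a (j, q, d)" "a ~= q" "a ~= d" by blast
   then show ?case using step(3) C_step that(3) by blast
  qed (use C0 R0 in blast)
  then show ?thesis by blast
 qed
 have C_ne: "q ~= d" if "(j, q, d) \<in> C" for j q d
 proof -
  have "fst (snd (j, q, d)) ~= snd (snd (j, q, d))"
   by (rule C_induct[OF that]) (use pc in \<open>auto simp: flag_move_def perm_inj[OF fp]\<close>)
  then show ?thesis by simp
 qed
 define S where "S \<delta> = {(j, x). \<exists>q d. (j, q, d) \<in> C & x \<in> edge_ball \<delta> q d - {edge_mid 0 q d}}" for \<delta>
 have ball_move: "face_move T j a x \<in> edge_ball \<delta> (perm T j a q) (perm T j a d) - {edge_mid 0 (perm T j a q) (perm T j a d)}"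
  if "x \<in> edge_ball \<delta> q d - {edge_mid 0 q d}" for j a x \<delta> q d
 proof -
  have e: "edge_mid 0 (perm T j a q) (perm T j a d) = face_move T j a (edge_mid 0 q d)"
   by (simp add: face_move_edge_mid[OF fp])
  have "face_move T j a x ~= face_move T j a (edge_mid 0 q d)"
   using that dist_face_move[OF fp, of j a x "edge_mid 0 q d"] by auto
  then show ?thesis using that unfolding edge_ball_def e by (auto simp: dist_face_move[OF fp] face_move_simplex[OF fp])
 qed
 have not_end: "a ~= q & a ~= d"
  if "(j, q, d) \<in> C" "x \<in> edge_ball \<delta> q d" "\<delta> <= 1/4" "x $ a = 0" for j q d x \<delta> a
  using edge_ball_coords(3)[OF that(2,3) C_ne[OF that(1)], of a] edge_ball_coords(1,2)[OF that(2,3) C_ne[OF that(1)]] that(4) by auto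
 have sat: "saturated T (S \<delta>)" if "\<delta> <= 1/4" for \<delta>
  unfolding saturated_def
 proof (intro conjI allI impI)
  show "S \<delta> \<subseteq> simplex_points" by (auto simp: S_def edge_ball_def simplex_points_def)
  fix j x a assume "(j, x) \<in> S \<delta>" "x $ a = 0"
  then obtain q d where qd: "(j, q, d) \<in> C" "x \<in> edge_ball \<delta> q d - {edge_mid 0 q d}" by (auto simp: S_def)
  then have "a ~= q" "a ~= d" using not_end \<open>x $ a = 0\<close> that by blast+
  from C_step[OF qd(1) this] ball_move[OF qd(2), of j a]
  show "(nbr T j a, face_move T j a x) \<in> S \<delta>" unfolding S_def flag_move_def by auto
 qed
 (* Near the midpoint of an edge its two labels are those with coordinate above 1/4. *)
 define \<kappa> where "\<kappa> j a x \<longleftrightarrow> (\<exists>q d. 1/4 < x $ q & 1/4 < x $ d & q < d & perm T j a d < perm T j a q)" for j a and x :: "real^4"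
 have \<kappa>: "\<kappa> j a x \<longleftrightarrow> ((q < d) ~= (perm T j a q < perm T j a d))"
  if "(j, q, d) \<in> C" "x \<in> edge_ball \<delta> q d" "\<delta> <= 1/4" for j a x q d \<delta>
 proof -
  note co = edge_ball_coords(3)[OF that(2,3) C_ne[OF that(1)]]
  have "perm T j a q ~= perm T j a d" using C_ne[OF that(1)] perm_inj[OF fp] by simp
  then show ?thesis unfolding \<kappa>_def co using C_ne[OF that(1)] by (metis linorder_neqE not_less_iff_gr_or_eq)
 qed
 (* On an edge, away from its midpoint, the larger coordinate chooses a direction of the edge. *)
 define f0 where "f0 jx \<longleftrightarrow> (\<exists>q d. 1/4 < snd jx $ q & 1/4 < snd jx $ d & snd jx $ d < snd jx $ q & q < d)" for jx :: "'t \<times> (real^4)"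
 have f0: "f0 (j, x) \<longleftrightarrow> q < d" if "(j, q, d) \<in> C \<or> (j, d, q) \<in> C" "x \<in> edge_ball \<delta> q d" "\<delta> <= 1/4" "x $ d < x $ q" for j x q d \<delta>
 proof -
  have "q ~= d" using that(1) C_ne by blast
  note co = edge_ball_coords(3)[OF that(2,3) this]
  show ?thesis unfolding f0_def snd_conv co using that(4) by (metis less_asym)
 qed
 note sat4 = sat[of "1/4", simplified]
 obtain f where f: "has_jumps T (S (1/4)) f \<kappa>"
 proof (rule function_with_jumps_exists[OF fp sat4, where \<kappa> = \<kappa> and ?f0.0 = f0])
  fix j x a assume "(j, x) \<in> S (1/4)" "x $ a = 0"
  then obtain q d where qd: "(j, q, d) \<in> C" "x \<in> edge_ball (1/4) q d - {edge_mid 0 q d}" by (auto simp: S_def)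
  then have aqd: "a ~= q" "a ~= d" using not_end[of j q d x "1/4" a] \<open>x $ a = 0\<close> by auto
  have "(nbr T j a, perm T j a q, perm T j a d) \<in> C" using C_step[OF qd(1) aqd] by (simp add: flag_move_def)
  from \<kappa>[OF this, of "face_move T j a x" "1/4" "perm T j a a"] \<kappa>[OF qd(1), of x "1/4" a] ball_move[OF qd(2), of j a] qd(2)
  show "\<kappa> (nbr T j a) (perm T j a a) (face_move T j a x) = \<kappa> j a x" by (auto simp: perm_back[OF fp])
 next
  fix j x a b assume jx: "(j, x) \<in> S (1/4)" and ab: "a ~= b" "x $ a = 0" "x $ b = 0"
  then obtain q d where qd: "(j, q, d) \<in> C" "x \<in> edge_ball (1/4) q d - {edge_mid 0 q d}" by (auto simp: S_def)
  have a: "a ~= q" "a ~= d" and b: "b ~= q" "b ~= d"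
   using not_end[OF qd(1), of x "1/4"] ab qd(2) by auto
  have qdne: "q ~= d" by (rule C_ne[OF qd(1)])
  have U: "UNIV = {q, d, a, b}" by (rule card_subset_eq[symmetric]) (use a b ab qdne in auto)
  have "x $ q ~= x $ d"
  proof
   assume e: "x $ q = x $ d"
   have "(\<Sum>e\<in>UNIV. x $ e) = 1" using qd(2) by (simp add: edge_ball_def std_simplex_def)
   then have "x $ q = 1/2" "x $ d = 1/2" using e ab a b qdne by (simp_all add: U)
   then have "x $ q = edge_mid 0 q d $ q" "x $ d = edge_mid 0 q d $ d" "x $ a = edge_mid 0 q d $ a" "x $ b = edge_mid 0 q d $ b"
    using ab a b by (simp_all add: edge_mid_def)
   then have "\<forall>e\<in>{q, d, a, b}. x $ e = edge_mid 0 q d $ e" by simp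
   then have "x = edge_mid 0 q d" unfolding vec_eq_iff U[symmetric] by simp
   then show False using qd(2) by simp
  qed
  then obtain q' d' where q'd': "x $ d' < x $ q'" "q' = q & d' = d \<or> q' = d & d' = q" by (metis linorder_neqE_linordered_idom)
  have sw: "edge_ball (1/4) q' d' = edge_ball (1/4) q d" "edge_mid 0 q' d' = edge_mid 0 q d"
   using q'd'(2) edge_mid_swap[of d q 0] qdne by (auto simp: edge_ball_def)
  have C': "(j, q', d') \<in> C \<or> (j, d', q') \<in> C" using q'd'(2) qd(1) by blast
  let ?\<sigma> = "perm T j a"
  have 1: "f0 (j, x) \<longleftrightarrow> q' < d'" by (rule f0[OF C' _ _ q'd'(1), of "1/4"]) (use qd(2) sw in auto)
  have C'': "(nbr T j a, ?\<sigma> q', ?\<sigma> d') \<in> C \<or> (nbr T j a, ?\<sigma> d', ?\<sigma> q') \<in> C"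
   using C_step[OF qd(1) a] q'd'(2) by (auto simp: flag_move_def)
  have 2: "f0 (nbr T j a, face_move T j a x) \<longleftrightarrow> ?\<sigma> q' < ?\<sigma> d'"
   by (rule f0[OF C'', of _ "1/4"])
    (use ball_move[of x "1/4" q' d' j a] qd(2) sw q'd'(1) in \<open>auto simp: face_move_nth[OF fp]\<close>)
  have "\<kappa> j a x \<longleftrightarrow> ((q < d) ~= (?\<sigma> q < ?\<sigma> d))" by (rule \<kappa>[OF qd(1), of _ "1/4"]) (use qd(2) in auto)
  also have "\<dots> \<longleftrightarrow> ((q' < d') ~= (?\<sigma> q' < ?\<sigma> d'))"
   using q'd'(2) qdne perm_inj[OF fp, of j a q d] by (metis less_asym linorder_neqE)
  finally show "(f0 (j, x) ~= f0 (nbr T j a, face_move T j a x)) = \<kappa> j a x" using 1 2 by simp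
 qed (use that in blast)
 let ?K = "pseudo_manifold T" and ?q = "quotient_point T"
 let ?X = "%\<delta>. subtopology simplices (S \<delta>)" and ?Y = "%\<delta>. subtopology ?K (?q ` S \<delta>)"
 have df: "descent_function (?X (1/4)) ?q f"
 proof (rule descent_function_of_jumps[OF fp sat4 f])
  fix j x assume "(j, x) \<in> S (1/4)"
  then obtain q d where qd: "(j, q, d) \<in> C" "x \<in> edge_ball (1/4) q d" by (auto simp: S_def)
  note co = edge_ball_coords[OF qd(2) order.refl C_ne[OF qd(1)]]
  define e where "e = min (x $ q - 1/4) (x $ d - 1/4)"
  have e: "e > 0" using co(1,2) by (simp add: e_def)
  have "\<kappa> j a z = \<kappa> j a x" if z: "(j, z) \<in> S (1/4)" "dist z x < e" for z a
  proof -
   obtain q' d' where q'd': "(j, q', d') \<in> C" "z \<in> edge_ball (1/4) q' d'" using z(1) by (auto simp: S_def)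
   note co' = edge_ball_coords(3)[OF q'd'(2) order.refl C_ne[OF q'd'(1)]]
   have near: "\<bar>z $ g - x $ g\<bar> < e" for g
    using component_le_norm_cart[of "z - x" g] z(2) by (simp add: dist_norm)
   have "1/4 < z $ q" "1/4 < z $ d" using near[of q] near[of d] by (auto simp: e_def)
   then have "(q = q' \<or> q = d') & (d = q' \<or> d = d')" using co' by blast
   then have "1/4 < z $ g \<longleftrightarrow> 1/4 < x $ g" for g unfolding co' co(3) using C_ne[OF qd(1)] by blast
   then show ?thesis unfolding \<kappa>_def by simp
  qed
  with e show "\<exists>e>0. \<forall>z a. (j, z) \<in> S (1/4) --> dist z x < e --> z $ a = 0 --> x $ a = 0 --> \<kappa> j a z = \<kappa> j a x" by blast
 next
  show "?q p = ?q q \<longleftrightarrow> glued T p q" for p q by (rule glued_class_eq_glued[OF fp])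
 qed
 obtain s where s: "local_system (?Y (1/4)) s" "trivialises (?X (1/4)) (pullback_system ?q s) f"
  using descent_exists[OF descent_map_saturated[OF fp sat4] df] by blast
 define m where "m = (i, edge_mid 0 p c)"
 have mD: "m \<in> simplex_points" using edge_mid_simplex[of c p 0] pc by (simp add: m_def simplex_points_def)
 have fib: "\<exists>q d. (j, q, d) \<in> C & y = edge_mid 0 q d" if g: "glued T m (j, y)" for j y
 proof -
  have "\<exists>q d. (fst (j, y), q, d) \<in> C & snd (j, y) = edge_mid 0 q d"
   using fp g
  proof (induction rule: glued_induct)
   case refl
   then show ?case using C0(1) by (auto simp: m_def)
  next
   case (step k x a)
   then obtain q d where qd: "(k, q, d) \<in> C" "x = edge_mid 0 q d" by blast
   then have "a ~= q" "a ~= d" using step(3) by (auto simp: edge_mid_def split: if_splits)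
   from C_step[OF qd(1) this] show ?case using qd(2) face_move_edge_mid[OF fp] by (auto simp: flag_move_def)
  qed
  then show ?thesis by simp
 qed
 have fib': "glued T m (j, edge_mid 0 q d)" if "(j, q, d) \<in> C" for j q d
 proof -
  have "glued T m (fst (j, q, d), edge_mid 0 (fst (snd (j, q, d))) (snd (snd (j, q, d))))"
  proof (rule C_induct[OF that])
   show "glued T m (fst (i, p, c), edge_mid 0 (fst (snd (i, p, c))) (snd (snd (i, p, c))))" by (simp add: m_def glued_refl)
   fix k q d a assume *: "(k, q, d) \<in> C" "glued T m (fst (k, q, d), edge_mid 0 (fst (snd (k, q, d))) (snd (snd (k, q, d))))" "a ~= q" "a ~= d"
   have "glued T (k, edge_mid 0 q d) (nbr T k a, face_move T k a (edge_mid 0 q d))"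
    by (rule glued_step[OF fp edge_mid_simplex]) (use C_ne[OF *(1)] *(3,4) in \<open>auto simp: edge_mid_def\<close>)
   with *(2) have "glued T m (nbr T k a, face_move T k a (edge_mid 0 q d))" using glued_trans by (metis fst_conv snd_conv)
   then show "glued T m (fst (flag_move T a (k, q, d)), edge_mid 0 (fst (snd (flag_move T a (k, q, d)))) (snd (snd (flag_move T a (k, q, d)))))"
    by (simp add: flag_move_def face_move_edge_mid[OF fp])
  qed
  then show ?thesis by simp
 qed
 define P where "P = ?q m"
 have topK: "topspace ?K = ?q ` simplex_points"
  by (simp add: pseudo_manifold_def topspace_quotient_topology topspace_simplices)
 have PK: "P \<in> topspace ?K" using mD by (simp add: P_def topK)
 have "P \<notin> ideal_vertices T"
 proof
  assume "P \<in> ideal_vertices T"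
  then obtain j e where "P = ?q (j, axis e 1)" unfolding ideal_vertices_def by blast
  then have "glued T (j, axis e 1) m" unfolding P_def glued_class_eq_glued[OF fp, symmetric] by simp
  from glued_values[OF fp this, of p] show False by (auto simp: m_def edge_mid_def axis_def split: if_splits)
 qed
 with mf PK have mp: "manifold_point ?K P" by blast
 define B where "B \<delta> = {(j, z) \<in> simplex_points. \<exists>y. (j, y) \<in> fibre T m & dist z y < \<delta>}" for \<delta>
 have B_eq: "B \<delta> = S \<delta> \<union> fibre T m" if "\<delta> > 0" for \<delta>
 proof
  show "B \<delta> \<subseteq> S \<delta> \<union> fibre T m"
   unfolding B_def S_def edge_ball_def fibre_def simplex_points_def using fib by fastforce
  show "S \<delta> \<union> fibre T m \<subseteq> B \<delta>"
  proof
   fix x assume "x \<in> S \<delta> \<union> fibre T m"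
   then show "x \<in> B \<delta>"
   proof
    assume "x \<in> S \<delta>"
    then show ?thesis unfolding S_def B_def edge_ball_def fibre_def simplex_points_def using fib' by fastforce
   next
    assume "x \<in> fibre T m"
    moreover from this have "x \<in> simplex_points" using glued_simplex[OF fp _ mD] by (simp add: fibre_def)
    ultimately show ?thesis unfolding B_def using that by (cases x) force
   qed
  qed
 qed
 have fibP: "?q x = P \<longleftrightarrow> x \<in> fibre T m" for x
  unfolding P_def fibre_def mem_Collect_eq glued_class_eq_glued[OF fp] using glued_sym[OF fp] by blast
 have S_fib: "x \<notin> fibre T m" if x: "x \<in> S \<delta>" "\<delta> <= 1/4" for x \<delta>
 proof
  obtain j z where jz: "x = (j, z)" by (cases x)
  obtain q d where qd: "(j, q, d) \<in> C" "z \<in> edge_ball \<delta> q d - {edge_mid 0 q d}" using x(1) jz by (auto simp: S_def)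
  assume "x \<in> fibre T m"
  then obtain q' d' where q'd': "(j, q', d') \<in> C" "z = edge_mid 0 q' d'" using fib[of j z] unfolding jz fibre_def by blast
  have "1/4 < z $ g \<longleftrightarrow> g = q' \<or> g = d'" for g using q'd'(2) C_ne[OF q'd'(1)] by (auto simp: edge_mid_def)
  then have "{q, d} = {q', d'}" using edge_ball_coords(3)[of z \<delta> q d] qd C_ne[OF qd(1)] x(2) by blast
  then have "edge_mid 0 q d = edge_mid 0 q' d'" using edge_mid_swap[of q d 0] C_ne[OF qd(1)] by (auto simp: doubleton_eq_iff)
  then show False using qd(2) q'd'(2) by simp
 qed
 have openB: "openin ?K (?q ` B (1/4))"
 proof -
  have step: "(nbr T j a, face_move T j a x) \<in> fibre T m" if "(j, x) \<in> fibre T m" "x $ a = 0" for j x a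
  proof -
   have "x \<in> std_simplex" using that(1) glued_simplex[OF fp _ mD] by (auto simp: fibre_def simplex_points_def)
   then show ?thesis using that(1) glued_trans[OF _ glued_step[OF fp _ that(2)]] unfolding fibre_def by blast
  qed
  have "fibre T m \<subseteq> simplex_points" using glued_simplex[OF fp _ mD] unfolding fibre_def by blast
  then have "saturated T (B (1/4))"
   using sat4 step unfolding B_eq[of "1/4", simplified] saturated_def Un_iff by blast
  moreover have "openin simplices (B (1/4))" unfolding B_def by (rule openin_simplex_balls)
  ultimately show ?thesis by (rule openin_saturated_image[OF fp])
 qed
 have "P \<in> ?q ` B (1/4)" unfolding B_eq[of "1/4", simplified] P_def by (auto simp: fibre_def glued_refl)
 from manifold_point_punctured_nbhd[OF mp openB this] obtain W where
  W: "openin ?K W" "P \<in> W" "W \<subseteq> ?q ` B (1/4)" "H1_trivial (subtopology ?K (W - {P}))" by metis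
 have WS: "W - {P} \<subseteq> ?q ` S (1/4)"
  using W(3) fibP unfolding B_eq[of "1/4", simplified] by blast
 have "local_system (subtopology ?K (W - {P})) s"
  using local_system_subtopology[OF s(1), of "W - {P}"] WS by (simp add: subtopology_subtopology Int_absorb1)
 then have tW: "trivial_system (subtopology ?K (W - {P})) s" using W(4) unfolding H1_trivial_def by blast
 have cq: "continuous_map simplices ?K ?q" by (rule descent_mapD(2)[OF descent_map_pseudo_manifold[OF fp]])
 have oW: "openin simplices {x \<in> topspace simplices. ?q x \<in> W}" by (rule openin_continuous_map_preimage[OF cq W(1)])
 have "\<exists>e>0. \<forall>z\<in>std_simplex. dist z (snd x) < e --> ?q (fst x, z) \<in> W" if x: "x \<in> fibre T m" for x
 proof -
  have "openin (top_of_set std_simplex) {z. (fst x, z) \<in> {x \<in> topspace simplices. ?q x \<in> W}}"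
   using oW by (simp add: openin_simplices)
  moreover have "snd x \<in> {z. (fst x, z) \<in> {x \<in> topspace simplices. ?q x \<in> W}}"
   using fibP[of x] x W(2) glued_simplex[OF fp _ mD, of x] by (auto simp: topspace_simplices fibre_def)
  ultimately show ?thesis unfolding openin_euclidean_subtopology_iff by blast
 qed
 then obtain e where e: "\<And>x. x \<in> fibre T m ==> e x > 0 & (\<forall>z\<in>std_simplex. dist z (snd x) < e x --> ?q (fst x, z) \<in> W)" by metis
 (* Radius for which the punctured balls map into the neighbourhood where the system is trivial. *)
 define \<delta> where "\<delta> = Min (insert (1/4) (e ` fibre T m))"
 have \<delta>: "\<delta> > 0" "\<delta> <= 1/4" "\<And>x. x \<in> fibre T m ==> \<delta> <= e x"
  unfolding \<delta>_def using finite_fibre[OF fp, of m] e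
   Min_le[of "insert (1/4) (e ` fibre T m)" "1/4"] Min_le[of "insert (1/4) (e ` fibre T m)"] by (auto)
 have S_mono: "S \<delta> \<subseteq> S (1/4)" unfolding S_def edge_ball_def using \<delta>(2) by fastforce
 have qS: "?q ` S \<delta> \<subseteq> W - {P}"
 proof
  fix y assume "y \<in> ?q ` S \<delta>"
  then obtain j z where jz: "(j, z) \<in> S \<delta>" "y = ?q (j, z)" by auto
  then have "(j, z) \<in> B \<delta>" using B_eq[OF \<delta>(1)] by blast
  then obtain w where w: "(j, w) \<in> fibre T m" "dist z w < \<delta>" "z \<in> std_simplex" unfolding B_def simplex_points_def by blast
  have "?q (j, z) \<in> W" using e[OF w(1)] w(2,3) \<delta>(3)[OF w(1)] by auto
  moreover have "y ~= P" using fibP[of "(j, z)"] S_fib[OF jz(1) \<delta>(2)] jz(2) by blast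
  ultimately show "y \<in> W - {P}" using jz(2) by blast
 qed
 have t\<delta>: "trivial_system (?Y \<delta>) s"
  using trivial_system_subtopology[OF tW, of "?q ` S \<delta>"] qS by (simp add: subtopology_subtopology Int_absorb1)
 have f\<delta>: "trivialises (?X \<delta>) (pullback_system ?q s) f"
  using trivialises_subtopology[OF s(2), of "S \<delta>"] S_mono by (simp add: subtopology_subtopology Int_absorb1)
 have tX: "topspace (?X \<delta>) = S \<delta>" using sat[OF \<delta>(2)] by (auto simp: saturated_def topspace_simplices)
 from descent_trivial_imp[OF descent_map_saturated[OF fp sat[OF \<delta>(2)]] f\<delta> t\<delta>] obtain \<psi> where
  \<psi>: "locally_constant_on (?X \<delta>) \<psi>"
  "\<And>x x'. x \<in> S \<delta> ==> x' \<in> S \<delta> ==> ?q x = ?q x' ==> (f x = f x') = (\<psi> x = \<psi> x')"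
  unfolding tX by metis
 define pt where "pt q d = edge_mid (\<delta>/4) q d" for q d
 have pt: "pt q d \<in> edge_ball \<delta> q d - {edge_mid 0 q d}" if "q ~= d" for q d
 proof -
  have "\<bar>\<delta>/4\<bar> <= 1/2" using \<delta> by simp
  then have "pt q d \<in> std_simplex" unfolding pt_def using that by (intro edge_mid_simplex) auto
  then show ?thesis using edge_mid_dist[OF that, of "\<delta>/4"] \<delta>(1) by (simp add: edge_ball_def pt_def)
 qed
 (* h is invariant under transport, which contradicts the reversal. *)
 define h where "h x \<longleftrightarrow> (case x of (j, q, d) => \<psi> (j, pt q d) ~= (q < d))" for x
 have "h x = h (i, p, c)" if "x \<in> C" for x
 proof (rule C_induct[OF that])
  fix j q d a assume *: "(j, q, d) \<in> C" "h (j, q, d) = h (i, p, c)" "a ~= q" "a ~= d"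
  have ne: "q ~= d" by (rule C_ne[OF *(1)])
  have S1: "(j, pt q d) \<in> S \<delta>" using pt[OF ne] *(1) by (auto simp: S_def)
  have z: "pt q d $ a = 0" using *(3,4) by (simp add: pt_def edge_mid_def)
  have mv: "face_move T j a (pt q d) = pt (perm T j a q) (perm T j a d)" by (simp add: pt_def face_move_edge_mid[OF fp])
  have S2: "(nbr T j a, face_move T j a (pt q d)) \<in> S \<delta>" using sat[OF \<delta>(2)] S1 z unfolding saturated_def by blast
  have "pt q d \<in> std_simplex" using pt[OF ne] by (simp add: edge_ball_def)
  then have "?q (j, pt q d) = ?q (nbr T j a, face_move T j a (pt q d))"
   using glued_step[OF fp _ z] glued_class_eq_glued[OF fp] by blast
  from \<psi>(2)[OF S1 S2 this] have "(\<psi> (j, pt q d) ~= \<psi> (nbr T j a, face_move T j a (pt q d))) = \<kappa> j a (pt q d)"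
   using f S_mono S1 z unfolding has_jumps_def by blast
  also have "\<kappa> j a (pt q d) = ((q < d) ~= (perm T j a q < perm T j a d))"
   by (rule \<kappa>[OF *(1) _ \<delta>(2)]) (use pt[OF ne] in blast)
  finally show "h (flag_move T a (j, q, d)) = h (i, p, c)"
   using *(2) unfolding h_def flag_move_def prod.case mv by argo
 qed simp
 from this[OF C0(2)] have "(\<psi> (i, pt c p) ~= (c < p)) = (\<psi> (i, pt p c) ~= (p < c))" by (simp add: h_def)
 moreover have "\<psi> (i, pt c p) = \<psi> (i, pt p c)"
 proof -
  let ?E = "edge_ball \<delta> p c - {edge_mid 0 p c}"
  have conn: "connected_space (top_of_set ?E)"
   using connected_punctured_edge_ball[OF pc \<delta>(1)] by (simp add: connected_space_subtopology)
  have ES: "(i, x) \<in> S \<delta>" if "x \<in> ?E" for x using that C0(1) by (auto simp: S_def)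
  have "continuous_map (top_of_set ?E) (?X \<delta>) (%x. (i, x))"
   by (rule continuous_map_simplex_slice)
    (use ES sat[OF \<delta>(2)] in \<open>auto simp: edge_ball_def saturated_def intro: continuous_intros\<close>)
  then have "locally_constant_on (top_of_set ?E) (%x. \<psi> (i, x))"
   using \<psi>(1) by (rule locally_constant_pullback)
  from connected_locally_constant[OF conn this, of "pt c p" "pt p c"] show ?thesis
   using pt[OF pc] pt[OF pc[symmetric]] edge_mid_swap[OF pc, of 0] by (simp add: edge_ball_def)
 qed
 ultimately show False using pc by (metis less_asym linorder_neqE)
qed

section \<open>The boundary of a compact 3-manifold\<close>

text \<open>By invariance of domain a chart in the open space and a chart in the half-space are compatible only
off the bounding plane.\<close>

lemma half_space_chart_interior:
 assumes U: "openin X U" "x \<in> U" and V: "openin (top_of_set {v :: real^3. 0 <= v $ 1}) V"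
  and \<phi>: "homeomorphic_map (subtopology X U) (top_of_set V) \<phi>"
 shows "manifold_point X x \<longleftrightarrow> 0 < \<phi> x $ 1"
proof
 let ?H = "{v :: real^3. 0 <= v $ 1}"
 have tU: "topspace (subtopology X U) = U" using openin_subset[OF U(1)] by auto
 have img: "\<phi> ` U = V" using homeomorphic_imp_surjective_map[OF \<phi>] unfolding tU by simp
 have VH: "V \<subseteq> ?H" using openin_subset[OF V] by simp
 {
  assume pos: "0 < \<phi> x $ 1"
  let ?G = "{y \<in> U. \<phi> y \<in> {v. 0 < v $ 1}}"
  have "continuous_map (subtopology X U) euclidean \<phi>"
   using homeomorphic_imp_continuous_map[OF \<phi>] continuous_map_into_fulltopology by blast
  moreover have op: "open {v :: real^3. 0 < v $ 1}" by (intro open_Collect_less continuous_intros)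
  ultimately have "openin (subtopology X U) ?G"
   using openin_continuous_map_preimage[of "subtopology X U" euclidean \<phi> "{v. 0 < v $ 1}"] unfolding tU by simp
  then have G: "openin X ?G" using U(1) openin_open_subtopology by blast
  have xG: "x \<in> ?G" using U(2) pos by simp
  obtain r W where W: "r > 0" "openin X W" "x \<in> W" "W \<subseteq> ?G \<inter> U" "\<phi> ` W = ?H \<inter> ball (\<phi> x) r"
   "homeomorphic_map (subtopology X W) (top_of_set (?H \<inter> ball (\<phi> x) r)) \<phi>"
   by (rule chart_ball[OF U V \<phi> G xG])
  have "0 < v $ 1" if "v \<in> ?H \<inter> ball (\<phi> x) r" for v
   using that W(4) unfolding W(5)[symmetric] by blast
  then have "?H \<inter> ball (\<phi> x) r = {v. 0 < v $ 1} \<inter> ball (\<phi> x) r" by (auto simp: less_imp_le)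
  then have "open (?H \<inter> ball (\<phi> x) r)" using op by auto
  then show "manifold_point X x" unfolding manifold_point_def
   using W(2,3) homeomorphic_map_imp_homeomorphic_space[OF W(6)] by blast
 }
 {
  assume "manifold_point X x"
  then obtain U' and V' :: "(real^3) set" where U': "openin X U'" "x \<in> U'" "open V'" "subtopology X U' homeomorphic_space top_of_set V'"
   unfolding manifold_point_def by blast
  then obtain \<psi> where \<psi>: "homeomorphic_map (subtopology X U') (top_of_set V') \<psi>" unfolding homeomorphic_space by blast
  have V'2: "openin (top_of_set UNIV) V'" using U'(3) by simp
  obtain r W where W: "r > 0" "openin X W" "x \<in> W" "W \<subseteq> U \<inter> U'" "\<psi> ` W = UNIV \<inter> ball (\<psi> x) r"
   "homeomorphic_map (subtopology X W) (top_of_set (UNIV \<inter> ball (\<psi> x) r)) \<psi>"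
   by (rule chart_ball[OF U'(1,2) V'2 \<psi> U])
  have W5: "homeomorphic_map (subtopology X W) (top_of_set (ball (\<psi> x) r)) \<psi>" using W(6) by simp
  have tW: "topspace (subtopology X W) = W" using openin_subset[OF W(2)] by auto
  obtain g where g: "homeomorphic_maps (subtopology X W) (top_of_set (ball (\<psi> x) r)) \<psi> g"
   using W5 homeomorphic_map_maps by blast
  have gc: "continuous_map (top_of_set (ball (\<psi> x) r)) (subtopology X W) g" and
   gi: "\<And>y. y \<in> W ==> g (\<psi> y) = y" "\<And>v. v \<in> ball (\<psi> x) r ==> \<psi> (g v) = v"
   using g unfolding homeomorphic_maps_def tW by auto
  have "continuous_map (subtopology X W) euclidean \<phi>"
  proof -
   have "continuous_map (subtopology X U) euclidean \<phi>"
    using homeomorphic_imp_continuous_map[OF \<phi>] continuous_map_into_fulltopology by blast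
   then have "continuous_map (subtopology (subtopology X U) W) euclidean \<phi>" by (rule continuous_map_from_subtopology)
   moreover have "U \<inter> W = W" using W(4) by blast
   ultimately show ?thesis by (simp add: subtopology_subtopology)
  qed
  then have "continuous_map (top_of_set (ball (\<psi> x) r)) euclidean (\<phi> \<circ> g)" using gc continuous_map_compose by blast
  then have c: "continuous_on (ball (\<psi> x) r) (\<phi> \<circ> g)" by simp
  have gW: "g v \<in> W" if "v \<in> ball (\<psi> x) r" for v
   using continuous_map_image_subset_topspace[OF gc] that tW by auto
  have inj: "inj_on \<phi> U" using homeomorphic_imp_injective_map[OF \<phi>] unfolding tU .
  have "inj_on (\<phi> \<circ> g) (ball (\<psi> x) r)"
  proof (rule inj_onI)
   fix v w assume vw: "v \<in> ball (\<psi> x) r" "w \<in> ball (\<psi> x) r" "(\<phi> \<circ> g) v = (\<phi> \<circ> g) w"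
   then have "g v = g w" using inj gW[OF vw(1)] gW[OF vw(2)] W(4) unfolding inj_on_def by auto
   then show "v = w" using gi(2) vw(1,2) by metis
  qed
  from invariance_of_domain[OF c open_ball this] have op: "open ((\<phi> \<circ> g) ` ball (\<psi> x) r)" .
  have sub: "(\<phi> \<circ> g) ` ball (\<psi> x) r \<subseteq> ?H"
  proof
   fix u assume "u \<in> (\<phi> \<circ> g) ` ball (\<psi> x) r"
   then obtain v where "v \<in> ball (\<psi> x) r" "u = \<phi> (g v)" by auto
   then show "u \<in> ?H" using gW W(4) img VH by blast
  qed
  have "\<phi> x \<in> (\<phi> \<circ> g) ` ball (\<psi> x) r"
   using gi(1)[OF W(3)] W(1) by (intro image_eqI[of _ _ "\<psi> x"]) auto
  then obtain e where "e > 0" "ball (\<phi> x) e \<subseteq> (\<phi> \<circ> g) ` ball (\<psi> x) r" using op unfolding open_contains_ball by blast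
  then have e: "e > 0" "ball (\<phi> x) e \<subseteq> ?H" using sub by (auto simp only: intro: subset_trans)
  have "\<phi> x - (e/2) *\<^sub>R axis 1 1 \<in> ball (\<phi> x) e" using e(1) by (simp add: dist_norm norm_axis_1)
  then have "\<phi> x - (e/2) *\<^sub>R axis 1 1 \<in> ?H" using e(2) by blast
  then have "0 <= \<phi> x $ 1 - e/2" by (simp add: axis_def)
  then show "0 < \<phi> x $ 1" using e(1) by linarith
 }
qed

lemma openin_manifold_interior: "openin X (manifold_interior X)"
proof (subst openin_subopen, intro ballI)
 fix x assume x: "x \<in> manifold_interior X"
 then obtain U and V :: "(real^3) set" where U: "openin X U" "x \<in> U" "open V" "subtopology X U homeomorphic_space top_of_set V"
  unfolding manifold_interior_def manifold_point_def by blast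
 then have "U \<subseteq> manifold_interior X" using openin_subset[OF U(1)] unfolding manifold_interior_def manifold_point_def by blast
 then show "\<exists>T. openin X T & x \<in> T & T \<subseteq> manifold_interior X" using U by blast
qed

lemma closedin_manifold_boundary: "closedin X (manifold_boundary X)"
 unfolding manifold_boundary_def by (rule closedin_diff) (auto simp: openin_manifold_interior)

text \<open>Half-balls become convex when the bounding plane is removed.\<close>

lemma H1_nice_manifold_boundary:
 assumes N: "compact_3_manifold_with_boundary N"
 shows "H1_nice_boundary N (manifold_boundary N)"
 unfolding H1_nice_boundary_def
proof (intro conjI closedin_manifold_boundary ballI allI impI)
 fix a G assume a: "a \<in> manifold_boundary N" and "openin N G & a \<in> G"
 then have G: "openin N G" "a \<in> G" by auto
 let ?H = "{v :: real^3. 0 <= v $ 1}"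
 have aN: "a \<in> topspace N" "\<not> manifold_point N a" using a by (auto simp: manifold_boundary_def manifold_interior_def)
 then obtain U V where U: "openin N U" "a \<in> U" and V: "openin (top_of_set ?H) V" and h: "subtopology N U homeomorphic_space top_of_set V"
  using N unfolding compact_3_manifold_with_boundary_def half_space_point_def by blast
 obtain \<phi> where \<phi>: "homeomorphic_map (subtopology N U) (top_of_set V) \<phi>" using h unfolding homeomorphic_space by blast
 obtain r W where W: "r > 0" "openin N W" "a \<in> W" "W \<subseteq> G \<inter> U" "\<phi> ` W = ?H \<inter> ball (\<phi> a) r"
  "homeomorphic_map (subtopology N W) (top_of_set (?H \<inter> ball (\<phi> a) r)) \<phi>"
  by (rule chart_ball[OF U V \<phi> G])
 have tW: "topspace (subtopology N W) = W" using openin_subset[OF W(2)] by auto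
 have bd: "y \<in> manifold_boundary N \<longleftrightarrow> \<not> 0 < \<phi> y $ 1" if "y \<in> W" for y
 proof -
  have "y \<in> U" "y \<in> topspace N" using that W(4) openin_subset[OF W(2)] by auto
  then show ?thesis using half_space_chart_interior[OF U(1) _ V \<phi>, of y] by (simp add: manifold_boundary_def manifold_interior_def)
 qed
 have \<phi>a: "\<not> 0 < \<phi> a $ 1" using bd[OF W(3)] a by simp
 have "\<phi> a \<in> \<phi> ` W" using W(3) by blast
 then have \<phi>a0: "\<phi> a $ 1 = 0" using \<phi>a unfolding W(5) by simp
 let ?C = "ball (\<phi> a) r \<inter> {v. axis 1 1 \<bullet> v > (0::real)}"
 have C: "?C = {v \<in> ?H \<inter> ball (\<phi> a) r. 0 < v $ 1}" by (auto simp: inner_axis')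
 have "homeomorphic_map (subtopology (subtopology N W) (W - manifold_boundary N)) (subtopology (top_of_set (?H \<inter> ball (\<phi> a) r)) ?C) \<phi>"
  by (rule homeomorphic_map_subtopologies_alt[OF W(6)]) (use bd in \<open>auto simp: inner_axis' tW\<close>)
 moreover have "subtopology (subtopology N W) (W - manifold_boundary N) = subtopology N (W - manifold_boundary N)"
  by (simp add: subtopology_subtopology Int_absorb1 Diff_subset)
 moreover have "?H \<inter> ball (\<phi> a) r \<inter> ?C = ?C" unfolding C by blast
 then have "subtopology (top_of_set (?H \<inter> ball (\<phi> a) r)) ?C = top_of_set ?C"
  by (simp add: subtopology_subtopology)
 ultimately have hom: "subtopology N (W - manifold_boundary N) homeomorphic_space top_of_set ?C"
  using homeomorphic_map_imp_homeomorphic_space by metis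
 have cv: "convex ?C" by (intro convex_Int convex_ball convex_halfspace_gt)
 have "H1_trivial (top_of_set ?C)" by (rule H1_trivial_convex[OF cv])
 then have "H1_trivial (subtopology N (W - manifold_boundary N))" using H1_trivial_homeomorphic hom homeomorphic_space_sym by blast
 moreover have "connected_space (top_of_set ?C)" using convex_connected[OF cv] by (simp add: connected_space_subtopology)
 then have "connected_space (subtopology N (W - manifold_boundary N))"
  using hom homeomorphic_connected_space by blast
 then have "connectedin N (W - manifold_boundary N)" using openin_subset[OF W(2)] unfolding connectedin_def by blast
 moreover have "W - manifold_boundary N ~= {}"
 proof -
  let ?v = "\<phi> a + (r/2) *\<^sub>R axis 1 1"
  have "dist (\<phi> a) ?v = r/2" using W(1) by (simp add: dist_norm norm_axis_1)
  moreover have "?v $ 1 = r/2" using \<phi>a0 by (simp add: axis_def)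
  ultimately have "?v \<in> \<phi> ` W" "0 < ?v $ 1" using W(1) unfolding W(5) by auto
  then obtain y where "y \<in> W" "?v = \<phi> y" "0 < ?v $ 1" by blast
  then have "y \<in> W" "0 < \<phi> y $ 1" by simp_all
  then show ?thesis using bd by blast
 qed
 ultimately show "\<exists>W. openin N W & a \<in> W & W \<subseteq> G & W - manifold_boundary N ~= {} &
   connectedin N (W - manifold_boundary N) & H1_trivial (subtopology N (W - manifold_boundary N))"
  using W(2,3,4) by blast
qed

lemma H1_nice_boundary_open_subspace:
 assumes D: "H1_nice_boundary Y D" and A: "openin Y A"
 shows "H1_nice_boundary (subtopology Y A) (A \<inter> D)"
 unfolding H1_nice_boundary_def
proof (intro conjI ballI allI impI)
 have "closedin Y D" using D unfolding H1_nice_boundary_def by blast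
 then show "closedin (subtopology Y A) (A \<inter> D)" by (simp add: closedin_subtopology_Int_closed)
 fix a U assume a: "a \<in> A \<inter> D" and "openin (subtopology Y A) U & a \<in> U"
 then have U: "openin Y U" "a \<in> U" "U \<subseteq> A" using A openin_open_subtopology by blast+
 obtain W where W: "openin Y W" "a \<in> W" "W \<subseteq> U" "W - D ~= {}" "connectedin Y (W - D)" "H1_trivial (subtopology Y (W - D))"
  by (rule nice_boundary_nbhd[OF D _ U(1,2)]) (use a in auto)
 have WA: "W - A \<inter> D = W - D" "A \<inter> (W - D) = W - D" "W - D \<subseteq> A" using W(3) U(3) by auto
 have "openin (subtopology Y A) W" using W(1,3) U(3) A openin_open_subtopology by blast
 moreover have "connectedin (subtopology Y A) (W - D)" using W(5) WA(3) by (simp add: connectedin_subtopology)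
 moreover have "H1_trivial (subtopology (subtopology Y A) (W - D))" using W(6) by (simp add: subtopology_subtopology WA)
 ultimately show "\<exists>W. openin (subtopology Y A) W & a \<in> W & W \<subseteq> U & W - A \<inter> D ~= {} &
   connectedin (subtopology Y A) (W - A \<inter> D) & H1_trivial (subtopology (subtopology Y A) (W - A \<inter> D))"
  by (intro exI[of _ W] conjI) (simp_all only: WA W not_False_eq_True)
qed

lemma connected_clopen_component:
 assumes "connectedin X C" "C ~= {}" "openin X C" "closedin X C"
 shows "C \<in> connected_components_of X"
proof -
 obtain x where x: "x \<in> C" using assms(2) by blast
 let ?K = "connected_component_of_set X x"
 have xX: "x \<in> topspace X" using x connectedin_subset_topspace[OF assms(1)] by blast
 have "C \<subseteq> ?K" by (rule connected_component_of_maximal[OF assms(1) x])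
 moreover have "?K \<subseteq> C"
  using connectedin_clopen_cases[OF connectedin_connected_component_of[of X x] assms(4,3)] x \<open>C \<subseteq> ?K\<close> by (auto simp: disjnt_def)
 ultimately have "C = ?K" by blast
 then show ?thesis using xX connected_component_in_connected_components_of[of X x] by simp
qed

text \<open>The interior of \<open>N\<close> is identified by \<open>h\<close> with the glued complex minus its vertices, and \<open>\<pi>\<close> sends a point of
the tetrahedra to the interior of \<open>N\<close>.\<close>

locale corner_collars =
 fixes N :: "'m topology" and T :: "('t::finite) gluing" and h :: "('t \<times> (real^4)) set => 'm"
 assumes N: "compact_3_manifold_with_boundary N"
  and tri: "ideal_triangulation (subtopology N (manifold_interior N)) T h"
begin

abbreviation "bN \<equiv> manifold_boundary N"
abbreviation "iN \<equiv> manifold_interior N"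

definition \<pi> :: "'t \<times> (real^4) => 'm" where "\<pi> = h \<circ> quotient_point T"
definition off_vertices :: "('t \<times> (real^4)) set" where "off_vertices = {(i, x). x \<in> std_simplex & (\<forall>p. x $ p < 1)}"
definition collar :: "('t \<times> 4) set => real => 'm set" where "collar V eps = \<pi> ` corner_points V eps"
text \<open>The tetrahedra with their corners cut off at depth \<open>eps\<close>; everything outside lies in collars.\<close>

definition core :: "real => ('t \<times> (real^4)) set" where "core eps = {(i, x). x \<in> std_simplex & (\<forall>p. x $ p < 1 - eps)}"

lemma fp: "face_pairing T" using tri unfolding ideal_triangulation_def by blast
lemma h_homeomorphic: "homeomorphic_map (minus_vertices T) (subtopology N iN) h" using tri unfolding ideal_triangulation_def by blast
lemma compact_N: "compact_space N" and Hausdorff_N: "Hausdorff_space N"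
 using N unfolding compact_3_manifold_with_boundary_def by auto

lemma iN_sub: "iN \<subseteq> topspace N" by (auto simp: manifold_interior_def)
lemma bN_eq: "bN = topspace N - iN" by (simp add: manifold_boundary_def)
lemma nice: "H1_nice_boundary N bN" by (rule H1_nice_manifold_boundary[OF N])

lemma simplex_le_1:
 assumes "x \<in> std_simplex"
 shows "x $ p <= 1"
proof -
 obtain c where "c ~= p" using exists_third[of p p] by metis
 then have "p ~= c" by simp
 then have "x $ p + x $ c <= 1" using simplex_pair_le_1[OF assms] by blast
 moreover have "0 <= x $ c" using assms by (simp add: std_simplex_def)
 ultimately show ?thesis by linarith
qed

lemma simplex_vertex: "x \<in> std_simplex ==> x $ p = 1 ==> x = axis p 1"
proof -
 assume x: "x \<in> std_simplex" "x $ p = 1"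
 have "x $ c = 0" if "c ~= p" for c
 proof -
  have "x $ p + x $ c <= 1" using simplex_pair_le_1[OF x(1)] that by metis
  moreover have "0 <= x $ c" using x(1) by (simp add: std_simplex_def)
  ultimately show ?thesis using x(2) by linarith
 qed
 then show ?thesis using x(2) by (auto simp: vec_eq_iff axis_def)
qed

lemma core_saturated: "saturated T (core eps)"
 unfolding saturated_def
proof (intro conjI allI impI)
 show "core eps \<subseteq> simplex_points" by (auto simp: core_def simplex_points_def)
 fix i x a assume *: "(i, x) \<in> core eps" "x $ a = 0"
 have "face_move T i a x $ p < 1 - eps" for p
 proof -
  obtain c where "p = perm T i a c" using perm_forth[OF fp] by metis
  then show ?thesis using * by (simp add: face_move_nth[OF fp] core_def)
 qed
 then show "(nbr T i a, face_move T i a x) \<in> core eps" using *(1) face_move_simplex[OF fp] by (auto simp: core_def)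
qed

lemma off_vertices_core: "off_vertices = core 0" by (simp add: off_vertices_def core_def)

lemma openin_core: "openin simplices (core eps)"
 unfolding openin_simplices
proof (intro conjI allI)
 show "core eps \<subseteq> simplex_points" by (auto simp: core_def simplex_points_def)
 fix i
 have "{x. (i, x) \<in> core eps} = std_simplex \<inter> {x. \<forall>p. x $ p < 1 - eps}" by (auto simp: core_def)
 moreover have "open {x :: real^4. \<forall>p. x $ p < 1 - eps}"
 proof -
  have "{x :: real^4. \<forall>p. x $ p < 1 - eps} = (\<Inter>p. {x. x $ p < 1 - eps})" by auto
  then show ?thesis by (auto intro!: open_INT open_Collect_less continuous_intros)
 qed
 ultimately show "openin (top_of_set std_simplex) {x. (i, x) \<in> core eps}" by auto
qed

lemma corner_points_off: "corner_points V eps \<subseteq> off_vertices" if "eps <= 1/2" for V eps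
proof
 fix u assume "u \<in> corner_points V eps"
 then obtain i x p where u: "u = (i, x)" "x \<in> corner_cone eps p" unfolding corner_points_def by blast
 then have x: "x \<in> std_simplex" "1/2 < x $ p" "x $ p < 1" using that by (auto simp: corner_cone_def)
 have "x $ c < 1" for c
 proof (cases "c = p")
  case False
  then have "x $ p + x $ c <= 1" using simplex_pair_le_1[OF x(1)] by metis
  then show ?thesis using x(2) by linarith
 qed (use x in simp)
 then show "u \<in> off_vertices" using u x(1) by (simp add: off_vertices_def)
qed

lemma vertex_iff:
 assumes u: "u \<in> simplex_points"
 shows "quotient_point T u \<in> ideal_vertices T \<longleftrightarrow> u \<notin> off_vertices"
proof
 assume "quotient_point T u \<in> ideal_vertices T"
 then obtain j e where "quotient_point T (j, axis e 1) = quotient_point T u" unfolding ideal_vertices_def by auto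
 then have "glued T u (j, axis e 1)" unfolding glued_class_eq_glued[OF fp] by (rule glued_sym[OF fp])
 from glued_values[OF fp this, of e] obtain d where "snd u $ d = 1" by auto
 then have "\<not> snd u $ d < 1" by simp
 then show "u \<notin> off_vertices" unfolding off_vertices_def by fastforce
next
 assume n: "u \<notin> off_vertices"
 obtain i x where ix: "u = (i, x)" by (cases u)
 have x: "x \<in> std_simplex" using u ix by (simp add: simplex_points_def)
 then obtain p where "\<not> x $ p < 1" using n ix by (auto simp: off_vertices_def)
 then have "x $ p = 1" using simplex_le_1[OF x, of p] by linarith
 then have "x = axis p 1" by (rule simplex_vertex[OF x])
 then show "quotient_point T u \<in> ideal_vertices T" unfolding ideal_vertices_def ix by blast
qed

lemma topspace_minus: "topspace (minus_vertices T) = quotient_point T ` off_vertices"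
using topspace_pseudo_manifold vertex_iff by (auto simp: off_vertices_def simplex_points_def minus_vertices_def)

lemma h_image: "h ` topspace (minus_vertices T) = iN"
 using homeomorphic_imp_surjective_map[OF h_homeomorphic] iN_sub by auto

lemma \<pi>_image: "\<pi> ` off_vertices = iN"
 using h_image unfolding topspace_minus \<pi>_def by (simp add: image_comp)

lemma \<pi>_eq:
 assumes "u \<in> off_vertices" "v \<in> off_vertices"
 shows "\<pi> u = \<pi> v \<longleftrightarrow> glued T u v"
proof -
 have "inj_on h (quotient_point T ` off_vertices)"
  using homeomorphic_imp_injective_map[OF h_homeomorphic] unfolding topspace_minus .
 from inj_on_eq_iff[OF this imageI imageI, OF assms] show ?thesis
  by (simp add: \<pi>_def glued_class_eq_glued[OF fp])
qed

lemma subtopology_minus: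
 assumes "S \<subseteq> off_vertices"
 shows "subtopology (minus_vertices T) (quotient_point T ` S) = subtopology (pseudo_manifold T) (quotient_point T ` S)"
proof -
 have "quotient_point T ` S \<subseteq> topspace (minus_vertices T)" using assms unfolding topspace_minus by blast
 then have "topspace (pseudo_manifold T) - ideal_vertices T \<inter> quotient_point T ` S = quotient_point T ` S &
   (topspace (pseudo_manifold T) - ideal_vertices T) \<inter> quotient_point T ` S = quotient_point T ` S \<or>
   (topspace (pseudo_manifold T) - ideal_vertices T) \<inter> quotient_point T ` S = quotient_point T ` S"
  by (auto simp: minus_vertices_def)
 then show ?thesis by (auto simp: minus_vertices_def subtopology_subtopology)
qed

lemma descent_map_\<pi>:
 assumes S: "saturated T S" "S \<subseteq> off_vertices"
 shows "descent_map (subtopology simplices S) (subtopology N (\<pi> ` S)) \<pi>"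
proof -
 have sub: "quotient_point T ` S \<subseteq> topspace (minus_vertices T)" using S(2) unfolding topspace_minus by blast
 have "homeomorphic_map (subtopology (minus_vertices T) (quotient_point T ` S)) (subtopology (subtopology N iN) (\<pi> ` S)) h"
  by (rule homeomorphic_map_subtopologies[OF h_homeomorphic]) (use sub h_image iN_sub in \<open>auto simp: \<pi>_def\<close>)
 moreover have "iN \<inter> \<pi> ` S = \<pi> ` S" using \<pi>_image S(2) by blast
 ultimately have "homeomorphic_map (subtopology (pseudo_manifold T) (quotient_point T ` S)) (subtopology N (\<pi> ` S)) h"
  unfolding subtopology_minus[OF S(2)] by (simp add: subtopology_subtopology)
 from descent_map_homeomorphic[OF descent_map_saturated[OF fp S(1)] this] show ?thesis by (simp add: \<pi>_def)
qed

lemma openin_\<pi>_image: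
 assumes S: "saturated T S" "S \<subseteq> off_vertices" "openin simplices S"
 shows "openin N (\<pi> ` S)"
proof -
 have sub: "quotient_point T ` S \<subseteq> topspace (minus_vertices T)" using S(2) unfolding topspace_minus by blast
 have "openin (pseudo_manifold T) (quotient_point T ` S)" by (rule openin_saturated_image[OF fp S(1,3)])
 moreover have "quotient_point T ` S \<subseteq> topspace (pseudo_manifold T) - ideal_vertices T" using sub by (auto simp: minus_vertices_def)
 ultimately have "openin (minus_vertices T) (quotient_point T ` S)"
  unfolding minus_vertices_def openin_subtopology by blast
 then have "openin (subtopology N iN) (h ` quotient_point T ` S)"
  using homeomorphic_imp_open_map[OF h_homeomorphic] unfolding open_map_def by blast
 then have "openin N (h ` quotient_point T ` S)" using openin_open_subtopology[OF openin_manifold_interior] by blast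
 then show ?thesis by (simp add: \<pi>_def image_comp)
qed

lemma collar_in: "collar V eps \<subseteq> iN" if "eps <= 1/2"
 using corner_points_off[OF that, of V] \<pi>_image unfolding collar_def by blast

lemma openin_collar: "corner_class T V ==> eps <= 1/2 ==> openin N (collar V eps)"
 unfolding collar_def by (intro openin_\<pi>_image saturated_corner_points fp corner_points_off openin_corner_points)

lemma corner_chart_collar:
 assumes V: "corner_class T V" and eps: "eps <= 1/2"
 shows "corner_chart T V eps (subtopology N (collar V eps)) \<pi>"
 unfolding corner_chart_def collar_def
proof (intro conjI ballI)
 show "descent_map (subtopology simplices (corner_points V eps)) (subtopology N (\<pi> ` corner_points V eps)) \<pi>"
  by (rule descent_map_\<pi>[OF saturated_corner_points[OF fp V eps] corner_points_off[OF eps]])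
 show "\<pi> p = \<pi> q \<longleftrightarrow> glued T p q" if "p \<in> corner_points V eps" "q \<in> corner_points V eps" for p q
  using \<pi>_eq corner_points_off[OF eps] that by blast
qed

lemma collar_mono: "eps' <= eps ==> collar V eps' \<subseteq> collar V eps"
 unfolding collar_def using corner_points_mono by blast

lemma corner_class_unique:
 assumes "corner_class T V" "corner_class T V'" "v \<in> V" "v \<in> V'"
 shows "V = V'"
proof -
 obtain x y where xy: "V = glued_class (corner_gluing T) x" "V' = glued_class (corner_gluing T) y" using assms(1,2) unfolding corner_class_def by blast
 with assms(3,4) have "glued_class (corner_gluing T) x = glued_class (corner_gluing T) v" "glued_class (corner_gluing T) y = glued_class (corner_gluing T) v"
  unfolding glued_class_eq_iff by (simp_all add: glued_class_def)
 then show ?thesis using xy by simp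
qed

text \<open>Collars of different ideal vertices are disjoint, as a point has at most one coordinate above 1/2.\<close>

lemma collar_inter:
 assumes V: "corner_class T V" "corner_class T V'" and eps: "eps <= 1/2" "eps' <= 1/2"
  and y: "y \<in> collar V eps" "y \<in> collar V' eps'"
 shows "V = V' & y \<in> collar V (min eps eps')"
proof -
 obtain u w where u: "u \<in> corner_points V eps" "y = \<pi> u" and w: "w \<in> corner_points V' eps'" "y = \<pi> w" using y unfolding collar_def by blast
 have "glued T u w" using \<pi>_eq u w corner_points_off eps by (metis subsetD)
 then have w2: "w \<in> corner_points V eps" using saturated_glued[OF fp saturated_corner_points[OF fp V(1) eps(1)]] u(1) by blast
 obtain i x where ix: "w = (i, x)" by (cases w)
 obtain p p' where p: "(i, p) \<in> V" "x \<in> corner_cone eps p" and p': "(i, p') \<in> V'" "x \<in> corner_cone eps' p'"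
  using w(1) w2 unfolding ix corner_points_def by blast
 have pp: "p = p'" using big_corner_cone[OF p(2) eps(1)] big_corner_cone[OF p'(2) eps(2)] by simp
 then have "V = V'" using corner_class_unique[OF V] p p' by blast
 moreover have "x \<in> corner_cone (min eps eps') p" using p(2) p'(2) pp by (auto simp: corner_cone_def)
 then have "w \<in> corner_points V (min eps eps')" using p(1) unfolding ix corner_points_def by blast
 ultimately show ?thesis using w(2) unfolding collar_def by blast
qed

lemma compactin_core_closed: "compactin N (\<pi> ` {(i, x). x \<in> std_simplex & (\<forall>p. x $ p <= 1 - eps)})" if eps: "0 < eps" for eps
proof -
 let ?S = "{x \<in> std_simplex. \<forall>p. x $ p <= 1 - eps}"
 have "closed ?S"
 proof -
  have "?S = (\<Inter>c. {x. 0 <= x $ c}) \<inter> {x. (\<Sum>c\<in>UNIV. x $ c) = 1} \<inter> (\<Inter>p. {x. x $ p <= 1 - eps})" by (auto simp: std_simplex_def)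
  then show ?thesis by (auto intro!: closed_Int closed_INT closed_Collect_le closed_Collect_eq continuous_intros)
 qed
 moreover have "bounded ?S"
 proof (rule boundedI)
  fix x assume "x \<in> ?S"
  then have x: "x \<in> std_simplex" by simp
  have "norm x <= (\<Sum>c\<in>UNIV. \<bar>x $ c\<bar>)" by (rule norm_le_l1_cart)
  also have "\<dots> = (\<Sum>c\<in>UNIV. x $ c)" using x by (simp add: std_simplex_def)
  finally show "norm x <= 1" using x by (simp add: std_simplex_def)
 qed
 ultimately have comp: "compact ?S" by (simp add: compact_eq_bounded_closed)
 have one: "compactin N (\<pi> ` ({i} \<times> ?S))" for i
 proof -
  have "continuous_map (top_of_set ?S) (subtopology simplices off_vertices) (%x. (i, x))"
  proof (rule continuous_map_simplex_slice)
   fix x assume "x \<in> ?S"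
   then have "x \<in> std_simplex" "\<forall>p. x $ p <= 1 - eps" by auto
   then show "(i, x) \<in> off_vertices" using eps by (auto simp: off_vertices_def intro: le_less_trans)
  qed (auto simp: off_vertices_def simplex_points_def)
  moreover have "continuous_map (subtopology simplices off_vertices) (subtopology N (\<pi> ` off_vertices)) \<pi>"
   by (rule descent_mapD(2)[OF descent_map_\<pi>]) (simp_all add: off_vertices_core core_saturated)
  then have "continuous_map (subtopology simplices off_vertices) N \<pi>" by (rule continuous_map_into_fulltopology)
  ultimately have c: "continuous_map (top_of_set ?S) N (\<pi> \<circ> (%x. (i, x)))" by (rule continuous_map_compose)
  have "compactin (top_of_set ?S) ?S" using comp by (simp add: compactin_subtopology)
  from image_compactin[OF this c] show ?thesis
  proof -
   have "(\<pi> \<circ> (%x. (i, x))) ` ?S = \<pi> ` ({i} \<times> ?S)" by auto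
   then show ?thesis using \<open>compactin N ((\<pi> \<circ> (%x. (i, x))) ` ?S)\<close> by simp
  qed
 qed
 have "\<pi> ` {(i, x). x \<in> std_simplex & (\<forall>p. x $ p <= 1 - eps)} = \<Union>(range (%i. \<pi> ` ({i} \<times> ?S)))" by auto
 moreover have "compactin N (\<Union>(range (%i. \<pi> ` ({i} \<times> ?S))))" by (rule compactin_Union) (use one in auto)
 ultimately show ?thesis by simp
qed

text \<open>The truncated tetrahedra have compact image, so near the boundary only collars are met.\<close>

lemma end_neighbourhood:
 assumes eps: "0 < eps" "eps <= 1/2"
 obtains O' where "openin N O'" "bN \<subseteq> O'" "O' \<inter> iN \<subseteq> (\<Union>V\<in>{V. corner_class T V}. collar V eps)"
proof -
 let ?C = "\<pi> ` {(i, x). x \<in> std_simplex & (\<forall>p. x $ p <= 1 - eps)}"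
 have "closedin N ?C" using compactin_imp_closedin[OF Hausdorff_N compactin_core_closed[OF eps(1)]] .
 then have 1: "openin N (topspace N - ?C)" by auto
 have "{(i, x). x \<in> std_simplex & (\<forall>p. x $ p <= 1 - eps)} \<subseteq> off_vertices"
  using eps by (auto simp: off_vertices_def intro: le_less_trans)
 then have "?C \<subseteq> iN" using \<pi>_image by blast
 then have 2: "bN \<subseteq> topspace N - ?C" unfolding bN_eq by blast
 have "(topspace N - ?C) \<inter> iN \<subseteq> (\<Union>V\<in>{V. corner_class T V}. collar V eps)"
 proof
  fix y assume y: "y \<in> (topspace N - ?C) \<inter> iN"
  then obtain i x where u: "(i, x) \<in> off_vertices" "y = \<pi> (i, x)" unfolding \<pi>_image[symmetric] by auto
  have "\<not> (\<forall>p. x $ p <= 1 - eps)" using y u by (auto simp: off_vertices_def)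
  then obtain p where p: "1 - eps < x $ p" by (auto simp: not_le)
  let ?V = "glued_class (corner_gluing T) (i, p)"
  have V: "corner_class T ?V" "(i, p) \<in> ?V" by (auto simp: corner_class_def glued_class_refl)
  have "x \<in> corner_cone eps p" using u(1) p by (auto simp: corner_cone_def off_vertices_def)
  then have "y \<in> collar ?V eps" using V(2) u(2) unfolding collar_def corner_points_def by blast
  then show "y \<in> (\<Union>V\<in>{V. corner_class T V}. collar V eps)" using V(1) by blast
 qed
 with 1 2 that show thesis by blast
qed

end

section \<open>Boundary components as ends of collars\<close>

context corner_collars
begin

text \<open>The boundary points approached from within the collar of the ideal vertex \<open>V\<close>.\<close>

definition end_of :: "('t \<times> 4) set => 'm set" where
 "end_of V = {b \<in> bN. \<exists>W. openin N W & b \<in> W & W - bN \<subseteq> collar V (1/2)}"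

text \<open>The collar completed by its end; an open subset of \<open>N\<close>.\<close>

definition closed_collar :: "('t \<times> 4) set => real => 'm set" where
 "closed_collar V eps = collar V eps \<union> end_of V"

lemma end_of_bN: "end_of V \<subseteq> bN" by (auto simp: end_of_def)

lemma end_of_collar: "eps <= 1/2 ==> end_of V \<inter> collar V' eps = {}"
 using end_of_bN collar_in unfolding bN_eq by blast

lemma end_nbhd:
 assumes V: "corner_class T V" and b: "b \<in> end_of V" and eps: "0 < eps" "eps <= 1/2" and G: "openin N G" "b \<in> G"
 obtains W where "openin N W" "b \<in> W" "W \<subseteq> G" "W - bN \<subseteq> collar V eps" "W - bN ~= {}" "W \<inter> bN \<subseteq> end_of V"
proof -
 obtain W0 where W0: "openin N W0" "b \<in> W0" "W0 - bN \<subseteq> collar V (1/2)" using b unfolding end_of_def by blast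
 obtain O' where O': "openin N O'" "bN \<subseteq> O'" "O' \<inter> iN \<subseteq> (\<Union>V\<in>{V. corner_class T V}. collar V eps)"
  by (rule end_neighbourhood[OF eps])
 define W where "W = W0 \<inter> O' \<inter> G"
 have "b \<in> O'" using O'(2) b end_of_bN by blast
 then have W: "openin N W" "b \<in> W" "W \<subseteq> G" using W0 O' G b unfolding W_def by auto
 have "W - bN \<subseteq> collar V eps"
 proof
  fix y assume y: "y \<in> W - bN"
  then have "y \<in> iN" using openin_subset[OF W(1)] unfolding bN_eq by blast
  then obtain V' where V': "corner_class T V'" "y \<in> collar V' eps" using O'(3) y unfolding W_def by blast
  have "y \<in> collar V (1/2)" using W0(3) y unfolding W_def by blast
  from collar_inter[OF V V'(1) order.refl eps(2) this V'(2)] have "V = V'" by blast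
  then show "y \<in> collar V eps" using V'(2) by simp
 qed
 moreover have "W - bN ~= {}" using nice_boundary_dense[OF nice W(1)] W(2) by blast
 moreover have "W \<inter> bN \<subseteq> end_of V" using W0 unfolding end_of_def W_def by blast
 ultimately show thesis using that W by blast
qed

lemma openin_closed_collar:
 assumes V: "corner_class T V" and eps: "0 < eps" "eps <= 1/2"
 shows "openin N (closed_collar V eps)"
proof (subst openin_subopen, intro ballI)
 fix y assume y: "y \<in> closed_collar V eps"
 show "\<exists>W. openin N W & y \<in> W & W \<subseteq> closed_collar V eps"
 proof (cases "y \<in> collar V eps")
  case True
  then show ?thesis using openin_collar[OF V eps(2)] unfolding closed_collar_def by blast
 next
  case False
  then have ye: "y \<in> end_of V" using y unfolding closed_collar_def by blast
  then have yN: "y \<in> topspace N" using end_of_bN unfolding bN_eq by blast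
  obtain W where W: "openin N W" "y \<in> W" "W \<subseteq> topspace N" "W - bN \<subseteq> collar V eps" "W - bN ~= {}" "W \<inter> bN \<subseteq> end_of V"
   by (rule end_nbhd[OF V ye eps openin_topspace yN])
  have "W \<subseteq> closed_collar V eps" using W(4,6) unfolding closed_collar_def by blast
  then show ?thesis using W(1,2) by blast
 qed
qed

lemma end_of_unique:
 assumes "corner_class T V" "corner_class T V'" "b \<in> end_of V" "b \<in> end_of V'"
 shows "V = V'"
proof -
 obtain W where W: "openin N W" "b \<in> W" "W - bN \<subseteq> collar V (1/2)" using assms(3) unfolding end_of_def by blast
 obtain W' where W': "openin N W'" "b \<in> W'" "W' - bN \<subseteq> collar V' (1/2)" using assms(4) unfolding end_of_def by blast
 obtain z where z: "z \<in> W \<inter> W'" "z \<notin> bN"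
  using nice_boundary_dense[OF nice, of "W \<inter> W'"] W W' by blast
 then have "z \<in> collar V (1/2)" "z \<in> collar V' (1/2)" using W(3) W'(3) by auto
 from collar_inter[OF assms(1,2) order.refl order.refl this] show ?thesis by blast
qed

text \<open>A half-ball minus the boundary is connected, so it lies in a single collar.\<close>

lemma end_of_cover:
 assumes b: "b \<in> bN"
 obtains V where "corner_class T V" "b \<in> end_of V"
proof -
 obtain O' where O': "openin N O'" "bN \<subseteq> O'" "O' \<inter> iN \<subseteq> (\<Union>V\<in>{V. corner_class T V}. collar V (1/2))"
  by (rule end_neighbourhood[of "1/2"]) auto
 have "b \<in> O'" using b O'(2) by blast
 obtain W where W: "openin N W" "b \<in> W" "W \<subseteq> O'" "W - bN ~= {}" "connectedin N (W - bN)" "H1_trivial (subtopology N (W - bN))"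
  by (rule nice_boundary_nbhd[OF nice b O'(1) \<open>b \<in> O'\<close>])
 have cov: "W - bN \<subseteq> (\<Union>V\<in>{V. corner_class T V}. collar V (1/2))"
  using W(3) O'(3) openin_subset[OF W(1)] unfolding bN_eq by blast
 obtain z where z: "z \<in> W - bN" using W(4) by blast
 then obtain V where V: "corner_class T V" "z \<in> collar V (1/2)" using cov by blast
 let ?E = "\<Union>V'\<in>{V'. corner_class T V' & V' ~= V}. collar V' (1/2)"
 have "W - bN \<subseteq> collar V (1/2)"
 proof (rule ccontr)
  assume n: "\<not> W - bN \<subseteq> collar V (1/2)"
  show False
  proof (rule connectedinD[OF W(5)])
   show "openin N (collar V (1/2))" by (rule openin_collar[OF V(1)]) simp
   show "openin N ?E" by (intro openin_Union) (auto intro!: openin_collar)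
   show "W - bN \<subseteq> collar V (1/2) \<union> ?E" using cov by blast
   show "collar V (1/2) \<inter> ?E \<inter> (W - bN) = {}" using collar_inter[OF V(1) _ order.refl order.refl] by blast
   show "collar V (1/2) \<inter> (W - bN) ~= {}" using z V(2) by blast
   show "?E \<inter> (W - bN) ~= {}" using n cov by blast
  qed
 qed
 then have "b \<in> end_of V" using b W(1,2) unfolding end_of_def by blast
 then show thesis using that V(1) by blast
qed

definition other_ends :: "('t \<times> 4) set => 'm set" where
 "other_ends V = (\<Union>V'\<in>{V'. corner_class T V' & V' ~= V}. closed_collar V' (1/2))"

lemma openin_other_ends: "openin N (other_ends V)"
 unfolding other_ends_def by (intro openin_Union) (auto intro!: openin_closed_collar)

lemma other_ends_disjoint:
 assumes V: "corner_class T V" and eps: "eps <= 1/2"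
 shows "closed_collar V eps \<inter> other_ends V = {}"
proof (rule equals0I)
 fix y assume y: "y \<in> closed_collar V eps \<inter> other_ends V"
 then obtain V' where V': "corner_class T V'" "V' ~= V" "y \<in> closed_collar V' (1/2)" unfolding other_ends_def by blast
 have h: "(1/2::real) <= 1/2" by simp
 from y have "y \<in> collar V eps \<or> y \<in> end_of V" unfolding closed_collar_def by blast
 moreover have "y \<in> collar V' (1/2) \<or> y \<in> end_of V'" using V'(3) unfolding closed_collar_def by blast
 ultimately show False
  using collar_inter[OF V V'(1) eps h] end_of_unique[OF V V'(1)] end_of_collar[OF eps] end_of_collar[OF h] V'(2) by blast
qed

lemma bN_split: "corner_class T V ==> bN \<subseteq> end_of V \<union> other_ends V"
using end_of_cover by (auto simp: other_ends_def closed_collar_def)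

lemma closedin_end_of:
 assumes V: "corner_class T V"
 shows "closedin N (end_of V)"
proof -
 have "end_of V = bN - other_ends V"
  using bN_split[OF V] end_of_bN[of V] other_ends_disjoint[OF V order.refl] unfolding closed_collar_def by blast
 then show ?thesis using closedin_diff[OF closedin_manifold_boundary openin_other_ends] by simp
qed

text \<open>What remains of \<open>N\<close> outside the given open set and the other completed collars is a compact subset of the interior, hence
covered by a single truncated complex.\<close>

lemma collar_cofinal:
 assumes V: "corner_class T V" and G: "openin N G" "end_of V \<subseteq> G"
 obtains eps where "0 < eps" "eps <= 1/2" "collar V eps \<subseteq> G"
proof -
 define F where "F = topspace N - G - other_ends V"
 have "closedin N F" unfolding F_def using G(1) openin_other_ends by blast
 then have cF: "compactin N F" using compact_N closedin_compact_space by blast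
 have F_iN: "F \<subseteq> iN" using bN_split[OF V] G(2) unfolding F_def bN_eq by blast
 let ?f = "%\<delta>. \<pi> ` core \<delta>"
 have cov: "F \<subseteq> \<Union>(?f ` {\<delta>. 0 < \<delta> & \<delta> <= 1/2})"
 proof
  fix y assume "y \<in> F"
  then obtain u where u: "u \<in> off_vertices" "y = \<pi> u" using F_iN unfolding \<pi>_image[symmetric] by blast
  obtain i x where ix: "u = (i, x)" by (cases u)
  have x: "x \<in> std_simplex" "\<And>p. x $ p < 1" using u(1) by (auto simp: ix off_vertices_def)
  define \<delta> where "\<delta> = Min (insert (1/2) (range (%p. (1 - x $ p)/2)))"
  have "0 < \<delta>" using x(2) by (simp add: \<delta>_def)
  moreover have "\<delta> <= 1/2" unfolding \<delta>_def by (rule Min_le) auto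
  moreover have "x $ p < 1 - \<delta>" for p
  proof -
   have "\<delta> <= (1 - x $ p)/2" unfolding \<delta>_def by (rule Min_le) auto
   then have "2 * \<delta> <= 1 - x $ p" by simp
   then show ?thesis using \<open>0 < \<delta>\<close> by linarith
  qed
  ultimately have "u \<in> core \<delta>" "\<delta> \<in> {\<delta>. 0 < \<delta> & \<delta> <= 1/2}" using x(1) by (auto simp: ix core_def)
  then show "y \<in> \<Union>(?f ` {\<delta>. 0 < \<delta> & \<delta> <= 1/2})" using u(2) by blast
 qed
 have op: "openin N U" if U: "U \<in> ?f ` {\<delta>. 0 < \<delta> & \<delta> <= 1/2}" for U
 proof -
  obtain \<delta> where \<delta>: "0 < \<delta>" "U = ?f \<delta>" using U by blast
  have "core \<delta> \<subseteq> off_vertices" using \<delta>(1) by (auto simp: core_def off_vertices_def intro: less_trans)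
  from openin_\<pi>_image[OF core_saturated this openin_core] show ?thesis using \<delta>(2) by simp
 qed
 have "\<exists>\<F>. finite \<F> & \<F> \<subseteq> ?f ` {\<delta>. 0 < \<delta> & \<delta> <= 1/2} & F \<subseteq> \<Union>\<F>"
  by (rule compactinD[OF cF op cov])
 then obtain \<F> where \<F>: "finite \<F>" "\<F> \<subseteq> ?f ` {\<delta>. 0 < \<delta> & \<delta> <= 1/2}" "F \<subseteq> \<Union>\<F>" by (elim exE conjE)
 obtain D where D: "D \<subseteq> {\<delta>. 0 < \<delta> & \<delta> <= 1/2}" "finite D" "\<F> = ?f ` D"
  using finite_subset_image[OF \<F>(1,2)] by blast
 define eps where "eps = Min (insert (1/2) D)"
 have eps0: "0 < eps" using D(1,2) by (auto simp: eps_def)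
 have eps1: "eps <= 1/2" unfolding eps_def by (rule Min_le) (use D(2) in auto)
 have FC: "F \<subseteq> \<pi> ` core eps"
 proof
  fix y assume "y \<in> F"
  then obtain \<delta> u where \<delta>: "\<delta> \<in> D" "u \<in> core \<delta>" "y = \<pi> u" using \<F>(3) D(3) by blast
  have "eps <= \<delta>" unfolding eps_def by (rule Min_le) (use D(2) \<delta>(1) in auto)
  then have "core \<delta> \<subseteq> core eps" unfolding core_def by (auto intro: less_le_trans)
  then show "y \<in> \<pi> ` core eps" using \<delta>(2,3) by blast
 qed
 have "collar V eps \<subseteq> G"
 proof (rule ccontr)
  assume "\<not> collar V eps \<subseteq> G"
  then obtain y where y: "y \<in> collar V eps" "y \<notin> G" by blast
  have "y \<notin> other_ends V" using other_ends_disjoint[OF V eps1] y(1) unfolding closed_collar_def by blast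
  moreover have "y \<in> topspace N" using collar_in[OF eps1] iN_sub y(1) by blast
  ultimately have "y \<in> F" using y(2) unfolding F_def by blast
  then obtain u where u: "u \<in> core eps" "y = \<pi> u" using FC by blast
  obtain w where w: "w \<in> corner_points V eps" "y = \<pi> w" using y(1) unfolding collar_def by blast
  have "u \<in> off_vertices" using u(1) eps0 by (auto simp: core_def off_vertices_def intro: less_trans)
  moreover have "w \<in> off_vertices" using corner_points_off[OF eps1] w(1) by blast
  ultimately have "glued T u w" using \<pi>_eq u(2) w(2) by blast
  then have "w \<in> core eps" using saturated_glued[OF fp core_saturated _ u(1)] by blast
  then show False using w(1) by (auto simp: core_def corner_points_def corner_cone_def dest: less_asym)
 qed
 with eps0 eps1 that show thesis by blast
qed

lemma collar_nonempty:
 assumes V: "corner_class T V" and eps: "0 < eps" "eps <= 1/2"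
 shows "collar V eps ~= {}"
proof -
 obtain i p where p: "(i, p) \<in> V" using corner_class_nonempty[OF V] by (metis all_not_in_conv surj_pair)
 obtain c where c: "c ~= p" using exists_third[of p p] by metis
 have "(i, edge_point eps p c) \<in> corner_points V eps" using edge_point_cone[OF eps c] p unfolding corner_points_def by blast
 then show ?thesis unfolding collar_def by blast
qed

lemma connected_collar: "corner_class T V ==> 0 < eps ==> eps <= 1/2 ==> connectedin N (collar V eps)"
 using connected_corner_chart[OF fp _ _ _ corner_chart_collar] collar_in[of eps V] iN_sub unfolding connectedin_def by blast

lemma end_of_nonempty: "corner_class T V ==> end_of V ~= {}"
 using collar_cofinal[of V "{}"] collar_nonempty by (metis openin_empty subset_empty)

text \<open>If two closed sets separated the end, disjoint neighbourhoods of them would split a thin collar,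
although the collar is connected and approaches every point of the end.\<close>

lemma connected_end_of:
 assumes V: "corner_class T V"
 shows "connectedin N (end_of V)"
 unfolding connectedin_closedin
proof (intro conjI notI)
 show "end_of V \<subseteq> topspace N" using closedin_subset[OF closedin_end_of[OF V]] .
 assume "\<exists>E1 E2. closedin N E1 & closedin N E2 & end_of V \<subseteq> E1 \<union> E2 & E1 \<inter> E2 \<inter> end_of V = {} &
   E1 \<inter> end_of V ~= {} & E2 \<inter> end_of V ~= {}"
 then obtain E1 E2 where E: "closedin N E1" "closedin N E2" "end_of V \<subseteq> E1 \<union> E2" "E1 \<inter> E2 \<inter> end_of V = {}"
   "E1 \<inter> end_of V ~= {}" "E2 \<inter> end_of V ~= {}" by blast
 have c: "closedin N (E1 \<inter> end_of V)" "closedin N (E2 \<inter> end_of V)" using E closedin_end_of[OF V] by auto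
 have "normal_space N" using compact_Hausdorff_or_regular_imp_normal_space compact_N Hausdorff_N by blast
 moreover have "disjnt (E1 \<inter> end_of V) (E2 \<inter> end_of V)" using E(4) by (auto simp: disjnt_def)
 ultimately obtain O1 O2 where O12: "openin N O1" "openin N O2" "E1 \<inter> end_of V \<subseteq> O1" "E2 \<inter> end_of V \<subseteq> O2" "disjnt O1 O2"
  using c unfolding normal_space_def by metis
 have "openin N (O1 \<union> O2)" "end_of V \<subseteq> O1 \<union> O2" using O12 E(3) by auto
 then obtain eps where eps: "0 < eps" "eps <= 1/2" "collar V eps \<subseteq> O1 \<union> O2" by (rule collar_cofinal[OF V])
 have meet: "O' \<inter> collar V eps ~= {}" if O': "openin N O'" "E \<inter> end_of V \<subseteq> O'" "E \<inter> end_of V ~= {}" for O' E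
 proof -
  obtain b where b: "b \<in> end_of V" "b \<in> O'" using O'(2,3) by blast
  obtain W where "openin N W" "b \<in> W" "W \<subseteq> O'" "W - bN \<subseteq> collar V eps" "W - bN ~= {}" "W \<inter> bN \<subseteq> end_of V"
   by (rule end_nbhd[OF V b(1) eps(1,2) O'(1) b(2)])
  then show ?thesis by blast
 qed
 show False
  by (rule connectedinD[OF connected_collar[OF V eps(1,2)] O12(1,2) eps(3)])
   (use O12 meet E in \<open>auto simp: disjnt_def\<close>)
qed

lemma end_of_component:
 assumes V: "corner_class T V"
 shows "end_of V \<in> connected_components_of (subtopology N bN)"
proof (rule connected_clopen_component)
 show "connectedin (subtopology N bN) (end_of V)"
  using connected_end_of[OF V] end_of_bN by (simp add: connectedin_subtopology)
 show "end_of V ~= {}" by (rule end_of_nonempty[OF V])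
 show "closedin (subtopology N bN) (end_of V)"
  using closedin_end_of[OF V] end_of_bN closedin_subset_topspace by blast
 have "end_of V = closed_collar V (1/2) \<inter> bN"
  using end_of_bN[of V] collar_in[of "1/2" V] unfolding closed_collar_def bN_eq by auto
 then show "openin (subtopology N bN) (end_of V)"
  using openin_closed_collar[OF V, of "1/2"] unfolding openin_subtopology by auto
qed

text \<open>The realisation of \<open>\<kappa>\<close> on the collar, continued over its end.\<close>

definition collar_system :: "('t \<times> 4) set => ('t => 4 => 4 => bool) => ('m => 'm => bool) => bool" where
 "collar_system V \<kappa> s \<longleftrightarrow> local_system (subtopology N (closed_collar V (1/2))) s & realises T V (1/2) \<pi> \<kappa> s"

lemma nice_closed_collar:
 assumes V: "corner_class T V" and eps: "0 < eps" "eps <= 1/2"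
 shows "H1_nice_boundary (subtopology N (closed_collar V eps)) (end_of V)"
  "topspace (subtopology N (closed_collar V eps)) - end_of V = collar V eps"
proof -
 have *: "closed_collar V eps \<inter> bN = end_of V"
  using end_of_bN[of V] collar_in[OF eps(2), of V] unfolding closed_collar_def bN_eq by auto
 from H1_nice_boundary_open_subspace[OF nice openin_closed_collar[OF assms]]
 show "H1_nice_boundary (subtopology N (closed_collar V eps)) (end_of V)" unfolding * .
 have "topspace (subtopology N (closed_collar V eps)) = closed_collar V eps"
  using openin_subset[OF openin_closed_collar[OF assms]] by auto
 then show "topspace (subtopology N (closed_collar V eps)) - end_of V = collar V eps"
  using end_of_collar[OF eps(2), of V V] unfolding closed_collar_def by auto
qed

lemma sub_collar: "subtopology (subtopology N (closed_collar V eps)) (collar V eps) = subtopology N (collar V eps)"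
 "subtopology (subtopology N (closed_collar V eps)) (end_of V) = subtopology N (end_of V)"
proof -
 have "closed_collar V eps \<inter> collar V eps = collar V eps" "closed_collar V eps \<inter> end_of V = end_of V" by (auto simp: closed_collar_def)
 then show "subtopology (subtopology N (closed_collar V eps)) (collar V eps) = subtopology N (collar V eps)"
  "subtopology (subtopology N (closed_collar V eps)) (end_of V) = subtopology N (end_of V)" by (simp_all add: subtopology_subtopology)
qed

lemma local_system_on_subset:
 assumes "local_system (subtopology N A) s" "B \<subseteq> A"
 shows "local_system (subtopology N B) s"
proof -
 have "A \<inter> B = B" using assms(2) by blast
 then show ?thesis using local_system_subtopology[OF assms(1), of B] by (simp add: subtopology_subtopology)
qed

lemma trivial_system_on_subset:
 assumes "trivial_system (subtopology N A) s" "B \<subseteq> A"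
 shows "trivial_system (subtopology N B) s"
proof -
 have "A \<inter> B = B" using assms(2) by blast
 then show ?thesis using trivial_system_subtopology[OF assms(1), of B] by (simp add: subtopology_subtopology)
qed

text \<open>Triviality passes from the collar to its end across the boundary.\<close>

lemma trivial_on_end:
 assumes V: "corner_class T V" and eps: "0 < eps" "eps <= 1/2"
  and s: "local_system (subtopology N (closed_collar V eps)) s" and t: "trivial_system (subtopology N (collar V eps)) s"
 shows "trivial_system (subtopology N (end_of V)) s"
proof -
 note n = nice_closed_collar[OF V eps]
 have "trivial_system (subtopology N (closed_collar V eps)) s"
  by (rule trivial_system_extends_boundary[OF n(1) s]) (simp only: n(2) sub_collar(1) t)
 then show ?thesis by (rule trivial_system_on_subset) (simp add: closed_collar_def)
qed

lemma collar_system_exists: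
 assumes V: "corner_class T V" and \<kappa>: "corner_cocycle T V \<kappa>"
 shows "\<exists>s. collar_system V \<kappa> s"
proof -
 have h: "(0::real) < 1/2" "(1/2::real) <= 1/2" by simp_all
 note n = nice_closed_collar[OF V h] and ch = corner_chart_collar[OF V h(2)]
 obtain s where s: "local_system (subtopology N (collar V (1/2))) s" "realises T V (1/2) \<pi> \<kappa> s"
  by (rule realises_exists[OF fp V h ch \<kappa>])
 have s1: "local_system (subtopology (subtopology N (closed_collar V (1/2))) (topspace (subtopology N (closed_collar V (1/2))) - end_of V)) s"
  by (simp only: n(2) sub_collar(1) s(1))
 obtain s' where s': "local_system (subtopology N (closed_collar V (1/2))) s'"
  "\<And>x. x \<in> topspace (subtopology N (closed_collar V (1/2))) - end_of V ==> s' x = s x"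
  by (rule local_system_extends_boundary[OF n(1) s1], rule that, assumption, blast)
 have c: "continuous_map (subtopology simplices (corner_points V (1/2))) (subtopology N (collar V (1/2))) \<pi>"
  using ch descent_mapD(2) unfolding corner_chart_def by blast
 have "realises T V (1/2) \<pi> \<kappa> s'"
  by (rule realises_cong[OF s(2) c]) (simp add: s'(2)[unfolded n(2)])
 then show ?thesis using s'(1) unfolding collar_system_def by blast
qed

text \<open>A trivialisation on the end extends to a neighbourhood, which contains a thinner collar; the
combinatorial class is the same for all depths.\<close>

lemma coboundary_iff_trivial_on_end:
 assumes V: "corner_class T V" and s: "collar_system V \<kappa> s"
 shows "trivial_system (subtopology N (end_of V)) s \<longleftrightarrow> corner_coboundary T V \<kappa>"
proof
 have h: "(0::real) < 1/2" "(1/2::real) <= 1/2" by simp_all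
 have s': "local_system (subtopology N (closed_collar V (1/2))) s" "realises T V (1/2) \<pi> \<kappa> s"
  using s unfolding collar_system_def by auto
 {
  assume "corner_coboundary T V \<kappa>"
  then have "trivial_system (subtopology N (collar V (1/2))) s"
   using realises_trivial_iff[OF fp V h corner_chart_collar[OF V h(2)] s'(2)] by blast
  then show "trivial_system (subtopology N (end_of V)) s" by (rule trivial_on_end[OF V h s'(1)])
 }
 {
  assume t: "trivial_system (subtopology N (end_of V)) s"
  have sub: "end_of V \<subseteq> closed_collar V (1/2)" by (simp add: closed_collar_def)
  obtain H where H: "openin N H" "end_of V \<subseteq> H" "H \<subseteq> closed_collar V (1/2)" "trivial_system (subtopology N H) s"
   by (rule trivial_near_closed[OF compact_N Hausdorff_N closedin_end_of[OF V] openin_closed_collar[OF V h] sub s'(1) t])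
  obtain eps where eps: "0 < eps" "eps <= 1/2" "collar V eps \<subseteq> H" by (rule collar_cofinal[OF V H(1,2)])
  have "trivial_system (subtopology N (collar V eps)) s" by (rule trivial_system_on_subset[OF H(4) eps(3)])
  then show "corner_coboundary T V \<kappa>"
   using realises_trivial_iff[OF fp V eps(1,2) corner_chart_collar[OF V eps(2)] realises_mono[OF eps(2) s'(2)]] by blast
 }
qed

text \<open>Every system on the end is defined up to a trivial one on a thin collar, where it is
realised by some \<open>\<kappa>\<close>.\<close>

lemma collar_system_for_end_system:
 assumes V: "corner_class T V" and s: "local_system (subtopology N (end_of V)) s"
 obtains \<kappa> where "corner_cocycle T V \<kappa>"
  "\<And>t. collar_system V \<kappa> t ==> trivial_system (subtopology N (end_of V)) (system_sum s t)"
proof -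
 obtain H s' where H: "openin N H" "end_of V \<subseteq> H" "local_system (subtopology N H) s'"
  "trivial_system (subtopology N (end_of V)) (system_sum s s')"
  by (rule local_system_extends_near_closed[OF compact_N Hausdorff_N closedin_end_of[OF V] s])
 obtain eps where eps: "0 < eps" "eps <= 1/2" "collar V eps \<subseteq> H" by (rule collar_cofinal[OF V H(1,2)])
 have s': "local_system (subtopology N (collar V eps)) s'" by (rule local_system_on_subset[OF H(3) eps(3)])
 note ch = corner_chart_collar[OF V eps(2)]
 obtain \<kappa> where \<kappa>: "corner_cocycle T V \<kappa>" "realises T V eps \<pi> \<kappa> s'" by (rule realises_some[OF fp V eps(1,2) ch s'])
 have "trivial_system (subtopology N (end_of V)) (system_sum s t)" if t: "collar_system V \<kappa> t" for t
 proof -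
  have t': "local_system (subtopology N (closed_collar V (1/2))) t" "realises T V (1/2) \<pi> \<kappa> t"
   using t unfolding collar_system_def by auto
  have sub: "closed_collar V eps \<subseteq> closed_collar V (1/2)" "closed_collar V eps \<subseteq> H"
   using collar_mono[OF eps(2)] eps(3) H(2) unfolding closed_collar_def by auto
  have l: "local_system (subtopology N (closed_collar V eps)) (system_sum s' t)"
   by (rule local_system_sum[OF local_system_on_subset[OF H(3) sub(2)] local_system_on_subset[OF t'(1) sub(1)]])
  have "realises T V eps \<pi> (%i p a. \<kappa> i p a ~= \<kappa> i p a) (system_sum s' t)"
   by (rule realises_sum[OF \<kappa>(2) realises_mono[OF eps(2) t'(2)]])
  moreover have "corner_coboundary T V (%i p a. \<kappa> i p a ~= \<kappa> i p a)" unfolding corner_coboundary_def by auto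
  ultimately have "trivial_system (subtopology N (collar V eps)) (system_sum s' t)"
   using realises_trivial_iff[OF fp V eps(1,2) ch] by blast
  then have "trivial_system (subtopology N (end_of V)) (system_sum s' t)" by (rule trivial_on_end[OF V eps(1,2) l])
  then obtain f where f: "trivialises (subtopology N (end_of V)) (system_sum s' t) f" unfolding trivial_system_def by blast
  obtain g where g: "trivialises (subtopology N (end_of V)) (system_sum s s') g" using H(4) unfolding trivial_system_def by blast
  have "system_sum (system_sum s s') (system_sum s' t) = system_sum s t" by (auto simp: system_sum_def fun_eq_iff)
  then show ?thesis using trivialises_sum[OF g f] unfolding trivial_system_def by auto
 qed
 with \<kappa>(1) that show thesis by blast
qed

lemma twice_card_edge_ends_of_order_four:
 assumes V: "corner_class T V" and four: "H1_order_four (subtopology N (end_of V))"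
 shows "2 * card (flags V // edge_flag_rel T V) = card V"
proof -
 let ?B = "subtopology N (end_of V)"
 obtain \<theta> :: "('m => 'm => bool) => bool \<times> bool" where
  \<theta>: "\<And>s t. local_system ?B s ==> local_system ?B t ==> \<theta> s = \<theta> t \<longleftrightarrow> trivial_system ?B (system_sum s t)"
   "\<And>b. \<exists>s. local_system ?B s & \<theta> s = b"
  using four unfolding H1_order_four_def by blast
 define sy where "sy \<kappa> = (SOME s. collar_system V \<kappa> s)" for \<kappa>
 have sy: "collar_system V \<kappa> (sy \<kappa>)" if "corner_cocycle T V \<kappa>" for \<kappa>
  unfolding sy_def by (rule someI_ex[OF collar_system_exists[OF V that]])
 have loc: "local_system ?B (sy \<kappa>)" if "corner_cocycle T V \<kappa>" for \<kappa>
  using sy[OF that] local_system_on_subset[of "closed_collar V (1/2)" _ "end_of V"]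
  unfolding collar_system_def closed_collar_def by blast
 show ?thesis
 proof (rule twice_card_edge_ends[OF fp V, where \<Phi> = "%\<kappa>. \<theta> (sy \<kappa>)"])
  fix \<kappa> \<mu> assume \<kappa>: "corner_cocycle T V \<kappa>" and \<mu>: "corner_cocycle T V \<mu>"
  have "collar_system V (%i p a. \<kappa> i p a ~= \<mu> i p a) (system_sum (sy \<kappa>) (sy \<mu>))"
   using sy[OF \<kappa>] sy[OF \<mu>] local_system_sum realises_sum unfolding collar_system_def by blast
  then show "\<theta> (sy \<kappa>) = \<theta> (sy \<mu>) \<longleftrightarrow> corner_coboundary T V (%i p a. \<kappa> i p a ~= \<mu> i p a)"
   using coboundary_iff_trivial_on_end[OF V] \<theta>(1)[OF loc[OF \<kappa>] loc[OF \<mu>]] by blast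
 next
  fix b
  obtain s where s: "local_system ?B s" "\<theta> s = b" using \<theta>(2) by blast
  obtain \<kappa> where \<kappa>: "corner_cocycle T V \<kappa>" "\<And>t. collar_system V \<kappa> t ==> trivial_system ?B (system_sum s t)"
   by (rule collar_system_for_end_system[OF V s(1)], rule that, assumption, blast)
  have "\<theta> s = \<theta> (sy \<kappa>)" unfolding \<theta>(1)[OF s(1) loc[OF \<kappa>(1)]] by (rule \<kappa>(2)[OF sy[OF \<kappa>(1)]])
  then have "corner_cocycle T V \<kappa> & \<theta> (sy \<kappa>) = b" using \<kappa>(1) s(2) by simp
  then show "\<exists>\<kappa>. corner_cocycle T V \<kappa> & \<theta> (sy \<kappa>) = b" by (intro exI[of _ \<kappa>])
 qed
qed

lemma twice_card_edge_ends_torus_or_klein: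
 assumes V: "corner_class T V"
  and B: "\<And>B. B \<in> connected_components_of (subtopology N bN) ==>
      subtopology N B homeomorphic_space torus \<or> subtopology N B homeomorphic_space klein_bottle"
 shows "2 * card (flags V // edge_flag_rel T V) = card V"
by (metis twice_card_edge_ends_of_order_four V B end_of_component H1_order_four_homeomorphic H1_order_four_torus homeomorphic_space_sym Hausdorff_N Hausdorff_space_subtopology homeomorphic_Hausdorff_space H1_order_four_klein_bottle)

end

section \<open>Triangle types around an ideal vertex\<close>

lemma edge_gluing_sym:
 assumes fp: "face_pairing T" and "(x, y) \<in> edge_gluing T"
 shows "(y, x) \<in> edge_gluing T"
proof -
 obtain i a e where xy: "x = (i, e)" "y = (nbr T i a, perm T i a ` e)" "card e = 2" "a \<notin> e"
  using assms(2) unfolding edge_gluing_def by blast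
 let ?a = "perm T i a a" and ?j = "nbr T i a" and ?e = "perm T i a ` e"
 have inj: "inj (perm T i a)" using perm_inj[OF fp] by (auto intro: injI)
 have "card ?e = 2" using xy(3) card_image[OF inj_on_subset[OF inj]] by simp
 moreover have "?a \<notin> ?e" using xy(4) by (simp add: image_iff perm_inj[OF fp] eq_commute)
 ultimately have "((?j, ?e), (nbr T ?j ?a, perm T ?j ?a ` ?e)) \<in> edge_gluing T"
  unfolding edge_gluing_def
  by (intro CollectI exI[of _ ?j] exI[of _ ?a] exI[of _ ?e] conjI refl)
 moreover have "nbr T ?j ?a = i" by (rule face_pairingD(3)[OF fp])
 moreover have "perm T ?j ?a ` ?e = e" by (simp add: image_image perm_back[OF fp])
 ultimately show ?thesis by (simp add: xy(1,2))
qed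

lemma edge_class_iff:
 assumes fp: "face_pairing T"
 shows "y \<in> glued_class (edge_gluing T) x \<longleftrightarrow> (x, y) \<in> (edge_gluing T)\<^sup>*"
by (simp add: glued_class_def sym_rtrancl_Un edge_gluing_sym fp)

context
 fixes T :: "('t::finite) gluing" and V
 assumes fp: "face_pairing T" and V: "corner_class T V"
  and no_rev: "\<And>i p c. p ~= c ==> ((i, p, c), (i, c, p)) \<notin> flag_reach T"
begin

definition flag_edge :: "'t \<times> 4 \<times> 4 => 't \<times> 4 set" where
 "flag_edge = (%(i, p, c). (i, {p, c}))"

lemma edge_flag_rel_step:
 assumes xy: "(x, (i, p, c)) \<in> edge_flag_rel T V" and a: "a ~= p" "a ~= c"
 shows "(x, flag_move T a (i, p, c)) \<in> edge_flag_rel T V"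
proof -
 have m: "(i, p, c) \<in> flags V" "x \<in> flags V" using xy unfolding edge_flag_rel_def by auto
 have st: "((i, p, c), flag_move T a (i, p, c)) \<in> {(x, flag_move T a x) | x a. x \<in> flags V & a ~= fst (snd x) & a ~= snd (snd x)}"
  using m(1) a by force
 have "(x, (i, p, c)) \<in> {(x, flag_move T a x) | x a. x \<in> flags V & a ~= fst (snd x) & a ~= snd (snd x)}\<^sup>*"
  using xy unfolding edge_flag_rel_def by blast
 from rtrancl_into_rtrancl[OF this st] show ?thesis
  using m(2) flag_move_in[OF fp V m(1) a(1)] unfolding edge_flag_rel_def by blast
qed

lemma edge_flag_rel_reach: "(x, y) \<in> edge_flag_rel T V ==> (x, y) \<in> flag_reach T"
proof -
 assume "(x, y) \<in> edge_flag_rel T V"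
 then have "(x, y) \<in> {(x, flag_move T a x) | x a. x \<in> flags V & a ~= fst (snd x) & a ~= snd (snd x)}\<^sup>*"
  unfolding edge_flag_rel_def by blast
 moreover have "{(x, flag_move T a x) | x a. x \<in> flags V & a ~= fst (snd x) & a ~= snd (snd x)} \<subseteq>
   {((i, p, c), flag_move T a (i, p, c)) | i p c a. a ~= p & a ~= c}" by force
 ultimately show ?thesis unfolding flag_reach_def using rtrancl_mono by blast
qed

text \<open>Transport of an end of an edge passes through the same unglued edges as the gluing of undirected edges, and it
meets none of them in both directions.\<close>

lemma bij_flag_edge:
 assumes x: "x \<in> flags V"
 shows "bij_betw flag_edge (edge_flag_rel T V `` {x}) (glued_class (edge_gluing T) (flag_edge x))"
 unfolding bij_betw_def
proof
 note eq = equiv_edge_flag_rel[OF fp V]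
 show "inj_on flag_edge (edge_flag_rel T V `` {x})"
 proof (rule inj_onI)
  fix y z assume y: "y \<in> edge_flag_rel T V `` {x}" and z: "z \<in> edge_flag_rel T V `` {x}" and e: "flag_edge y = flag_edge z"
  obtain i p c where yp: "y = (i, p, c)" by (cases y)
  obtain j q d where zq: "z = (j, q, d)" by (cases z)
  have yz: "(y, z) \<in> edge_flag_rel T V" using y z eq by (meson Image_singleton_iff equivE symD transD)
  then have pc: "p ~= c" unfolding yp edge_flag_rel_def flags_def by blast
  have ji: "j = i" and "{q, d} = {p, c}" using e by (simp_all add: yp zq flag_edge_def)
  then have "q = p & d = c \<or> q = c & d = p" by (auto simp: doubleton_eq_iff)
  moreover have "\<not> (q = c & d = p)"
   using no_rev[OF pc, of i] edge_flag_rel_reach[OF yz] unfolding yp zq ji by blast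
  ultimately show "y = z" using yp zq ji by blast
 qed
 show "flag_edge ` (edge_flag_rel T V `` {x}) = glued_class (edge_gluing T) (flag_edge x)"
 proof
  show "flag_edge ` (edge_flag_rel T V `` {x}) \<subseteq> glued_class (edge_gluing T) (flag_edge x)"
  proof
   fix u assume "u \<in> flag_edge ` (edge_flag_rel T V `` {x})"
   then obtain y where y: "(x, y) \<in> edge_flag_rel T V" "u = flag_edge y" by blast
   have "(x, y) \<in> {(x, flag_move T a x) | x a. x \<in> flags V & a ~= fst (snd x) & a ~= snd (snd x)}\<^sup>*"
    using y(1) unfolding edge_flag_rel_def by blast
   then have "(flag_edge x, flag_edge y) \<in> (edge_gluing T)\<^sup>*"
   proof (induction rule: rtrancl_induct)
    case (step y z)
    then obtain i p c a where *: "y = (i, p, c)" "z = flag_move T a y" "y \<in> flags V" "a ~= p" "a ~= c" by force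
    have "p ~= c" using *(1,3) by (auto simp: flags_def)
    then have "card {p, c} = 2" "a \<notin> {p, c}" using *(4,5) by auto
    then have "((i, {p, c}), (nbr T i a, perm T i a ` {p, c})) \<in> edge_gluing T" unfolding edge_gluing_def by blast
    then have "(flag_edge y, flag_edge z) \<in> edge_gluing T" using *(1,2) by (simp add: flag_edge_def flag_move_def)
    then show ?case using step(3) by (rule rtrancl_into_rtrancl[rotated])
   qed simp
   then show "u \<in> glued_class (edge_gluing T) (flag_edge x)" unfolding edge_class_iff[OF fp] y(2) .
  qed
  show "glued_class (edge_gluing T) (flag_edge x) \<subseteq> flag_edge ` (edge_flag_rel T V `` {x})"
  proof
   fix u assume "u \<in> glued_class (edge_gluing T) (flag_edge x)"
   then have "(flag_edge x, u) \<in> (edge_gluing T)\<^sup>*" unfolding edge_class_iff[OF fp] .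
   then show "u \<in> flag_edge ` (edge_flag_rel T V `` {x})"
   proof (induction rule: rtrancl_induct)
    case base
    have "(x, x) \<in> edge_flag_rel T V" using x unfolding edge_flag_rel_def by auto
    then show ?case by blast
   next
    case (step u v)
    then obtain y where y: "(x, y) \<in> edge_flag_rel T V" "u = flag_edge y" by blast
    obtain i p c where yp: "y = (i, p, c)" by (cases y)
    obtain a where a: "a \<notin> {p, c}" "v = (nbr T i a, perm T i a ` {p, c})"
     using step(2) unfolding y(2) yp flag_edge_def edge_gluing_def by auto
    have "(x, flag_move T a y) \<in> edge_flag_rel T V" using edge_flag_rel_step[of x i p c a] y(1) a(1) yp by blast
    moreover have "v = flag_edge (flag_move T a y)" using a(2) yp by (simp add: flag_edge_def flag_move_def)
    ultimately show ?case by blast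
   qed
  qed
 qed
qed

text \<open>Each end contributes \<open>edge_degree\<close> many flags of weight \<open>1 / edge_degree\<close>.\<close>

lemma sum_inverse_degrees:
 "(\<Sum>x\<in>flags V. 1 / real (edge_degree T (flag_edge x))) = real (card (flags V // edge_flag_rel T V))"
proof -
 note eq = equiv_edge_flag_rel[OF fp V]

 have one: "(\<Sum>x\<in>E. 1 / real (edge_degree T (flag_edge x))) = 1" if E: "E \<in> flags V // edge_flag_rel T V" for E
 proof -
  have "edge_degree T (flag_edge x) = card E" if x: "x \<in> E" for x
  proof -
   have xc: "x \<in> flags V" using E x eq by (meson in_quotient_imp_subset subsetD)
   have "E = edge_flag_rel T V `` {x}"
   proof -
    obtain y where y: "E = edge_flag_rel T V `` {y}" using E by (rule quotientE)
    then have "(y, x) \<in> edge_flag_rel T V" using x by blast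
    from equiv_class_eq[OF eq this] y show ?thesis by simp
   qed
   then show ?thesis unfolding edge_degree_def using bij_betw_same_card[OF bij_flag_edge[OF xc]] by simp
  qed
  then have "(\<Sum>x\<in>E. 1 / real (edge_degree T (flag_edge x))) = (\<Sum>x\<in>E. 1 / real (card E))" by simp
  also have "\<dots> = 1"
  using in_quotient_imp_non_empty eq E by auto
  finally show ?thesis .
 qed
 have "(\<Sum>x\<in>flags V. 1 / real (edge_degree T (flag_edge x))) =
   (\<Sum>x\<in>\<Union>(flags V // edge_flag_rel T V). 1 / real (edge_degree T (flag_edge x)))"
  using Union_quotient[OF eq] by simp
 also have "\<dots> = (\<Sum>E\<in>flags V // edge_flag_rel T V. \<Sum>x\<in>E. 1 / real (edge_degree T (flag_edge x)))"
  by (subst sum.Union_disjoint) (use quotient_disj[OF eq] in auto)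
 also have "\<dots> = real (card (flags V // edge_flag_rel T V))" using one by simp
 finally show ?thesis .
qed

text \<open>Three half-edges and one face per triangle: the sum is the Euler characteristic of the link.\<close>

lemma sum_tri_euler_corner_class:
 assumes "2 * card (flags V // edge_flag_rel T V) = card V"
 shows "(\<Sum>v\<in>V. tri_euler T v) = 0"
proof -
 have tri: "(\<Sum>e\<in>tri_edges p. g e) = (\<Sum>c\<in>UNIV - {p}. g {p, c})" for p :: 4 and g :: "4 set => real"
 proof -
  have "tri_edges p = (%c. {p, c}) ` (UNIV - {p})" by (auto simp: tri_edges_def)
  moreover have "inj_on (%c. {p, c}) (UNIV - {p})" by (auto simp: inj_on_def doubleton_eq_iff)
  ultimately show ?thesis by (simp add: sum.reindex)
 qed
 have "tri_euler T v = - (1 / 2) + (\<Sum>c\<in>UNIV - {snd v}. 1 / real (edge_degree T (flag_edge (fst v, snd v, c))))" for v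
  by (cases v) (simp add: tri_euler_def tri flag_edge_def)
 then have "(\<Sum>v\<in>V. tri_euler T v) =
   - (real (card V) / 2) + (\<Sum>v\<in>V. \<Sum>c\<in>UNIV - {snd v}. 1 / real (edge_degree T (flag_edge (fst v, snd v, c))))"
  by (simp add: sum_subtractf)
 also have "(\<Sum>v\<in>V. \<Sum>c\<in>UNIV - {snd v}. 1 / real (edge_degree T (flag_edge (fst v, snd v, c)))) =
   (\<Sum>x\<in>flags V. 1 / real (edge_degree T (flag_edge x)))"
 proof -
  have "(\<Sum>v\<in>V. \<Sum>c\<in>UNIV - {snd v}. 1 / real (edge_degree T (flag_edge (fst v, snd v, c)))) =
    (\<Sum>u\<in>Sigma V (%v. UNIV - {snd v}). 1 / real (edge_degree T (flag_edge (fst (fst u), snd (fst u), snd u))))"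
   by (subst sum.Sigma) (auto simp: case_prod_unfold)
  also have "\<dots> = (\<Sum>x\<in>flags V. 1 / real (edge_degree T (flag_edge x)))"
   by (rule sum.reindex_bij_witness[where i = "%(i, p, c). ((i, p), c)" and j = "%u. (fst (fst u), snd (fst u), snd u)"])
    (auto simp: flags_def)
  finally show ?thesis .
 qed
 also have "- (real (card V) / 2) + \<dots> = 0" unfolding sum_inverse_degrees using assms by simp
 finally show ?thesis .
qed

end

section \<open>Weights of solutions and angle structures\<close>

text \<open>The number of discs meeting face \<open>a\<close> in the arc that cuts off \<open>v\<close>.\<close>

definition arc_value :: "('t::finite) coords => 't => 4 => 4 => real" where
 "arc_value s i a v = (\<Sum>q | {a, v} \<in> faced_edges q. fst s $ (i, q)) + snd s $ (i, v)"

lemma sum_faced: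
 assumes "card e = 2" "e \<in> faced_edges q"
 shows "(\<Sum>q | e \<in> faced_edges q. f q) = f q"
proof -
 have "{q. e \<in> faced_edges q} = {q}" using unique_faced_quad[OF assms(1)] assms(2) by blast
 then show ?thesis by simp
qed

lemma solution_space_iff:
 assumes fp: "face_pairing T"
 shows "s \<in> solution_space T \<longleftrightarrow>
  (\<forall>i a v. v ~= a --> arc_value s i a v = arc_value s (nbr T i a) (perm T i a a) (perm T i a v))"
proof -
 obtain x y where s: "s = (x, y)" by (cases s)
 have ne: "perm T i a v ~= perm T i a a" if "v ~= a" for i a v using that perm_inj[OF fp] by simp
 have av: "arc_value s i a v = x $ (i, q) + y $ (i, v)" if "v ~= a" "{a, v} \<in> faced_edges q" for i a v q
  unfolding arc_value_def s using sum_faced[OF _ that(2), of "%q. x $ (i, q)"] that(1) by simp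
 have ex: "\<exists>q. {a, v} \<in> faced_edges q" if "v ~= a" for a v using unique_faced_quad[of "{a, v}"] that by auto
 have "(\<forall>q p q' p'. meets_face_in (quad_edges q) a (arc_edges a v) -->
   meets_face_in (tri_edges p) a (arc_edges a v) -->
   meets_face_in (quad_edges q') (perm T i a a) (arc_edges (perm T i a a) (perm T i a v)) -->
   meets_face_in (tri_edges p') (perm T i a a) (arc_edges (perm T i a a) (perm T i a v)) -->
   x $ (i, q) + y $ (i, p) = x $ (nbr T i a, q') + y $ (nbr T i a, p')) \<longleftrightarrow>
   arc_value s i a v = arc_value s (nbr T i a) (perm T i a a) (perm T i a v)" if v: "v ~= a" for i a v
 proof -
  obtain q where q: "{a, v} \<in> faced_edges q" using ex[OF v] by blast
  obtain q' where q': "{perm T i a a, perm T i a v} \<in> faced_edges q'" using ex[OF ne[OF v]] by blast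
  have u: "{a, v} \<in> faced_edges r \<longleftrightarrow> r = q" for r using unique_faced_quad[of "{a, v}"] v q by auto
  have u': "{perm T i a a, perm T i a v} \<in> faced_edges r \<longleftrightarrow> r = q'" for r
   using unique_faced_quad[of "{perm T i a a, perm T i a v}"] ne[OF v, of i] q' by (metis card_2_iff)
  show ?thesis
   unfolding quad_meets_face_in_iff[OF v] tri_meets_face_in_iff[OF v]
    quad_meets_face_in_iff[OF ne[OF v]] tri_meets_face_in_iff[OF ne[OF v]] u u' av[OF v q] av[OF ne[OF v] q'] by auto
 qed
 then show ?thesis unfolding solution_space_def s by auto
qed

text \<open>The formula is chosen so that it can be expressed through the arcs of either face at the edge (\<open>edge_weight_arcs\<close>),
which makes it invariant under gluing.\<close>

definition edge_weight :: "('t::finite) coords => 't \<times> 4 set => real" where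
 "edge_weight s = (%(i, e). - ((\<Sum>p\<in>e. snd s $ (i, p)) + (\<Sum>q | e \<notin> faced_edges q. fst s $ (i, q))) / 2)"

definition tet_weight :: "('t::finite) coords => 't => real" where
 "tet_weight s i = (\<Sum>q\<in>UNIV. fst s $ (i, q)) + (\<Sum>p\<in>UNIV. snd s $ (i, p)) / 2"

lemma face_quads:
 fixes a v b :: 4
 assumes "a ~= v" "a ~= b" "v ~= b"
 shows "{v, b} \<notin> faced_edges q \<longleftrightarrow> {a, v} \<in> faced_edges q \<or> {a, b} \<in> faced_edges q"
  "\<not> ({a, v} \<in> faced_edges q & {a, b} \<in> faced_edges q)"
proof -
 have "\<forall>a v b :: 4. a ~= v --> a ~= b --> v ~= b -->
   ({v, b} \<notin> faced_edges q \<longleftrightarrow> {a, v} \<in> faced_edges q \<or> {a, b} \<in> faced_edges q) &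
   \<not> ({a, v} \<in> faced_edges q & {a, b} \<in> faced_edges q)"
  by (cases q) (simp_all add: forall_4 doubleton_eq_iff)
 from this[THEN spec, THEN spec, THEN spec, THEN mp, THEN mp, THEN mp, OF assms]
 show "{v, b} \<notin> faced_edges q \<longleftrightarrow> {a, v} \<in> faced_edges q \<or> {a, b} \<in> faced_edges q"
  "\<not> ({a, v} \<in> faced_edges q & {a, b} \<in> faced_edges q)" by auto
qed

text \<open>Each quadrilateral type faces exactly one edge of the face with corners \<open>a\<close>, \<open>v\<close> and \<open>b\<close>, so those not facing
\<open>{v, b}\<close> are the types facing \<open>{a, v}\<close> or \<open>{a, b}\<close>.\<close>

lemma edge_weight_arcs:
 assumes "a ~= v" "a ~= b" "v ~= b"
 shows "edge_weight s (i, {v, b}) = - (arc_value s i a v + arc_value s i a b) / 2"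
proof -
 have "{q. {v, b} \<notin> faced_edges q} = {q. {a, v} \<in> faced_edges q} \<union> {q. {a, b} \<in> faced_edges q}"
  using face_quads(1)[OF assms] by blast
 moreover have "{q. {a, v} \<in> faced_edges q} \<inter> {q. {a, b} \<in> faced_edges q} = {}"
  using face_quads(2)[OF assms] by blast
 ultimately have "(\<Sum>q | {v, b} \<notin> faced_edges q. fst s $ (i, q)) =
   (\<Sum>q | {a, v} \<in> faced_edges q. fst s $ (i, q)) + (\<Sum>q | {a, b} \<in> faced_edges q. fst s $ (i, q))"
  by (simp add: sum.union_disjoint)
 then show ?thesis using assms by (simp add: edge_weight_def arc_value_def)
qed

lemma edge_weight_step:
 assumes fp: "face_pairing T" and s: "s \<in> solution_space T" and g: "(u, w) \<in> edge_gluing T"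
 shows "edge_weight s u = edge_weight s w"
proof -
 obtain i a e where u: "u = (i, e)" "w = (nbr T i a, perm T i a ` e)" "card e = 2" "a \<notin> e"
  using g unfolding edge_gluing_def by blast
 obtain v b where e: "e = {v, b}" "v ~= b" using u(3) by (meson card_2_iff)
 have ne: "a ~= v" "a ~= b" using u(4) e by auto
 have "perm T i a a ~= perm T i a v" "perm T i a a ~= perm T i a b" "perm T i a v ~= perm T i a b"
  using ne e(2) perm_inj[OF fp] by auto
 from edge_weight_arcs[OF this, of s "nbr T i a"] edge_weight_arcs[OF ne e(2), of s i] show ?thesis
  using s ne unfolding solution_space_iff[OF fp] u(1,2) e(1) by simp
qed

lemma edge_weight_class:
 assumes fp: "face_pairing T" and s: "s \<in> solution_space T" and g: "w \<in> glued_class (edge_gluing T) u"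
 shows "edge_weight s w = edge_weight s u"
proof -
 have "(u, w) \<in> (edge_gluing T)\<^sup>*" using g edge_class_iff[OF fp] by blast
 then show ?thesis
 proof (induction rule: rtrancl_induct)
  case (step y z)
  then show ?case using edge_weight_step[OF fp s step(2)] by simp
 qed simp
qed

text \<open>The identity holds for arbitrary vectors, by exchanging the order of summation.\<close>

lemma gen_euler_weights:
 fixes s :: "('t::finite) coords"
 shows "gen_euler T s = - (\<Sum>i\<in>UNIV. tet_weight s i) - 2 * (\<Sum>u | card (snd u) = 2. edge_weight s u / real (edge_degree T u))"
proof -
 obtain x y where s: "s = (x, y)" by (cases s)
 define D where "D i e = 1 / real (edge_degree T (i, e))" for i e
 let ?E = "{e :: 4 set. card e = 2}"
 have tri: "tri_edges p = {e \<in> ?E. p \<in> e}" for p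
  by (auto simp: tri_edges_def card_2_iff)
 have q: "(\<Sum>q\<in>UNIV. x $ (i, q) * (\<Sum>e\<in>quad_edges q. D i e)) =
   (\<Sum>e\<in>?E. (\<Sum>q | e \<notin> faced_edges q. x $ (i, q)) * D i e)" for i
  using sum.swap_restrict[of "UNIV :: quad set" ?E "%q e. x $ (i, q) * D i e" "%q e. e \<notin> faced_edges q"]
  by (simp add: quad_edges_def sum_distrib_left sum_distrib_right)
 have t: "(\<Sum>p\<in>UNIV. y $ (i, p) * (\<Sum>e\<in>tri_edges p. D i e)) = (\<Sum>e\<in>?E. (\<Sum>p\<in>e. y $ (i, p)) * D i e)" for i
  using sum.swap_restrict[of "UNIV :: 4 set" ?E "%p e. y $ (i, p) * D i e" "%p e. p \<in> e"]
  by (simp add: tri sum_distrib_left sum_distrib_right)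
 have tet: "(\<Sum>q\<in>UNIV. x $ (i, q) * quad_euler T (i, q)) + (\<Sum>p\<in>UNIV. y $ (i, p) * tri_euler T (i, p)) =
   - tet_weight s i - 2 * (\<Sum>e\<in>?E. edge_weight s (i, e) * D i e)" for i
 proof -
  have "(\<Sum>q\<in>UNIV. x $ (i, q) * quad_euler T (i, q)) =
    (\<Sum>q\<in>UNIV. x $ (i, q) * (\<Sum>e\<in>quad_edges q. D i e)) - (\<Sum>q\<in>UNIV. x $ (i, q))"
   unfolding sum_subtractf[symmetric] by (rule sum.cong) (auto simp: quad_euler_def D_def algebra_simps)
  moreover have "(\<Sum>p\<in>UNIV. y $ (i, p) * tri_euler T (i, p)) =
    (\<Sum>p\<in>UNIV. y $ (i, p) * (\<Sum>e\<in>tri_edges p. D i e)) - (\<Sum>p\<in>UNIV. y $ (i, p)) / 2"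
   unfolding sum_subtractf[symmetric] sum_divide_distrib by (rule sum.cong) (auto simp: tri_euler_def D_def algebra_simps)
  moreover have "2 * (\<Sum>e\<in>?E. edge_weight s (i, e) * D i e) =
    - (\<Sum>e\<in>?E. (\<Sum>p\<in>e. y $ (i, p)) * D i e) - (\<Sum>e\<in>?E. (\<Sum>q | e \<notin> faced_edges q. x $ (i, q)) * D i e)"
   unfolding sum_subtractf[symmetric] sum_negf[symmetric] sum_distrib_left
   by (rule sum.cong) (auto simp: edge_weight_def s algebra_simps add_divide_distrib diff_divide_distrib)
  ultimately show ?thesis unfolding q t by (simp add: tet_weight_def s)
 qed
 have "gen_euler T s = (\<Sum>i\<in>UNIV. (\<Sum>q\<in>UNIV. x $ (i, q) * quad_euler T (i, q)) + (\<Sum>p\<in>UNIV. y $ (i, p) * tri_euler T (i, p)))"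
  by (simp add: gen_euler_def s sum.distrib sum.cartesian_product flip: UNIV_Times_UNIV)
 also have "\<dots> = - (\<Sum>i\<in>UNIV. tet_weight s i) - 2 * (\<Sum>i\<in>UNIV. \<Sum>e\<in>?E. edge_weight s (i, e) * D i e)"
  unfolding tet by (simp add: sum_subtractf sum_negf sum_distrib_left)
 also have "(\<Sum>i\<in>UNIV. \<Sum>e\<in>?E. edge_weight s (i, e) * D i e) = (\<Sum>u | card (snd u) = 2. edge_weight s u / real (edge_degree T u))"
 proof -
  have "(UNIV :: 't set) \<times> ?E = {u. card (snd u) = 2}" by auto
  then show ?thesis unfolding sum.cartesian_product by (simp add: D_def case_prod_unfold)
 qed
 finally show ?thesis .
qed

text \<open>The two faced edges together contain all four corners, so the triangle coordinates cancel.\<close>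

lemma quad_coordinate_weights:
 "fst s $ (i, q) = tet_weight s i + (\<Sum>e\<in>faced_edges q. edge_weight s (i, e))"
proof -
 have six: "{r. {a, b :: 4} \<notin> faced_edges r} = UNIV - {q}" if "{a, b} \<in> faced_edges q" "a ~= b" for a b
  using unique_faced_quad[of "{a, b}"] that by auto
 have "(\<Sum>r | {a, b} \<notin> faced_edges r. fst s $ (i, r)) = (\<Sum>r\<in>UNIV. fst s $ (i, r)) - fst s $ (i, q)"
  if "{a, b} \<in> faced_edges q" "a ~= b" for a b
  unfolding six[OF that] by (simp add: sum_diff1)
 then have w: "edge_weight s (i, {a, b}) = - (snd s $ (i, a) + snd s $ (i, b) + (\<Sum>r\<in>UNIV. fst s $ (i, r)) - fst s $ (i, q)) / 2"
  if "{a, b} \<in> faced_edges q" "a ~= b" for a b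
  using that by (simp add: edge_weight_def)
 show ?thesis
  using w[of 1 2] w[of 3 4] w[of 1 3] w[of 2 4] w[of 1 4] w[of 2 3]
  by (cases q) (simp_all add: tet_weight_def sum_4 doubleton_eq_iff field_simps)
qed

definition faced_angle :: "('t \<times> quad => real) => 't \<times> 4 set => real" where
 "faced_angle \<alpha> = (%(i, e). \<Sum>q | e \<in> faced_edges q. \<alpha> (i, q))"

lemma sum_angle_weights:
 fixes s :: "('t::finite) coords"
 shows "(\<Sum>k\<in>UNIV. \<alpha> k * fst s $ k) =
  (\<Sum>i\<in>UNIV. tet_weight s i * (\<Sum>q\<in>UNIV. \<alpha> (i, q))) + (\<Sum>u | card (snd u) = 2. edge_weight s u * faced_angle \<alpha> u)"
proof -
 let ?E = "{e :: 4 set. card e = 2}"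
 have f: "faced_edges q = {e \<in> ?E. e \<in> faced_edges q}" for q
  by (cases q) auto
 have sw: "(\<Sum>q\<in>UNIV. \<Sum>e\<in>faced_edges q. \<alpha> (i, q) * edge_weight s (i, e)) = (\<Sum>e\<in>?E. edge_weight s (i, e) * faced_angle \<alpha> (i, e))" for i
 proof -
  have "(\<Sum>q\<in>UNIV. \<Sum>e\<in>faced_edges q. \<alpha> (i, q) * edge_weight s (i, e)) =
    (\<Sum>q\<in>UNIV. \<Sum>e\<in>{e \<in> ?E. e \<in> faced_edges q}. \<alpha> (i, q) * edge_weight s (i, e))"
   using f by (metis (no_types, lifting))
  also have "\<dots> = (\<Sum>e\<in>?E. \<Sum>q | e \<in> faced_edges q. \<alpha> (i, q) * edge_weight s (i, e))"
   using sum.swap_restrict[of "UNIV :: quad set" ?E "%q e. \<alpha> (i, q) * edge_weight s (i, e)" "%q e. e \<in> faced_edges q"] by simp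
  also have "\<dots> = (\<Sum>e\<in>?E. edge_weight s (i, e) * faced_angle \<alpha> (i, e))"
   by (simp add: faced_angle_def sum_distrib_left mult.commute)
  finally show ?thesis .
 qed
 have tet: "(\<Sum>q\<in>UNIV. \<alpha> (i, q) * fst s $ (i, q)) =
   tet_weight s i * (\<Sum>q\<in>UNIV. \<alpha> (i, q)) + (\<Sum>e\<in>?E. edge_weight s (i, e) * faced_angle \<alpha> (i, e))" for i
 proof -
  have "(\<Sum>q\<in>UNIV. \<alpha> (i, q) * fst s $ (i, q)) =
    (\<Sum>q\<in>UNIV. tet_weight s i * \<alpha> (i, q) + (\<Sum>e\<in>faced_edges q. \<alpha> (i, q) * edge_weight s (i, e)))"
   by (rule sum.cong) (auto simp: quad_coordinate_weights[of s] algebra_simps sum_distrib_left)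
  then show ?thesis by (simp add: sum.distrib sw sum_distrib_left)
 qed
 have "(\<Sum>k\<in>UNIV. \<alpha> k * fst s $ k) = (\<Sum>i\<in>UNIV. \<Sum>q\<in>UNIV. \<alpha> (i, q) * fst s $ (i, q))"
  by (simp add: sum.cartesian_product flip: UNIV_Times_UNIV)
 also have "\<dots> = (\<Sum>i\<in>UNIV. tet_weight s i * (\<Sum>q\<in>UNIV. \<alpha> (i, q))) + (\<Sum>i\<in>UNIV. \<Sum>e\<in>?E. edge_weight s (i, e) * faced_angle \<alpha> (i, e))"
  unfolding tet by (simp add: sum.distrib)
 also have "(\<Sum>i\<in>UNIV. \<Sum>e\<in>?E. edge_weight s (i, e) * faced_angle \<alpha> (i, e)) = (\<Sum>u | card (snd u) = 2. edge_weight s u * faced_angle \<alpha> u)"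
 proof -
  have "(UNIV :: 't set) \<times> ?E = {u. card (snd u) = 2}" by auto
  then show ?thesis unfolding sum.cartesian_product by (simp add: case_prod_unfold)
 qed
 finally show ?thesis .
qed

lemma edge_gluing_card:
 assumes fp: "face_pairing T" and "(u, w) \<in> edge_gluing T"
 shows "card (snd u) = 2" "card (snd w) = 2"
proof -
 have "card (snd u) = 2" if "(u, w) \<in> edge_gluing T" for u w using that unfolding edge_gluing_def by auto
 then show "card (snd u) = 2" "card (snd w) = 2" using assms edge_gluing_sym by metis+
qed

lemma edge_class_card:
 assumes fp: "face_pairing T" and w: "w \<in> glued_class (edge_gluing T) u" and u: "card (snd u) = 2"
 shows "card (snd w) = 2"
proof -
 have "(u, w) \<in> (edge_gluing T)\<^sup>*" using w edge_class_iff[OF fp] by blast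
 then show ?thesis by (induction rule: rtrancl_induct) (use u edge_gluing_card[OF fp] in blast)+
qed

lemma edge_class_eq:
 assumes fp: "face_pairing T" and w: "w \<in> glued_class (edge_gluing T) u"
 shows "glued_class (edge_gluing T) w = glued_class (edge_gluing T) u"
 using w glued_class_eq_iff[of "edge_gluing T" u w] unfolding glued_class_def by blast

lemma edges_image: "edges T = glued_class (edge_gluing T) ` {u. card (snd u) = 2}"
 unfolding edges_def by (rule arg_cong[where f = "%S. glued_class (edge_gluing T) ` S"]) auto

lemma edge_degree_class:
 assumes fp: "face_pairing T" and E: "E \<in> edges T" and u: "u \<in> E"
 shows "glued_class (edge_gluing T) u = E" "edge_degree T u = card E"
proof -
 obtain w where w: "E = glued_class (edge_gluing T) w" using E unfolding edges_image by blast
 then show "glued_class (edge_gluing T) u = E" using edge_class_eq[OF fp] u by blast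
 then show "edge_degree T u = card E" unfolding edge_degree_def by simp
qed

lemma sum_edge_classes:
 fixes T :: "('t::finite) gluing" and g :: "'t \<times> 4 set => real"
 assumes fp: "face_pairing T"
 shows "(\<Sum>u | card (snd u) = 2. g u) = (\<Sum>E\<in>edges T. \<Sum>u\<in>E. g u)"
proof -
 let ?S = "{u :: 't \<times> 4 set. card (snd u) = 2}"
 have "{u \<in> ?S. glued_class (edge_gluing T) u = E} = E" if E: "E \<in> edges T" for E
 proof
  show "{u \<in> ?S. glued_class (edge_gluing T) u = E} \<subseteq> E" using glued_class_refl by auto
  obtain w where w: "E = glued_class (edge_gluing T) w" "card (snd w) = 2" using E unfolding edges_image by blast
  show "E \<subseteq> {u \<in> ?S. glued_class (edge_gluing T) u = E}"
   using edge_class_card[OF fp _ w(2)] edge_degree_class(1)[OF fp E] unfolding w(1) by blast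
 qed
 then show ?thesis using sum.image_gen[of ?S g "glued_class (edge_gluing T)"] unfolding edges_image[symmetric] by simp
qed

lemma edge_class_nonempty: "E \<in> edges T ==> E ~= {}"
 unfolding edges_image by (metis empty_iff glued_class_refl imageE)

lemma sum_over_edge_constant:
 fixes T :: "('t::finite) gluing"
 assumes fp: "face_pairing T" and E: "E \<in> edges T" and c: "\<And>u. u \<in> E ==> g u = (c::real)"
 shows "(\<Sum>u\<in>E. g u / real (edge_degree T u)) = c"
proof -
 have "(\<Sum>u\<in>E. g u / real (edge_degree T u)) = (\<Sum>u\<in>E. c / real (card E))"
  by (rule sum.cong) (use c edge_degree_class(2)[OF fp E] in auto)
 then show ?thesis using edge_class_nonempty[OF E] by simp
qed

lemma faced_edges_eq:
 assumes "{a, b} \<in> faced_edges q" "UNIV = {a, b, c, d :: 4}" "c \<notin> {a, b}" "d \<notin> {a, b}"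
 shows "faced_edges q = {{a, b}, {c, d}}"
proof -
 have cd: "{c, d} = - {a, b}" using assms(2-4) by blast
 have "- {1, 2} = {3, 4 :: 4}" "- {3, 4} = {1, 2 :: 4}" "- {1, 3} = {2, 4 :: 4}" "- {2, 4} = {1, 3 :: 4}"
  "- {1, 4} = {2, 3 :: 4}" "- {2, 3} = {1, 4 :: 4}"
  by (simp_all add: set_eq_iff forall_4)
 then have "faced_edges q = {e, - e}" if "e \<in> faced_edges q" for e
  using that by (cases q; simp only: faced_edges.simps insert_iff empty_iff simp_thms; elim disjE;
    simp add: insert_commute)
 from this[OF assms(1)] show ?thesis unfolding cd .
qed

text \<open>The inverse of the passage to weights, for zero weights on the tetrahedra.\<close>

definition edge_vector :: "('t \<times> 4 set => real) => ('t::finite) coords" where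
 "edge_vector w = ((\<chi> k. \<Sum>e\<in>faced_edges (snd k). w (fst k, e)), (\<chi> k. - (\<Sum>e\<in>tri_edges (snd k). w (fst k, e))))"

text \<open>The inverse of the passage to weights, for zero weights on the edges.\<close>

definition tet_vector :: "('t => real) => ('t::finite) coords" where
 "tet_vector z = ((\<chi> k. z (fst k)), (\<chi> k. - z (fst k)))"

lemma exists_faced_quad: "a ~= v ==> \<exists>q. {a, v} \<in> faced_edges q"
 using unique_faced_quad[of "{a, v}"] by auto

lemma arc_value_quad:
 assumes "a ~= v" "{a, v} \<in> faced_edges q"
 shows "arc_value s i a v = fst s $ (i, q) + snd s $ (i, v)"
 unfolding arc_value_def using sum_faced[OF _ assms(2)] assms(1) by simp

lemma arc_value_edge_vector:
 assumes U: "UNIV = {a, v, b, c :: 4}" and ne: "a ~= v" "b \<notin> {a, v}" "c \<notin> {a, v}" "b ~= c"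
 shows "arc_value (edge_vector w) i a v = w (i, {b, c}) - w (i, {v, b}) - w (i, {v, c})"
proof -
 obtain q where q: "{a, v} \<in> faced_edges q" using exists_faced_quad[OF ne(1)] by blast
 have f: "faced_edges q = {{a, v}, {b, c}}" by (rule faced_edges_eq[OF q U ne(2,3)])
 have "UNIV - {v} = {a, b, c}" unfolding U using ne by auto
 moreover have "tri_edges v = (%d. {v, d}) ` (UNIV - {v})" by (auto simp: tri_edges_def)
 ultimately have t: "tri_edges v = {{v, a}, {v, b}, {v, c}}" by simp
 have "{a, v} ~= {b, c}" "{v, a} \<notin> {{v, b}, {v, c}}" "{v, b} ~= {v, c}" using ne by (auto simp: doubleton_eq_iff)
 then show ?thesis unfolding arc_value_quad[OF ne(1) q]
  by (simp add: edge_vector_def f t insert_commute)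
qed

lemma edge_vector_solution:
 assumes fp: "face_pairing T" and w: "\<And>u v. (u, v) \<in> edge_gluing T ==> w u = w v"
 shows "edge_vector w \<in> solution_space T"
 unfolding solution_space_iff[OF fp]
proof (intro allI impI)
 fix i a v :: _ assume va: "(v::4) ~= a"
 obtain b c where bc: "b ~= a" "b ~= v" "c ~= a" "c ~= v" "b ~= c" "UNIV = {a, v, b, c}"
  using four_elements[of v a] va by metis
 let ?s = "perm T i a" and ?j = "nbr T i a"
 have inv: "w (i, {d, e}) = w (?j, {?s d, ?s e})" if "d ~= a" "e ~= a" "d ~= e" for d e
 proof (rule w)
  have "card {d, e} = 2" "a \<notin> {d, e}" using that by auto
  then have "((i, {d, e}), (?j, ?s ` {d, e})) \<in> edge_gluing T" unfolding edge_gluing_def by blast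
  then show "((i, {d, e}), (?j, {?s d, ?s e})) \<in> edge_gluing T" by simp
 qed
 have ne: "?s a ~= ?s v" "?s b \<notin> {?s a, ?s v}" "?s c \<notin> {?s a, ?s v}" "?s b ~= ?s c"
  using va bc perm_inj[OF fp] by auto
 have U: "UNIV = {?s a, ?s v, ?s b, ?s c}"
  by (rule card_subset_eq[symmetric]) (use ne in auto)
 have "arc_value (edge_vector w) i a v = w (i, {b, c}) - w (i, {v, b}) - w (i, {v, c})"
  by (rule arc_value_edge_vector[OF bc(6)]) (use va bc in auto)
 also have "\<dots> = arc_value (edge_vector w) ?j (?s a) (?s v)"
  unfolding arc_value_edge_vector[OF U ne]
  using inv[of b c] inv[of v b] inv[of v c] va bc(1-5) by simp
 finally show "arc_value (edge_vector w) i a v = arc_value (edge_vector w) ?j (?s a) (?s v)" .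
qed

lemma edge_vector_weights:
 shows "card e = 2 ==> edge_weight (edge_vector w) (i, e) = w (i, e)" "tet_weight (edge_vector w) i = 0"
proof -
 have ew: "edge_weight (edge_vector w) (i, e) = w (i, e)" if e2: "card e = 2" for e
 proof -
  obtain v b where e: "e = {v, b}" "v ~= b" using e2 by (meson card_2_iff)
  obtain a c where ac: "a ~= v" "a ~= b" "c ~= v" "c ~= b" "a ~= c" "UNIV = {v, b, a, c}"
   using four_elements[of b v] e(2) by metis
  have U: "UNIV = {a, v, b, c}" "UNIV = {a, b, v, c}" using ac(6) by auto
  have "arc_value (edge_vector w) i a v = w (i, {b, c}) - w (i, {v, b}) - w (i, {v, c})"
   by (rule arc_value_edge_vector[OF U(1)]) (use e(2) ac in auto)
  moreover have "arc_value (edge_vector w) i a b = w (i, {v, c}) - w (i, {b, v}) - w (i, {b, c})"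
   by (rule arc_value_edge_vector[OF U(2)]) (use e(2) ac in auto)
  ultimately show ?thesis unfolding e(1) edge_weight_arcs[OF ac(1,2) e(2)] by (simp add: insert_commute)
 qed
 then show "card e = 2 ==> edge_weight (edge_vector w) (i, e) = w (i, e)" by blast
 have "(\<Sum>e\<in>faced_edges Q12_34. edge_weight (edge_vector w) (i, e)) = (\<Sum>e\<in>faced_edges Q12_34. w (i, e))"
  by (rule sum.cong) (auto simp: ew)
 then have "fst (edge_vector w) $ (i, Q12_34) = tet_weight (edge_vector w) i + (\<Sum>e\<in>faced_edges Q12_34. w (i, e))"
  unfolding quad_coordinate_weights[of "edge_vector w"] by simp
 then show "tet_weight (edge_vector w) i = 0" unfolding edge_vector_def by simp
qed

lemma tet_vector_solution_weights:
 assumes fp: "face_pairing T"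
 shows "tet_vector z \<in> solution_space T" "card e = 2 ==> edge_weight (tet_vector z) (i, e) = 0" "tet_weight (tet_vector z) i = z i"
proof -
 have arc: "arc_value (tet_vector z) i a v = 0" if av: "a ~= v" for i a v
 proof -
  obtain q where "{a, v} \<in> faced_edges q" using exists_faced_quad[OF av] by blast
  from arc_value_quad[OF av this, of "tet_vector z" i] show ?thesis by (simp add: tet_vector_def)
 qed
 show "tet_vector z \<in> solution_space T" unfolding solution_space_iff[OF fp] using arc perm_inj[OF fp] by metis
 have ew: "edge_weight (tet_vector z) (i, e) = 0" if e2: "card e = 2" for e
 proof -
  obtain v b where e: "e = {v, b}" "v ~= b" using e2 by (meson card_2_iff)
  obtain a where "a ~= v" "a ~= b" using exists_third[of v b] by blast
  then show ?thesis using edge_weight_arcs[of a v b "tet_vector z" i] e arc by simp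
 qed
 then show "card e = 2 ==> edge_weight (tet_vector z) (i, e) = 0" by blast
 have "(\<Sum>e\<in>faced_edges Q12_34. edge_weight (tet_vector z) (i, e)) = 0"
  by (rule sum.neutral) (auto simp: ew)
 moreover have "fst (tet_vector z) $ (i, Q12_34) = z i" by (simp add: tet_vector_def)
 ultimately show "tet_weight (tet_vector z) i = z i"
  using quad_coordinate_weights[of "tet_vector z" i Q12_34] by linarith
qed

text \<open>The pairing with \<open>\<alpha>\<close> and \<open>gen_euler\<close> are both linear in the weights. The converse follows by testing on
the solutions with a single nonzero weight.\<close>

lemma angle_structure_iff:
 fixes T :: "('t::finite) gluing"
 assumes fp: "face_pairing T" and pos: "\<And>k. 0 < \<alpha> k"
 shows "angle_structure T \<alpha> \<longleftrightarrow> (\<forall>s\<in>solution_space T. (\<Sum>k\<in>UNIV. \<alpha> k * fst s $ k) = - pi * gen_euler T s)"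
proof
 assume a: "angle_structure T \<alpha>"
 then have tet: "\<And>i. (\<Sum>q\<in>UNIV. \<alpha> (i, q)) = pi" and edge: "\<And>E. E \<in> edges T ==> (\<Sum>u\<in>E. faced_angle \<alpha> u) = 2 * pi"
  unfolding angle_structure_def faced_angle_def by auto
 show "\<forall>s\<in>solution_space T. (\<Sum>k\<in>UNIV. \<alpha> k * fst s $ k) = - pi * gen_euler T s"
 proof
  fix s assume s: "s \<in> solution_space T"
  have "(\<Sum>u\<in>E. edge_weight s u * faced_angle \<alpha> u) = 2 * pi * (\<Sum>u\<in>E. edge_weight s u / real (edge_degree T u))"
   if E: "E \<in> edges T" for E
  proof -
   obtain u0 where u0: "u0 \<in> E" using edge_class_nonempty[OF E] by blast
   have c: "edge_weight s u = edge_weight s u0" if "u \<in> E" for u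
    using edge_weight_class[OF fp s, of u u0] edge_degree_class(1)[OF fp E u0] that by blast
   have "(\<Sum>u\<in>E. edge_weight s u * faced_angle \<alpha> u) = edge_weight s u0 * (2 * pi)"
    using c by (simp add: edge[OF E, symmetric] sum_distrib_left)
   then show ?thesis using sum_over_edge_constant[OF fp E c] by simp
  qed
  then have "(\<Sum>u | card (snd u) = 2. edge_weight s u * faced_angle \<alpha> u) =
    2 * pi * (\<Sum>u | card (snd u) = 2. edge_weight s u / real (edge_degree T u))"
   unfolding sum_edge_classes[OF fp] sum_distrib_left by simp
  then show "(\<Sum>k\<in>UNIV. \<alpha> k * fst s $ k) = - pi * gen_euler T s"
   unfolding sum_angle_weights gen_euler_weights tet by (simp add: sum_distrib_left[symmetric] algebra_simps)
 qed
next
 assume eq: "\<forall>s\<in>solution_space T. (\<Sum>k\<in>UNIV. \<alpha> k * fst s $ k) = - pi * gen_euler T s"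
 have tet: "(\<Sum>q\<in>UNIV. \<alpha> (j, q)) = pi" for j
 proof -
  let ?z = "%i. if i = j then 1 else 0 :: real"
  note w = tet_vector_solution_weights[OF fp, where z = ?z]
  have ew: "edge_weight (tet_vector ?z) u = 0" if "card (snd u) = 2" for u
   using w(2)[of "snd u" "fst u"] that by simp
  have z: "(\<Sum>u | card (snd u) = 2. edge_weight (tet_vector ?z) u * faced_angle \<alpha> u) = 0"
   "(\<Sum>u | card (snd u) = 2. edge_weight (tet_vector ?z) u / real (edge_degree T u)) = 0"
   by (rule sum.neutral, use ew in simp)+
  show ?thesis
   using eq[rule_format, OF w(1)] unfolding sum_angle_weights gen_euler_weights w(3) z
   by (simp add: if_distrib[of "%x. x * _"] cong: if_cong)
 qed
 have edge: "(\<Sum>u\<in>E. faced_angle \<alpha> u) = 2 * pi" if E: "E \<in> edges T" for E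
 proof -
  let ?w = "%u. if u \<in> E then 1 else 0 :: real"
  have inE: "u \<in> E \<longleftrightarrow> v \<in> E" if uv: "(u, v) \<in> edge_gluing T" for u v
  proof -
   have "glued_class (edge_gluing T) u = glued_class (edge_gluing T) v" unfolding glued_class_eq_iff using uv by blast
   then show ?thesis using edge_degree_class(1)[OF fp E] glued_class_refl by metis
  qed
  have sol: "edge_vector ?w \<in> solution_space T" by (rule edge_vector_solution[OF fp]) (use inE in auto)
  have ew: "edge_weight (edge_vector ?w) u = ?w u" if "card (snd u) = 2" for u
   using edge_vector_weights(1)[of "snd u" ?w "fst u"] that by simp
  have E2: "card (snd u) = 2" if "u \<in> E" for u
  proof -
   obtain w where "E = glued_class (edge_gluing T) w" "card (snd w) = 2" using E unfolding edges_image by blast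
   then show ?thesis using edge_class_card[OF fp, of u w] that by simp
  qed
  have sumE: "(\<Sum>u | card (snd u) = 2. edge_weight (edge_vector ?w) u * g u) = (\<Sum>u\<in>E. g u)" for g
  proof -
   have "(\<Sum>u | card (snd u) = 2. edge_weight (edge_vector ?w) u * g u) = (\<Sum>u | card (snd u) = 2. if u \<in> E then g u else 0)"
    by (rule sum.cong) (use ew in auto)
   also have "\<dots> = (\<Sum>u\<in>{u. card (snd u) = 2} \<inter> E. g u)" by (simp add: sum.inter_restrict)
   also have "{u. card (snd u) = 2} \<inter> E = E" using E2 by blast
   finally show ?thesis .
  qed
  have "(\<Sum>u | card (snd u) = 2. edge_weight (edge_vector ?w) u / real (edge_degree T u)) = (\<Sum>u\<in>E. 1 / real (edge_degree T u))"
   using sumE[of "%u. 1 / real (edge_degree T u)"] by simp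
  also have "\<dots> = 1" by (rule sum_over_edge_constant[OF fp E]) simp
  finally show ?thesis
   using eq[rule_format, OF sol] unfolding sum_angle_weights gen_euler_weights edge_vector_weights(2) sumE by simp
 qed
 show "angle_structure T \<alpha>" unfolding angle_structure_def using pos tet edge unfolding faced_angle_def by auto
qed

section \<open>Separation and the polytope of solutions\<close>

lemma linear_gen_euler:
 fixes T :: "('t::finite) gluing"
 shows "linear (gen_euler T)"
by (simp add: gen_euler_def linearI case_prod_unfold sum.distrib algebra_simps sum_distrib_left)

lemma subspace_solution_space:
 fixes T :: "('t::finite) gluing"
 assumes fp: "face_pairing T"
 shows "subspace (solution_space T)"
proof (rule subspaceI)
 have add: "arc_value (s + t) i a v = arc_value s i a v + arc_value t i a v" for s t :: "'t coords" and i a v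
  by (simp add: arc_value_def sum.distrib)
 have scale: "arc_value (c *\<^sub>R s) i a v = c * arc_value s i a v" for s :: "'t coords" and c i a v
  by (simp add: arc_value_def sum_distrib_left algebra_simps)
 show "0 \<in> solution_space T" unfolding solution_space_iff[OF fp] by (simp add: arc_value_def)
 show "s + t \<in> solution_space T" if "s \<in> solution_space T" "t \<in> solution_space T" for s t
  using that unfolding solution_space_iff[OF fp] add by simp
 show "c *\<^sub>R s \<in> solution_space T" if "s \<in> solution_space T" for c s
  using that unfolding solution_space_iff[OF fp] scale by simp
qed

definition quad_nonneg :: "('t::finite) coords => bool" where
 "quad_nonneg s \<longleftrightarrow> (\<forall>k. 0 <= fst s $ k)"

definition quad_pos :: "('t::finite) coords => bool" where
 "quad_pos s \<longleftrightarrow> (\<exists>k. 0 < fst s $ k)"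

lemma angle_structure_imp_negative:
 fixes T :: "('t::finite) gluing"
 assumes fp: "face_pairing T" and a: "angle_structure T \<alpha>"
  and s: "s \<in> solution_space T" "quad_nonneg s" "quad_pos s"
 shows "gen_euler T s < 0"
proof -
 have pos: "0 < \<alpha> k" for k using a unfolding angle_structure_def by blast
 obtain k where k: "0 < fst s $ k" using s(3) unfolding quad_pos_def by blast
 have "0 < (\<Sum>k\<in>UNIV. \<alpha> k * fst s $ k)"
 proof (rule sum_pos2[of _ k])
  show "0 <= \<alpha> j * fst s $ j" for j
  proof -
   have "0 <= fst s $ j" using s(2) unfolding quad_nonneg_def by blast
   then show ?thesis using pos[of j] by simp
  qed
 qed (use k pos in auto)
 also have "\<dots> = - pi * gen_euler T s" using a s(1) angle_structure_iff[OF fp, of \<alpha>] pos by blast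
 finally have "pi * gen_euler T s < 0" by simp
 then show ?thesis by (simp add: mult_less_0_iff)
qed

text \<open>The quadrilateral parts of solutions with \<open>gen_euler T s = 0\<close> form a subspace \<open>K\<close>, which misses the simplex \<open>S\<close> by
assumption. A separating functional vanishes on \<open>K\<close>, hence is a multiple of \<open>gen_euler\<close> on solutions, and it is positive on \<open>S\<close>, so
its coordinates are positive. The factor is fixed by the solution \<open>tet_vector\<close> with all quadrilateral coordinates 1.\<close>

lemma angle_structure_of_negative:
 fixes T :: "('t::finite) gluing"
 assumes fp: "face_pairing T"
  and neg: "\<And>s. s \<in> solution_space T ==> quad_nonneg s ==> quad_pos s ==> gen_euler T s < 0"
 shows "\<exists>\<alpha>. angle_structure T \<alpha>"
proof -
 let ?C = "solution_space T" and ?\<chi> = "gen_euler T"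
 note lin = linear_gen_euler[of T]
 note sub = subspace_solution_space[OF fp]
 define K where "K = fst ` {s \<in> ?C. ?\<chi> s = 0}"
 have "subspace {s \<in> ?C. ?\<chi> s = 0}"
 proof -
  have "{s \<in> ?C. ?\<chi> s = 0} = ?C \<inter> {s. ?\<chi> s = 0}" by blast
  then show ?thesis using subspace_inter[OF sub linear_subspace_kernel[OF lin]] by simp
 qed
 then have K: "subspace K" unfolding K_def using linear_fst by (rule linear_subspace_image[rotated])
 define S where "S = {x :: real ^ ('t \<times> quad). (\<forall>k. 0 <= x $ k) & (\<Sum>k\<in>UNIV. x $ k) = 1}"
 have S_eq: "S = (\<Inter>k. {x. 0 <= x $ k}) \<inter> {x. (\<Sum>k\<in>UNIV. x $ k) = 1}" by (auto simp: S_def)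
 have "closed S" unfolding S_eq by (auto intro!: closed_Int closed_INT closed_Collect_le closed_Collect_eq continuous_intros)
 moreover have "bounded S"
 proof (rule boundedI)
  fix x assume x: "x \<in> S"
  have "norm x <= (\<Sum>k\<in>UNIV. \<bar>x $ k\<bar>)" by (rule norm_le_l1_cart)
  also have "\<dots> = (\<Sum>k\<in>UNIV. x $ k)" by (rule sum.cong) (use x in \<open>auto simp: S_def\<close>)
  finally show "norm x <= 1" using x unfolding S_def by simp
 qed
 ultimately have compS: "compact S" by (simp add: compact_eq_bounded_closed)
 have convS: "convex S"
  unfolding convex_def S_def by (auto simp: sum.distrib sum_distrib_left[symmetric])
 have ax: "axis k 1 \<in> S" for k by (auto simp: S_def axis_def)
 have disj: "K \<inter> S = {}"
 proof (rule equals0I)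
  fix x assume "x \<in> K \<inter> S"
  then obtain s where s: "s \<in> ?C" "?\<chi> s = 0" "fst s \<in> S" unfolding K_def by blast
  have "\<exists>k. 0 < fst s $ k"
  proof (rule ccontr)
   assume "\<not> (\<exists>k. 0 < fst s $ k)"
   then have "(\<Sum>k\<in>UNIV. fst s $ k) <= 0" by (intro sum_nonpos) (auto simp: not_less)
   then show False using s(3) by (simp add: S_def)
  qed
  then show False using neg[OF s(1)] s(2,3) by (auto simp: S_def quad_nonneg_def quad_pos_def)
 qed
 obtain a b where a: "\<And>x. x \<in> K ==> a \<bullet> x < b" and b: "\<And>x. x \<in> S ==> b < a \<bullet> x"
  using separating_hyperplane_closed_compact[OF subspace_imp_convex[OF K] closed_subspace[OF K] convS compS _ disj] ax by blast
 have b0: "0 < b" using a[OF subspace_0[OF K]] by simp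
 have aK: "a \<bullet> x = 0" if x: "x \<in> K" for x
 proof (rule ccontr)
  assume n: "a \<bullet> x ~= 0"
  have "a \<bullet> ((b / (a \<bullet> x)) *\<^sub>R x) < b" by (rule a) (rule subspace_scale[OF K x])
  then show False using n by simp
 qed
 have apos: "0 < a $ k" for k
  using b[OF ax[of k]] b0 by (simp add: inner_axis)
 let ?one = "tet_vector (%_. 1) :: 't coords"
 have one: "?one \<in> ?C" by (rule tet_vector_solution_weights(1)[OF fp])
 have one_neg: "?\<chi> ?one < 0"
  by (rule neg[OF one]) (auto simp: quad_nonneg_def quad_pos_def tet_vector_def)
 have a1: "0 < a \<bullet> fst ?one"
  unfolding inner_vec_def by (rule sum_pos) (auto simp: tet_vector_def apos)
 (* The value of gen_euler at ?one is negative, so c is positive. *)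
 define c where "c = a \<bullet> fst ?one / - ?\<chi> ?one"
 have c: "0 < c" unfolding c_def using a1 one_neg by (simp add: divide_pos_neg)
 have val: "a \<bullet> fst s = - c * ?\<chi> s" if s: "s \<in> ?C" for s
 proof -
  let ?u = "?\<chi> ?one *\<^sub>R s - ?\<chi> s *\<^sub>R ?one"
  have "?u \<in> ?C" using s one sub by (intro subspace_diff subspace_scale)
  moreover have "?\<chi> ?u = 0" by (simp add: linear_diff[OF lin] linear_scale[OF lin])
  ultimately have "fst ?u \<in> K" unfolding K_def by blast
  from aK[OF this] have "?\<chi> ?one * (a \<bullet> fst s) = ?\<chi> s * (a \<bullet> fst ?one)" by (simp add: inner_diff_right)
  then show ?thesis unfolding c_def using one_neg by (simp add: field_simps)
 qed
 define \<alpha> where "\<alpha> k = pi / c * a $ k" for k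
 have \<alpha>: "0 < \<alpha> k" for k unfolding \<alpha>_def using c apos by simp
 have "(\<Sum>k\<in>UNIV. \<alpha> k * fst s $ k) = - pi * ?\<chi> s" if s: "s \<in> ?C" for s
 proof -
  have "(\<Sum>k\<in>UNIV. \<alpha> k * fst s $ k) = pi / c * (a \<bullet> fst s)"
   by (simp add: \<alpha>_def inner_vec_def sum_distrib_left mult.assoc)
  then show ?thesis unfolding val[OF s] using c by simp
 qed
 then have "angle_structure T \<alpha>" unfolding angle_structure_iff[OF fp, of \<alpha>, OF \<alpha>] by (rule ballI)
 then show ?thesis by blast
qed

definition all_triangles :: "('t::finite) coords" where "all_triangles = (0, \<chi> k. 1)"

lemma all_triangles_solution:
 assumes fp: "face_pairing T"
 shows "all_triangles \<in> solution_space T"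
 unfolding solution_space_iff[OF fp] by (simp add: all_triangles_def arc_value_def)

definition coordinate_sum :: "('t::finite) coords => real" where
 "coordinate_sum s = (\<Sum>k\<in>UNIV. fst s $ k) + (\<Sum>k\<in>UNIV. snd s $ k)"

lemma projective_iff:
 "s \<in> projective_solution_space T \<longleftrightarrow>
   s \<in> solution_space T & quad_nonneg s & (\<forall>k. 0 <= snd s $ k) & coordinate_sum s = 1"
 by (auto simp: projective_solution_space_def quad_nonneg_def coordinate_sum_def case_prod_unfold)

text \<open>Adding triangles changes neither the quadrilateral coordinates nor \<open>gen_euler\<close>, and makes all coordinates non-negative.\<close>

lemma negative_of_projective:
 fixes T :: "('t::finite) gluing"
 assumes fp: "face_pairing T"
  and link: "\<And>s. s \<in> solution_space T ==> fst s = 0 ==> gen_euler T s = 0"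
  and neg: "\<And>s. s \<in> projective_solution_space T ==> quad_pos s ==> gen_euler T s < 0"
  and s: "s \<in> solution_space T" "quad_nonneg s" "quad_pos s"
 shows "gen_euler T s < 0"
proof -
 note lin = linear_gen_euler[of T]
 note sub = subspace_solution_space[OF fp]
 (* R exceeds the absolute value of every triangle coordinate. *)
 define R where "R = (\<Sum>k\<in>UNIV. \<bar>snd s $ k\<bar>)"
 define t where "t = s + R *\<^sub>R all_triangles"
 have tC: "t \<in> solution_space T" unfolding t_def
  using s(1) all_triangles_solution[OF fp] sub by (intro subspace_add subspace_scale)
 have ft: "fst t = fst s" by (simp add: t_def all_triangles_def)
 have snn: "0 <= snd t $ k" for k
 proof -
  have "\<bar>snd s $ k\<bar> <= R" unfolding R_def by (rule member_le_sum) auto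
  then show ?thesis by (simp add: t_def all_triangles_def)
 qed
 have \<chi>t: "gen_euler T t = gen_euler T s"
 proof -
  have "gen_euler T (all_triangles :: 't coords) = 0"
   by (rule link[OF all_triangles_solution[OF fp]]) (simp add: all_triangles_def)
  then show ?thesis by (simp add: t_def linear_add[OF lin] linear_scale[OF lin])
 qed
 obtain k where k: "0 < fst s $ k" using s(3) unfolding quad_pos_def by blast
 have "0 < (\<Sum>k\<in>UNIV. fst t $ k)" unfolding ft
  by (rule sum_pos2[of _ k]) (use s(2) k in \<open>auto simp: quad_nonneg_def\<close>)
 moreover have "0 <= (\<Sum>k\<in>UNIV. snd t $ k)" by (rule sum_nonneg) (rule snn)
 ultimately have r: "0 < coordinate_sum t" unfolding coordinate_sum_def by linarith
 define u where "u = (1 / coordinate_sum t) *\<^sub>R t"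
 have "coordinate_sum u = (1 / coordinate_sum t) * coordinate_sum t"
  by (simp add: u_def coordinate_sum_def sum_distrib_left distrib_left del: times_divide_eq_left)
 then have "coordinate_sum u = 1" using r by simp
 moreover have "u \<in> solution_space T" unfolding u_def using tC sub by (rule subspace_scale[rotated])
 moreover have "quad_nonneg u" using s(2) r by (simp add: u_def quad_nonneg_def ft)
 moreover have "\<forall>k. 0 <= snd u $ k" using snn r by (simp add: u_def)
 ultimately have "u \<in> projective_solution_space T" unfolding projective_iff by blast
 moreover have "0 < fst u $ k" using k r by (simp add: u_def ft)
 then have "quad_pos u" unfolding quad_pos_def by blast
 ultimately have "gen_euler T u < 0" by (rule neg)
 moreover have "gen_euler T u = gen_euler T s / coordinate_sum t"
  using linear_scale[OF lin, of "1 / coordinate_sum t" t] by (simp add: u_def \<chi>t)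
 ultimately show ?thesis using r by (simp add: divide_less_0_iff)
qed

lemma compact_convex_projective:
 fixes T :: "('t::finite) gluing"
 assumes fp: "face_pairing T"
 shows "compact (projective_solution_space T)" "convex (projective_solution_space T)"
proof -
 let ?A = "{s :: 't coords. (\<forall>k. 0 <= fst s $ k) & (\<forall>k. 0 <= snd s $ k) & coordinate_sum s = 1}"
 have eq: "projective_solution_space T = solution_space T \<inter> ?A"
  using projective_iff[of _ T] unfolding quad_nonneg_def by blast
 have A: "?A = (\<Inter>k. {s. 0 <= fst s $ k}) \<inter> (\<Inter>k. {s. 0 <= snd s $ k}) \<inter> {s. coordinate_sum s = 1}" by auto
 have "closed ?A" unfolding A unfolding coordinate_sum_def
  by (intro closed_Int closed_INT ballI closed_Collect_le closed_Collect_eq continuous_intros)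
 then have "closed (projective_solution_space T)"
  unfolding eq by (rule closed_Int[OF closed_subspace[OF subspace_solution_space[OF fp]]])
 moreover have "bounded (projective_solution_space T)"
 proof (rule boundedI)
  fix s assume s: "s \<in> projective_solution_space T"
  have "norm s <= norm (fst s) + norm (snd s)" using norm_Pair_le[of "fst s" "snd s"] by simp
  also have "\<dots> <= (\<Sum>k\<in>UNIV. \<bar>fst s $ k\<bar>) + (\<Sum>k\<in>UNIV. \<bar>snd s $ k\<bar>)"
   by (intro add_mono norm_le_l1_cart)
  also have "(\<Sum>k\<in>UNIV. \<bar>fst s $ k\<bar>) = (\<Sum>k\<in>UNIV. fst s $ k)"
   by (rule sum.cong) (use s in \<open>auto simp: eq\<close>)
  also have "(\<Sum>k\<in>UNIV. \<bar>snd s $ k\<bar>) = (\<Sum>k\<in>UNIV. snd s $ k)"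
   by (rule sum.cong) (use s in \<open>auto simp: eq\<close>)
  also have "(\<Sum>k\<in>UNIV. fst s $ k) + (\<Sum>k\<in>UNIV. snd s $ k) = 1" using s unfolding eq coordinate_sum_def by simp
  finally show "norm s <= 1" .
 qed
 ultimately show "compact (projective_solution_space T)" by (simp add: compact_eq_bounded_closed)
 have "convex ?A"
  unfolding convex_def
 proof (intro ballI allI impI CollectI conjI)
  fix x y :: "'t coords" and u v :: real and k
  assume x: "x \<in> ?A" and y: "y \<in> ?A" and uv: "0 <= u" "0 <= v" "u + v = 1"
  have "0 <= fst x $ k" "0 <= fst y $ k" using x y by blast+
  then show "0 <= fst (u *\<^sub>R x + v *\<^sub>R y) $ k" using uv by simp
 next
  fix x y :: "'t coords" and u v :: real and k
  assume x: "x \<in> ?A" and y: "y \<in> ?A" and uv: "0 <= u" "0 <= v" "u + v = 1"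
  have "0 <= snd x $ k" "0 <= snd y $ k" using x y by blast+
  then show "0 <= snd (u *\<^sub>R x + v *\<^sub>R y) $ k" using uv by simp
 next
  fix x y :: "'t coords" and u v :: real
  assume x: "x \<in> ?A" and y: "y \<in> ?A" and uv: "0 <= u" "0 <= v" "u + v = 1"
  have "coordinate_sum (u *\<^sub>R x + v *\<^sub>R y) = u * coordinate_sum x + v * coordinate_sum y"
   by (simp add: coordinate_sum_def sum.distrib sum_distrib_left distrib_left)
  then show "coordinate_sum (u *\<^sub>R x + v *\<^sub>R y) = 1" using x y uv by simp
 qed
 then show "convex (projective_solution_space T)"
  unfolding eq by (rule convex_Int[OF subspace_imp_convex[OF subspace_solution_space[OF fp]]])
qed

text \<open>The set \<open>G\<close> is convex and contains all vertices, hence the whole polytope.\<close>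

lemma projective_negative_of_vertices:
 fixes T :: "('t::finite) gluing"
 assumes fp: "face_pairing T"
  and link: "\<And>s. s \<in> solution_space T ==> fst s = 0 ==> gen_euler T s = 0"
  and neg: "\<And>V. V extreme_point_of projective_solution_space T ==> quad_pos V ==> gen_euler T V < 0"
  and s: "s \<in> projective_solution_space T" "quad_pos s"
 shows "gen_euler T s < 0"
proof -
 let ?P = "projective_solution_space T"
 note lin = linear_gen_euler[of T]
 define G where "G = {s :: 't coords. quad_nonneg s & (fst s = 0 & gen_euler T s = 0 \<or> gen_euler T s < 0)}"
 have "{V. V extreme_point_of ?P} \<subseteq> G"
 proof
  fix V assume "V \<in> {V. V extreme_point_of ?P}"
  then have V: "V extreme_point_of ?P" by simp
  then have VP: "V \<in> solution_space T" "quad_nonneg V" using projective_iff[of V T] unfolding extreme_point_of_def by blast+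
  show "V \<in> G"
  proof (cases "quad_pos V")
   case True
   then show ?thesis using neg[OF V] VP by (simp add: G_def)
  next
   case False
   then have "fst V $ k = 0" for k using VP(2) unfolding quad_nonneg_def quad_pos_def not_ex not_less by (intro antisym) blast+
   then have "fst V = 0" by (simp add: vec_eq_iff)
   then show ?thesis using link VP by (simp add: G_def)
  qed
 qed
 moreover have "convex G"
  unfolding convex_def
 proof (intro ballI allI impI)
  fix x y u v assume x: "x \<in> G" and y: "y \<in> G" and uv: "0 <= u" "0 <= v" "u + v = (1::real)"
  show "u *\<^sub>R x + v *\<^sub>R y \<in> G"
  proof (cases "u = 0 \<or> v = 0")
   case True
   then have "u = 0 & v = 1 \<or> u = 1 & v = 0" using uv by auto
   then show ?thesis using x y by auto
  next
   case False
   then have p: "0 < u" "0 < v" using uv by auto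
   have e: "gen_euler T (u *\<^sub>R x + v *\<^sub>R y) = u * gen_euler T x + v * gen_euler T y"
    by (simp add: linear_add[OF lin] linear_scale[OF lin])
   have nn: "quad_nonneg (u *\<^sub>R x + v *\<^sub>R y)" using x y uv by (simp add: G_def quad_nonneg_def)
   have le: "gen_euler T x <= 0" "gen_euler T y <= 0" using x y by (auto simp: G_def)
   show ?thesis
   proof (cases "gen_euler T x < 0 \<or> gen_euler T y < 0")
    case True
    then have "u * gen_euler T x + v * gen_euler T y < 0"
     using p le by (metis add_neg_nonpos add_nonpos_neg mult_nonneg_nonpos mult_pos_neg less_imp_le)
    then show ?thesis using nn e by (simp add: G_def)
   next
    case False
    then have "fst x = 0" "fst y = 0" "gen_euler T x = 0" "gen_euler T y = 0" using x y by (auto simp: G_def)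
    then show ?thesis using nn e by (simp add: G_def)
   qed
  qed
 qed
 ultimately have "convex hull {V. V extreme_point_of ?P} \<subseteq> G" by (rule hull_minimal)
 then have "s \<in> G" using s(1) Krein_Milman_Minkowski[OF compact_convex_projective[OF fp]] by blast
 then show ?thesis using s(2) by (auto simp: G_def quad_pos_def)
qed

text \<open>Without quadrilaterals the compatibility equations say that the triangle coordinates are constant around each ideal vertex.\<close>

lemma gen_euler_triangle_solution:
 fixes T :: "('t::finite) gluing"
 assumes fp: "face_pairing T"
  and zero: "\<And>V. corner_class T V ==> (\<Sum>v\<in>V. tri_euler T v) = 0"
  and s: "s \<in> solution_space T" "fst s = 0"
 shows "gen_euler T s = 0"
proof -
 let ?cl = "glued_class (corner_gluing T)"
 have step: "snd s $ (i, p) = snd s $ (nbr T i a, perm T i a p)" if "a ~= p" for i p a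
  using s(1)[unfolded solution_space_iff[OF fp], rule_format, of p a i] that by (simp add: arc_value_def s(2))
 have const: "snd s $ v = snd s $ w" if w: "v \<in> ?cl w" for v w
 proof -
  have V: "corner_class T (?cl w)" unfolding corner_class_def by blast
  show ?thesis
   by (rule corner_class_induct[OF fp V glued_class_refl w, where P = "%v. snd s $ v = snd s $ w"])
    (use step in auto)
 qed
 have fib: "{v. ?cl v = ?cl w} = ?cl w" for w
 proof
  show "{v. ?cl v = ?cl w} \<subseteq> ?cl w"
  using glued_class_refl by fastforce
  show "?cl w \<subseteq> {v. ?cl v = ?cl w}"

  proof
   fix v assume "v \<in> ?cl w"
   then have "?cl w = ?cl v" unfolding glued_class_eq_iff by (simp add: glued_class_def)
   then show "v \<in> {v. ?cl v = ?cl w}" by simp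
  qed
 qed
 have "gen_euler T s = (\<Sum>v\<in>UNIV. snd s $ v * tri_euler T v)"
  using s(2) by (simp add: gen_euler_def case_prod_unfold)
 also have "\<dots> = (\<Sum>V\<in>range ?cl. \<Sum>v\<in>{v. ?cl v = V}. snd s $ v * tri_euler T v)"
  using sum.image_gen[of UNIV "%v. snd s $ v * tri_euler T v" ?cl] by simp
 also have "\<dots> = 0"
 proof (rule sum.neutral, intro ballI)
  fix V assume "V \<in> range ?cl"
  then obtain w where w: "V = ?cl w" by blast
  have "(\<Sum>v\<in>V. snd s $ v * tri_euler T v) = (\<Sum>v\<in>V. snd s $ w * tri_euler T v)"
   by (rule sum.cong) (use const w in auto)
  also have "\<dots> = 0"
  proof -
   have "corner_class T V" unfolding corner_class_def using w by blast
   then show ?thesis unfolding sum_distrib_left[symmetric] using zero by simp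
  qed
  finally show "(\<Sum>v\<in>{v. ?cl v = V}. snd s $ v * tri_euler T v) = 0" unfolding w fib .
 qed
 finally show ?thesis .
qed

theorem theorem3:
  fixes N M :: "'m topology"
    and T :: "('t::finite) gluing"
    and h :: "('t \<times> (real^4)) set \<Rightarrow> 'm"
  assumes "compact_3_manifold_with_boundary N"
    and "manifold_boundary N \<noteq> {}"
    and "M = subtopology N (manifold_interior N)"
    and "ideal_triangulation M T h"
    and "\<And>B. B \<in> connected_components_of (subtopology N (manifold_boundary N)) \<Longrightarrow>
           subtopology N B homeomorphic_space torus \<or>
           subtopology N B homeomorphic_space klein_bottle"
  shows "((\<exists>\<alpha>. angle_structure T \<alpha>) \<longleftrightarrow>
            (\<forall>s \<in> solution_space T.
               (\<forall>k. 0 \<le> fst s $ k) \<and> (\<exists>k. 0 < fst s $ k) \<longrightarrow> gen_euler T s < 0))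
       \<and> ((\<forall>s \<in> solution_space T.
               (\<forall>k. 0 \<le> fst s $ k) \<and> (\<exists>k. 0 < fst s $ k) \<longrightarrow> gen_euler T s < 0) \<longleftrightarrow>
            (\<forall>s \<in> projective_solution_space T. (\<exists>k. 0 < fst s $ k) \<longrightarrow> gen_euler T s < 0))
       \<and> ((\<forall>s \<in> projective_solution_space T. (\<exists>k. 0 < fst s $ k) \<longrightarrow> gen_euler T s < 0) \<longleftrightarrow>
            (\<forall>V. V extreme_point_of projective_solution_space T \<and> (\<exists>k. 0 < fst V $ k) \<longrightarrow>
               gen_euler T V < 0))"
proof -
 interpret corner_collars N T h
  by standard (use assms(1,3,4) in auto)
 have mf: "manifold_point (pseudo_manifold T) P" if "P \<in> topspace (pseudo_manifold T) - ideal_vertices T" for P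
  using assms(4) that unfolding ideal_triangulation_def by blast
 have "(\<Sum>v\<in>V. tri_euler T v) = 0" if V: "corner_class T V" for V
  by (rule sum_tri_euler_corner_class[OF fp V no_reversed_edge[OF fp mf] twice_card_edge_ends_torus_or_klein[OF V assms(5)]])
 then have link: "gen_euler T s = 0" if "s \<in> solution_space T" "fst s = 0" for s
  using gen_euler_triangle_solution[OF fp _ that] by blast
 let ?angle = "\<exists>\<alpha>. angle_structure T \<alpha>"
 let ?sol = "\<forall>s\<in>solution_space T. quad_nonneg s & quad_pos s --> gen_euler T s < 0"
 let ?proj = "\<forall>s\<in>projective_solution_space T. quad_pos s --> gen_euler T s < 0"
 let ?vert = "\<forall>V. V extreme_point_of projective_solution_space T & quad_pos V --> gen_euler T V < 0"
 have "?angle \<longleftrightarrow> ?sol"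
  using angle_structure_imp_negative[OF fp] angle_structure_of_negative[OF fp] by blast
 moreover have "?sol \<longleftrightarrow> ?proj"
  using negative_of_projective[OF fp link] projective_iff[of _ T] by blast
 moreover have "?proj \<longleftrightarrow> ?vert"
  using projective_negative_of_vertices[OF fp link] unfolding extreme_point_of_def by blast
 ultimately show ?thesis unfolding quad_nonneg_def quad_pos_def by blast
qed

end
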